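(* Let $\mathsf J$ be the standard almost complex structure on $S^6$. Then: (1) $h^{1,0}=h^{2,0}=h^{2,3}=h^{1,3}=0$; (2) $P_m(S^6,\mathsf J)=1$ for every $m\ge1$, and $\kappa^{\mathsf J}(S^6)=0$.
   Context: Standard almost complex structure: with $e^1,\dots,e^7$ the dual standard basis of $\mathbb R^7$ and $e^{ijk}=e^i\wedge e^j\wedge e^k$, let $\Phi=e^{123}+e^{145}+e^{167}+e^{246}-e^{257}-e^{347}-e^{356}$ and define the cross product $\times$ on $\mathbb R^7$ by $(u\times v)\cdot w=\Phi(u,v,w)$, with $\cdot$ the Euclidean inner product. For $u\in S^6\subset\mathbb R^7$, $\mathsf J_u(v)=u\times v$ on $T_uS^6=\{v:u\cdot v=0\}$. For a compact almost complex manifold $(X,J)$ of real dimension $2n$: split $T^*X\otimes\mathbb C=(T^*X)^{1,0}\oplus(T^*X)^{0,1}$; put $\Lambda^{p,q}=\Lambda^p((T^*X)^{1,0})\otimes\Lambda^q((T^*X)^{0,1})$, $\Omega^{p,q}(X)=\Gamma(X,\Lambda^{p,q})$, $\bar\partial=\pi^{p,q+1}\circ d:\Omega^{p,q}(X)\to\Omega^{p,q+1}(X)$, where $\pi^{p,q}$ is the projection onto type $(p,q)$. Fix a $J$-compatible Riemannian metric, let $\bar\partial^*$ be the formal $L^2$-adjoint of $\bar\partial$, $\Delta_{\bar\partial}=\bar\partial\bar\partial^*+\bar\partial^*\bar\partial$, and $h^{p,q}=\dim_{\mathbb C}\{\varphi\in\Omega^{p,q}(X):\Delta_{\bar\partial}\varphi=0\}$;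 for $q=0$ this is $\dim_{\mathbb C}\{\varphi\in\Omega^{p,0}(X):\bar\partial\varphi=0\}$, and for $q\in\{0,n\}$ it is independent of the metric. Let $\mathcal K=\Lambda^{n,0}$. Using $\Lambda^{n,1}\cong(T^*X)^{0,1}\otimes\mathcal K$ regard $\bar\partial_1=\bar\partial$ as an operator $\Gamma(\mathcal K)\to\Gamma((T^*X)^{0,1}\otimes\mathcal K)$, and define $\bar\partial_m$ on $\mathcal K^{\otimes m}$ inductively by $\bar\partial_m(s_1\otimes s_2)=\bar\partial s_1\otimes s_2+s_1\otimes\bar\partial_{m-1}s_2$. $P_m(X,J)=\dim_{\mathbb C}\{s\in\Gamma(X,\mathcal K^{\otimes m}):\bar\partial_m s=0\}$. The Kodaira dimension $\kappa^J(X)$ is $-\infty$ if $P_m(X,J)=0$ for all $m\ge1$, and otherwise $\limsup_{m\to\infty}\frac{\log P_m(X,J)}{\log m}$. *)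

theory Defs
  imports
    "HOL-Analysis.Analysis"
    "HOL-Combinatorics.Permutations"
    "HOL-Library.Function_Algebras"
begin

section \<open>Complex vector spaces of functions\<close>

definition cscale :: "complex \<Rightarrow> ('a \<Rightarrow> complex) \<Rightarrow> 'a \<Rightarrow> complex"
  where "cscale c f = (\<lambda>x. c * f x)"

definition cscale2 :: "complex \<Rightarrow> ('a \<Rightarrow> 'b \<Rightarrow> complex) \<Rightarrow> 'a \<Rightarrow> 'b \<Rightarrow> complex"
  where "cscale2 c f = (\<lambda>x. cscale c (f x))"

lemma vector_space_cscale: "vector_space cscale"
  by unfold_locales (auto simp: cscale_def fun_eq_iff algebra_simps)

lemma vector_space_cscale2: "vector_space cscale2"
  by unfold_locales (auto simp: cscale_def cscale2_def fun_eq_iff algebra_simps)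

abbreviation cspan :: "('a \<Rightarrow> complex) set \<Rightarrow> ('a \<Rightarrow> complex) set"
  where "cspan \<equiv> module.span cscale"

text \<open>The library's \<^const>\<open>vector_space.dim\<close> is \<open>0\<close> on infinite-dimensional spaces,
  so the infinite-dimensional case has to be separated.\<close>

definition cdim :: "('a \<Rightarrow> 'b \<Rightarrow> complex) set \<Rightarrow> enat"
  where "cdim V =
    (if \<exists>B. finite B \<and> V \<subseteq> module.span cscale2 B
     then enat (vector_space.dim cscale2 V) else \<infinity>)"

section \<open>The six-sphere and its tensor fields\<close>

type_synonym vec7 = "real ^ 7"

abbreviation S6 :: "vec7 set" where "S6 \<equiv> sphere 0 1"

definition tangent :: "vec7 \<Rightarrow> vec7 set"
  where "tangent u = {v. u \<bullet> v = 0}"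

definition tproj :: "vec7 \<Rightarrow> vec7 \<Rightarrow> vec7"
  where "tproj u v = v - (u \<bullet> v) *\<^sub>R u"

text \<open>A complex \<open>k\<close>-tensor on the tangent space at \<open>u\<close> is encoded by its unique extension to
  a multilinear map on \<open>vec7\<close> that vanishes as soon as one argument is normal, i.e. a multiple
  of \<open>u\<close>. The arguments form a list; the value on lists of length other than \<open>k\<close> is \<open>0\<close>.
  A tensor field on the sphere is \<open>0\<close> at all points outside the sphere. With these conventions
  tensor fields correspond one-to-one to their encodings.\<close>

type_synonym tensor = "vec7 list \<Rightarrow> complex"
type_synonym tensor_field = "vec7 \<Rightarrow> tensor"

primrec Ck_on :: "nat \<Rightarrow> ('a::euclidean_space \<Rightarrow> 'b::real_normed_vector) \<Rightarrow> 'a set \<Rightarrow> bool"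
  where
    "Ck_on 0 f U \<longleftrightarrow> continuous_on U f"
  | "Ck_on (Suc k) f U \<longleftrightarrow>
       (\<forall>x\<in>U. f differentiable (at x)) \<and> (\<forall>v. Ck_on k (\<lambda>x. frechet_derivative f (at x) v) U)"

text \<open>Only meaningful for open \<open>U\<close>.\<close>

definition smooth_on :: "('a::euclidean_space \<Rightarrow> 'b::real_normed_vector) \<Rightarrow> 'a set \<Rightarrow> bool"
  where "smooth_on f U \<longleftrightarrow> (\<forall>k. Ck_on k f U)"

definition retr :: "vec7 \<Rightarrow> vec7"
  where "retr x = x /\<^sub>R norm x"

definition pull :: "tensor_field \<Rightarrow> tensor_field"
  where "pull \<omega> x vs = \<omega> (retr x) (map (frechet_derivative retr (at x)) vs)"

text \<open>Since \<^const>\<open>retr\<close> is a smooth retraction of the punctured space onto the sphere, a tensor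
  field on the sphere is smooth iff its pullback along \<^const>\<open>retr\<close> is, and the latter is
  a field on an open subset of Euclidean space.\<close>

definition smooth_tensor :: "tensor_field \<Rightarrow> bool"
  where "smooth_tensor \<omega> \<longleftrightarrow> (\<forall>vs. smooth_on (\<lambda>x. pull \<omega> x vs) (- {0}))"

definition sections :: "(vec7 \<Rightarrow> tensor set) \<Rightarrow> tensor_field set"
  where "sections F =
    {s. (\<forall>u\<in>S6. s u \<in> F u) \<and> (\<forall>u. u \<notin> S6 \<longrightarrow> s u = (\<lambda>_. 0)) \<and> smooth_tensor s}"

definition drop_nth :: "nat \<Rightarrow> 'a list \<Rightarrow> 'a list"
  where "drop_nth i vs = take i vs @ drop (Suc i) vs"

text \<open>Exterior derivative of a form on an open subset of \<open>vec7\<close>, by the invariant formula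
  applied to constant vector fields.\<close>

definition ext_deriv_flat :: "tensor_field \<Rightarrow> tensor_field"
  where "ext_deriv_flat \<eta> x vs =
    (\<Sum>i<length vs. (- 1) ^ i *
       frechet_derivative (\<lambda>y. \<eta> y (drop_nth i vs)) (at x) (vs ! i))"

text \<open>Exterior derivative on the sphere. If \<open>\<iota>\<close> is the inclusion and \<open>r\<close> is \<^const>\<open>retr\<close>, then
  \<open>d \<omega> = \<iota>\<^sup>* r\<^sup>* (d \<omega>) = \<iota>\<^sup>* (d (r\<^sup>* \<omega>))\<close> because \<open>d\<close> commutes with pullbacks. As
  \<open>d (r\<^sup>* \<omega>) = r\<^sup>* (d \<omega>)\<close> vanishes on normal arguments, no further projection is needed.\<close>

definition ext_deriv :: "tensor_field \<Rightarrow> tensor_field"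
  where "ext_deriv \<omega> u = (if u \<in> S6 then ext_deriv_flat (pull \<omega>) u else (\<lambda>_. 0))"

section \<open>The standard almost complex structure\<close>

definition wedge :: "(vec7 \<Rightarrow> 'b::comm_ring_1) list \<Rightarrow> vec7 list \<Rightarrow> 'b"
  where "wedge \<alpha>s vs =
    (if length vs = length \<alpha>s
     then \<Sum>\<sigma> | \<sigma> permutes {..<length \<alpha>s}.
            of_int (sign \<sigma>) * (\<Prod>i<length \<alpha>s. (\<alpha>s ! i) (vs ! \<sigma> i))
     else 0)"

text \<open>The index type \<open>7\<close> is the ring of integers modulo 7, so the last coordinate is written
  \<open>x $ 7\<close>, which is the same as \<open>x $ 0\<close>.\<close>

definition e3 :: "7 \<Rightarrow> 7 \<Rightarrow> 7 \<Rightarrow> vec7 \<Rightarrow> vec7 \<Rightarrow> vec7 \<Rightarrow> real"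
  where "e3 i j k u v w = wedge [\<lambda>x. x $ i, \<lambda>x. x $ j, \<lambda>x. x $ k] [u, v, w]"

definition Phi :: "vec7 \<Rightarrow> vec7 \<Rightarrow> vec7 \<Rightarrow> real"
  where "Phi u v w =
    e3 1 2 3 u v w + e3 1 4 5 u v w + e3 1 6 7 u v w + e3 2 4 6 u v w
    - e3 2 5 7 u v w - e3 3 4 7 u v w - e3 3 5 6 u v w"

definition cross7 :: "vec7 \<Rightarrow> vec7 \<Rightarrow> vec7"
  where "cross7 u v = (THE c. \<forall>w. c \<bullet> w = Phi u v w)"

text \<open>Almost complex structures are encoded as \<open>J u v\<close>, relevant for \<open>u\<close> on the sphere and
  \<open>v\<close> tangent at \<open>u\<close> only.\<close>

type_synonym acs = "vec7 \<Rightarrow> vec7 \<Rightarrow> vec7"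

definition std_J :: acs
  where "std_J u v = cross7 u v"

section \<open>Forms of type (p,q) and the operator dbar\<close>

definition cotangent10 :: "acs \<Rightarrow> vec7 \<Rightarrow> (vec7 \<Rightarrow> complex) set"
  where "cotangent10 J u =
    {\<alpha>. linear \<alpha> \<and> \<alpha> u = 0 \<and> (\<forall>v\<in>tangent u. \<alpha> (J u v) = \<i> * \<alpha> v)}"

definition cotangent01 :: "acs \<Rightarrow> vec7 \<Rightarrow> (vec7 \<Rightarrow> complex) set"
  where "cotangent01 J u =
    {\<alpha>. linear \<alpha> \<and> \<alpha> u = 0 \<and> (\<forall>v\<in>tangent u. \<alpha> (J u v) = - \<i> * \<alpha> v)}"

definition Lambda :: "acs \<Rightarrow> nat \<Rightarrow> nat \<Rightarrow> vec7 \<Rightarrow> tensor set"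
  where "Lambda J p q u =
    cspan {wedge (\<alpha>s @ \<beta>s) | \<alpha>s \<beta>s.
      length \<alpha>s = p \<and> set \<alpha>s \<subseteq> cotangent10 J u \<and>
      length \<beta>s = q \<and> set \<beta>s \<subseteq> cotangent01 J u}"

definition Omega :: "acs \<Rightarrow> nat \<Rightarrow> nat \<Rightarrow> tensor_field set"
  where "Omega J p q = sections (Lambda J p q)"

definition type_proj :: "acs \<Rightarrow> nat \<Rightarrow> nat \<Rightarrow> vec7 \<Rightarrow> tensor \<Rightarrow> tensor"
  where "type_proj J p q u \<eta> =
    (THE \<alpha>. \<exists>c. (\<forall>a\<le>p + q. c a \<in> Lambda J a (p + q - a) u) \<and>
               \<eta> = (\<Sum>a\<le>p + q. c a) \<and> \<alpha> = c p)"

definition dbar :: "acs \<Rightarrow> nat \<Rightarrow> nat \<Rightarrow> tensor_field \<Rightarrow> tensor_field"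
  where "dbar J p q \<omega> u =
    (if u \<in> S6 then type_proj J p (Suc q) u (ext_deriv \<omega> u) else (\<lambda>_. 0))"

section \<open>Compatible metrics and Hodge numbers\<close>

type_synonym metric = "vec7 \<Rightarrow> vec7 \<Rightarrow> vec7 \<Rightarrow> real"

definition riemannian_metric :: "metric \<Rightarrow> bool"
  where "riemannian_metric g \<longleftrightarrow>
    (\<forall>u\<in>S6. \<forall>v\<in>tangent u. \<forall>w\<in>tangent u. \<forall>w'\<in>tangent u. \<forall>c.
       g u v w = g u w v \<and>
       g u v (w + w') = g u v w + g u v w' \<and>
       g u v (c *\<^sub>R w) = c * g u v w \<and>
       (v \<noteq> 0 \<longrightarrow> g u v v > 0)) \<and>
    (\<forall>v w. smooth_on (\<lambda>x. g (retr x) (frechet_derivative retr (at x) v)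
                                    (frechet_derivative retr (at x) w)) (- {0}))"

definition compatible_metric :: "acs \<Rightarrow> metric \<Rightarrow> bool"
  where "compatible_metric J g \<longleftrightarrow>
    riemannian_metric g \<and>
    (\<forall>u\<in>S6. \<forall>v\<in>tangent u. \<forall>w\<in>tangent u. g u (J u v) (J u w) = g u v w)"

definition is_orthonormal_basis :: "metric \<Rightarrow> vec7 \<Rightarrow> vec7 set \<Rightarrow> bool"
  where "is_orthonormal_basis g u B \<longleftrightarrow>
    B \<subseteq> tangent u \<and> finite B \<and> card B = 6 \<and>
    (\<forall>v\<in>B. \<forall>w\<in>B. g u v w = (if v = w then 1 else 0))"

text \<open>The Hermitian inner product induced by \<open>g\<close> on alternating \<open>k\<close>-tensors. The normalization
  makes wedge products of an orthonormal coframe orthonormal. The value does not depend on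
  the choice of basis.\<close>

definition form_inner :: "metric \<Rightarrow> nat \<Rightarrow> vec7 \<Rightarrow> tensor \<Rightarrow> tensor \<Rightarrow> complex"
  where "form_inner g k u \<alpha> \<beta> =
    (let B = (SOME B. is_orthonormal_basis g u B) in
     (\<Sum>vs | set vs \<subseteq> B \<and> length vs = k. \<alpha> vs * cnj (\<beta> vs)) / fact k)"

text \<open>Density of the Riemannian volume of \<open>g\<close> relative to that of the round metric. The matrix
  is the Gram matrix of the inner product on \<open>vec7\<close> that is \<open>g\<close> on the tangent space
  and makes \<open>u\<close> a unit normal vector.\<close>

definition vol_density :: "metric \<Rightarrow> vec7 \<Rightarrow> real"
  where "vol_density g u =
    sqrt (det (\<chi> i j. g u (tproj u (axis i 1)) (tproj u (axis j 1)) + u $ i * u $ j))"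

text \<open>Integration over the sphere against the Riemannian volume of \<open>g\<close>: in polar coordinates
  the integral over the unit ball of a function \<open>f (retr x)\<close> is
  \<open>1/7\<close> times the round surface integral of \<open>f\<close>.\<close>

definition sphere_integral :: "metric \<Rightarrow> (vec7 \<Rightarrow> complex) \<Rightarrow> complex"
  where "sphere_integral g f =
    7 * (LINT x:ball 0 1|lborel. of_real (vol_density g (retr x)) * f (retr x))"

definition L2_inner :: "metric \<Rightarrow> nat \<Rightarrow> tensor_field \<Rightarrow> tensor_field \<Rightarrow> complex"
  where "L2_inner g k \<phi> \<psi> = sphere_integral g (\<lambda>u. form_inner g k u (\<phi> u) (\<psi> u))"

text \<open>The formal adjoint of \<^term>\<open>dbar J p q\<close>, mapping forms of type \<open>(p, q+1)\<close> to forms of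
  type \<open>(p, q)\<close>.\<close>

definition dbar_adj :: "acs \<Rightarrow> metric \<Rightarrow> nat \<Rightarrow> nat \<Rightarrow> tensor_field \<Rightarrow> tensor_field"
  where "dbar_adj J g p q \<phi> =
    (THE \<psi>. \<psi> \<in> Omega J p q \<and>
       (\<forall>\<theta>\<in>Omega J p q. L2_inner g (p + Suc q) (dbar J p q \<theta>) \<phi> = L2_inner g (p + q) \<theta> \<psi>))"

definition dbar_laplacian :: "acs \<Rightarrow> metric \<Rightarrow> nat \<Rightarrow> nat \<Rightarrow> tensor_field \<Rightarrow> tensor_field"
  where "dbar_laplacian J g p q \<phi> =
    (case q of 0 \<Rightarrow> 0 | Suc r \<Rightarrow> dbar J p r (dbar_adj J g p r \<phi>))
    + dbar_adj J g p q (dbar J p q \<phi>)"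

definition hodge_number :: "acs \<Rightarrow> metric \<Rightarrow> nat \<Rightarrow> nat \<Rightarrow> enat"
  where "hodge_number J g p q = cdim {\<phi> \<in> Omega J p q. dbar_laplacian J g p q \<phi> = 0}"

section \<open>Plurigenera and Kodaira dimension\<close>

definition tens :: "nat \<Rightarrow> tensor \<Rightarrow> tensor \<Rightarrow> tensor"
  where "tens k a b = (\<lambda>vs. a (take k vs) * b (drop k vs))"

text \<open>The \<open>m\<close>-th tensor power of the canonical bundle, as a bundle of \<open>3m\<close>-tensors.\<close>

primrec Kpow :: "acs \<Rightarrow> nat \<Rightarrow> vec7 \<Rightarrow> tensor set"
  where
    "Kpow J 0 u = Lambda J 0 0 u"
  | "Kpow J (Suc m) u = cspan {tens 3 \<kappa> s | \<kappa> s. \<kappa> \<in> Lambda J 3 0 u \<and> s \<in> Kpow J m u}"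

text \<open>In tensors with values in the tensor product of the \<open>(0,1)\<close>-cotangent bundle with a power
  of the canonical bundle, the first list entry is the argument of the \<open>(0,1)\<close>-factor.\<close>

definition T01_K :: "acs \<Rightarrow> vec7 \<Rightarrow> tensor set"
  where "T01_K J u =
    cspan {tens 1 (wedge [\<alpha>]) \<kappa> | \<alpha> \<kappa>. \<alpha> \<in> cotangent01 J u \<and> \<kappa> \<in> Lambda J 3 0 u}"

text \<open>Sends \<open>\<alpha> \<otimes> \<kappa>\<close> to \<open>\<alpha> \<and> \<kappa>\<close>.\<close>

definition wedge_out :: "tensor \<Rightarrow> tensor"
  where "wedge_out t vs = (\<Sum>i<length vs. (- 1) ^ i * t (vs ! i # drop_nth i vs))"

definition dbar_K1 :: "acs \<Rightarrow> tensor_field \<Rightarrow> tensor_field"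
  where "dbar_K1 J s u =
    (if u \<in> S6 then THE t. t \<in> T01_K J u \<and> wedge_out t = dbar J 3 0 s u else (\<lambda>_. 0))"

text \<open>\<open>s \<otimes> t\<close> with the \<open>(0,1)\<close>-slot of \<open>t\<close> moved to the front.\<close>

definition tens_front :: "nat \<Rightarrow> tensor \<Rightarrow> tensor \<Rightarrow> tensor"
  where "tens_front k s t =
    (\<lambda>vs. case vs of [] \<Rightarrow> 0 | w # vs' \<Rightarrow> s (take k vs') * t (w # drop k vs'))"

text \<open>The graph of the operator dbar on the \<open>m\<close>-th power of the canonical bundle, determined by
  additivity and the Leibniz rule. Every global section of the power \<open>m + 1\<close> is
  a finite sum of tensor products of global sections.\<close>

inductive dbar_K_graph :: "acs \<Rightarrow> nat \<Rightarrow> tensor_field \<Rightarrow> tensor_field \<Rightarrow> bool" for J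
  where
    base: "s \<in> Omega J 3 0 \<Longrightarrow> dbar_K_graph J 1 s (dbar_K1 J s)"
  | leibniz: "s1 \<in> Omega J 3 0 \<Longrightarrow> m \<ge> 1 \<Longrightarrow> dbar_K_graph J m s2 t2 \<Longrightarrow>
      dbar_K_graph J (Suc m)
        (\<lambda>u. tens 3 (s1 u) (s2 u))
        (\<lambda>u. tens 4 (dbar_K1 J s1 u) (s2 u) + tens_front 3 (s1 u) (t2 u))"
  | add: "dbar_K_graph J m s t \<Longrightarrow> dbar_K_graph J m s' t' \<Longrightarrow>
      dbar_K_graph J m (s + s') (t + t')"

definition dbar_K :: "acs \<Rightarrow> nat \<Rightarrow> tensor_field \<Rightarrow> tensor_field"
  where "dbar_K J m s = (THE t. dbar_K_graph J m s t)"

definition plurigenus :: "acs \<Rightarrow> nat \<Rightarrow> enat"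
  where "plurigenus J m = cdim {s \<in> sections (Kpow J m). dbar_K J m s = 0}"

definition ln_enat :: "enat \<Rightarrow> ereal"
  where "ln_enat n =
    (case n of enat k \<Rightarrow> if k = 0 then - \<infinity> else ereal (ln (real k)) | \<infinity> \<Rightarrow> \<infinity>)"

definition kodaira_dim :: "acs \<Rightarrow> ereal"
  where "kodaira_dim J =
    (if \<forall>m\<ge>1. plurigenus J m = 0 then - \<infinity>
     else limsup (\<lambda>m. ln_enat (plurigenus J m) / ereal (ln (real m))))"

end

(* At a point u the complexified tangent space splits into the eigenspaces E+ and E- of the cross
   product with u. The bracket of two (0,1)-fields has a (1,0)-part, namely i times their cross
   product, and the products of E- with itself generate E+. Hence a function annihilated by all
   (0,1)-vectors is constant, and a section of E+ or E- whose (0,1)-derivative vanishes is parallel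
   for a connection with torsion and curvature, which forces it to be zero.
   Forms of type (1,0) are sections of E-, and by the cross product forms of type (2,0) are sections
   of E+. A form phi of type (p,3) is dbar-coclosed iff its metric dual has vanishing divergence on
   vectors of type (p,2); contracting the dual with the complex volume form on E+, which is
   dbar-closed and nowhere zero, gives a section of E+ (p = 1) or E- (p = 2) with vanishing
   (0,1)-derivative, so phi = 0. Finally the volume form trivializes all powers of the canonical
   bundle, and dbar (f vol^m) = (dbar f) vol^m, so the plurigenera count constant functions. *)

theory Submission
  imports Defs
begin

text \<open>Without local holomorphic coordinates everything is expressed by global fields in
  \<open>complex ^ 7\<close>. A tensor becomes the array of its ambient components, functions are
  extended with degree 0, and the flat derivative replaces a connection; torsion and curvature then
  show up as explicit cross products and multiples of the normal \<open>cv u\<close>. The type of an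
  array is read off a polynomial: let z times one projection plus the other act on all slots; the
  coefficient of z^p is the part of type (p,q). A parallel section F vanishes because its mixed
  second derivatives along F and its conjugate must agree, while one of them is 0 and the other is
  -|F|^2 F. The metric is an arbitrary compatible one. For the types (p,3) its volume density and
  inverse are absorbed into the dual of the form, and what remains is a condition on the flat
  divergence that mentions no metric. The adjoint is a definite description, so its existence has to
  be proved; the integration by parts behind it comes from the rotation invariance of Lebesgue
  measure on the ball.\<close>

section \<open>Smooth functions\<close>

lemma Ck_on_cong:
  assumes "open U" "\<And>x. x \<in> U ==> f x = g x"
  shows "Ck_on k f U \<longleftrightarrow> Ck_on k g U"
  using assms(2)
proof (induction k arbitrary: f g)
  case 0
  then show ?case by (simp cong: continuous_on_cong)
next
  case (Suc k)
  have hd: "(f has_derivative D) (at x) \<longleftrightarrow> (g has_derivative D) (at x)" if "x \<in> U" for x D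
    using has_derivative_transform_within_open[of f D x UNIV U g]
      has_derivative_transform_within_open[of g D x UNIV U f] Suc.prems assms(1) that by auto
  then have fd: "frechet_derivative f (at x) = frechet_derivative g (at x)" if "x \<in> U" for x
    using that by (simp add: frechet_derivative_def)
  have "(f differentiable (at x)) = (g differentiable (at x))" if "x \<in> U" for x
    using hd[OF that] by (simp add: differentiable_def)
  then show ?case using fd Suc.IH[of "\<lambda>x. frechet_derivative f (at x) v" "\<lambda>x. frechet_derivative g (at x) v" for v]
    by simp
qed

lemma Ck_on_const: "Ck_on k (\<lambda>x. c) U"
  by (induction k arbitrary: c) (auto simp: frechet_derivative_const)

lemma Ck_on_SucD: "Ck_on (Suc k) f U ==> Ck_on k f U"
proof (induction k arbitrary: f)
  case 0
  then show ?case
    by (auto intro!: continuous_at_imp_continuous_on differentiable_imp_continuous_within)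
next
  case (Suc k)
  then show ?case by (metis Ck_on.simps(2))
qed

lemma frechet_derivative_eq:
  "(f has_derivative f') (at x) ==> frechet_derivative f (at x) = f'"
  using frechet_derivative_at by metis

lemma Ck_on_SucI:
  assumes "open U" "\<And>x. x \<in> U ==> (f has_derivative f' x) (at x)"
    "\<And>v. Ck_on k (\<lambda>x. f' x v) U"
  shows "Ck_on (Suc k) f U"
proof -
  have "Ck_on k (\<lambda>x. frechet_derivative f (at x) v) U" for v
    using Ck_on_cong[OF assms(1), of "\<lambda>x. frechet_derivative f (at x) v" "\<lambda>x. f' x v" k] assms(2,3)
      frechet_derivative_eq by metis
  then show ?thesis using assms(2) by (auto simp: differentiable_def)
qed

lemma Ck_on_Suc_has_derivative:
  "Ck_on (Suc k) f U ==> x \<in> U ==> (f has_derivative frechet_derivative f (at x)) (at x)"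
  by (simp add: frechet_derivative_works)

lemma Ck_on_add:
  "open U ==> Ck_on k f U ==> Ck_on k g U ==> Ck_on k (\<lambda>x. f x + g x) U"
proof (induction k arbitrary: f g)
  case 0 then show ?case by (auto intro: continuous_intros)
next
  case (Suc k)
  show ?case
    by (rule Ck_on_SucI[OF Suc.prems(1) has_derivative_add[OF Ck_on_Suc_has_derivative[OF Suc.prems(2)] Ck_on_Suc_has_derivative[OF Suc.prems(3)]]])
      (use Suc in auto)
qed

lemma Ck_on_bounded_linear:
  assumes "bounded_linear L"
  shows "open U ==> Ck_on k f U ==> Ck_on k (\<lambda>x. L (f x)) U"
proof (induction k arbitrary: f)
  case 0 then show ?case by (auto intro!: bounded_linear.continuous_on[OF assms])
next
  case (Suc k)
  show ?case
    by (rule Ck_on_SucI[OF Suc.prems(1) bounded_linear.has_derivative[OF assms Ck_on_Suc_has_derivative[OF Suc.prems(2)]]])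
      (use Suc in auto)
qed

lemma Ck_on_linear:
  assumes "bounded_linear L" "open U" shows "Ck_on k L U"
proof (cases k)
  case 0 then show ?thesis
    using bounded_linear.continuous_on[OF assms(1) continuous_on_id] by simp
next
  case (Suc n)
  show ?thesis unfolding Suc
    by (rule Ck_on_SucI[OF assms(2) bounded_linear.has_derivative[OF assms(1) has_derivative_ident]])
      (rule Ck_on_const)
qed

lemma Ck_on_bilinear:
  assumes "bounded_bilinear B"
  shows "open U ==> Ck_on k f U ==> Ck_on k g U ==> Ck_on k (\<lambda>x. B (f x) (g x)) U"
proof (induction k arbitrary: f g)
  case 0 then show ?case by (auto intro!: bounded_bilinear.continuous_on[OF assms])
next
  case (Suc k)
  show ?case
    by (rule Ck_on_SucI[OF Suc.prems(1) bounded_bilinear.FDERIV[OF assms Ck_on_Suc_has_derivative[OF Suc.prems(2)] Ck_on_Suc_has_derivative[OF Suc.prems(3)]]])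
      (use Suc in \<open>auto intro!: Ck_on_add Suc.IH intro: Ck_on_SucD[OF Suc.prems(2)] Ck_on_SucD[OF Suc.prems(3)]\<close>)
qed

text \<open>The derivative is again built from 1/f, but only its regularity of order k enters at
  step k + 1, so the induction closes. The square root is treated in the same way.\<close>

lemma Ck_on_inverse:
  fixes f :: "'a::euclidean_space => 'b::real_normed_field"
  assumes "open U" "\<And>x. x \<in> U ==> f x \<noteq> 0"
  shows "Ck_on k f U ==> Ck_on k (\<lambda>x. inverse (f x)) U"
proof (induction k)
  case 0 then show ?case using assms by (auto intro!: continuous_intros)
next
  case (Suc k)
  have i: "Ck_on k (\<lambda>x. inverse (f x)) U" using Suc.IH Ck_on_SucD[OF Suc.prems] by simp
  have d: "((\<lambda>x. inverse (f x)) has_derivative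
      (\<lambda>h. - (inverse (f x) * frechet_derivative f (at x) h * inverse (f x)))) (at x)" if "x \<in> U" for x
    using Deriv.has_derivative_inverse[OF assms(2)[OF that] Ck_on_Suc_has_derivative[OF Suc.prems that]] .
  have "Ck_on k (\<lambda>x. - (inverse (f x) * frechet_derivative f (at x) v * inverse (f x))) U" for v
    by (intro Ck_on_bounded_linear[OF bounded_linear_minus[OF bounded_linear_ident] assms(1)]
        Ck_on_bilinear[OF bounded_bilinear_mult assms(1)] i) (use Suc.prems in simp)
  with Ck_on_SucI[OF assms(1) d] show ?case by blast
qed

lemma Ck_on_sqrt:
  fixes f :: "'a::euclidean_space => real"
  assumes "open U" "\<And>x. x \<in> U ==> f x > 0"
  shows "Ck_on k f U ==> Ck_on k (\<lambda>x. sqrt (f x)) U"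
proof (induction k)
  case 0 then show ?case using assms by (auto intro!: continuous_intros)
next
  case (Suc k)
  have i: "Ck_on k (\<lambda>x. sqrt (f x)) U" using Suc.IH Ck_on_SucD[OF Suc.prems] by simp
  have i2: "Ck_on k (\<lambda>x. inverse (sqrt (f x))) U"
    by (rule Ck_on_inverse[OF assms(1) _ i]) (use assms(2) in force)
  have d: "((\<lambda>x. sqrt (f x)) has_derivative
      (\<lambda>h. inverse (sqrt (f x)) * frechet_derivative f (at x) h / 2)) (at x)" if "x \<in> U" for x
  proof -
    have "(sqrt has_derivative (\<lambda>h. h * (inverse (sqrt (f x)) / 2))) (at (f x))"
      using DERIV_real_sqrt[OF assms(2)[OF that]] unfolding has_field_derivative_def by (simp only: mult.commute[of _ "inverse _ / 2"])
    from has_derivative_compose[OF Ck_on_Suc_has_derivative[OF Suc.prems that] this]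
    show ?thesis by (simp add: mult_ac)
  qed
  have "Ck_on k (\<lambda>x. inverse (sqrt (f x)) * frechet_derivative f (at x) v / 2) U" for v
    by (intro Ck_on_bounded_linear[OF bounded_linear_divide assms(1)]
        Ck_on_bilinear[OF bounded_bilinear_mult assms(1)] i2) (use Suc.prems in simp)
  with Ck_on_SucI[OF assms(1) d] show ?case by blast
qed

lemma Ck_on_sum:
  "open U ==> (\<And>i. i \<in> I ==> Ck_on k (f i) U) ==> Ck_on k (\<lambda>x. \<Sum>i\<in>I. f i x) U"
  by (induction I rule: infinite_finite_induct) (auto intro: Ck_on_const Ck_on_add)

subsection \<open>Symmetry of second derivatives\<close>

lemma has_real_derivative_along:
  fixes f :: "'a::real_normed_vector => real"
  assumes "(f has_derivative f') (at (x + s *\<^sub>R v))"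
  shows "((\<lambda>s. f (x + s *\<^sub>R v)) has_real_derivative f' v) (at s)"
proof -
  have "((\<lambda>s. x + s *\<^sub>R v) has_derivative (\<lambda>h. h *\<^sub>R v)) (at s)"
    by (auto intro!: derivative_eq_intros)
  from has_derivative_compose[OF this assms]
  have "((\<lambda>s. f (x + s *\<^sub>R v)) has_derivative (\<lambda>h. f' (h *\<^sub>R v))) (at s)" .
  moreover have "f' (h *\<^sub>R v) = f' v * h" for h
    using linear_cmul[OF has_derivative_linear[OF assms]] by (simp add: mult.commute)
  ultimately show ?thesis by (simp add: has_field_derivative_def)
qed

text \<open>Two applications of the mean value theorem: in direction v to the difference of f across
  the step h w, and in direction w to the derivative along v.\<close>

lemma second_difference_mvt:
  fixes f :: "'a::euclidean_space => real"
  assumes "h > 0" "\<And>s t. 0 \<le> s ==> s \<le> h ==> 0 \<le> t ==> t \<le> h ==> x + s *\<^sub>R v + t *\<^sub>R w \<in> U"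
    and f: "\<And>y. y \<in> U ==> f differentiable (at y)"
    and g: "\<And>y. y \<in> U ==> (\<lambda>z. frechet_derivative f (at z) v) differentiable (at y)"
  obtains s t where "0 \<le> s" "s \<le> h" "0 \<le> t" "t \<le> h"
    "f (x + h *\<^sub>R v + h *\<^sub>R w) - f (x + h *\<^sub>R v) - f (x + h *\<^sub>R w) + f x
      = h * (h * frechet_derivative (\<lambda>z. frechet_derivative f (at z) v) (at (x + s *\<^sub>R v + t *\<^sub>R w)) w)"
proof -
  define g where "g = (\<lambda>z. frechet_derivative f (at z) v)"
  have df: "((\<lambda>s. f (x + t *\<^sub>R w + s *\<^sub>R v)) has_real_derivative g (x + t *\<^sub>R w + s *\<^sub>R v)) (at s)"
    if "0 \<le> s" "s \<le> h" "0 \<le> t" "t \<le> h" for s t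
    unfolding g_def
    by (rule has_real_derivative_along) (use f assms(2)[OF that] in \<open>simp add: frechet_derivative_works[symmetric] add_ac\<close>)
  have "\<exists>s>0. s < h \<and> (f (x + h *\<^sub>R w + h *\<^sub>R v) - f (x + 0 *\<^sub>R w + h *\<^sub>R v)) - (f (x + h *\<^sub>R w + 0 *\<^sub>R v) - f (x + 0 *\<^sub>R w + 0 *\<^sub>R v))
    = (h - 0) * (g (x + h *\<^sub>R w + s *\<^sub>R v) - g (x + 0 *\<^sub>R w + s *\<^sub>R v))"
    by (rule MVT2[OF assms(1)], rule DERIV_diff; rule df) (use assms(1) in auto)
  then obtain s where s: "0 < s" "s < h" "(f (x + h *\<^sub>R w + h *\<^sub>R v) - f (x + h *\<^sub>R v)) - (f (x + h *\<^sub>R w) - f x)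
    = h * (g (x + h *\<^sub>R w + s *\<^sub>R v) - g (x + s *\<^sub>R v))" by auto
  have dg: "((\<lambda>t. g (x + s *\<^sub>R v + t *\<^sub>R w)) has_real_derivative
      frechet_derivative g (at (x + s *\<^sub>R v + t *\<^sub>R w)) w) (at t)" if "0 \<le> t" "t \<le> h" for t
    by (rule has_real_derivative_along)
      (use g assms(2)[of s t] that s in \<open>simp add: frechet_derivative_works[symmetric] g_def\<close>)
  have "\<exists>t>0. t < h \<and> g (x + s *\<^sub>R v + h *\<^sub>R w) - g (x + s *\<^sub>R v + 0 *\<^sub>R w)
    = (h - 0) * frechet_derivative g (at (x + s *\<^sub>R v + t *\<^sub>R w)) w"
    by (rule MVT2[OF assms(1)]) (rule dg)
  then obtain t where t: "0 < t" "t < h" "g (x + s *\<^sub>R v + h *\<^sub>R w) - g (x + s *\<^sub>R v)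
    = h * frechet_derivative g (at (x + s *\<^sub>R v + t *\<^sub>R w)) w" by auto
  show ?thesis
    by (rule that[of s t]) (use s t in \<open>simp_all add: g_def[symmetric] add_ac diff_diff_eq algebra_simps\<close>)
qed

text \<open>Both mixed derivatives represent the same second difference at points close to x. If
  they differed by 2 e at x, then by continuity they would still differ at these points.\<close>

lemma symmetric_second_derivative_real:
  fixes f :: "'a::euclidean_space => real"
  assumes "open U" "x \<in> U" "Ck_on 2 f U"
  shows "frechet_derivative (\<lambda>z. frechet_derivative f (at z) v) (at x) w
       = frechet_derivative (\<lambda>z. frechet_derivative f (at z) w) (at x) v"
proof (rule ccontr)
  define A where "A = (\<lambda>v w y. frechet_derivative (\<lambda>z. frechet_derivative f (at z) v) (at y) w)"
  assume "\<not> ?thesis"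
  then have ne: "A v w x \<noteq> A w v x" by (simp add: A_def)
  define e where "e = \<bar>A v w x - A w v x\<bar> / 2"
  have e: "e > 0" using ne by (simp add: e_def)
  have ck: "\<And>y. y \<in> U ==> f differentiable (at y)"
    "\<And>v y. y \<in> U ==> (\<lambda>z. frechet_derivative f (at z) v) differentiable (at y)"
    "\<And>v w. continuous_on U (A v w)"
    using assms(3) by (auto simp: numeral_2_eq_2 A_def)
  have "\<exists>d>0. \<forall>y. dist y x < d \<longrightarrow> dist (A a b y) (A a b x) < e" for a b
    using ck(3)[of a b] assms(1,2) e by (metis continuous_on_eq_continuous_at continuous_at_eps_delta)
  then obtain d1 d2 where d: "d1 > 0" "d2 > 0" "\<And>y. dist y x < d1 ==> dist (A v w y) (A v w x) < e"
     "\<And>y. dist y x < d2 ==> dist (A w v y) (A w v x) < e" by metis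
  obtain d3 where d3: "d3 > 0" "ball x d3 \<subseteq> U" using assms(1,2) open_contains_ball by metis
  define d where "d = min d1 (min d2 d3)"
  have dpos: "d > 0" using d d3 by (simp add: d_def)
  \<comment> \<open>All points of the parallelogram with sides h v and h w lie within h (|v| + |w|)
    < d of x. The added 1 covers the case v = w = 0.\<close>
  define h where "h = d / (2 * (norm v + norm w + 1))"
  have hpos: "h > 0" using dpos by (simp add: h_def add_nonneg_pos)
  have dist: "dist (x + s *\<^sub>R a + t *\<^sub>R b) x < d" if "0 \<le> s" "s \<le> h" "0 \<le> t" "t \<le> h"
    "norm a + norm b = norm v + norm w" for s t a b
  proof -
    have "dist (x + s *\<^sub>R a + t *\<^sub>R b) x \<le> norm (s *\<^sub>R a) + norm (t *\<^sub>R b)"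
      unfolding dist_norm by (metis add.assoc add_diff_cancel_left' norm_triangle_ineq)
    also have "\<dots> \<le> h * norm a + h * norm b"
      using that by (auto intro!: add_mono mult_right_mono)
    also have "\<dots> = h * (norm v + norm w)" using that(5) by (simp add: distrib_left[symmetric])
    also have "\<dots> < h * (2 * (norm v + norm w + 1))"
    proof (rule mult_strict_left_mono[OF _ hpos])
      define n where "n = norm v + norm w"
      have "0 \<le> n" by (simp add: n_def)
      then show "norm v + norm w < 2 * (norm v + norm w + 1)" unfolding n_def[symmetric] by simp
    qed
    also have "\<dots> = d" using add_nonneg_pos[of "norm v + norm w" 1] by (simp add: h_def)
    finally show ?thesis .
  qed
  have U: "x + s *\<^sub>R a + t *\<^sub>R b \<in> U" if "0 \<le> s" "s \<le> h" "0 \<le> t" "t \<le> h"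
    "norm a + norm b = norm v + norm w" for s t a b
    using dist[OF that] d3 by (auto simp: d_def dist_commute)
  have UU: "\<And>s t. 0 \<le> s ==> s \<le> h ==> 0 \<le> t ==> t \<le> h ==> x + s *\<^sub>R v + t *\<^sub>R w \<in> U"
    "\<And>s t. 0 \<le> s ==> s \<le> h ==> 0 \<le> t ==> t \<le> h ==> x + s *\<^sub>R w + t *\<^sub>R v \<in> U"
    by (rule U; simp)+
  obtain s t where st: "0 \<le> s" "s \<le> h" "0 \<le> t" "t \<le> h"
    "f (x + h *\<^sub>R v + h *\<^sub>R w) - f (x + h *\<^sub>R v) - f (x + h *\<^sub>R w) + f x
      = h * (h * A v w (x + s *\<^sub>R v + t *\<^sub>R w))"
    unfolding A_def by (rule second_difference_mvt[where f=f, OF hpos UU(1) ck(1) ck(2)])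
  obtain s' t' where st': "0 \<le> s'" "s' \<le> h" "0 \<le> t'" "t' \<le> h"
    "f (x + h *\<^sub>R w + h *\<^sub>R v) - f (x + h *\<^sub>R w) - f (x + h *\<^sub>R v) + f x
      = h * (h * A w v (x + s' *\<^sub>R w + t' *\<^sub>R v))"
    unfolding A_def by (rule second_difference_mvt[where f=f, OF hpos UU(2) ck(1) ck(2)])
  have "f (x + h *\<^sub>R w + h *\<^sub>R v) = f (x + h *\<^sub>R v + h *\<^sub>R w)" by (simp add: add_ac)
  then have "h * (h * A v w (x + s *\<^sub>R v + t *\<^sub>R w)) = h * (h * A w v (x + s' *\<^sub>R w + t' *\<^sub>R v))"
    unfolding st(5)[symmetric] st'(5)[symmetric] by simp
  then have "A v w (x + s *\<^sub>R v + t *\<^sub>R w) = A w v (x + s' *\<^sub>R w + t' *\<^sub>R v)"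
    using hpos by simp
  moreover have "dist (A v w (x + s *\<^sub>R v + t *\<^sub>R w)) (A v w x) < e"
    using dist[OF st(1-4), of v w] by (intro d(3)) (simp add: d_def)
  moreover have "dist (A w v (x + s' *\<^sub>R w + t' *\<^sub>R v)) (A w v x) < e"
    using dist[OF st'(1-4), of w v] by (intro d(4)) (simp add: d_def)
  ultimately show False unfolding e_def dist_real_def by (smt (verit) field_sum_of_halves)
qed

lemma symmetric_second_derivative:
  fixes f :: "'a::euclidean_space => complex"
  assumes "open U" "x \<in> U" "Ck_on 2 f U"
  shows "frechet_derivative (\<lambda>z. frechet_derivative f (at z) v) (at x) w
       = frechet_derivative (\<lambda>z. frechet_derivative f (at z) w) (at x) v"
proof -
  have *: "L (frechet_derivative (\<lambda>z. frechet_derivative f (at z) v) (at x) w)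
     = frechet_derivative (\<lambda>z. frechet_derivative (\<lambda>x. L (f x)) (at z) v) (at x) w"
    if L: "bounded_linear L" for L :: "complex => real" and v w
  proof -
    have 1: "frechet_derivative (\<lambda>x. L (f x)) (at z) v = L (frechet_derivative f (at z) v)" if "z \<in> U" for z
      using frechet_derivative_eq[OF bounded_linear.has_derivative[OF L Ck_on_Suc_has_derivative[of 1 f U z]]]
        that assms(3) by (simp add: numeral_2_eq_2)
    have "((\<lambda>z. frechet_derivative f (at z) v) has_derivative frechet_derivative (\<lambda>z. frechet_derivative f (at z) v) (at x)) (at x)"
      using assms(2,3) by (simp add: numeral_2_eq_2 frechet_derivative_works[symmetric])
    from bounded_linear.has_derivative[OF L this]
    have "((\<lambda>z. frechet_derivative (\<lambda>x. L (f x)) (at z) v) has_derivative (\<lambda>h. L (frechet_derivative (\<lambda>z. frechet_derivative f (at z) v) (at x) h))) (at x)"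
      by (rule has_derivative_transform_within_open[OF _ assms(1,2)]) (simp add: 1)
    from frechet_derivative_eq[OF this] show ?thesis by simp
  qed
  show ?thesis
    by (rule complex_eqI; simp only: *[OF bounded_linear_Re] *[OF bounded_linear_Im])
      (rule symmetric_second_derivative_real[OF assms(1,2) Ck_on_bounded_linear[OF _ assms(1,3)]],
       simp add: bounded_linear_Re bounded_linear_Im)+
qed

lemma open_minus0 [simp]: "open (- {0::'a::real_normed_vector})" by (rule open_Compl[OF closed_singleton])

lemma smooth_on_cong:
  "open U ==> (\<And>x. x \<in> U ==> f x = g x) ==> smooth_on f U \<longleftrightarrow> smooth_on g U"
  unfolding smooth_on_def using Ck_on_cong by metis

lemma smooth_on_bilinear:
  "bounded_bilinear B ==> open U ==> smooth_on f U ==> smooth_on g U ==> smooth_on (\<lambda>x. B (f x) (g x)) U"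
  by (simp add: smooth_on_def Ck_on_bilinear)

lemma smooth_on_bounded_linear:
  "bounded_linear L ==> open U ==> smooth_on f U ==> smooth_on (\<lambda>x. L (f x)) U"
  by (simp add: smooth_on_def Ck_on_bounded_linear)

lemma smooth_on_imp_has_derivative:
  "smooth_on f U ==> x \<in> U ==> (f has_derivative frechet_derivative f (at x)) (at x)"
  unfolding smooth_on_def using Ck_on_Suc_has_derivative[of 0] by metis

lemma smooth_on_frechet: "smooth_on f U ==> smooth_on (\<lambda>x. frechet_derivative f (at x) v) U"
  unfolding smooth_on_def using Ck_on.simps(2) by metis

lemma smooth_on_norm: "smooth_on (norm :: 'a::euclidean_space => real) (- {0})"
proof -
  have "Ck_on k (\<lambda>x. sqrt (x \<bullet> x)) (- {0::'a})" for k
    by (rule Ck_on_sqrt, simp, simp, rule Ck_on_bilinear[OF bounded_bilinear_inner]) (auto intro!: Ck_on_linear bounded_linear_ident)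
  then show ?thesis by (simp add: smooth_on_def norm_eq_sqrt_inner[abs_def])
qed

section \<open>Calculus on the sphere\<close>

lemma retr_in_S6: "x \<noteq> 0 ==> retr x \<in> S6" by (simp add: retr_def)
lemma norm_retr_eq_1 [simp]: "x \<noteq> 0 ==> norm (retr x) = 1" by (simp add: retr_def)
lemma retr_S6: "u \<in> S6 ==> retr u = u" by (simp add: retr_def)
lemma S6_nonzero: "u \<in> S6 ==> u \<noteq> 0" by auto
lemma retr_scaleR: "c > 0 ==> retr (c *\<^sub>R x) = retr x" by (simp add: retr_def)
lemma norm_retr: "norm x *\<^sub>R retr x = x" by (cases "x = 0") (simp_all add: retr_def)

text \<open>Functions on the sphere are functions on \<open>vec7\<close> whose values off the sphere
  are irrelevant. They are differentiated along their extension of degree \<open>0\<close>, i.e. \<open>sder i\<close>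
  is the derivative along the tangential part of the \<open>i\<close>-th basis vector.\<close>

definition sm :: "(vec7 => complex) => bool"
  where "sm f \<longleftrightarrow> smooth_on (\<lambda>x. f (retr x)) (- {0})"

definition sder :: "7 => (vec7 => complex) => vec7 => complex"
  where "sder i f u = frechet_derivative (\<lambda>x. f (retr x)) (at u) (axis i 1)"

section \<open>Algebra of smooth functions on the sphere\<close>

lemma sm_cong: "(\<And>u. u \<in> S6 ==> f u = g u) ==> sm f \<longleftrightarrow> sm g"
  unfolding sm_def by (rule smooth_on_cong[OF open_minus0]) (auto simp: retr_in_S6)

lemma sm_const: "sm (\<lambda>u. c)" by (simp add: sm_def smooth_on_def Ck_on_const)

lemma sm_add: "sm f ==> sm g ==> sm (\<lambda>u. f u + g u)"
  by (simp add: sm_def smooth_on_def Ck_on_add)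

lemma sm_mult: "sm f ==> sm g ==> sm (\<lambda>u. f u * g u)"
  unfolding sm_def by (rule smooth_on_bilinear[OF bounded_bilinear_mult open_minus0])

lemma sm_minus: "sm f ==> sm (\<lambda>u. - f u)"
  unfolding sm_def by (rule smooth_on_bounded_linear[OF bounded_linear_minus[OF bounded_linear_ident] open_minus0])

lemma sm_diff: "sm f ==> sm g ==> sm (\<lambda>u. f u - g u)"
  using sm_add[of f "\<lambda>u. - g u"] sm_minus[of g] by simp

lemma sm_cnj: "sm f ==> sm (\<lambda>u. cnj (f u))"
  unfolding sm_def by (rule smooth_on_bounded_linear[OF bounded_linear_cnj open_minus0])

lemma sm_sum: "(\<And>i. i \<in> I ==> sm (f i)) ==> sm (\<lambda>u. \<Sum>i\<in>I. f i u)"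
  by (simp add: sm_def smooth_on_def Ck_on_sum)

lemma sm_prod: "(\<And>i. i \<in> I ==> sm (f i)) ==> sm (\<lambda>u. \<Prod>i\<in>I. f i u)"
  by (induction I rule: infinite_finite_induct) (auto intro: sm_const sm_mult)

lemma sm_inverse: "sm f ==> (\<And>u. u \<in> S6 ==> f u \<noteq> 0) ==> sm (\<lambda>u. inverse (f u))"
  unfolding sm_def smooth_on_def by (intro allI Ck_on_inverse) (auto simp: retr_in_S6)

lemma sm_divide: "sm f ==> sm g ==> (\<And>u. u \<in> S6 ==> g u \<noteq> 0) ==> sm (\<lambda>u. f u / g u)"
  unfolding divide_inverse by (intro sm_mult sm_inverse)

lemma sm_of_real: "smooth_on (\<lambda>x. h (retr x)) (- {0}) ==> sm (\<lambda>u. complex_of_real (h u))"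
  unfolding sm_def by (rule smooth_on_bounded_linear[OF bounded_linear_of_real open_minus0])

lemma sm_sqrt:
  assumes "sm (\<lambda>u. complex_of_real (h u))" "\<And>u. u \<in> S6 ==> h u > 0"
  shows "sm (\<lambda>u. complex_of_real (sqrt (h u)))"
proof (rule sm_of_real)
  have "smooth_on (\<lambda>x. h (retr x)) (- {0})"
    using smooth_on_bounded_linear[OF bounded_linear_Re open_minus0 assms(1)[unfolded sm_def]] by simp
  then show "smooth_on (\<lambda>x. sqrt (h (retr x))) (- {0})"
    unfolding smooth_on_def by (intro allI Ck_on_sqrt) (auto simp: retr_in_S6 assms(2))
qed

lemma smooth_on_inverse_norm: "smooth_on (\<lambda>x::vec7. inverse (norm x)) (- {0})"
  using smooth_on_norm unfolding smooth_on_def by (intro allI Ck_on_inverse) auto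

lemma smooth_on_nth: "smooth_on (\<lambda>x::vec7. x $ i) (- {0})"
  unfolding smooth_on_def by (intro allI Ck_on_linear bounded_linear_vec_nth) auto

lemma sm_coord: "sm (\<lambda>u. complex_of_real (u $ i))"
  by (rule sm_of_real)
    (simp add: retr_def smooth_on_bilinear[OF bounded_bilinear_mult open_minus0 smooth_on_inverse_norm smooth_on_nth])

lemmas sm_intros = sm_const sm_add sm_mult sm_minus sm_diff sm_cnj sm_sum sm_prod sm_coord

lemma sm_continuous: "sm f ==> continuous_on (- {0}) (\<lambda>x. f (retr x))"
  unfolding sm_def smooth_on_def using Ck_on.simps(1) by blast

lemma sm_continuous_S6: "sm f ==> continuous_on S6 f"
  using continuous_on_subset[OF sm_continuous, of f S6]
  by (rule continuous_on_eq) (auto simp: retr_S6)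

lemma sm_has_derivative:
  "sm f ==> x \<noteq> 0 ==> ((\<lambda>x. f (retr x)) has_derivative frechet_derivative (\<lambda>x. f (retr x)) (at x)) (at x)"
  unfolding sm_def by (rule smooth_on_imp_has_derivative) auto

lemma linear_axis_expansion:
  fixes f :: "vec7 => complex"
  assumes "linear f" shows "f v = (\<Sum>i\<in>UNIV. of_real (v $ i) * f (axis i 1))"
proof -
  have "v = (\<Sum>i\<in>UNIV. (v $ i) *\<^sub>R axis i 1)"
    using basis_expansion[of v] by (simp add: scalar_mult_eq_scaleR)
  then have "f v = (\<Sum>i\<in>UNIV. f ((v $ i) *\<^sub>R axis i 1))" using linear_sum[OF assms] by metis
  also have "\<dots> = (\<Sum>i\<in>UNIV. (v $ i) *\<^sub>R f (axis i 1))"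
    by (simp only: linear_cmul[OF assms])
  finally show ?thesis by (simp only: scaleR_conv_of_real)
qed

lemma sm_frechet_sder:
  assumes "sm f" "x \<noteq> 0"
  shows "frechet_derivative (\<lambda>x. f (retr x)) (at x) v = (\<Sum>i\<in>UNIV. of_real (v $ i) * sder i f x)"
  unfolding sder_def
  by (rule linear_axis_expansion[OF has_derivative_linear[OF sm_has_derivative[OF assms]]])

section \<open>Rules for tangential derivatives\<close>

lemma sder_cong:
  assumes "\<And>u. u \<in> S6 ==> f u = g u" "u \<noteq> 0"
  shows "sder i f u = sder i g u"
proof -
  have "(\<lambda>x. f (retr x)) x = (\<lambda>x. g (retr x)) x" if "x \<in> -{0}" for x
    using that assms(1) retr_in_S6 by simp
  then have "((\<lambda>x. f (retr x)) has_derivative D) (at u) \<longleftrightarrow> ((\<lambda>x. g (retr x)) has_derivative D) (at u)" for D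
    using has_derivative_transform_within_open[of "\<lambda>x. f (retr x)" D u UNIV "-{0}" "\<lambda>x. g (retr x)"]
      has_derivative_transform_within_open[of "\<lambda>x. g (retr x)" D u UNIV "-{0}" "\<lambda>x. f (retr x)"] assms(2) by auto
  then show ?thesis by (simp add: sder_def frechet_derivative_def)
qed

lemma sder_eqI:
  "((\<lambda>x. f (retr x)) has_derivative f') (at u) ==> sder i f u = f' (axis i 1)"
  unfolding sder_def by (simp add: frechet_derivative_eq)

lemma sder_const: "sder i (\<lambda>u. c) u = 0"
  by (simp add: sder_def frechet_derivative_const)

lemma sder_add: "sm f ==> sm g ==> u \<in> S6 ==> sder i (\<lambda>u. f u + g u) u = sder i f u + sder i g u"
  unfolding sder_def[of _ f] sder_def[of _ g]
  by (rule sder_eqI[OF has_derivative_add[OF sm_has_derivative sm_has_derivative]]) auto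

lemma sder_mult:
  "sm f ==> sm g ==> u \<in> S6 ==> sder i (\<lambda>u. f u * g u) u = f u * sder i g u + sder i f u * g u"
  unfolding sder_def[of _ f] sder_def[of _ g]
  by (rule trans[OF sder_eqI[OF has_derivative_mult[OF sm_has_derivative sm_has_derivative]]]) (auto simp: retr_S6)

lemma sder_bounded_linear:
  assumes "bounded_linear L" "sm f" "u \<in> S6"
  shows "sder i (\<lambda>u. L (f u)) u = L (sder i f u)"
  unfolding sder_def[of _ f]
  by (rule sder_eqI[OF bounded_linear.has_derivative[OF assms(1) sm_has_derivative]]) (use assms in auto)

lemma sder_minus: "sm f ==> u \<in> S6 ==> sder i (\<lambda>u. - f u) u = - sder i f u"
  by (rule sder_bounded_linear[OF bounded_linear_minus[OF bounded_linear_ident]])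

lemma sder_cnj: "sm f ==> u \<in> S6 ==> sder i (\<lambda>u. cnj (f u)) u = cnj (sder i f u)"
  by (rule sder_bounded_linear[OF bounded_linear_cnj])

lemma sder_diff: "sm f ==> sm g ==> u \<in> S6 ==> sder i (\<lambda>u. f u - g u) u = sder i f u - sder i g u"
  using sder_add[of f "\<lambda>u. - g u" u i] by (simp add: sm_minus sder_minus)

lemma sder_cmult: "sm f ==> u \<in> S6 ==> sder i (\<lambda>u. c * f u) u = c * sder i f u"
  by (simp add: sder_mult sm_const sder_const)

lemma sder_sum:
  "u \<in> S6 ==> (\<And>j. j \<in> I ==> sm (f j)) ==> sder i (\<lambda>u. \<Sum>j\<in>I. f j u) u = (\<Sum>j\<in>I. sder i (f j) u)"
  by (induction I rule: infinite_finite_induct) (simp_all add: sder_const sder_add sm_sum)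

lemma norm_has_derivative: "x \<noteq> 0 ==> (norm has_derivative (\<lambda>h. h \<bullet> sgn x)) (at x)"
  using GDERIV_norm[of x] by (simp add: gderiv_def)

lemma retr_has_derivative:
  assumes "x \<noteq> 0"
  shows "(retr has_derivative (\<lambda>v. (v - (retr x \<bullet> v) *\<^sub>R retr x) /\<^sub>R norm x)) (at x)"
proof -
  have "((\<lambda>x. x /\<^sub>R norm x) has_derivative
    (\<lambda>v. inverse (norm x) *\<^sub>R v + (- (inverse (norm x) * (v \<bullet> sgn x) * inverse (norm x))) *\<^sub>R x)) (at x)"
    by (intro has_derivative_scaleR Deriv.has_derivative_inverse norm_has_derivative has_derivative_ident) (use assms in auto)
  then show ?thesis unfolding retr_def[abs_def]
    by (rule has_derivative_eq_rhs) (simp add: fun_eq_iff sgn_div_norm algebra_simps inner_commute)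
qed

lemma frechet_derivative_retr:
  "x \<noteq> 0 ==> frechet_derivative retr (at x) v = (v - (retr x \<bullet> v) *\<^sub>R retr x) /\<^sub>R norm x"
  by (subst frechet_derivative_eq[OF retr_has_derivative]) auto

lemma sder_coord:
  assumes "u \<in> S6"
  shows "sder i (\<lambda>u. complex_of_real (u $ j)) u = of_real ((if i = j then 1 else 0) - u $ i * u $ j)"
proof -
  have "((\<lambda>x. complex_of_real (retr x $ j)) has_derivative
     (\<lambda>v. of_real (((v - (retr u \<bullet> v) *\<^sub>R retr u) /\<^sub>R norm u) $ j))) (at u)"
    by (rule bounded_linear.has_derivative[OF bounded_linear_of_real
          bounded_linear.has_derivative[OF bounded_linear_vec_nth retr_has_derivative]]) (use assms in auto)
  from sder_eqI[OF this] show ?thesis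
    using assms by (simp add: retr_S6 inner_axis) (simp add: axis_def)
qed

text \<open>The derivative of a function of degree 0 has degree -1. The factor restores degree 0, so
  that \<open>sder i f\<close> can be treated as a function on the sphere and differentiated
  again.\<close>

lemma sder_retr:
  assumes "sm f" "x \<noteq> 0"
  shows "sder i f (retr x) = norm x *\<^sub>R sder i f x"
proof -
  let ?E = "\<lambda>x. f (retr x)"
  have 1: "((\<lambda>y::vec7. norm x *\<^sub>R y) has_derivative (\<lambda>v. norm x *\<^sub>R v)) (at (retr x))"
    by (auto intro!: derivative_eq_intros)
  have "(?E has_derivative frechet_derivative ?E (at x)) (at (norm x *\<^sub>R retr x))"
    using sm_has_derivative[OF assms] by (simp add: norm_retr)
  from has_derivative_compose[OF 1 this]
  have "(?E has_derivative (\<lambda>v. frechet_derivative ?E (at x) (norm x *\<^sub>R v))) (at (retr x))"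
    using assms(2) by (simp add: retr_scaleR)
  from sder_eqI[OF this] show ?thesis
    using linear_cmul[OF has_derivative_linear[OF sm_has_derivative[OF assms]]] by (simp add: sder_def)
qed

lemma sm_sder:
  assumes "sm f" shows "sm (sder i f)"
proof -
  have "smooth_on (\<lambda>x. norm x *\<^sub>R sder i f x) (- {0})"
    unfolding sder_def using assms unfolding sm_def
    by (intro smooth_on_bilinear[OF bounded_bilinear_scaleR open_minus0] smooth_on_norm smooth_on_frechet)
  then show ?thesis unfolding sm_def
    using smooth_on_cong[OF open_minus0, of "\<lambda>x. sder i f (retr x)" "\<lambda>x. norm x *\<^sub>R sder i f x"]
      sder_retr[OF assms] by simp
qed

text \<open>Before the second derivative is taken, \<open>sder j f\<close> is extended with degree
  0, that is, the flat derivative is multiplied by the norm. The derivative of the norm along the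
  i-th axis is \<open>u $ i\<close>, and this is the only obstruction to commuting.\<close>

lemma sder_commute:
  assumes "sm f" "u \<in> S6"
  shows "sder i (sder j f) u - sder j (sder i f) u = of_real (u $ i) * sder j f u - of_real (u $ j) * sder i f u"
proof -
  let ?E = "\<lambda>x. f (retr x)"
  have u: "u \<noteq> 0" "norm u = 1" using assms(2) by auto
  have E: "smooth_on ?E (- {0})" using assms(1) by (simp add: sm_def)
  have *: "sder i (sder j f) u = of_real (u $ i) * sder j f u
     + frechet_derivative (\<lambda>x. frechet_derivative ?E (at x) (axis j 1)) (at u) (axis i 1)" for i j
  proof -
    have "((\<lambda>x. sder j f x) has_derivative
        frechet_derivative (\<lambda>x. frechet_derivative ?E (at x) (axis j 1)) (at u)) (at u)"
      using smooth_on_imp_has_derivative[OF smooth_on_frechet[OF E]] u unfolding sder_def by simp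
    then have "((\<lambda>x. norm x *\<^sub>R sder j f x) has_derivative
       (\<lambda>v. norm u *\<^sub>R frechet_derivative (\<lambda>x. frechet_derivative ?E (at x) (axis j 1)) (at u) v
          + (v \<bullet> sgn u) *\<^sub>R sder j f u)) (at u)"
      by (rule has_derivative_scaleR[OF norm_has_derivative[OF u(1)]])
    then have "((\<lambda>x. sder j f (retr x)) has_derivative
       (\<lambda>v. norm u *\<^sub>R frechet_derivative (\<lambda>x. frechet_derivative ?E (at x) (axis j 1)) (at u) v
          + (v \<bullet> sgn u) *\<^sub>R sder j f u)) (at u)"
      by (rule has_derivative_transform_within_open[OF _ open_minus0])
        (use u sder_retr[OF assms(1)] in auto)
    from sder_eqI[OF this] show ?thesis
      using u by (simp add: sgn_div_norm inner_axis' scaleR_conv_of_real)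
  qed
  have "Ck_on 2 ?E (- {0})" using E by (simp add: smooth_on_def)
  from symmetric_second_derivative[OF open_minus0 _ this, of u "axis j 1" "axis i 1"] u
  show ?thesis by (simp add: *)
qed

text \<open>Euler's relation: the extension of degree 0 is constant on the ray through u.\<close>

lemma sder_euler:
  assumes "sm f" "u \<in> S6"
  shows "(\<Sum>i\<in>UNIV. of_real (u $ i) * sder i f u) = 0"
proof -
  let ?E = "\<lambda>x. f (retr x)"
  have u: "u \<noteq> 0" using assms(2) by auto
  have 1: "((\<lambda>t::real. t *\<^sub>R u) has_derivative (\<lambda>h. h *\<^sub>R u)) (at 1)"
    by (auto intro!: derivative_eq_intros)
  have "(?E has_derivative frechet_derivative ?E (at u)) (at (1 *\<^sub>R u))"
    using sm_has_derivative[OF assms(1) u] by simp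
  from has_derivative_compose[OF 1 this]
  have "((\<lambda>t. ?E (t *\<^sub>R u)) has_derivative (\<lambda>h. frechet_derivative ?E (at u) (h *\<^sub>R u))) (at 1)" .
  moreover have "((\<lambda>t. ?E (t *\<^sub>R u)) has_derivative (\<lambda>h. 0)) (at 1)"
    by (rule has_derivative_transform_within_open[OF has_derivative_const open_greaterThan[of 0]])
      (auto simp: retr_scaleR)
  ultimately have "frechet_derivative ?E (at u) (1 *\<^sub>R u) = 0"
    using has_derivative_unique by (metis (no_types, lifting))
  then show ?thesis using sm_frechet_sder[OF assms(1) u, of u] by simp
qed

subsection \<open>Complex directions and vector fields\<close>

type_synonym cvec = "complex ^ 7"

definition cv :: "vec7 => cvec" where "cv u = (\<chi> i. of_real (u $ i))"

text \<open>The complex bilinear extension of the Euclidean product, not the Hermitian one. The two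
  eigenspaces of the cross product with u are isotropic for it and dual to each other.\<close>

definition cdot :: "cvec => cvec => complex" (infixl "\<odot>" 70)
  where "a \<odot> b = (\<Sum>i\<in>UNIV. a $ i * b $ i)"

definition dder :: "cvec => (vec7 => complex) => vec7 => complex"
  where "dder a f u = (\<Sum>i\<in>UNIV. a $ i * sder i f u)"

text \<open>The flat derivative of the components. It is not projected back to the tangent space, so
  derivatives of tangential fields may have a normal part.\<close>

definition vder :: "cvec => (vec7 => cvec) => vec7 => cvec"
  where "vder a F u = (\<chi> j. dder a (\<lambda>u. F u $ j) u)"

definition smv :: "(vec7 => cvec) => bool"
  where "smv F \<longleftrightarrow> (\<forall>j. sm (\<lambda>u. F u $ j))"

lemma cv_nth [simp]: "cv u $ i = of_real (u $ i)" by (simp add: cv_def)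
lemma vder_nth [simp]: "vder a F u $ j = dder a (\<lambda>u. F u $ j) u" by (simp add: vder_def)
lemma smvD: "smv F ==> sm (\<lambda>u. F u $ j)" by (simp add: smv_def)

lemma cdot_commute: "a \<odot> b = b \<odot> a" by (simp add: cdot_def mult.commute)
lemma cdot_add_left: "(a + b) \<odot> c = a \<odot> c + b \<odot> c" by (simp add: cdot_def sum.distrib algebra_simps)
lemma cdot_add_right: "a \<odot> (b + c) = a \<odot> b + a \<odot> c" by (simp add: cdot_def sum.distrib algebra_simps)
lemma cdot_diff_left: "(a - b) \<odot> c = a \<odot> c - b \<odot> c" by (simp add: cdot_def sum_subtractf algebra_simps)
lemma cdot_diff_right: "a \<odot> (b - c) = a \<odot> b - a \<odot> c" by (simp add: cdot_def sum_subtractf algebra_simps)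
lemma cdot_scale_left: "(k *s a) \<odot> b = k * (a \<odot> b)" by (simp add: cdot_def sum_distrib_left algebra_simps)
lemma cdot_scale_right: "a \<odot> (k *s b) = k * (a \<odot> b)" by (simp add: cdot_def sum_distrib_left algebra_simps)
lemma cdot_minus_left: "(- a) \<odot> b = - (a \<odot> b)" by (simp add: cdot_def sum_negf)
lemma cdot_minus_right: "a \<odot> (- b) = - (a \<odot> b)" by (simp add: cdot_def sum_negf)
lemma cdot_zero_left: "0 \<odot> b = 0" by (simp add: cdot_def)
lemma cdot_zero_right: "b \<odot> 0 = 0" by (simp add: cdot_def)
lemmas cdot_linear = cdot_add_left cdot_add_right cdot_diff_left cdot_diff_right cdot_scale_left
  cdot_scale_right cdot_minus_left cdot_minus_right cdot_zero_left cdot_zero_right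
lemma if_one_mult: "(if b then 1 else 0) * x = (if b then x else (0::complex))"
  "x * (if b then 1 else 0) = (if b then x else (0::complex))" by auto
lemma cdot_axis: "a \<odot> axis i 1 = a $ i" "axis i 1 \<odot> a = a $ i"
  by (simp_all add: cdot_def axis_def if_one_mult)
lemma cdot_ext: "(\<And>c. a \<odot> c = b \<odot> c) ==> a = b"
  by (metis cdot_axis(1) vec_eq_iff)
lemma cdot_sum_left: "(\<Sum>i\<in>I. f i) \<odot> b = (\<Sum>i\<in>I. f i \<odot> b)"
  by (induction I rule: infinite_finite_induct) (simp_all add: cdot_linear)
lemma cv_cdot_self: "u \<in> S6 ==> cv u \<odot> cv u = 1"
proof -
  assume "u \<in> S6"
  then have "u \<bullet> u = 1" by (simp add: dot_square_norm)
  then have "(\<Sum>i\<in>UNIV. u $ i * u $ i) = 1" by (simp add: inner_vec_def)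
  then show ?thesis unfolding cdot_def cv_nth of_real_mult[symmetric] of_real_sum[symmetric] by simp
qed

lemma dder_dir_add: "dder (a + b) f u = dder a f u + dder b f u"
  by (simp add: dder_def sum.distrib algebra_simps)
lemma dder_dir_scale: "dder (k *s a) f u = k * dder a f u"
  by (simp add: dder_def sum_distrib_left algebra_simps)
lemma dder_dir_diff: "dder (a - b) f u = dder a f u - dder b f u"
  by (simp add: dder_def sum_subtractf algebra_simps)
lemma dder_dir_zero: "dder 0 f u = 0" by (simp add: dder_def)
lemma dder_axis: "dder (axis i 1) f u = sder i f u"
  by (simp add: dder_def axis_def if_one_mult)

lemma dder_cong: "(\<And>u. u \<in> S6 ==> f u = g u) ==> u \<in> S6 ==> dder a f u = dder a g u"
  unfolding dder_def by (intro sum.cong refl arg_cong2[of _ _ _ _ "(*)"] sder_cong) auto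
lemma dder_const: "dder a (\<lambda>u. c) u = 0" by (simp add: dder_def sder_const)
lemma dder_add: "sm f ==> sm g ==> u \<in> S6 ==> dder a (\<lambda>u. f u + g u) u = dder a f u + dder a g u"
  by (simp add: dder_def sder_add sum.distrib algebra_simps)
lemma dder_diff: "sm f ==> sm g ==> u \<in> S6 ==> dder a (\<lambda>u. f u - g u) u = dder a f u - dder a g u"
  by (simp add: dder_def sder_diff sum_subtractf algebra_simps)
lemma dder_minus: "sm f ==> u \<in> S6 ==> dder a (\<lambda>u. - f u) u = - dder a f u"
  by (simp add: dder_def sder_minus sum_negf)
lemma dder_mult: "sm f ==> sm g ==> u \<in> S6 ==> dder a (\<lambda>u. f u * g u) u = f u * dder a g u + dder a f u * g u"
  by (simp add: dder_def sder_mult sum.distrib sum_distrib_left sum_distrib_right algebra_simps)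
lemma dder_cmult: "sm f ==> u \<in> S6 ==> dder a (\<lambda>u. c * f u) u = c * dder a f u"
  by (simp add: dder_def sder_cmult sum_distrib_left algebra_simps)
lemma dder_sum: "u \<in> S6 ==> (\<And>j. j \<in> I ==> sm (f j)) ==> dder a (\<lambda>u. \<Sum>j\<in>I. f j u) u = (\<Sum>j\<in>I. dder a (f j) u)"
  by (induction I rule: infinite_finite_induct) (simp_all add: dder_const dder_add sm_sum)
lemma dder_coord: "u \<in> S6 ==> dder a (\<lambda>u. of_real (u $ j)) u = a $ j - (cv u \<odot> a) * of_real (u $ j)"
  by (simp add: dder_def sder_coord cdot_def sum_subtractf algebra_simps sum_distrib_left if_distrib[of "\<lambda>x. _ * x"]
     if_distrib[of of_real] cong: if_cong)
lemma dder_normal: "sm f ==> u \<in> S6 ==> dder (cv u) f u = 0"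
  using sder_euler by (simp add: dder_def)

lemma smv_const: "smv (\<lambda>u. a)" by (simp add: smv_def sm_const)
lemma smv_cv: "smv cv" by (simp add: smv_def sm_coord)
lemma smv_add: "smv F ==> smv G ==> smv (\<lambda>u. F u + G u)" by (simp add: smv_def sm_add)
lemma smv_diff: "smv F ==> smv G ==> smv (\<lambda>u. F u - G u)" by (simp add: smv_def sm_diff)
lemma smv_scale: "sm f ==> smv G ==> smv (\<lambda>u. f u *s G u)" by (simp add: smv_def sm_mult)
lemma sm_cdot: "smv F ==> smv G ==> sm (\<lambda>u. F u \<odot> G u)"
  unfolding cdot_def by (auto intro!: sm_intros dest: smvD)
lemmas smv_intros = smv_const smv_cv smv_add smv_diff smv_scale sm_cdot sm_intros

lemma vder_cong: "(\<And>u. u \<in> S6 ==> F u = G u) ==> u \<in> S6 ==> vder a F u = vder a G u"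
  unfolding vec_eq_iff vder_nth by (auto intro!: dder_cong)
lemma vder_const: "vder a (\<lambda>u. c) u = 0" by (simp add: vec_eq_iff dder_const)
lemma vder_add: "smv F ==> smv G ==> u \<in> S6 ==> vder a (\<lambda>u. F u + G u) u = vder a F u + vder a G u"
  by (simp add: vec_eq_iff dder_add smvD)
lemma vder_diff: "smv F ==> smv G ==> u \<in> S6 ==> vder a (\<lambda>u. F u - G u) u = vder a F u - vder a G u"
  by (simp add: vec_eq_iff dder_diff smvD)
lemma vder_scale: "sm f ==> smv G ==> u \<in> S6 ==> vder a (\<lambda>u. f u *s G u) u = f u *s vder a G u + dder a f u *s G u"
  by (simp add: vec_eq_iff dder_mult smvD)
lemma vder_cscale: "smv G ==> u \<in> S6 ==> vder a (\<lambda>u. c *s G u) u = c *s vder a G u"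
  by (simp add: vec_eq_iff dder_cmult smvD)
lemma vder_cv: "u \<in> S6 ==> vder a cv u = a - (cv u \<odot> a) *s cv u"
  by (simp add: vec_eq_iff dder_coord)
lemma dder_cdot: "smv F ==> smv G ==> u \<in> S6 ==> dder a (\<lambda>u. F u \<odot> G u) u = F u \<odot> vder a G u + vder a F u \<odot> G u"
  by (simp add: cdot_def dder_sum dder_mult smvD sm_mult sum.distrib)
lemma vder_dir_add: "vder (a + b) f u = vder a f u + vder b f u" by (simp add: vec_eq_iff dder_dir_add)
lemma vder_dir_scale: "vder (k *s a) f u = k *s vder a f u" by (simp add: vec_eq_iff dder_dir_scale)
lemma vder_normal: "smv f ==> u \<in> S6 ==> vder (cv u) f u = 0" by (simp add: vec_eq_iff dder_normal smvD)
text \<open>The second-order terms cancel up to the defect in \<open>sder_commute\<close>, which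
  pairs A and B with the normal and hence vanishes for tangential fields.\<close>

lemma dder_bracket:
  assumes f: "sm f" and A: "smv A" and B: "smv B" and u: "u \<in> S6"
    and tA: "cv u \<odot> A u = 0" and tB: "cv u \<odot> B u = 0"
  shows "dder (A u) (\<lambda>u. dder (B u) f u) u - dder (B u) (\<lambda>u. dder (A u) f u) u
    = dder (vder (A u) B u - vder (B u) A u) f u"
proof -
  have *: "dder a (\<lambda>u. dder (B u) f u) u
     = dder (vder a B u) f u + (\<Sum>i\<in>UNIV. \<Sum>j\<in>UNIV. a $ i * B u $ j * sder i (sder j f) u)"
    if "smv B" for a B
  proof -
    have "dder a (\<lambda>u. dder (B u) f u) u = (\<Sum>j\<in>UNIV. B u $ j * dder a (sder j f) u + dder a (\<lambda>u. B u $ j) u * sder j f u)"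
      unfolding dder_def[of "B _"] using smvD[OF that] sm_sder[OF f]
      by (subst dder_sum[OF u]) (auto intro!: sum.cong dder_mult sm_mult u)
    also have "\<dots> = (\<Sum>j\<in>UNIV. \<Sum>i\<in>UNIV. a $ i * B u $ j * sder i (sder j f) u) + dder (vder a B u) f u"
      by (simp add: sum.distrib dder_def[of "vder a B u"] dder_def[of a "sder _ f"] sum_distrib_left mult_ac)
    finally show ?thesis by (subst sum.swap) simp
  qed
  have "(\<Sum>i\<in>UNIV. \<Sum>j\<in>UNIV. A u $ i * B u $ j * sder i (sder j f) u) - (\<Sum>i\<in>UNIV. \<Sum>j\<in>UNIV. B u $ i * A u $ j * sder i (sder j f) u)
     = (\<Sum>i\<in>UNIV. \<Sum>j\<in>UNIV. A u $ i * B u $ j * (sder i (sder j f) u - sder j (sder i f) u))"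
    by (subst (2) sum.swap) (simp add: sum_subtractf algebra_simps)
  also have "\<dots> = (cv u \<odot> A u) * dder (B u) f u - (cv u \<odot> B u) * dder (A u) f u"
  proof -
    have "(\<Sum>i\<in>UNIV. \<Sum>j\<in>UNIV. cv u $ i * B u $ i * (A u $ j * sder j f u))
       = (\<Sum>i\<in>UNIV. \<Sum>j\<in>UNIV. cv u $ j * B u $ j * (A u $ i * sder i f u))" by (rule sum.swap)
    then show ?thesis
      unfolding sder_commute[OF f u] cdot_def dder_def sum_product
      by (simp add: sum_subtractf algebra_simps)
  qed
  finally show ?thesis using * A B tA tB by (simp add: dder_dir_diff)
qed

lemma vder_bracket:
  assumes "smv F" "smv A" "smv B" "u \<in> S6" "cv u \<odot> A u = 0" "cv u \<odot> B u = 0"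
  shows "vder (A u) (\<lambda>u. vder (B u) F u) u - vder (B u) (\<lambda>u. vder (A u) F u) u
    = vder (vder (A u) B u - vder (B u) A u) F u"
  using dder_bracket[OF smvD[OF assms(1)] assms(2-)] by (simp add: vec_eq_iff)

declare mem_sphere_0 [simp del] mem_sphere [simp del]

section \<open>The cross product\<close>

lemma exhaust_7: fixes x :: 7
  shows "x = 1 \<or> x = 2 \<or> x = 3 \<or> x = 4 \<or> x = 5 \<or> x = 6 \<or> x = 7"
proof (induct x)
  case (of_int z)
  then have "z = 0 \<or> z = 1 \<or> z = 2 \<or> z = 3 \<or> z = 4 \<or> z = 5 \<or> z = 6" by auto
  moreover have "(0::7) = 7" by simp
  ultimately show ?case by auto
qed

lemma UNIV_7: "UNIV = {1::7, 2, 3, 4, 5, 6, 7}" using exhaust_7 by auto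

lemma forall_7: "(\<forall>i::7. P i) \<longleftrightarrow> P 1 \<and> P 2 \<and> P 3 \<and> P 4 \<and> P 5 \<and> P 6 \<and> P 7"
  by (metis exhaust_7)

lemma sum_7: "sum f (UNIV::7 set) = f 1 + f 2 + f 3 + f 4 + f 5 + f 6 + f 7"
  unfolding UNIV_7 by (simp add: ac_simps)

text \<open>The product of imaginary octonions in coordinates. Over an arbitrary commutative ring it
  covers the real cross product and its complex bilinear extension.\<close>

definition xcross :: "'a::comm_ring_1 ^ 7 => 'a ^ 7 => 'a ^ 7"
  where "xcross a b = (\<chi> k.
    if k = 1 then (a$2*b$3 - a$3*b$2) + (a$4*b$5 - a$5*b$4) + (a$6*b$7 - a$7*b$6)
    else if k = 2 then (a$3*b$1 - a$1*b$3) + (a$4*b$6 - a$6*b$4) - (a$5*b$7 - a$7*b$5)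
    else if k = 3 then (a$1*b$2 - a$2*b$1) - (a$4*b$7 - a$7*b$4) - (a$5*b$6 - a$6*b$5)
    else if k = 4 then (a$5*b$1 - a$1*b$5) + (a$6*b$2 - a$2*b$6) - (a$7*b$3 - a$3*b$7)
    else if k = 5 then (a$1*b$4 - a$4*b$1) - (a$7*b$2 - a$2*b$7) - (a$6*b$3 - a$3*b$6)
    else if k = 6 then (a$7*b$1 - a$1*b$7) + (a$2*b$4 - a$4*b$2) - (a$3*b$5 - a$5*b$3)
    else (a$1*b$6 - a$6*b$1) - (a$2*b$5 - a$5*b$2) - (a$3*b$4 - a$4*b$3))"

lemma xcross_nth:
  "xcross a b $ 1 = (a$2*b$3 - a$3*b$2) + (a$4*b$5 - a$5*b$4) + (a$6*b$7 - a$7*b$6)"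
  "xcross a b $ 2 = (a$3*b$1 - a$1*b$3) + (a$4*b$6 - a$6*b$4) - (a$5*b$7 - a$7*b$5)"
  "xcross a b $ 3 = (a$1*b$2 - a$2*b$1) - (a$4*b$7 - a$7*b$4) - (a$5*b$6 - a$6*b$5)"
  "xcross a b $ 4 = (a$5*b$1 - a$1*b$5) + (a$6*b$2 - a$2*b$6) - (a$7*b$3 - a$3*b$7)"
  "xcross a b $ 5 = (a$1*b$4 - a$4*b$1) - (a$7*b$2 - a$2*b$7) - (a$6*b$3 - a$3*b$6)"
  "xcross a b $ 6 = (a$7*b$1 - a$1*b$7) + (a$2*b$4 - a$4*b$2) - (a$3*b$5 - a$5*b$3)"
  "xcross a b $ 7 = (a$1*b$6 - a$6*b$1) - (a$2*b$5 - a$5*b$2) - (a$3*b$4 - a$4*b$3)"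
  by (simp_all add: xcross_def)

lemma e3_eq: "e3 i j k u v w =
  u$i * v$j * w$k + u$j * v$k * w$i + u$k * v$i * w$j - u$i * v$k * w$j - u$j * v$i * w$k - u$k * v$j * w$i"
proof -
  have s: "{..<3} = {0, 1, 2::nat}" by auto
  have f0: "finite {1::nat, 2}" "0 \<notin> {1::nat, 2}" and f1: "finite {2::nat}" "1 \<notin> {2::nat}" by auto
  have p: "(\<Prod>i<3. f i) = f 0 * f 1 * f (2::nat)" for f :: "nat => real"
    by (simp add: eval_nat_numeral)
  have l: "length [\<lambda>x::vec7. x $ i, \<lambda>x. x $ j, \<lambda>x. x $ k] = 3" "length [u,v,w] = 3" by simp_all
  show ?thesis
    unfolding e3_def wedge_def l p simp_thms if_True
    unfolding s sum_over_permutations_insert[OF f0] sum_over_permutations_insert[OF f1] permutes_sing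
    by (simp add: sign_swap_id permutation_swap_id sign_compose sign_id transpose_def)
qed

lemma Phi_eq: "Phi u v w = xcross u v \<bullet> w"
  unfolding Phi_def e3_eq inner_vec_def sum_7 xcross_nth by (simp add: algebra_simps)

lemma cross7_eq: "cross7 u v = xcross u v"
  unfolding cross7_def Phi_eq by (rule the_equality) (auto simp: vector_eq_rdot)

abbreviation ccross :: "cvec => cvec => cvec" (infixl "\<otimes>" 75) where "ccross \<equiv> xcross"

lemma xcross_add_left: "(a + b) \<otimes> c = a \<otimes> c + b \<otimes> c"
  and xcross_add_right: "c \<otimes> (a + b) = c \<otimes> a + c \<otimes> b"
  and xcross_scale_left: "(k *s a) \<otimes> c = k *s (a \<otimes> c)"
  and xcross_scale_right: "c \<otimes> (k *s a) = k *s (c \<otimes> a)"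
  and xcross_minus_left: "(- a) \<otimes> c = - (a \<otimes> c)"
  and xcross_minus_right: "c \<otimes> (- a) = - (c \<otimes> a)"
  and xcross_diff_left: "(a - b) \<otimes> c = a \<otimes> c - b \<otimes> c"
  and xcross_diff_right: "c \<otimes> (a - b) = c \<otimes> a - c \<otimes> b"
  and xcross_self: "a \<otimes> a = 0"
  and xcross_zero_left: "0 \<otimes> a = 0"
  and xcross_zero_right: "a \<otimes> 0 = 0"
  by (simp_all add: vec_eq_iff forall_7 xcross_nth algebra_simps)

lemmas xcross_linear = xcross_add_left xcross_add_right xcross_scale_left xcross_scale_right
  xcross_minus_left xcross_minus_right xcross_diff_left xcross_diff_right xcross_zero_left xcross_zero_right

lemma xcross_anticommute: "b \<otimes> a = - (a \<otimes> b)"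
  by (simp add: vec_eq_iff forall_7 xcross_nth algebra_simps)

lemma xcross_dot_cyc: "(a \<otimes> b) \<odot> c = (b \<otimes> c) \<odot> a"
  by (simp add: cdot_def sum_7 xcross_nth algebra_simps)

lemma xcross_dot_swap: "(a \<otimes> b) \<odot> c = - ((a \<otimes> c) \<odot> b)"
  by (simp add: cdot_def sum_7 xcross_nth algebra_simps)

lemma xcross_dot_self: "a \<odot> (a \<otimes> b) = 0" "(a \<otimes> b) \<odot> a = 0" "(b \<otimes> a) \<odot> a = 0" "a \<odot> (b \<otimes> a) = 0"
  by (simp_all add: cdot_def sum_7 xcross_nth algebra_simps)

text \<open>Polarization of u x (u x c) = (u . c) u - (u . u) c, checked in coordinates. The
  formulas for iterated products of eigenvectors are derived from it.\<close>

lemma xcross_double: "a \<otimes> (b \<otimes> c) + b \<otimes> (a \<otimes> c) = (- 2 * (a \<odot> b)) *s c + (b \<odot> c) *s a + (a \<odot> c) *s b"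
  by (simp add: vec_eq_iff forall_7 cdot_def sum_7 xcross_nth algebra_simps)

lemma xcross_sum_left: "(\<Sum>i\<in>I. f i) \<otimes> b = (\<Sum>i\<in>I. f i \<otimes> b)"
  by (induction I rule: infinite_finite_induct) (simp_all add: xcross_linear)
lemma xcross_sum_right: "b \<otimes> (\<Sum>i\<in>I. f i) = (\<Sum>i\<in>I. b \<otimes> f i)"
  by (induction I rule: infinite_finite_induct) (simp_all add: xcross_linear)

lemma cv_xcross: "cv (xcross a b) = cv a \<otimes> cv b"
  by (simp add: vec_eq_iff forall_7 xcross_nth)

section \<open>Complex conjugation of vectors\<close>

definition vcnj :: "cvec => cvec" where "vcnj a = (\<chi> i. cnj (a $ i))"

lemma vcnj_nth [simp]: "vcnj a $ i = cnj (a $ i)" by (simp add: vcnj_def)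
lemma vcnj_vcnj [simp]: "vcnj (vcnj a) = a" by (simp add: vec_eq_iff)
lemma vcnj_cv [simp]: "vcnj (cv u) = cv u" by (simp add: vec_eq_iff)
lemma vcnj_add: "vcnj (a + b) = vcnj a + vcnj b" by (simp add: vec_eq_iff)
lemma vcnj_minus: "vcnj (- a) = - vcnj a" by (simp add: vec_eq_iff)
lemma vcnj_diff: "vcnj (a - b) = vcnj a - vcnj b" by (simp add: vec_eq_iff)
lemma vcnj_scale: "vcnj (k *s b) = cnj k *s vcnj b" by (simp add: vec_eq_iff)
lemma vcnj_xcross: "vcnj (a \<otimes> b) = vcnj a \<otimes> vcnj b"
  by (simp add: vec_eq_iff forall_7 xcross_nth)
lemma cnj_cdot: "cnj (a \<odot> b) = vcnj a \<odot> vcnj b" by (simp add: cdot_def)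

lemma vcnj_cdot_self_eq_0: "vcnj a \<odot> a = 0 ==> a = 0"
proof -
  assume "vcnj a \<odot> a = 0"
  then have "complex_of_real (\<Sum>i\<in>UNIV. (cmod (a $ i))\<^sup>2) = 0"
    by (simp add: cdot_def mult.commute complex_norm_square del: of_real_power)
  then have "(\<Sum>i\<in>UNIV. (cmod (a $ i))\<^sup>2) = 0" by (simp only: of_real_eq_0_iff)
  then show "a = 0" by (simp add: sum_nonneg_eq_0_iff vec_eq_iff)
qed

lemma vder_vcnj: "smv F ==> u \<in> S6 ==> vder c (\<lambda>u. vcnj (F u)) u = vcnj (vder (vcnj c) F u)"
  by (simp add: vec_eq_iff dder_def sder_cnj smvD)

lemma smv_vcnj: "smv F ==> smv (\<lambda>u. vcnj (F u))" by (simp add: smv_def sm_cnj)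

lemma smv_xcross: "smv F ==> smv G ==> smv (\<lambda>u. F u \<otimes> G u)"
  unfolding smv_def forall_7[of "\<lambda>j. sm (\<lambda>u. (F u \<otimes> G u) $ j)"] xcross_nth by (auto intro!: sm_intros)

lemma vder_xcross:
  assumes "smv F" "smv G" "u \<in> S6"
  shows "vder a (\<lambda>u. F u \<otimes> G u) u = F u \<otimes> vder a G u + vder a F u \<otimes> G u"
proof -
  note s = smvD[OF assms(1)] smvD[OF assms(2)]
  have m: "sm (\<lambda>u. F u $ i * G u $ j)" for i j by (intro sm_mult s)
  have d: "dder a (\<lambda>u. F u $ i * G u $ j) u = F u $ i * dder a (\<lambda>u. G u $ j) u + dder a (\<lambda>u. F u $ i) u * G u $ j" for i j
    by (rule dder_mult[OF s assms(3)])
  show ?thesis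
    unfolding vec_eq_iff forall_7 vder_nth xcross_nth vector_add_component
    by (simp add: dder_add dder_diff d m assms(3) sm_diff sm_add)
qed

lemma two_smult_eq_0: "2 *s a = 0 ==> a = (0 :: cvec)" by simp

section \<open>The complex structure on tangent spaces\<close>

text \<open>For a real unit vector u, \<open>Em\<close> consists of the tangent vectors of type
  (0,1) and \<open>Ep\<close> of those of type (1,0); \<open>Pm\<close> and \<open>Pp\<close> are
  the projections to them along the other eigenspace and the normal.\<close>

definition Em :: "cvec => cvec set" where "Em u = {a. u \<otimes> a = (- \<i>) *s a}"
definition Ep :: "cvec => cvec set" where "Ep u = {a. u \<otimes> a = \<i> *s a}"
definition Pm :: "cvec => cvec => cvec"
  where "Pm u a = (1/2) *s (a - (u \<odot> a) *s u + \<i> *s (u \<otimes> a))"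
definition Pp :: "cvec => cvec => cvec"
  where "Pp u a = (1/2) *s (a - (u \<odot> a) *s u - \<i> *s (u \<otimes> a))"

lemma EmD: "a \<in> Em u ==> u \<otimes> a = (- \<i>) *s a" by (simp add: Em_def)
lemma EpD: "a \<in> Ep u ==> u \<otimes> a = \<i> *s a" by (simp add: Ep_def)

text \<open>Reversing \<open>u\<close> exchanges the two eigenspaces, so every fact has a mirror image.\<close>

lemma Ep_uminus: "Ep u = Em (- u)" and Em_uminus: "Em u = Ep (- u)"
  by (auto simp: Em_def Ep_def xcross_linear) (metis add.inverse_inverse)+

lemma Pp_uminus: "Pp u = Pm (- u)" and Pm_uminus: "Pm u = Pp (- u)"
  by (auto simp: fun_eq_iff Pp_def Pm_def xcross_linear cdot_linear vec_eq_iff)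

lemma Pp_eq_Pm_uminus_apply: "Pp u a = Pm (- u) a" by (simp add: Pp_uminus)

lemma Em_dot_u: "a \<in> Em u ==> u \<odot> a = 0"
  using xcross_dot_self(1)[of u a] by (simp add: EmD cdot_linear)
lemma Ep_dot_u: "a \<in> Ep u ==> u \<odot> a = 0"
  using xcross_dot_self(1)[of u a] by (simp add: EpD cdot_linear)

text \<open>The cross product with u is skew for \<open>\<odot>\<close>, so eigenvectors pair to 0
  unless their eigenvalues add up to 0.\<close>

lemma Em_Em_dot: "a \<in> Em u ==> b \<in> Em u ==> a \<odot> b = 0"
proof -
  assume a: "a \<in> Em u" and b: "b \<in> Em u"
  have "(u \<otimes> a) \<odot> b = - ((u \<otimes> b) \<odot> a)" by (rule xcross_dot_swap)
  then show "a \<odot> b = 0" using a b by (simp add: EmD cdot_linear cdot_commute[of b a])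
qed
lemma Ep_Ep_dot: "a \<in> Ep u ==> b \<in> Ep u ==> a \<odot> b = 0"
  unfolding Ep_uminus by (rule Em_Em_dot)

lemma Em_scale: "a \<in> Em u ==> k *s a \<in> Em u"
  and Ep_add: "a \<in> Ep u ==> b \<in> Ep u ==> a + b \<in> Ep u"
  and Ep_scale: "a \<in> Ep u ==> k *s a \<in> Ep u"
  and Ep_zero: "0 \<in> Ep u"
  by (auto simp: Em_def Ep_def xcross_linear vec_eq_iff algebra_simps)

lemma vcnj_Em: "vcnj a \<in> Em (cv u) \<longleftrightarrow> a \<in> Ep (cv u)"
  and vcnj_Ep: "vcnj a \<in> Ep (cv u) \<longleftrightarrow> a \<in> Em (cv u)"
proof -
  have *: "vcnj a \<in> Em (cv u)" if "a \<in> Ep (cv u)" for a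
    using arg_cong[OF EpD[OF that], of vcnj] by (simp add: Em_def vcnj_xcross vcnj_scale)
  have **: "vcnj a \<in> Ep (cv u)" if "a \<in> Em (cv u)" for a
    using arg_cong[OF EmD[OF that], of vcnj] by (simp add: Ep_def vcnj_xcross vcnj_scale vcnj_minus)
  show "vcnj a \<in> Em (cv u) \<longleftrightarrow> a \<in> Ep (cv u)" using * ** vcnj_vcnj by metis
  show "vcnj a \<in> Ep (cv u) \<longleftrightarrow> a \<in> Em (cv u)" using * ** vcnj_vcnj by metis
qed

lemma vcnj_Pm: "vcnj (Pm (cv u) a) = Pp (cv u) (vcnj a)"
  by (simp add: Pm_def Pp_def vcnj_scale vcnj_add vcnj_diff vcnj_xcross cnj_cdot vec_eq_iff)
text \<open>As u, a and b are mutually orthogonal, multiplications by u and by a anticommute on b,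
  so that the eigenvalue of b changes its sign.\<close>

lemma Em_cross: "a \<in> Em u ==> b \<in> Em u ==> a \<otimes> b \<in> Ep u"
proof -
  assume a: "a \<in> Em u" and b: "b \<in> Em u"
  have "u \<otimes> (a \<otimes> b) + a \<otimes> (u \<otimes> b) = 0"
    by (subst xcross_double) (simp add: Em_dot_u[OF a] Em_dot_u[OF b] Em_Em_dot[OF a b] cdot_commute[of _ u])
  then show ?thesis using b by (simp add: Ep_def EmD xcross_linear add_eq_0_iff2)
qed
lemma Ep_cross: "a \<in> Ep u ==> b \<in> Ep u ==> a \<otimes> b \<in> Em u"
  unfolding Ep_uminus[of u] Em_uminus[of u] by (rule Em_cross)

text \<open>Moving u past a and past b gives two expressions for the product of u with
  \<open>a \<otimes> b\<close>. Their comparison leaves a multiple of u.\<close>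

lemma Ep_Em_cross: "a \<in> Ep u ==> b \<in> Em u ==> a \<otimes> b = (\<i> * (a \<odot> b)) *s u"
proof -
  assume a: "a \<in> Ep u" and b: "b \<in> Em u"
  have 1: "u \<otimes> (a \<otimes> b) + a \<otimes> (u \<otimes> b) = (a \<odot> b) *s u"
    by (subst xcross_double) (simp add: Em_dot_u[OF b] Ep_dot_u[OF a] cdot_commute[of _ u])
  have 2: "u \<otimes> (b \<otimes> a) + b \<otimes> (u \<otimes> a) = (a \<odot> b) *s u"
    by (subst xcross_double) (simp add: Em_dot_u[OF b] Ep_dot_u[OF a] cdot_commute[of _ u] cdot_commute[of b a])
  have "u \<otimes> (a \<otimes> b) = (a \<odot> b) *s u + \<i> *s (a \<otimes> b)"
    using 1 b by (simp add: EmD xcross_linear algebra_simps)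
  moreover have "- (u \<otimes> (a \<otimes> b)) - \<i> *s (a \<otimes> b) = (a \<odot> b) *s u"
    using 2 a by (simp add: EpD xcross_linear xcross_anticommute[of b a])
  ultimately have "2 *s (\<i> *s (a \<otimes> b) + (a \<odot> b) *s u) = 0"
    by (simp add: vec_eq_iff algebra_simps)
  from two_smult_eq_0[OF this] have "\<i> *s (a \<otimes> b) = (- (a \<odot> b)) *s u"
    by (simp add: vec_eq_iff eq_neg_iff_add_eq_0)
  then have "\<i> *s (\<i> *s (a \<otimes> b)) = \<i> *s ((- (a \<odot> b)) *s u)" by (rule arg_cong)
  then show ?thesis by (simp add: vec_eq_iff)
qed
lemma Em_Ep_cross: "a \<in> Em u ==> b \<in> Ep u ==> a \<otimes> b = (- \<i> * (a \<odot> b)) *s u"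
  using Ep_Em_cross[of b u a] by (simp add: xcross_anticommute[of a b] cdot_commute vec_eq_iff)

text \<open>The expansion of a double cross product in complex dimension 3, with an additional
  factor 2. The second term of \<open>xcross_double\<close> is a multiple of c because
  \<open>w \<otimes> c'\<close> is normal.\<close>

lemma Em_Ep_Ep_cross:
  assumes w: "w \<in> Em u" and c: "c \<in> Ep u" and c': "c' \<in> Ep u"
  shows "w \<otimes> (c \<otimes> c') = (2 * (w \<odot> c')) *s c - (2 * (w \<odot> c)) *s c'"
proof -
  have "w \<otimes> (c \<otimes> c') + c \<otimes> (w \<otimes> c') = (- 2 * (w \<odot> c)) *s c' + (w \<odot> c') *s c"
    by (subst xcross_double) (simp add: Ep_Ep_dot[OF c c'])
  moreover have "c \<otimes> (w \<otimes> c') = - ((w \<odot> c') *s c)"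
    unfolding Em_Ep_cross[OF w c'] xcross_scale_right xcross_anticommute[of c u] EpD[OF c]
    by (simp add: vec_eq_iff mult.assoc[symmetric] mult.commute[of \<i>]) (simp add: mult.assoc)
  ultimately show ?thesis by (simp add: vec_eq_iff algebra_simps)
qed
lemma Ep_Em_Em_cross:
  assumes "w \<in> Ep u" "c \<in> Em u" "c' \<in> Em u"
  shows "w \<otimes> (c \<otimes> c') = (2 * (w \<odot> c')) *s c - (2 * (w \<odot> c)) *s c'"
  using assms unfolding Ep_uminus[of u] Em_uminus[of u] by (rule Em_Ep_Ep_cross)

section \<open>Projections to the eigenspaces\<close>

lemma Pm_add: "Pm u (a + b) = Pm u a + Pm u b"
  and Pm_scale: "Pm u (k *s a) = k *s Pm u a"
  and Pm_zero: "Pm u 0 = 0"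
  by (simp_all add: Pm_def cdot_linear xcross_linear vec_eq_iff algebra_simps)
lemma Pp_add: "Pp u (a + b) = Pp u a + Pp u b"
  and Pp_scale: "Pp u (k *s a) = k *s Pp u a"
  and Pp_zero: "Pp u 0 = 0"
  by (simp_all add: Pp_uminus Pm_add Pm_scale Pm_zero)
lemma Pm_sum: "Pm u (\<Sum>i\<in>I. f i) = (\<Sum>i\<in>I. Pm u (f i))"
  by (induction I rule: infinite_finite_induct) (simp_all add: Pm_add Pm_zero)
lemma Pp_sum: "Pp u (\<Sum>i\<in>I. f i) = (\<Sum>i\<in>I. Pp u (f i))"
  by (induction I rule: infinite_finite_induct) (simp_all add: Pp_add Pp_zero)

lemma Pm_Em: "a \<in> Em u ==> Pm u a = a"
  by (simp add: Pm_def Em_dot_u EmD vec_eq_iff)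
lemma Pp_Em: "a \<in> Em u ==> Pp u a = 0"
  by (simp add: Pp_def Em_dot_u EmD vec_eq_iff)
lemma Pp_Ep: "a \<in> Ep u ==> Pp u a = a"
  by (simp add: Pp_def Ep_dot_u EpD vec_eq_iff)
lemma Pm_Ep: "a \<in> Ep u ==> Pm u a = 0"
  by (simp add: Pm_def Ep_dot_u EpD vec_eq_iff)
lemma Pm_dot: "Pm u a \<odot> b = a \<odot> Pp u b"
proof -
  have "(u \<otimes> a) \<odot> b = - (a \<odot> (u \<otimes> b))" using xcross_dot_swap[of u a b] by (simp add: cdot_commute)
  then show ?thesis by (simp add: Pm_def Pp_def cdot_linear algebra_simps cdot_commute[of u])
qed
lemma Pp_dot: "Pp u a \<odot> b = a \<odot> Pm u b"
  by (metis Pm_dot cdot_commute)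
lemma Pm_Pp_decomp: "Pm u a + Pp u a + (u \<odot> a) *s u = a"
  by (simp add: Pm_def Pp_def vec_eq_iff algebra_simps)

lemma xcross_unit: "u \<odot> u = 1 ==> u \<otimes> (u \<otimes> a) = (u \<odot> a) *s u - a"
proof -
  assume "u \<odot> u = 1"
  then have "2 *s (u \<otimes> (u \<otimes> a) - ((u \<odot> a) *s u - a)) = 0"
    using xcross_double[of u u a] by (simp add: vec_eq_iff algebra_simps)
  from two_smult_eq_0[OF this] show ?thesis by simp
qed

lemma Pm_in_Em: "u \<odot> u = 1 ==> Pm u a \<in> Em u"
  by (simp add: Em_def Pm_def xcross_linear xcross_self xcross_unit vec_eq_iff algebra_simps)
lemma Pp_in_Ep: "u \<odot> u = 1 ==> Pp u a \<in> Ep u"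
  unfolding Pp_uminus Ep_uminus by (rule Pm_in_Em) (simp add: cdot_linear)
lemma sum_axis: "(\<Sum>i\<in>UNIV. c $ i *s axis i 1) = (c :: cvec)"
  by (rule basis_expansion)

text \<open>The vector c is a quarter of the sum of
  \<open>Pm u e \<otimes> (c \<otimes> Pp u e)\<close> over the standard basis vectors e: by
  \<open>Em_Ep_Ep_cross\<close> the sum is 2 * 3 - 2 times c. Each summand is a product of two
  vectors of E-.\<close>

lemma Ep_generated:
  assumes u: "u \<odot> u = 1" and c: "c \<in> Ep u"
    and add: "\<And>a b. L (a + b) = L a + (L b :: 'b::ab_group_add)"
    and scale: "\<And>k a. L a = 0 ==> L (k *s a) = 0"
    and gen: "\<And>a b. a \<in> Em u ==> b \<in> Em u ==> L (a \<otimes> b) = 0"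
  shows "L c = 0"
proof -
  define x where "x = (\<Sum>i\<in>UNIV. Pm u (axis i 1) \<otimes> (c \<otimes> Pp u (axis i 1)))"
  have L0: "L 0 = 0" using add[of 0 0] by simp
  have Lsum: "L (\<Sum>i\<in>I. f i) = (\<Sum>i\<in>I. L (f i))" for I :: "7 set" and f
    by (induction I rule: infinite_finite_induct) (simp_all add: L0 add)
  have Lx: "L x = 0"
    unfolding x_def Lsum by (intro sum.neutral ballI gen Pm_in_Em u Ep_cross c Pp_in_Ep)
  \<comment> \<open>The trace of \<open>Pp u\<close>, which is the complex dimension of E+: half of
    the trace 7 - 1 of the tangential projection.\<close>
  have tr: "(\<Sum>i\<in>UNIV. Pm u (axis i 1) \<odot> Pp u (axis i 1)) = 3"
  proof -
    have "Pm u (axis i 1) \<odot> Pp u (axis i 1) = (1 - u $ i * u $ i) / 2" (is "?l i = _") for i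
      unfolding Pm_dot Pp_Ep[OF Pp_in_Ep[OF u]]
      by (simp add: Pp_def cdot_linear cdot_axis)
        (metis cdot_axis(1) xcross_dot_self(3))
    then have "(\<Sum>i\<in>UNIV. Pm u (axis i 1) \<odot> Pp u (axis i 1)) = (\<Sum>i\<in>(UNIV::7 set). 1 - u $ i * u $ i) / 2"
      by (simp only: sum_divide_distrib)
    also have "\<dots> = 3" using u by (simp add: sum_subtractf cdot_def)
    finally show ?thesis .
  qed
  have "x = (\<Sum>i\<in>UNIV. (2 * (Pm u (axis i 1) \<odot> Pp u (axis i 1))) *s c - (2 * c $ i) *s Pp u (axis i 1))"
    unfolding x_def Em_Ep_Ep_cross[OF Pm_in_Em[OF u] c Pp_in_Ep[OF u]]
    by (simp add: Pm_dot[of u _ c] Pp_Ep[OF c] cdot_axis)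
  also have "\<dots> = (2 * (\<Sum>i\<in>UNIV. Pm u (axis i 1) \<odot> Pp u (axis i 1))) *s c - 2 *s Pp u (\<Sum>i\<in>UNIV. c $ i *s axis i 1)"
    by (simp add: sum_subtractf Pp_sum Pp_scale vec_eq_iff sum_distrib_left sum_distrib_right mult.assoc)
  also have "\<dots> = 4 *s c" by (simp add: tr sum_axis Pp_Ep[OF c] vec_eq_iff)
  finally have "c = (1/4) *s x" by (simp add: vec_eq_iff)
  then show ?thesis using scale[OF Lx] by simp
qed

section \<open>Fields of pure type obtained by projecting constant vectors\<close>

lemma smv_Pm: "smv F ==> smv (\<lambda>u. Pm (cv u) (F u))" and smv_Pp: "smv F ==> smv (\<lambda>u. Pp (cv u) (F u))"
  unfolding Pm_def Pp_def by (intro smv_intros smv_xcross; assumption)+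

text \<open>Projecting a constant vector at each point extends a vector of E- to a global field of
  type (0,1). Its derivative consists of the derivative of the complex structure and that of the
  normal projection.\<close>

lemma vder_Pm:
  assumes "u \<in> S6" "cv u \<odot> c = 0"
  shows "vder c (\<lambda>u. Pm (cv u) a) u = (1/2) *s (\<i> *s (c \<otimes> a) - (c \<odot> a) *s cv u - (cv u \<odot> a) *s c)"
proof -
  have D: "vder c (\<lambda>u. Pm (cv u) a) u = (1/2) *s (0 - ((cv u \<odot> a) *s vder c cv u + (cv u \<odot> vder c (\<lambda>u. a) u + vder c cv u \<odot> a) *s cv u)
      + \<i> *s (cv u \<otimes> vder c (\<lambda>u. a) u + vder c cv u \<otimes> a))"
    unfolding Pm_def using assms(1)
    by (simp only: vder_cscale vder_add vder_diff vder_scale smv_intros smv_xcross vder_xcross dder_cdot)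
      (simp only: vder_const)
  show ?thesis unfolding D using assms
    by (simp add: vder_cv vder_const xcross_linear cdot_linear vec_eq_iff algebra_simps)
qed

lemma vder_Pp:
  assumes "u \<in> S6" "cv u \<odot> c = 0"
  shows "vder c (\<lambda>u. Pp (cv u) a) u = (1/2) *s (- (\<i> *s (c \<otimes> a)) - (c \<odot> a) *s cv u - (cv u \<odot> a) *s c)"
proof -
  have D: "vder c (\<lambda>u. Pp (cv u) a) u = (1/2) *s (0 - ((cv u \<odot> a) *s vder c cv u + (cv u \<odot> vder c (\<lambda>u. a) u + vder c cv u \<odot> a) *s cv u)
      - \<i> *s (cv u \<otimes> vder c (\<lambda>u. a) u + vder c cv u \<otimes> a))"
    unfolding Pp_def using assms(1)
    by (simp only: vder_cscale vder_add vder_diff vder_scale smv_intros smv_xcross vder_xcross dder_cdot)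
      (simp only: vder_const)
  show ?thesis unfolding D using assms
    by (simp add: vder_cv vder_const xcross_linear cdot_linear vec_eq_iff algebra_simps)
qed

section \<open>Sections annihilated by the (0,1)-part of the derivative vanish\<close>

lemma Em_const_field:
  assumes "u \<in> S6" "a \<in> Em (cv u)" "b \<in> Em (cv u)"
  shows "vder a (\<lambda>u. Pm (cv u) b) u = (\<i>/2) *s (a \<otimes> b)"
  using vder_Pm[OF assms(1) Em_dot_u[OF assms(2)], of b] Em_Em_dot[OF assms(2,3)] Em_dot_u[OF assms(3)]
  by (simp add: vec_eq_iff)

text \<open>The canonical Hermitian connection of the nearly Kaehler sphere has torsion: the bracket of two
  fields of type (0,1) has a (1,0)-part, which is \<open>\<i>\<close> times the cross product.\<close>

lemma Em_bracket:
  assumes "smv F" "u \<in> S6" "a \<in> Em (cv u)" "b \<in> Em (cv u)"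
  shows "vder a (\<lambda>u. vder (Pm (cv u) b) F u) u - vder b (\<lambda>u. vder (Pm (cv u) a) F u) u
    = \<i> *s vder (a \<otimes> b) F u"
proof -
  have u: "cv u \<odot> cv u = 1" using assms(2) by (rule cv_cdot_self)
  have "vder (Pm (cv u) a) (\<lambda>u. vder (Pm (cv u) b) F u) u - vder (Pm (cv u) b) (\<lambda>u. vder (Pm (cv u) a) F u) u
    = vder (vder (Pm (cv u) a) (\<lambda>u. Pm (cv u) b) u - vder (Pm (cv u) b) (\<lambda>u. Pm (cv u) a) u) F u"
    by (rule vder_bracket[OF assms(1) smv_Pm[OF smv_const] smv_Pm[OF smv_const] assms(2)])
      (intro Em_dot_u Pm_in_Em u)+
  moreover have "(\<i>/2) *s (a \<otimes> b) - (\<i>/2) *s (b \<otimes> a) = \<i> *s (a \<otimes> b)"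
    by (simp add: xcross_anticommute[of b a] vec_eq_iff)
  ultimately show ?thesis using assms(2-4) by (simp add: Pm_Em Em_const_field vder_dir_scale)
qed

lemma Em_bracket_scalar:
  assumes "sm f" "u \<in> S6" "a \<in> Em (cv u)" "b \<in> Em (cv u)"
  shows "dder a (\<lambda>u. dder (Pm (cv u) b) f u) u - dder b (\<lambda>u. dder (Pm (cv u) a) f u) u
    = \<i> * dder (a \<otimes> b) f u"
proof -
  have "smv (\<lambda>u. f u *s axis 1 1)" using assms(1) by (intro smv_scale smv_const)
  moreover have "dder a (\<lambda>u. (f u *s axis 1 1) $ 1) u = dder a f u" for a u by simp
  ultimately show ?thesis using Em_bracket[of "\<lambda>u. f u *s axis 1 1" u a b] assms(2-)
    by (simp add: vec_eq_iff forall_7)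
qed

text \<open>The hypotheses prescribe the derivative of F in all tangential directions, so F is
  parallel for a connection. Its curvature is tested on the value b of F at u and the conjugate a of
  b: both are extended to fields of pure type, and the two orders of differentiation give 0 and a
  multiple of b by -|b|^2.\<close>

lemma parallel_section_zero:
  assumes F: "smv F" "\<And>u. u \<in> S6 ==> F u \<in> Em (cv u)"
    and m: "\<And>u w. u \<in> S6 ==> w \<in> Em (cv u) ==> vder w F u = (\<i>/2) *s (w \<otimes> F u)"
    and p: "\<And>u c. u \<in> S6 ==> c \<in> Ep (cv u) ==> vder c F u = - ((c \<odot> F u) *s cv u)"
    and u: "u \<in> S6"
  shows "F u = 0"
proof -
  have uu: "cv u \<odot> cv u = 1" using u by (rule cv_cdot_self)
  have uu': "cv v \<odot> cv v = 1" if "v \<in> S6" for v using that by (rule cv_cdot_self)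
  define b where "b = F u"
  define a where "a = vcnj b"
  have b: "b \<in> Em (cv u)" using F(2)[OF u] by (simp add: b_def)
  have a: "a \<in> Ep (cv u)" using b by (simp add: a_def vcnj_Ep)
  let ?A = "\<lambda>u. Pp (cv u) a" and ?B = "\<lambda>u. Pm (cv u) b"
  note ta = Ep_dot_u[OF a] and tb = Em_dot_u[OF b]
  have ba: "b \<otimes> a = (- \<i> * (a \<odot> b)) *s cv u" using Em_Ep_cross[OF b a] by (simp add: cdot_commute)
  have dB: "vder a ?B u = - ((a \<odot> b) *s cv u)"
    by (simp add: vder_Pm[OF u ta] tb Ep_Em_cross[OF a b]) (simp add: vec_eq_iff mult.assoc field_simps)
  have dA: "vder b ?A u = - ((a \<odot> b) *s cv u)"
    by (simp add: vder_Pp[OF u tb] ta ba cdot_commute[of b a]) (simp add: vec_eq_iff mult.assoc field_simps)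
  have sA: "smv ?A" and sB: "smv ?B" by (intro smv_Pp smv_Pm smv_const)+
  have "vder (?A u) (\<lambda>u. vder (?B u) F u) u - vder (?B u) (\<lambda>u. vder (?A u) F u) u
      = vder (vder (?A u) ?B u - vder (?B u) ?A u) F u"
    by (rule vder_bracket[OF F(1) sA sB u]) (intro Ep_dot_u Em_dot_u Pp_in_Ep Pm_in_Em uu)+
  \<comment> \<open>The derivatives of the two fields along each other are the same multiple of the
    normal, so their bracket vanishes at u.\<close>
  then have comm: "vder a (\<lambda>u. vder (?B u) F u) u = vder b (\<lambda>u. vder (?A u) F u) u"
    by (simp add: Pp_Ep[OF a] Pm_Em[OF b] dA dB) (simp add: vec_eq_iff dder_dir_zero)
  have "vder a (\<lambda>u. vder (?B u) F u) u = vder a (\<lambda>u. (\<i>/2) *s (?B u \<otimes> F u)) u"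
    by (rule vder_cong) (auto intro!: m Pm_in_Em uu' u)
  also have "\<dots> = (\<i>/2) *s (?B u \<otimes> vder a F u + vder a ?B u \<otimes> F u)"
    using vder_cscale[OF smv_xcross[OF sB F(1)] u] vder_xcross[OF sB F(1) u] by simp
  \<comment> \<open>The derivative of F and the derivative of the projected field contribute
    opposite terms.\<close>
  also have "\<dots> = (1/2) *s ((a \<odot> b) *s b - (a \<odot> b) *s b)"
    unfolding p[OF u a] dB Pm_Em[OF b] b_def[symmetric] xcross_linear EmD[OF b] xcross_anticommute[of b "cv u"]
    by (simp add: vec_eq_iff)
  finally have 1: "vder a (\<lambda>u. vder (?B u) F u) u = 0" by (simp add: vec_eq_iff)
  have "vder b (\<lambda>u. vder (?A u) F u) u = vder b (\<lambda>u. (- (?A u \<odot> F u)) *s cv u) u"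
    by (rule vder_cong) (auto simp: p Pp_in_Ep uu' u vec_eq_iff)
  also have "\<dots> = (- (?A u \<odot> F u)) *s vder b cv u + dder b (\<lambda>u. - (?A u \<odot> F u)) u *s cv u"
    by (rule vder_scale[OF sm_minus[OF sm_cdot[OF sA F(1)]] smv_cv u])
  also have "dder b (\<lambda>u. - (?A u \<odot> F u)) u = - (?A u \<odot> vder b F u + vder b ?A u \<odot> F u)"
    using dder_minus[OF sm_cdot[OF sA F(1)] u] dder_cdot[OF sA F(1) u] by simp
  also have "?A u \<odot> vder b F u + vder b ?A u \<odot> F u = 0"
    unfolding dA m[OF u b] Pp_Ep[OF a] b_def[symmetric] by (simp add: xcross_self cdot_linear tb)
  finally have "vder b (\<lambda>u. vder (?A u) F u) u = - ((a \<odot> b) *s b)"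
    by (simp add: Pp_Ep[OF a] vder_cv[OF u] tb b_def[symmetric])
  with 1 comm have "a \<odot> b = 0 \<or> b = 0" by simp
  then show ?thesis using vcnj_cdot_self_eq_0 unfolding a_def b_def by blast
qed

text \<open>Pairing with E+ sees the E- part of a derivative, so H removes this part;
  differentiating the eigenvalue equation of F determines the rest. Brackets of (0,1)-fields then
  give the derivative in the directions \<open>a \<otimes> b\<close>, which generate E+, and F
  satisfies the equations of \<open>parallel_section_zero\<close>.\<close>

lemma E_minus_section_zero:
  assumes F: "smv F" "\<And>u. u \<in> S6 ==> F u \<in> Em (cv u)"
    and H: "\<And>u w c. u \<in> S6 ==> w \<in> Em (cv u) ==> c \<in> Ep (cv u) ==> vder w F u \<odot> c = 0"
    and u: "u \<in> S6"
  shows "F u = 0"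
proof -
  have m: "vder w F u = (\<i>/2) *s (w \<otimes> F u)" if u: "u \<in> S6" and w: "w \<in> Em (cv u)" for u w
  proof -
    let ?X = "vder w F u"
    note uu = cv_cdot_self[OF u]
    have "vder w (\<lambda>u. cv u \<otimes> F u) u = vder w (\<lambda>u. (- \<i>) *s F u) u"
      by (intro vder_cong u) (simp add: EmD[OF F(2)])
    then have 1: "cv u \<otimes> ?X + w \<otimes> F u = (- \<i>) *s ?X"
      by (simp only: vder_xcross[OF smv_cv F(1) u] vder_cscale[OF F(1) u] vder_cv[OF u] Em_dot_u[OF w]) simp
    have "dder w (\<lambda>u. cv u \<odot> F u) u = dder w (\<lambda>u. 0) u"
      using F(2) by (intro dder_cong u) (auto dest: Em_dot_u)
    then have 2: "cv u \<odot> ?X = 0"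
      using Em_Em_dot[OF w F(2)[OF u]]
      by (simp add: dder_cdot[OF smv_cv F(1) u] dder_const vder_cv[OF u] Em_dot_u[OF w])
    have 3: "Pm (cv u) ?X = 0"
      by (rule cdot_ext) (simp add: Pm_dot H[OF u w Pp_in_Ep[OF uu]] cdot_linear)
    have "?X \<in> Ep (cv u)" using Pm_Pp_decomp[of "cv u" ?X] 2 3 Pp_in_Ep[OF uu, of ?X] by simp
    from 1[unfolded EpD[OF this]] have "w \<otimes> F u = (- 2 * \<i>) *s ?X" by (simp add: vec_eq_iff algebra_simps eq_neg_iff_add_eq_0)
    then show ?thesis by (simp add: vec_eq_iff)
  qed
  have gen: "vder (a \<otimes> b) F u + ((a \<otimes> b) \<odot> F u) *s cv u = 0"
    if u: "u \<in> S6" and a: "a \<in> Em (cv u)" and b: "b \<in> Em (cv u)" for u a b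
  proof -
    \<comment> \<open>The second (0,1)-derivatives follow by differentiating the formula
      \<open>m\<close> along a projected constant field.\<close>
    have *: "vder a (\<lambda>u. vder (Pm (cv u) b) F u) u = (\<i>/2) *s (b \<otimes> ((\<i>/2) *s (a \<otimes> F u)) + ((\<i>/2) *s (a \<otimes> b)) \<otimes> F u)"
      if a: "a \<in> Em (cv u)" and b: "b \<in> Em (cv u)" for a b
    proof -
      have "vder a (\<lambda>u. vder (Pm (cv u) b) F u) u = vder a (\<lambda>u. (\<i>/2) *s (Pm (cv u) b \<otimes> F u)) u"
        by (rule vder_cong) (auto intro!: m Pm_in_Em cv_cdot_self u)
      also have "\<dots> = (\<i>/2) *s (Pm (cv u) b \<otimes> vder a F u + vder a (\<lambda>u. Pm (cv u) b) u \<otimes> F u)"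
        using vder_cscale[OF smv_xcross[OF smv_Pm[OF smv_const] F(1)] u] vder_xcross[OF smv_Pm[OF smv_const] F(1) u] by simp
      finally show ?thesis by (simp only: Pm_Em[OF b] m[OF u a] Em_const_field[OF u a b])
    qed
    define \<phi> where "\<phi> = (a \<otimes> b) \<odot> F u"
    note Fu = F(2)[OF u]
    have abF: "(a \<otimes> b) \<otimes> F u = (\<i> * \<phi>) *s cv u"
      using Ep_Em_cross[OF Em_cross[OF a b] Fu] by (simp add: \<phi>_def)
    have bF: "(b \<otimes> F u) \<odot> a = \<phi>" unfolding \<phi>_def by (rule xcross_dot_cyc[symmetric])
    have aF: "(a \<otimes> F u) \<odot> b = - \<phi>" by (simp only: \<phi>_def xcross_dot_swap[of a b] minus_minus)
    have a_bF: "a \<otimes> (b \<otimes> F u) = (- \<i> * \<phi>) *s cv u"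
      using Em_Ep_cross[OF a Em_cross[OF b Fu]] bF by (simp add: cdot_commute)
    have b_aF: "b \<otimes> (a \<otimes> F u) = (\<i> * \<phi>) *s cv u"
      using Em_Ep_cross[OF b Em_cross[OF a Fu]] aF by (simp add: cdot_commute)
    have "\<i> *s vder (a \<otimes> b) F u = (- \<i> * \<phi>) *s cv u"
      unfolding Em_bracket[OF F(1) u a b, symmetric] *[OF a b] *[OF b a] xcross_scale_left xcross_scale_right
        xcross_anticommute[of b a] xcross_minus_left abF a_bF b_aF
      by (simp add: vec_eq_iff algebra_simps)
    then have "\<i> *s (vder (a \<otimes> b) F u + \<phi> *s cv u) = 0" by (simp add: vector_add_ldistrib)
    then have "\<i> = 0 \<or> vder (a \<otimes> b) F u + \<phi> *s cv u = 0" by (simp only: vector_mul_eq_0)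
    then show ?thesis unfolding \<phi>_def using complex_i_not_zero by blast
  qed
  have p: "vder c F u = - ((c \<odot> F u) *s cv u)" if u: "u \<in> S6" and c: "c \<in> Ep (cv u)" for u c
  proof -
    have "vder c F u + (c \<odot> F u) *s cv u = 0"
    proof (rule Ep_generated[OF cv_cdot_self[OF u] c, where L = "\<lambda>c. vder c F u + (c \<odot> F u) *s cv u"])
      fix k a assume "vder a F u + (a \<odot> F u) *s cv u = 0"
      moreover have "vder (k *s a) F u + ((k *s a) \<odot> F u) *s cv u = k *s (vder a F u + (a \<odot> F u) *s cv u)"
        by (simp add: vder_dir_scale cdot_linear vec_eq_iff algebra_simps)
      ultimately show "vder (k *s a) F u + ((k *s a) \<odot> F u) *s cv u = 0" by simp
    qed (use gen[OF u] in \<open>auto simp: vder_dir_add cdot_linear vec_eq_iff algebra_simps\<close>)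
    then show ?thesis by (simp add: eq_neg_iff_add_eq_0)
  qed
  show ?thesis by (rule parallel_section_zero[OF F m p u])
qed

text \<open>Here H removes the E+ part of the (0,1)-derivative, the eigenvalue equation forces the
  E- part to vanish, and a normal part remains. The brackets again determine the derivative along
  E+, after which the conjugate of F is parallel.\<close>

lemma E_plus_section_zero:
  assumes F: "smv F" "\<And>u. u \<in> S6 ==> F u \<in> Ep (cv u)"
    and H: "\<And>u w c. u \<in> S6 ==> w \<in> Em (cv u) ==> c \<in> Em (cv u) ==> vder w F u \<odot> c = 0"
    and u: "u \<in> S6"
  shows "F u = 0"
proof -
  have m: "vder w F u = - ((w \<odot> F u) *s cv u)" if u: "u \<in> S6" and w: "w \<in> Em (cv u)" for u w
  proof -
    let ?X = "vder w F u"
    note uu = cv_cdot_self[OF u]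
    have "vder w (\<lambda>u. cv u \<otimes> F u) u = vder w (\<lambda>u. \<i> *s F u) u"
      by (intro vder_cong u) (simp add: EpD[OF F(2)])
    then have 1: "cv u \<otimes> ?X + w \<otimes> F u = \<i> *s ?X"
      by (simp only: vder_xcross[OF smv_cv F(1) u] vder_cscale[OF F(1) u] vder_cv[OF u] Em_dot_u[OF w]) simp
    have "dder w (\<lambda>u. cv u \<odot> F u) u = dder w (\<lambda>u. 0) u"
      using F(2) by (intro dder_cong u) (auto dest: Ep_dot_u)
    then have 2: "cv u \<odot> ?X = - (w \<odot> F u)"
      by (simp add: dder_cdot[OF smv_cv F(1) u] dder_const vder_cv[OF u] Em_dot_u[OF w] eq_neg_iff_add_eq_0)
    have 3: "Pp (cv u) ?X = 0"
      by (rule cdot_ext) (simp add: Pp_dot H[OF u w Pm_in_Em[OF uu]] cdot_linear)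
    have X: "?X = Pm (cv u) ?X - (w \<odot> F u) *s cv u"
      using Pm_Pp_decomp[of "cv u" ?X] 2 3 by (simp add: vec_eq_iff)
    have c: "cv u \<otimes> ?X = (- \<i>) *s Pm (cv u) ?X"
      by (subst X) (simp add: xcross_linear xcross_self EmD[OF Pm_in_Em[OF uu]])
    have "(- \<i>) *s Pm (cv u) ?X + (- \<i> * (w \<odot> F u)) *s cv u = \<i> *s ?X"
      using 1 unfolding c Em_Ep_cross[OF w F(2)[OF u]] .
    also have "\<dots> = \<i> *s (Pm (cv u) ?X - (w \<odot> F u) *s cv u)" by (rule arg_cong[OF X])
    finally have "(- \<i>) *s Pm (cv u) ?X + (- \<i> * (w \<odot> F u)) *s cv u
      = \<i> *s (Pm (cv u) ?X - (w \<odot> F u) *s cv u)" .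
    then have "(2 * \<i>) *s Pm (cv u) ?X = 0" by (simp only: vec_eq_iff) (simp add: algebra_simps)
    then have X0: "Pm (cv u) ?X = 0" by simp
    show ?thesis using X unfolding X0 by simp
  qed
  have gen: "vder (a \<otimes> b) F u + (\<i>/2) *s ((a \<otimes> b) \<otimes> F u) = 0"
    if u: "u \<in> S6" and a: "a \<in> Em (cv u)" and b: "b \<in> Em (cv u)" for u a b
  proof -
    note Fu = F(2)[OF u]
    have *: "vder a (\<lambda>u. vder (Pm (cv u) b) F u) u = - ((b \<odot> F u) *s a)"
      if a: "a \<in> Em (cv u)" and b: "b \<in> Em (cv u)" for a b
    proof -
      have sB: "smv (\<lambda>u. Pm (cv u) b)" by (intro smv_Pm smv_const)
      have "vder a (\<lambda>u. vder (Pm (cv u) b) F u) u = vder a (\<lambda>u. (- (Pm (cv u) b \<odot> F u)) *s cv u) u"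
        by (rule vder_cong) (auto simp: m Pm_in_Em cv_cdot_self u vec_eq_iff)
      also have "\<dots> = (- (Pm (cv u) b \<odot> F u)) *s vder a cv u + dder a (\<lambda>u. - (Pm (cv u) b \<odot> F u)) u *s cv u"
        by (rule vder_scale[OF sm_minus[OF sm_cdot[OF sB F(1)]] smv_cv u])
      also have "dder a (\<lambda>u. - (Pm (cv u) b \<odot> F u)) u
          = - (Pm (cv u) b \<odot> vder a F u + vder a (\<lambda>u. Pm (cv u) b) u \<odot> F u)"
        using dder_minus[OF sm_cdot[OF sB F(1)] u] dder_cdot[OF sB F(1) u] by simp
      also have "Pm (cv u) b \<odot> vder a F u + vder a (\<lambda>u. Pm (cv u) b) u \<odot> F u = 0"
        unfolding Pm_Em[OF b] m[OF u a] Em_const_field[OF u a b]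
        by (simp add: cdot_linear Ep_Ep_dot[OF Em_cross[OF a b] Fu] cdot_commute[of b] Em_dot_u[OF b])
      finally show ?thesis by (simp add: Pm_Em[OF b] vder_cv[OF u] Em_dot_u[OF a])
    qed
    have 1: "\<i> *s vder (a \<otimes> b) F u = (a \<odot> F u) *s b - (b \<odot> F u) *s a"
      unfolding Em_bracket[OF F(1) u a b, symmetric] *[OF a b] *[OF b a] by simp
    have 2: "(a \<otimes> b) \<otimes> F u = (2 * (a \<odot> F u)) *s b - (2 * (b \<odot> F u)) *s a"
      unfolding xcross_anticommute[of "a \<otimes> b"] Ep_Em_Em_cross[OF Fu a b]
      by (simp add: vec_eq_iff cdot_commute)
    have "vder (a \<otimes> b) F u = (- \<i>) *s (\<i> *s vder (a \<otimes> b) F u)" by (simp add: vec_eq_iff)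
    then show ?thesis unfolding 1 2 by (simp add: vec_eq_iff algebra_simps)
  qed
  have p: "vder c F u = (- \<i>/2) *s (c \<otimes> F u)" if u: "u \<in> S6" and c: "c \<in> Ep (cv u)" for u c
  proof -
    have "vder c F u + (\<i>/2) *s (c \<otimes> F u) = 0"
    proof (rule Ep_generated[OF cv_cdot_self[OF u] c, where L = "\<lambda>c. vder c F u + (\<i>/2) *s (c \<otimes> F u)"])
      fix k a assume "vder a F u + (\<i>/2) *s (a \<otimes> F u) = 0"
      moreover have "vder (k *s a) F u + (\<i>/2) *s ((k *s a) \<otimes> F u) = k *s (vder a F u + (\<i>/2) *s (a \<otimes> F u))"
        by (simp add: vder_dir_scale xcross_linear vec_eq_iff algebra_simps)
      ultimately show "vder (k *s a) F u + (\<i>/2) *s ((k *s a) \<otimes> F u) = 0" by simp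
    qed (use gen[OF u] in \<open>auto simp: vder_dir_add xcross_linear vec_eq_iff algebra_simps\<close>)
    then show ?thesis by (simp add: vec_eq_iff eq_neg_iff_add_eq_0)
  qed
  \<comment> \<open>Conjugation exchanges the directions: \<open>p\<close> describes the
    (0,1)-derivative of the conjugate, and \<open>m\<close> its (1,0)-derivative.\<close>
  have "vcnj (F u) = 0"
  proof (rule parallel_section_zero[where F = "\<lambda>u. vcnj (F u)"])
    show "smv (\<lambda>u. vcnj (F u))" by (rule smv_vcnj[OF F(1)])
    fix v assume v: "v \<in> S6"
    show "vcnj (F v) \<in> Em (cv v)" using F(2)[OF v] by (simp add: vcnj_Em)
    show "vder w (\<lambda>u. vcnj (F u)) v = (\<i>/2) *s (w \<otimes> vcnj (F v))" if "w \<in> Em (cv v)" for w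
      using p[OF v, of "vcnj w"] that by (simp add: vder_vcnj[OF F(1) v] vcnj_Ep vcnj_scale vcnj_xcross vcnj_minus)
    show "vder w (\<lambda>u. vcnj (F u)) v = - ((w \<odot> vcnj (F v)) *s cv v)" if "w \<in> Ep (cv v)" for w
      using m[OF v, of "vcnj w"] that by (simp add: vder_vcnj[OF F(1) v] vcnj_Em vcnj_scale vcnj_minus cnj_cdot)
  qed (rule u)
  then show ?thesis using vcnj_vcnj[of "F u"] by (simp add: vec_eq_iff)
qed

text \<open>The brackets make the derivative vanish along E+ too. The extension of degree 0 then has
  derivative 0 on the punctured space, which is connected.\<close>

lemma Em_constant_function:
  assumes f: "sm f"
    and H: "\<And>u w. u \<in> S6 ==> w \<in> Em (cv u) ==> dder w f u = 0"
  obtains c where "\<And>u. u \<in> S6 ==> f u = c"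
proof -
  have gen: "dder (a \<otimes> b) f u = 0" if u: "u \<in> S6" and a: "a \<in> Em (cv u)" and b: "b \<in> Em (cv u)" for u a b
  proof -
    have "dder a (\<lambda>u. dder (Pm (cv u) b) f u) u = dder a (\<lambda>u. 0) u" for a b
      by (rule dder_cong) (auto intro!: H Pm_in_Em cv_cdot_self u)
    then show ?thesis using Em_bracket_scalar[OF f u a b] by (simp add: dder_const)
  qed
  have p: "dder c f u = 0" if "u \<in> S6" "c \<in> Ep (cv u)" for u c
    by (rule Ep_generated[OF cv_cdot_self[OF that(1)] that(2), where L = "\<lambda>c. dder c f u"])
      (auto simp: dder_dir_add dder_dir_scale gen that)
  have z: "dder a f u = 0" if "u \<in> S6" for a u
    using Pm_Pp_decomp[of "cv u" a, symmetric] p[OF that Pp_in_Ep] H[OF that Pm_in_Em] dder_normal[OF f that]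
      cv_cdot_self[OF that] by (metis add_0 dder_dir_add dder_dir_scale mult_zero_right)
  have s: "sder i f x = 0" if "x \<noteq> 0" for i x
    using sder_retr[OF f that, of i] z[OF retr_in_S6[OF that], of "axis i 1"] that by (simp add: dder_axis)
  have "((\<lambda>x. f (retr x)) has_derivative (\<lambda>h. 0)) (at x)" if "x \<in> - {0}" for x
  proof -
    have "frechet_derivative (\<lambda>x. f (retr x)) (at x) = (\<lambda>h. 0)"
      using sm_frechet_sder[OF f, of x] that s[of x] by (simp add: fun_eq_iff)
    then show ?thesis using sm_has_derivative[OF f, of x] that by simp
  qed
  moreover have "connected (- {0::vec7})" by (rule connected_punctured_universe) simp
  ultimately have "f (retr u) = f (retr v)" if "u \<in> S6" "v \<in> S6" for u v
    using has_derivative_zero_unique_connected[of "- {0}" "\<lambda>x. f (retr x)" u v] that S6_nonzero by simp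
  moreover have "axis 1 1 \<in> S6" by (simp add: mem_sphere norm_axis_1)
  ultimately show ?thesis using that[of "f (axis 1 1)"] retr_S6 by metis
qed

section \<open>Components of multilinear maps\<close>

definition tup :: "'a set => nat => 'a list set"
  where "tup A k = {xs. set xs \<subseteq> A \<and> length xs = k}"

abbreviation idx :: "nat => 7 list set" where "idx \<equiv> tup UNIV"

lemma finite_tup: "finite A ==> finite (tup A k)"
  unfolding tup_def by (rule finite_lists_length_eq)

lemma tup_0 [simp]: "tup A 0 = {[]}" by (auto simp: tup_def)

lemma in_idx: "I \<in> idx k \<longleftrightarrow> length I = k" by (simp add: tup_def)

lemma sum_tup_Suc:
  assumes "finite A"
  shows "(\<Sum>xs\<in>tup A (Suc k). f xs) = (\<Sum>a\<in>A. \<Sum>xs\<in>tup A k. f (a # xs))"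
proof -
  have "bij_betw (\<lambda>(a, xs). a # xs) (A \<times> tup A k) (tup A (Suc k))"
    by (rule bij_betw_byWitness[where f' = "\<lambda>xs. (hd xs, tl xs)"])
      (auto simp: tup_def length_Suc_conv)
  then have "(\<Sum>xs\<in>tup A (Suc k). f xs) = (\<Sum>x\<in>A \<times> tup A k. f (case x of (a, xs) => a # xs))"
    by (rule sum.reindex_bij_betw[symmetric])
  then show ?thesis by (simp add: sum.cartesian_product case_prod_unfold)
qed

lemma sum_idx_Suc: "(\<Sum>I\<in>idx (Suc k). f I) = (\<Sum>i\<in>UNIV. \<Sum>I\<in>idx k. f (i # I))"
  by (rule sum_tup_Suc) simp

lemma prod_sum_tup:
  fixes f :: "nat => 'a => 'b::comm_semiring_1"
  assumes "finite A"
  shows "(\<Prod>j<k. \<Sum>a\<in>A. f j a) = (\<Sum>xs\<in>tup A k. \<Prod>j<k. f j (xs ! j))"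
proof (induction k arbitrary: f)
  case (Suc k)
  have "(\<Prod>j<Suc k. \<Sum>a\<in>A. f j a) = (\<Sum>a\<in>A. f 0 a) * (\<Sum>xs\<in>tup A k. \<Prod>j<k. f (Suc j) (xs ! j))"
    by (simp add: prod.lessThan_Suc_shift Suc del: prod.lessThan_Suc)
  also have "\<dots> = (\<Sum>a\<in>A. \<Sum>xs\<in>tup A k. \<Prod>j<Suc k. f j ((a # xs) ! j))"
    by (simp add: prod.lessThan_Suc_shift sum_product del: prod.lessThan_Suc)
  finally show ?case by (simp add: sum_tup_Suc[OF assms])
qed simp

abbreviation ax :: "7 => vec7" where "ax i \<equiv> axis i 1"

definition cmp :: "tensor => 7 list => complex" where "cmp \<eta> I = \<eta> (map ax I)"

fun cmono :: "cvec list => 7 list => complex" where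
  "cmono (z # zs) (i # I) = z $ i * cmono zs I"
| "cmono zs I = 1"

text \<open>The complex multilinear extension of the tensor with components c. It allows evaluation
  on vectors of pure type, which are never real unless they are 0.\<close>

definition ev :: "(7 list => complex) => cvec list => complex"
  where "ev c zs = (\<Sum>I\<in>idx (length zs). c I * cmono zs I)"

text \<open>Inverse to \<open>cmp\<close> on k-linear tensors; the value 0 at other lengths is the
  convention for tensors of degree k.\<close>

definition tensor_of :: "nat => (7 list => complex) => tensor"
  where "tensor_of k c vs = (if length vs = k then ev c (map cv vs) else 0)"

lemma ev_Nil [simp]: "ev c [] = c []" by (simp add: ev_def)

lemma ev_Cons: "ev c (z # zs) = (\<Sum>i\<in>UNIV. z $ i * ev (\<lambda>I. c (i # I)) zs)"
  by (simp add: ev_def sum_idx_Suc sum_distrib_left mult_ac)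

lemma ev_cong: "(\<And>I. length I = length zs ==> c I = d I) ==> ev c zs = ev d zs"
  by (simp add: ev_def in_idx)

lemma cmono_prod: "length I = length zs ==> cmono zs I = (\<Prod>j<length zs. zs ! j $ (I ! j))"
  by (induction zs I rule: cmono.induct) (auto simp: prod.lessThan_Suc_shift simp del: prod.lessThan_Suc)

lemma cv_axis: "cv (ax i) = axis i 1" by (simp add: vec_eq_iff axis_def)

lemma ev_axes: "ev c (map (\<lambda>i. axis i 1) I) = c I"
  by (induction I arbitrary: c) (simp_all add: ev_Cons axis_def if_one_mult)

lemma cmp_tensor_of: "cmp (tensor_of k c) I = (if length I = k then c I else 0)"
  by (simp add: cmp_def tensor_of_def comp_def cv_axis ev_axes)

lemma tensor_of_cong: "(\<And>I. length I = k ==> c I = d I) ==> tensor_of k c = tensor_of k d"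
  by (auto simp: tensor_of_def fun_eq_iff intro: ev_cong)

lemma tensor_of_cmp_tensor_of: "tensor_of k (cmp (tensor_of k c)) = tensor_of k c"
  by (rule tensor_of_cong) (simp add: cmp_tensor_of)

subsection \<open>Matrices acting on all slots\<close>

fun act :: "(7 => 7 => complex) => (7 list => complex) => 7 list => complex" where
  "act M c [] = c []"
| "act M c (i # I) = (\<Sum>j\<in>UNIV. M i j * act M (\<lambda>J. c (j # J)) I)"

lemma act_cong: "(\<And>J. length J = length I ==> c J = d J) ==> act M c I = act M d I"
proof (induction I arbitrary: c d)
  case (Cons i I)
  have "act M (\<lambda>J. c (j # J)) I = act M (\<lambda>J. d (j # J)) I" for j
    by (rule Cons.IH) (simp add: Cons.prems)
  then show ?case by simp
qed simp

lemma act_add: "act M (\<lambda>J. c J + d J) I = act M c I + act M d I"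
  by (induction I arbitrary: c d) (simp_all add: sum.distrib algebra_simps)
lemma act_scale: "act M (\<lambda>J. k * c J) I = k * act M c I"
  by (induction I arbitrary: c) (simp_all add: sum_distrib_left algebra_simps)
lemma act_minus: "act M (\<lambda>J. - c J) I = - act M c I"
  using act_scale[of M "-1" c I] by simp
lemma act_zero: "act M (\<lambda>J. 0) I = 0"
  using act_scale[of M 0 "\<lambda>_. 0" I] by simp
lemma act_sum: "act M (\<lambda>J. \<Sum>x\<in>X. c x J) I = (\<Sum>x\<in>X. act M (c x) I)"
  by (induction X rule: infinite_finite_induct) (simp_all add: act_zero act_add)

lemma act_act: "act M (act N c) I = act (\<lambda>i j. \<Sum>k\<in>UNIV. M i k * N k j) c I"
proof (induction I arbitrary: c)
  case (Cons i I)
  have "act M (act N c) (i # I) = (\<Sum>j\<in>UNIV. \<Sum>l\<in>UNIV. M i j * N j l * act M (act N (\<lambda>J. c (l # J))) I)"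
    by (simp add: act_sum act_scale sum_distrib_left mult.assoc)
  also have "\<dots> = (\<Sum>l\<in>UNIV. \<Sum>j\<in>UNIV. M i j * N j l * act M (act N (\<lambda>J. c (l # J))) I)"
    by (rule sum.swap)
  finally show ?case by (simp add: Cons.IH sum_distrib_right)
qed simp

lemma act_transpose: "(\<Sum>I\<in>idx k. b I * act M c I) = (\<Sum>I\<in>idx k. act (\<lambda>i j. M j i) b I * c I)"
proof (induction k arbitrary: b c)
  case (Suc k)
  have "(\<Sum>I\<in>idx (Suc k). b I * act M c I)
     = (\<Sum>i\<in>UNIV. \<Sum>j\<in>UNIV. M i j * (\<Sum>I\<in>idx k. b (i # I) * act M (\<lambda>J. c (j # J)) I))"
    by (simp add: sum_idx_Suc sum_distrib_left sum.swap[of _ UNIV "idx k"] mult_ac)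
  also have "\<dots> = (\<Sum>j\<in>UNIV. \<Sum>i\<in>UNIV. M i j * (\<Sum>I\<in>idx k. act (\<lambda>i j. M j i) (\<lambda>J. b (i # J)) I * c (j # I)))"
    unfolding Suc.IH by (rule sum.swap)
  also have "\<dots> = (\<Sum>I\<in>idx (Suc k). act (\<lambda>i j. M j i) b I * c I)"
    by (simp add: sum_idx_Suc sum_distrib_left sum_distrib_right sum.swap[of _ UNIV "idx k"] mult_ac)
  finally show ?case .
qed simp

lemma act_prod: "act M c I = (\<Sum>J\<in>idx (length I). (\<Prod>j<length I. M (I ! j) (J ! j)) * c J)"
proof (induction I arbitrary: c)
  case (Cons i I)
  show ?case
    by (simp add: Cons.IH sum_idx_Suc prod.lessThan_Suc_shift sum_distrib_left mult.assoc del: prod.lessThan_Suc)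
qed simp

lemma ev_act: "ev (act M c) zs = ev c (map (\<lambda>z. \<chi> j. \<Sum>i\<in>UNIV. z $ i * M i j) zs)"
proof (induction zs arbitrary: c)
  case (Cons z zs)
  have l: "ev (\<lambda>I. \<Sum>j\<in>X. a j * d j I) zs = (\<Sum>j\<in>X. a j * ev (d j) zs)" for X a d
    by (simp add: ev_def sum_distrib_left sum_distrib_right sum.swap[of _ X] mult_ac)
  have "ev (act M c) (z # zs) = (\<Sum>i\<in>UNIV. \<Sum>j\<in>UNIV. z $ i * M i j * ev (act M (\<lambda>J. c (j # J))) zs)"
    by (simp add: ev_Cons l sum_distrib_left mult.assoc)
  also have "\<dots> = (\<Sum>j\<in>UNIV. \<Sum>i\<in>UNIV. z $ i * M i j * ev (act M (\<lambda>J. c (j # J))) zs)"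
    by (rule sum.swap)
  finally show ?case by (simp add: ev_Cons Cons.IH sum_distrib_right)
qed simp

subsection \<open>Type decomposition\<close>

text \<open>\<open>tp M N p\<close> is the part where \<open>M\<close> acts on \<open>p\<close> slots and \<open>N\<close> on the remaining ones.\<close>

fun tp :: "(7 => 7 => complex) => (7 => 7 => complex) => nat => (7 list => complex) => 7 list => complex" where
  "tp M N p c [] = (if p = 0 then c [] else 0)"
| "tp M N p c (i # I) = (if p = 0 then 0 else (\<Sum>j\<in>UNIV. M i j * tp M N (p - 1) (\<lambda>J. c (j # J)) I))
     + (\<Sum>j\<in>UNIV. N i j * tp M N p (\<lambda>J. c (j # J)) I)"

abbreviation pencil :: "complex => (7 => 7 => complex) => (7 => 7 => complex) => 7 => 7 => complex"
  where "pencil z M N \<equiv> (\<lambda>i j. z * M i j + N i j)"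

text \<open>Type as weight: scaling the slots of M by z multiplies a tensor of type (p, k - p) by
  z^p. Polynomial identities in z thus replace sums over subsets of slots.\<close>

definition typed :: "(7 => 7 => complex) => (7 => 7 => complex) => nat => nat => (7 list => complex) => bool"
  where "typed M N k p c \<longleftrightarrow> (\<forall>I z. length I = k \<longrightarrow> act (pencil z M N) c I = z ^ p * c I)"

lemma tp_eq_0: "length I < p ==> tp M N p c I = 0"
  by (induction I arbitrary: p c) auto

text \<open>Expanding the action over all slots, the exponent of z counts the slots that receive M.
  So the pencil is a generating function for the parts \<open>tp\<close>.\<close>

lemma act_pencil: "act (pencil z M N) c I = (\<Sum>p\<le>length I. z ^ p * tp M N p c I)"
proof (induction I arbitrary: c)
  case (Cons i I)
  let ?n = "length I"
  let ?t = "\<lambda>p j. tp M N p (\<lambda>J. c (j # J)) I"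
  have "(\<Sum>p\<le>Suc ?n. z ^ p * tp M N p c (i # I))
      = (\<Sum>p\<le>Suc ?n. z ^ p * (if p = 0 then 0 else (\<Sum>j\<in>UNIV. M i j * ?t (p - 1) j)))
        + (\<Sum>p\<le>Suc ?n. z ^ p * (\<Sum>j\<in>UNIV. N i j * ?t p j))"
    by (simp only: tp.simps distrib_left sum.distrib)
  also have "(\<Sum>p\<le>Suc ?n. z ^ p * (if p = 0 then 0 else (\<Sum>j\<in>UNIV. M i j * ?t (p - 1) j)))
      = (\<Sum>p\<le>?n. z * z ^ p * (\<Sum>j\<in>UNIV. M i j * ?t p j))"
    by (subst sum.atMost_Suc_shift) simp
  also have "(\<Sum>p\<le>Suc ?n. z ^ p * (\<Sum>j\<in>UNIV. N i j * ?t p j)) = (\<Sum>p\<le>?n. z ^ p * (\<Sum>j\<in>UNIV. N i j * ?t p j))"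
    by (simp add: tp_eq_0)
  finally have "(\<Sum>p\<le>Suc ?n. z ^ p * tp M N p c (i # I))
     = (\<Sum>p\<le>?n. \<Sum>j\<in>UNIV. (z * M i j + N i j) * (z ^ p * ?t p j))"
    by (simp add: sum.distrib[symmetric] sum_distrib_left algebra_simps)
  also have "\<dots> = (\<Sum>j\<in>UNIV. (z * M i j + N i j) * (\<Sum>p\<le>?n. z ^ p * ?t p j))"
    by (subst sum.swap) (simp add: sum_distrib_left)
  finally show ?case by (simp add: Cons.IH)
qed simp

lemma poly_coeff_eq:
  fixes a b :: "nat => complex"
  assumes "\<And>z. (\<Sum>p\<le>n. z ^ p * a p) = (\<Sum>p\<le>n. z ^ p * b p)" "p \<le> n"
  shows "a p = b p"
  using polyfun_eq_coeffs[where c = a and d = b and n = n] assms by (simp add: mult.commute)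

text \<open>Linearity of \<open>tp\<close>, alternation and commutation with other actions are
  reduced to the same properties of \<open>act\<close> by comparing coefficients.\<close>

lemma tp_eqI:
  assumes "\<And>z. act (pencil z M N) c I = (\<Sum>p\<le>length I. z ^ p * b p)" "p \<le> length I"
  shows "tp M N p c I = b p"
  by (rule poly_coeff_eq[where n = "length I" and a = "\<lambda>p. tp M N p c I" and b = b, OF _ assms(2)])
    (simp add: act_pencil[symmetric] assms(1))

lemma typed_tp_same: "typed M N k p c ==> length I = k ==> p \<le> k ==> tp M N p c I = c I"
  by (subst tp_eqI[where b = "\<lambda>q. if q = p then c I else 0"])
    (auto simp: typed_def if_distrib[of "\<lambda>x. _ * x"] cong: if_cong)

lemma typed_tp_other: "typed M N k p c ==> length I = k ==> p \<le> k ==> q \<noteq> p ==> tp M N q c I = 0"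
proof (cases "q \<le> k")
  case True
  assume "typed M N k p c" "length I = k" "p \<le> k" "q \<noteq> p"
  then show ?thesis using True
    by (subst tp_eqI[where b = "\<lambda>q. if q = p then c I else 0"])
      (auto simp: typed_def if_distrib[of "\<lambda>x. _ * x"] cong: if_cong)
qed (simp add: tp_eq_0)

lemma tp_cong: "(\<And>J. length J = length I ==> c J = d J) ==> tp M N p c I = tp M N p d I"
proof (induction I arbitrary: c d p)
  case (Cons i I)
  have "tp M N p (\<lambda>J. c (j # J)) I = tp M N p (\<lambda>J. d (j # J)) I" for j p
    by (rule Cons.IH) (simp add: Cons.prems)
  then show ?case by simp
qed simp

lemma tp_sum: "tp M N p (\<lambda>J. \<Sum>x\<in>X. c x J) I = (\<Sum>x\<in>X. tp M N p (c x) I)"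
proof (cases "p \<le> length I")
  case True
  show ?thesis
    by (rule tp_eqI[OF _ True]) (simp add: act_sum act_pencil sum_distrib_left sum.swap[of _ X])
qed (simp add: tp_eq_0)

lemma tp_scale: "tp M N p (\<lambda>J. k * c J) I = k * tp M N p c I"
proof (cases "p \<le> length I")
  case True
  show ?thesis
    by (rule tp_eqI[OF _ True]) (simp add: act_scale act_pencil sum_distrib_left mult_ac)
qed (simp add: tp_eq_0)

lemma tp_add: "tp M N p (\<lambda>J. c J + d J) I = tp M N p c I + tp M N p d I"
proof (cases "p \<le> length I")
  case True
  show ?thesis
    by (rule tp_eqI[OF _ True]) (simp add: act_add act_pencil sum.distrib distrib_left)
qed (simp add: tp_eq_0)

text \<open>For idempotents M and N whose products with each other vanish, the pencil reproduces N
  and multiplies M by z; each slot carrying M contributes one factor z.\<close>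

lemma typed_tp:
  assumes MM: "\<And>i j. (\<Sum>k\<in>UNIV. M i k * M k j) = M i j" and NN: "\<And>i j. (\<Sum>k\<in>UNIV. N i k * N k j) = N i j"
    and MN: "\<And>i j. (\<Sum>k\<in>UNIV. M i k * N k j) = 0" and NM: "\<And>i j. (\<Sum>k\<in>UNIV. N i k * M k j) = 0"
  shows "typed M N k p (tp M N p c)"
proof -
  have "act (pencil z M N) (tp M N p c) I = z ^ p * tp M N p c I" for z I
  proof (induction I arbitrary: p c)
    case (Cons i I)
    let ?Q = "pencil z M N"
    have QM: "(\<Sum>j\<in>UNIV. ?Q i j * M j l) = z * M i l" for l
      by (simp add: distrib_right sum.distrib mult.assoc sum_distrib_left[symmetric] MM NM)
    have QN: "(\<Sum>j\<in>UNIV. ?Q i j * N j l) = N i l" for l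
      by (simp add: distrib_right sum.distrib mult.assoc sum_distrib_left[symmetric] NN MN)
    have e: "(\<Sum>j\<in>UNIV. ?Q i j * (\<Sum>l\<in>UNIV. X j l * t l)) = (\<Sum>l\<in>UNIV. (\<Sum>j\<in>UNIV. ?Q i j * X j l) * t l)" for X t
      by (simp only: sum_distrib_left sum_distrib_right mult.assoc) (rule sum.swap)
    have a: "act ?Q (\<lambda>J. tp M N p c (j # J)) I =
       (if p = 0 then 0 else (\<Sum>l\<in>UNIV. M j l * (z ^ (p - 1) * tp M N (p - 1) (\<lambda>J. c (l # J)) I)))
       + (\<Sum>l\<in>UNIV. N j l * (z ^ p * tp M N p (\<lambda>J. c (l # J)) I))" for j
      by (cases "p = 0") (simp_all add: act_add act_sum act_scale Cons.IH)
    show ?case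
    proof (cases p)
      case 0
      show ?thesis unfolding act.simps a by (simp add: 0 e QN[simplified])
    next
      case (Suc q)
      show ?thesis unfolding act.simps a
        by (simp add: Suc distrib_left sum.distrib e QN[simplified] QM[simplified] del: distrib_right_numeral)
          (simp add: sum_distrib_left mult_ac)
    qed
  qed simp
  then show ?thesis by (simp add: typed_def)
qed

lemma tp_transpose:
  "(\<Sum>I\<in>idx k. b I * tp M N p c I) = (\<Sum>I\<in>idx k. tp (\<lambda>i j. M j i) (\<lambda>i j. N j i) p b I * c I)"
proof (cases "p \<le> k")
  case True
  show ?thesis
  proof (rule poly_coeff_eq[OF _ True])
    fix z
    have e: "act (pencil z M N) c I = (\<Sum>p\<le>k. z ^ p * tp M N p c I)" if "I \<in> idx k" for M N c I
      using that by (simp add: act_pencil in_idx)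
    have "(\<Sum>p\<le>k. z ^ p * (\<Sum>I\<in>idx k. b I * tp M N p c I)) = (\<Sum>p\<le>k. \<Sum>I\<in>idx k. b I * (z ^ p * tp M N p c I))"
      by (simp add: sum_distrib_left mult_ac)
    also have "\<dots> = (\<Sum>I\<in>idx k. \<Sum>p\<le>k. b I * (z ^ p * tp M N p c I))" by (rule sum.swap)
    also have "\<dots> = (\<Sum>I\<in>idx k. b I * act (pencil z M N) c I)" by (simp add: e sum_distrib_left)
    also have "\<dots> = (\<Sum>I\<in>idx k. act (pencil z (\<lambda>i j. M j i) (\<lambda>i j. N j i)) b I * c I)" by (rule act_transpose)
    also have "\<dots> = (\<Sum>I\<in>idx k. \<Sum>p\<le>k. z ^ p * (tp (\<lambda>i j. M j i) (\<lambda>i j. N j i) p b I * c I))"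
      by (simp add: e sum_distrib_right mult.assoc)
    also have "\<dots> = (\<Sum>p\<le>k. \<Sum>I\<in>idx k. z ^ p * (tp (\<lambda>i j. M j i) (\<lambda>i j. N j i) p b I * c I))" by (rule sum.swap)
    also have "\<dots> = (\<Sum>p\<le>k. z ^ p * (\<Sum>I\<in>idx k. tp (\<lambda>i j. M j i) (\<lambda>i j. N j i) p b I * c I))"
      by (simp only: sum_distrib_left)
    finally show "(\<Sum>p\<le>k. z ^ p * (\<Sum>I\<in>idx k. b I * tp M N p c I))
      = (\<Sum>p\<le>k. z ^ p * (\<Sum>I\<in>idx k. tp (\<lambda>i j. M j i) (\<lambda>i j. N j i) p b I * c I))" .
  qed
qed (auto intro!: sum.cong simp: tp_eq_0 in_idx)

lemma tp_act_commute:
  assumes "\<And>i j. (\<Sum>k\<in>UNIV. S i k * M k j) = (\<Sum>k\<in>UNIV. M i k * S k j)"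
    "\<And>i j. (\<Sum>k\<in>UNIV. S i k * N k j) = (\<Sum>k\<in>UNIV. N i k * S k j)"
  shows "act S (tp M N p c) I = tp M N p (act S c) I"
proof (cases "p \<le> length I")
  case True
  show ?thesis
  proof (rule sym, rule tp_eqI[OF _ True])
    fix z
    have "(\<Sum>k\<in>UNIV. S i k * pencil z M N k j) = (\<Sum>k\<in>UNIV. pencil z M N i k * S k j)" for i j
    proof -
      have "(\<Sum>k\<in>UNIV. S i k * pencil z M N k j) = z * (\<Sum>k\<in>UNIV. S i k * M k j) + (\<Sum>k\<in>UNIV. S i k * N k j)"
        by (simp add: distrib_left sum.distrib sum_distrib_left mult_ac)
      also have "\<dots> = z * (\<Sum>k\<in>UNIV. M i k * S k j) + (\<Sum>k\<in>UNIV. N i k * S k j)" by (simp only: assms)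
      also have "\<dots> = (\<Sum>k\<in>UNIV. pencil z M N i k * S k j)"
        by (simp add: distrib_right sum.distrib sum_distrib_left mult.assoc)
      finally show ?thesis .
    qed
    then have "act (pencil z M N) (act S c) I = act S (act (pencil z M N) c) I"
      unfolding act_act by simp
    also have "\<dots> = act S (\<lambda>J. \<Sum>p\<le>length I. z ^ p * tp M N p c J) I"
      by (rule act_cong) (simp add: act_pencil)
    finally show "act (pencil z M N) (act S c) I = (\<Sum>p\<le>length I. z ^ p * act S (tp M N p c) I)"
      by (simp add: act_sum act_scale)
  qed
next
  case False
  then have "act S (tp M N p c) I = act S (\<lambda>_. 0) I" by (intro act_cong) (simp add: tp_eq_0)
  then show ?thesis using False by (simp add: act_zero tp_eq_0)
qed

subsection \<open>Alternating functions on lists\<close>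

text \<open>Only swaps of neighbours are mentioned, which suits induction over lists; these swaps
  generate all permutations, see \<open>altern_permute\<close>.\<close>

definition altern :: "('a list => complex) => bool"
  where "altern c \<longleftrightarrow> (\<forall>xs a b ys. c (xs @ a # b # ys) = - c (xs @ b # a # ys))"

lemma alternD: "altern c ==> c (xs @ a # b # ys) = - c (xs @ b # a # ys)"
  unfolding altern_def by iprover

lemma altern_Cons: "altern c ==> altern (\<lambda>J. c (j # J))"
  unfolding altern_def by (metis append_Cons)

lemma altern_linear: assumes "altern c" "altern d" shows "altern (\<lambda>I. k * c I + l * d I)"
  unfolding altern_def
proof (intro allI)
  fix xs ys and a b
  show "k * c (xs @ a # b # ys) + l * d (xs @ a # b # ys) = - (k * c (xs @ b # a # ys) + l * d (xs @ b # a # ys))"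
    by (simp add: alternD[OF assms(1), of xs a b ys] alternD[OF assms(2), of xs a b ys])
qed

lemma altern_zero: "altern (\<lambda>I. 0)" unfolding altern_def by simp
lemma altern_add: "altern c ==> altern d ==> altern (\<lambda>I. c I + d I)" using altern_linear[of c d 1 1] by simp
lemma altern_scale: "altern c ==> altern (\<lambda>I. k * c I)" using altern_linear[of c "\<lambda>_. 0" k 0] altern_zero by simp
lemma altern_sum: "(\<And>x. x \<in> X ==> altern (c x)) ==> altern (\<lambda>I. \<Sum>x\<in>X. c x I)"
  by (induction X rule: infinite_finite_induct) (auto intro: altern_add altern_zero)

lemma altern_act: "altern c ==> altern (act M c)"
proof -
  have "act M c (xs @ a # b # ys) = - act M c (xs @ b # a # ys)" if "altern c" for xs a b ys
    using that
  proof (induction xs arbitrary: c)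
    case Nil
    have "(\<Sum>j\<in>UNIV. \<Sum>l\<in>UNIV. M a j * (M b l * act M (\<lambda>J. c (j # l # J)) ys))
       = (\<Sum>l\<in>UNIV. \<Sum>j\<in>UNIV. M a j * (M b l * act M (\<lambda>J. c (j # l # J)) ys))" by (rule sum.swap)
    also have "\<dots> = (\<Sum>l\<in>UNIV. \<Sum>j\<in>UNIV. - (M b l * (M a j * act M (\<lambda>J. c (l # j # J)) ys)))"
    proof (intro sum.cong refl)
      fix j l
      have "(\<lambda>J. c (j # l # J)) = (\<lambda>J. - c (l # j # J))" using alternD[OF Nil, of "[]" j l] by (simp only: append_Nil)
      then show "M a j * (M b l * act M (\<lambda>J. c (j # l # J)) ys) = - (M b l * (M a j * act M (\<lambda>J. c (l # j # J)) ys))"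
        by (simp add: act_minus)
    qed
    finally show ?case by (simp add: sum_distrib_left sum_negf)
  next
    case (Cons x xs)
    show ?case using Cons.IH[OF altern_Cons[OF Cons.prems]] by (simp add: sum_negf)
  qed
  then show "altern c ==> altern (act M c)" unfolding altern_def[of "act M c"] by iprover
qed

lemma altern_tp: assumes "altern c" shows "altern (tp M N p c)"
  unfolding altern_def
proof (intro allI)
  fix xs ys :: "7 list" and a b
  let ?I = "xs @ a # b # ys" and ?J = "xs @ b # a # ys"
  have l: "length ?I = length ?J" by simp
  show "tp M N p c ?I = - tp M N p c ?J"
  proof (cases "p \<le> length ?I")
    case True
    show ?thesis
    proof (rule tp_eqI[OF _ True])
      fix z
      have "act (pencil z M N) c ?I = - act (pencil z M N) c ?J" by (rule alternD[OF altern_act[OF assms]])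
      then show "act (pencil z M N) c ?I = (\<Sum>p\<le>length ?I. z ^ p * - tp M N p c ?J)"
        by (simp add: act_pencil sum_negf)
    qed
  qed (simp add: tp_eq_0)
qed

lemma altern_move: "altern c ==> c (zs @ xs @ a # ys) = (-1) ^ length xs * c (zs @ a # xs @ ys)"
proof (induction xs arbitrary: zs)
  case (Cons x xs)
  have "c (zs @ (x # xs) @ a # ys) = (-1) ^ length xs * c (zs @ x # a # xs @ ys)"
    using Cons.IH[of "zs @ [x]"] Cons.prems by simp
  also have "c (zs @ x # a # xs @ ys) = - c (zs @ a # x # xs @ ys)" by (rule alternD[OF Cons.prems])
  finally show ?case by simp
qed simp

lemma altern_swap:
  assumes "altern c" shows "c (us @ x # vs @ y # ws) = - c (us @ y # vs @ x # ws)"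
  using altern_move[OF assms, of us "x # vs" y ws] altern_move[OF assms, of us vs x ws]
    altern_move[OF assms, of "us @ [y]" vs x ws] by simp

lemma permute_list_transpose:
  "permute_list (Transposition.transpose (length us) (length us + Suc (length vs))) (us @ x # vs @ y # ws)
     = us @ y # vs @ x # ws"
proof (rule nth_equalityI)
  fix i assume "i < length (permute_list (Transposition.transpose (length us) (length us + Suc (length vs))) (us @ x # vs @ y # ws))"
  then have i: "i < length (us @ x # vs @ y # ws)" by simp
  have p: "Transposition.transpose (length us) (length us + Suc (length vs)) permutes {..<length (us @ x # vs @ y # ws)}"
    by (rule permutes_swap_id) auto
  show "permute_list (Transposition.transpose (length us) (length us + Suc (length vs))) (us @ x # vs @ y # ws) ! i
     = (us @ y # vs @ x # ws) ! i"
    unfolding permute_list_nth[OF p i]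
    using i by (auto simp: Transposition.transpose_def nth_append nth_Cons' split: if_splits)
qed simp

lemma altern_transpose:
  assumes "altern c" "a < length xs" "b < length xs" "a \<noteq> b"
  shows "c (permute_list (Transposition.transpose a b) xs) = - c xs"
proof -
  have *: "c (permute_list (Transposition.transpose a b) xs) = - c xs" if "a < b" "b < length xs" for a b
  proof -
    have "xs = take a xs @ xs ! a # drop (Suc a) xs" using that by (intro id_take_nth_drop) simp
    also have "drop (Suc a) xs = take (b - Suc a) (drop (Suc a) xs) @ xs ! b # drop (Suc b) xs"
      using id_take_nth_drop[of "b - Suc a" "drop (Suc a) xs"] that by simp
    finally have e: "xs = take a xs @ xs ! a # take (b - Suc a) (drop (Suc a) xs) @ xs ! b # drop (Suc b) xs" .
    have "permute_list (Transposition.transpose a b) xs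
       = take a xs @ xs ! b # take (b - Suc a) (drop (Suc a) xs) @ xs ! a # drop (Suc b) xs"
      by (subst e) (use that permute_list_transpose[of "take a xs" "take (b - Suc a) (drop (Suc a) xs)"] in simp)
    then show ?thesis
      using altern_swap[OF assms(1), of "take a xs" "xs ! b"] e by metis
  qed
  show ?thesis
  proof (cases "a < b")
    case False
    then show ?thesis using *[of b a] assms by (simp add: transpose_commute)
  qed (use * assms in auto)
qed

text \<open>Induction over transpositions. This connects the swaps of neighbours with the signed
  permutation sum in \<open>wedge\<close>.\<close>

lemma altern_permute:
  assumes "altern c" "\<sigma> permutes {..<length xs}"
  shows "c (permute_list \<sigma> xs) = of_int (sign \<sigma>) * c xs"
proof -
  have "\<forall>xs. length xs = n \<longrightarrow> c (permute_list \<sigma> xs) = of_int (sign \<sigma>) * c xs" if "\<sigma> permutes {..<n}" for \<sigma> n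
    using that finite_lessThan[of n]
  proof (induction rule: permutes_induct)
    case id
    show ?case by (simp add: permute_list_id)
  next
    case (swap a b p)
    show ?case
    proof (intro allI impI)
      fix xs :: "'a list" assume xs: "length xs = n"
      have sw: "Transposition.transpose a b permutes {..<n}" using swap by (intro permutes_swap_id)
      have "permute_list (Transposition.transpose a b \<circ> p) xs = permute_list p (permute_list (Transposition.transpose a b) xs)"
        using swap xs by (intro permute_list_compose) simp
      then have "c (permute_list (Transposition.transpose a b \<circ> p) xs)
         = of_int (sign p) * c (permute_list (Transposition.transpose a b) xs)" using swap xs by simp
      also have "c (permute_list (Transposition.transpose a b) xs) = - c xs"
        using swap xs by (intro altern_transpose assms) auto
      finally have 1: "c (permute_list (Transposition.transpose a b \<circ> p) xs) = of_int (sign p) * - c xs" .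
      have 2: "sign (Transposition.transpose a b \<circ> p) = - sign p"
        using swap by (subst sign_compose) (auto simp: permutation_swap_id sign_swap_id permutes_imp_permutation[OF finite_lessThan \<open>p permutes {..<n}\<close>])
      show "c (permute_list (Transposition.transpose a b \<circ> p) xs) = of_int (sign (Transposition.transpose a b \<circ> p)) * c xs"
        unfolding 1 2 by simp
    qed
  qed
  then show ?thesis using assms(2) by blast
qed

text \<open>A swap of neighbours is a transposition of positions, of sign -1.\<close>

lemma alternI_permute:
  assumes "\<And>\<sigma> xs. \<sigma> permutes {..<length xs} ==> c (permute_list \<sigma> xs) = of_int (sign \<sigma>) * c xs"
  shows "altern c"
  unfolding altern_def
proof (intro allI)
  fix xs ys :: "'a list" and a b :: 'a
  let ?t = "Transposition.transpose (length xs) (length xs + Suc (length ([]::'a list)))"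
  have p: "?t permutes {..<length (xs @ b # a # ys)}" by (rule permutes_swap_id) auto
  have "permute_list ?t (xs @ b # a # ys) = xs @ a # b # ys" using permute_list_transpose[of xs "[]"] by simp
  with assms[OF p] show "c (xs @ a # b # ys) = - c (xs @ b # a # ys)" by (simp add: sign_swap_id)
qed

section \<open>Forms of type (p,q) in components\<close>

lemma sum_permutations_compose_both:
  "(\<Sum>\<sigma> | \<sigma> permutes {..<n}. f (\<tau> \<circ> \<sigma>)) = (\<Sum>\<sigma> | \<sigma> permutes {..<n}. f \<sigma>)"
  "(\<Sum>\<sigma> | \<sigma> permutes {..<n}. f (\<sigma> \<circ> \<tau>)) = (\<Sum>\<sigma> | \<sigma> permutes {..<n}. f \<sigma>)"
  if "\<tau> permutes {..<n}" for f :: "(nat => nat) => complex"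
  using setum_permutations_compose_left[OF that, of f] sum_permutations_compose_right[OF that, of f] by simp_all

lemma sign_compose_lessThan:
  "\<sigma> permutes {..<n::nat} ==> \<tau> permutes {..<n} ==> sign (\<sigma> \<circ> \<tau>) = sign \<sigma> * sign \<tau>"
  by (intro sign_compose permutes_imp_permutation[OF finite_lessThan])

lemma sign_mult_self: "of_int (sign \<sigma>) * of_int (sign \<sigma>) = (1::complex)"
  by (simp add: sign_def)

lemma wedge_permute_args:
  fixes \<alpha>s :: "(vec7 => complex) list"
  assumes "\<tau> permutes {..<length vs}"
  shows "wedge \<alpha>s (permute_list \<tau> vs) = of_int (sign \<tau>) * wedge \<alpha>s vs"
proof (cases "length vs = length \<alpha>s")
  case True
  let ?n = "length \<alpha>s"
  let ?f = "\<lambda>\<sigma>. of_int (sign \<sigma>) * (\<Prod>i<?n. (\<alpha>s ! i) (vs ! \<sigma> i))"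
  have \<tau>: "\<tau> permutes {..<?n}" using assms True by simp
  have "wedge \<alpha>s (permute_list \<tau> vs) = (\<Sum>\<sigma> | \<sigma> permutes {..<?n}. of_int (sign \<tau>) * ?f (\<tau> \<circ> \<sigma>))"
    unfolding wedge_def length_permute_list True if_P[OF refl]
  proof (rule sum.cong, simp)
    fix \<sigma> assume "\<sigma> \<in> {\<sigma>. \<sigma> permutes {..<?n}}"
    then have \<sigma>: "\<sigma> permutes {..<?n}" by simp
    have "permute_list \<tau> vs ! \<sigma> i = vs ! \<tau> (\<sigma> i)" if "i < ?n" for i
      using permute_list_nth[OF assms, of "\<sigma> i"] permutes_in_image[OF \<sigma>, of i] that True by simp
    then show "of_int (sign \<sigma>) * (\<Prod>i<?n. (\<alpha>s ! i) (permute_list \<tau> vs ! \<sigma> i)) = of_int (sign \<tau>) * ?f (\<tau> \<circ> \<sigma>)"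
      by (simp add: sign_compose_lessThan[OF \<tau> \<sigma>] mult.assoc[symmetric] sign_mult_self)
  qed
  also have "\<dots> = of_int (sign \<tau>) * (\<Sum>\<sigma> | \<sigma> permutes {..<?n}. ?f \<sigma>)"
    using sum_permutations_compose_both(1)[OF \<tau>, of ?f] by (simp only: sum_distrib_left[symmetric])
  finally show ?thesis using True by (simp add: wedge_def)
qed (simp add: wedge_def)

lemma wedge_permute_forms:
  fixes \<alpha>s :: "(vec7 => complex) list"
  assumes "\<tau> permutes {..<length \<alpha>s}"
  shows "wedge (permute_list \<tau> \<alpha>s) vs = of_int (sign \<tau>) * wedge \<alpha>s vs"
proof (cases "length vs = length \<alpha>s")
  case True
  let ?n = "length \<alpha>s"
  let ?f = "\<lambda>\<sigma>. of_int (sign \<sigma>) * (\<Prod>i<?n. (\<alpha>s ! i) (vs ! \<sigma> i))"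
  have inv: "Hilbert_Choice.inv \<tau> permutes {..<?n}" by (rule permutes_inv[OF assms])
  have "wedge (permute_list \<tau> \<alpha>s) vs = (\<Sum>\<sigma> | \<sigma> permutes {..<?n}. of_int (sign \<tau>) * ?f (\<sigma> \<circ> Hilbert_Choice.inv \<tau>))"
    unfolding wedge_def length_permute_list True if_P[OF refl]
  proof (rule sum.cong, simp)
    fix \<sigma> assume "\<sigma> \<in> {\<sigma>. \<sigma> permutes {..<?n}}"
    then have \<sigma>: "\<sigma> permutes {..<?n}" by simp
    have "(\<Prod>i<?n. (permute_list \<tau> \<alpha>s ! i) (vs ! \<sigma> i)) = (\<Prod>i<?n. (\<alpha>s ! \<tau> i) (vs ! \<sigma> (Hilbert_Choice.inv \<tau> (\<tau> i))))"
      using permute_list_nth[OF assms] permutes_inverses[OF assms] by simp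
    also have "\<dots> = (\<Prod>i<?n. (\<alpha>s ! i) (vs ! \<sigma> (Hilbert_Choice.inv \<tau> i)))"
      using permutes_imp_bij[OF assms] by (intro prod.reindex_bij_betw)
    finally show "of_int (sign \<sigma>) * (\<Prod>i<?n. (permute_list \<tau> \<alpha>s ! i) (vs ! \<sigma> i)) = of_int (sign \<tau>) * ?f (\<sigma> \<circ> Hilbert_Choice.inv \<tau>)"
      using sign_inverse[OF permutes_imp_permutation[OF finite_lessThan assms]]
      by (simp add: sign_compose_lessThan[OF \<sigma> inv] mult.assoc[symmetric] mult.commute[of "of_int (sign \<sigma>)"] sign_mult_self)
  qed
  also have "\<dots> = of_int (sign \<tau>) * (\<Sum>\<sigma> | \<sigma> permutes {..<?n}. ?f \<sigma>)"
    using sum_permutations_compose_both(2)[OF inv, of ?f] by (simp only: sum_distrib_left[symmetric])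
  finally show ?thesis using True by (simp add: wedge_def)
qed (simp add: wedge_def)

lemma altern_wedge_args: "altern (wedge (\<alpha>s :: (vec7 => complex) list))"
  by (rule alternI_permute) (rule wedge_permute_args)

lemma altern_wedge_forms: "altern (\<lambda>\<alpha>s :: (vec7 => complex) list. wedge \<alpha>s vs)"
  by (rule alternI_permute) (rule wedge_permute_forms)

lemma altern_cmp: "altern \<eta> ==> altern (cmp \<eta>)"
  unfolding altern_def[of "cmp \<eta>"] cmp_def map_append list.map by (intro allI alternD)

lemma wedge_slot_sum:
  fixes \<gamma>s :: "(vec7 => complex) list"
  shows "wedge (\<gamma>s @ (\<lambda>v. \<Sum>i\<in>X. a i * \<alpha> i v) # \<delta>s) vs = (\<Sum>i\<in>X. a i * wedge (\<gamma>s @ \<alpha> i # \<delta>s) vs)"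
proof -
  let ?n = "length \<gamma>s" and ?L = "Suc (length \<gamma>s + length \<delta>s)"
  \<comment> \<open>The remaining product omits the position of the varying factor, so an arbitrary
    entry can stand there.\<close>
  have p: "(\<Prod>i<?L. ((\<gamma>s @ \<beta> # \<delta>s) ! i) (w i)) = \<beta> (w ?n) * (\<Prod>i\<in>{..<?L} - {?n}. ((\<gamma>s @ undefined # \<delta>s) ! i) (w i))" for \<beta> w
  proof -
    have "(\<Prod>i\<in>{..<?L} - {?n}. ((\<gamma>s @ \<beta> # \<delta>s) ! i) (w i)) = (\<Prod>i\<in>{..<?L} - {?n}. ((\<gamma>s @ undefined # \<delta>s) ! i) (w i))"
      by (rule prod.cong) (auto simp: nth_append nth_Cons')
    then show ?thesis by (subst prod.remove[of _ ?n]) auto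
  qed
  show ?thesis
  proof (cases "length vs = ?L")
    case True
    show ?thesis unfolding wedge_def
      by (simp add: True p del: prod.lessThan_Suc)
        (simp add: sum_distrib_left sum_distrib_right sum.swap[of _ X] mult_ac)
  qed (simp add: wedge_def)
qed

subsection \<open>Projection matrices\<close>

definition pm :: "cvec => 7 => 7 => complex" where "pm u i j = Pm u (axis j 1) $ i"
definition pp :: "cvec => 7 => 7 => complex" where "pp u i j = Pp u (axis j 1) $ i"

lemma pm_mult: "(\<Sum>j\<in>UNIV. pm u i j * z $ j) = Pm u z $ i"
proof -
  have "Pm u z = (\<Sum>j\<in>UNIV. z $ j *s Pm u (axis j 1))"
    by (subst sum_axis[symmetric, of z]) (simp only: Pm_sum Pm_scale)
  then show ?thesis by (simp add: pm_def mult.commute)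
qed
lemma pp_mult: "(\<Sum>j\<in>UNIV. pp u i j * z $ j) = Pp u z $ i"
  using pm_mult[of "-u" i z] by (simp add: pm_def pp_def Pp_uminus)

text \<open>The projections are adjoint to each other for the bilinear product, because E+ and E-
  are isotropic and dual to each other.\<close>

lemma pm_transpose: "pm u j i = pp u i j"
  unfolding pm_def pp_def using Pm_dot[of u "axis i 1" "axis j 1"] by (simp add: cdot_axis)
lemma pp_transpose: "pp u j i = pm u i j" by (simp add: pm_transpose)

lemma pm_mult': "(\<Sum>j\<in>UNIV. z $ j * pm u j i) = Pp u z $ i"
  using pp_mult[of u i z] by (simp add: pm_transpose mult.commute)
lemma pp_mult': "(\<Sum>j\<in>UNIV. z $ j * pp u j i) = Pm u z $ i"
  using pm_mult[of u i z] by (simp add: pp_transpose mult.commute)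

lemma pm_pm: "u \<odot> u = 1 ==> (\<Sum>k\<in>UNIV. pm u i k * pm u k j) = pm u i j"
  and pp_pp: "u \<odot> u = 1 ==> (\<Sum>k\<in>UNIV. pp u i k * pp u k j) = pp u i j"
  and pm_pp: "u \<odot> u = 1 ==> (\<Sum>k\<in>UNIV. pm u i k * pp u k j) = 0"
  and pp_pm: "u \<odot> u = 1 ==> (\<Sum>k\<in>UNIV. pp u i k * pm u k j) = 0"
  unfolding pm_def[of u _ j] pp_def[of u _ j] pm_mult pp_mult
  by (simp_all add: Pm_Em Pm_Ep Pp_Em Pp_Ep Pm_in_Em Pp_in_Ep)

lemma pm_add_pp: "pm u i j + pp u i j = (if i = j then 1 else 0) - u $ i * u $ j"
  using arg_cong[OF Pm_Pp_decomp[of u "axis j 1"], of "\<lambda>v. v $ i"]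
  by (simp add: pm_def pp_def cdot_axis algebra_simps) (simp add: axis_def)

lemma cnj_pm: "cnj (pm (cv u) i j) = pp (cv u) i j"
  using arg_cong[OF vcnj_Pm[of u "axis j 1"], of "\<lambda>v. v $ i"]
  by (simp add: pm_def pp_def) (simp add: cv_axis[symmetric])
lemma cnj_pp: "cnj (pp (cv u) i j) = pm (cv u) i j"
  using arg_cong[OF cnj_pm[of u i j], of cnj] by simp

lemma sm_pm: "sm (\<lambda>u. pm (cv u) i j)" and sm_pp: "sm (\<lambda>u. pp (cv u) i j)"
  unfolding pm_def pp_def by (intro smvD smv_Pm smv_Pp smv_const)+

text \<open>Components of a (1,0)-form lie in \<^term>\<open>Em u\<close>, because its values on \<^term>\<open>Em u\<close> vanish
  and this space is its own annihilator among tangent vectors. This is why \<^const>\<open>pm\<close> projects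
  the slots of type (1,0).\<close>

abbreviation ftyped :: "cvec => nat => nat => (7 list => complex) => bool"
  where "ftyped u \<equiv> typed (pm u) (pp u)"
abbreviation ftp :: "cvec => nat => (7 list => complex) => 7 list => complex"
  where "ftp u \<equiv> tp (pm u) (pp u)"

lemma ftyped_ftp: "u \<odot> u = 1 ==> ftyped u k p (ftp u p c)"
  by (rule typed_tp) (simp_all add: pm_pm pp_pp pm_pp pp_pm)

lemma linear_dot: "linear \<alpha> ==> \<alpha> v = (\<chi> i. \<alpha> (ax i)) \<odot> cv v" for \<alpha> :: "vec7 => complex"
  using linear_axis_expansion[of \<alpha> v] by (simp add: cdot_def mult.commute)

text \<open>The cross product with u acts on the components of a covector by its transpose, and it
  is skew; this causes the sign. Extending J from tangent vectors to all of \<open>vec7\<close> is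
  harmless, as both sides vanish on u.\<close>

lemma cotangent_comps:
  assumes u: "u \<in> S6" and lin: "linear \<alpha>" and k: "\<alpha> u = 0"
    and J: "\<And>v. v \<in> tangent u ==> \<alpha> (std_J u v) = k * \<alpha> v"
  shows "cv u \<otimes> (\<chi> i. \<alpha> (ax i)) = (- k) *s (\<chi> i. \<alpha> (ax i))"
proof -
  let ?F = "\<chi> i. \<alpha> (ax i)"
  have uu: "u \<bullet> u = 1" using u by (simp add: dot_square_norm mem_sphere)
  have *: "\<alpha> (xcross u v) = k * \<alpha> v" for v
  proof -
    have x: "xcross u u = 0" by (simp add: vec_eq_iff forall_7 xcross_nth)
    have "xcross u (tproj u v) = xcross u v"
      unfolding tproj_def using x
      by (simp add: vec_eq_iff forall_7 xcross_nth algebra_simps)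
    moreover have "tproj u v \<in> tangent u" by (simp add: tangent_def tproj_def inner_diff_right uu)
    moreover have "\<alpha> (tproj u v) = \<alpha> v"
      unfolding tproj_def linear_diff[OF lin] linear_cmul[OF lin] k by simp
    ultimately show ?thesis using J[of "tproj u v"] by (simp add: std_J_def cross7_eq)
  qed
  show ?thesis
  proof (rule vec_eq_iff[THEN iffD2], rule allI)
    fix i
    have "(cv u \<otimes> ?F) $ i = - ((cv u \<otimes> axis i 1) \<odot> ?F)"
      using xcross_dot_swap[of "cv u" ?F "axis i 1"] by (simp add: cdot_axis)
    also have "(cv u \<otimes> axis i 1) \<odot> ?F = \<alpha> (xcross u (ax i))"
      by (subst linear_dot[OF lin]) (simp add: cv_xcross cv_axis cdot_commute)
    finally show "(cv u \<otimes> ?F) $ i = ((- k) *s ?F) $ i" by (simp add: *)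
  qed
qed

lemma cotangent10_Em: "u \<in> S6 ==> \<alpha> \<in> cotangent10 std_J u ==> (\<chi> i. \<alpha> (ax i)) \<in> Em (cv u)"
  using cotangent_comps[of u \<alpha> \<i>] by (simp add: cotangent10_def Em_def)
lemma cotangent01_Ep: "u \<in> S6 ==> \<alpha> \<in> cotangent01 std_J u ==> (\<chi> i. \<alpha> (ax i)) \<in> Ep (cv u)"
  using cotangent_comps[of u \<alpha> "-\<i>"] by (simp add: cotangent01_def Ep_def)

lemma cv_add: "cv (a + b) = cv a + cv b" and cv_scaleR: "cv (r *\<^sub>R a) = of_real r *s cv a"
  by (simp_all add: vec_eq_iff)

lemma linear_cdot_cv: "linear (\<lambda>v. F \<odot> cv v)"
  by (rule linearI) (simp_all only: cv_add cv_scaleR cdot_linear scaleR_conv_of_real[where 'a = complex])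

lemma Em_cotangent10: "F \<in> Em (cv u) ==> (\<lambda>v. F \<odot> cv v) \<in> cotangent10 std_J u"
  and Ep_cotangent01: "F \<in> Ep (cv u) ==> (\<lambda>v. F \<odot> cv v) \<in> cotangent01 std_J u"
proof -
  have *: "F \<odot> cv (std_J u v) = - ((cv u \<otimes> F) \<odot> cv v)" for v
    unfolding std_J_def cross7_eq cv_xcross using xcross_dot_swap[of "cv u" "cv v" F] by (simp add: cdot_commute[of F])
  show "(\<lambda>v. F \<odot> cv v) \<in> cotangent10 std_J u" if "F \<in> Em (cv u)"
    unfolding cotangent10_def using that
    by (simp add: linear_cdot_cv * EmD cdot_linear) (simp add: cdot_commute[of F] Em_dot_u)
  show "(\<lambda>v. F \<odot> cv v) \<in> cotangent01 std_J u" if "F \<in> Ep (cv u)"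
    unfolding cotangent01_def using that
    by (simp add: linear_cdot_cv * EpD cdot_linear) (simp add: cdot_commute[of F] Ep_dot_u)
qed

subsection \<open>Components of wedge products\<close>

lemma wedge_linear_prod:
  fixes \<alpha>s :: "(vec7 => complex) list"
  assumes lin: "\<And>\<alpha>. \<alpha> \<in> set \<alpha>s ==> linear \<alpha>" and l: "length vs = length \<alpha>s" and \<sigma>: "\<sigma> permutes {..<length \<alpha>s}"
  shows "(\<Prod>i<length \<alpha>s. (\<alpha>s ! i) (vs ! \<sigma> i))
    = (\<Sum>I\<in>idx (length \<alpha>s). (\<Prod>i<length \<alpha>s. (\<alpha>s ! i) (ax (I ! \<sigma> i))) * cmono (map cv vs) I)"
proof -
  let ?n = "length \<alpha>s" and ?\<tau> = "Hilbert_Choice.inv \<sigma>"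
  have re: "(\<Prod>j<?n. g (?\<tau> j) j) = (\<Prod>i<?n. g i (\<sigma> i))" for g :: "nat => nat => complex"
    using prod.reindex_bij_betw[OF permutes_imp_bij[OF \<sigma>], of "\<lambda>j. g (?\<tau> j) j"] permutes_inverses[OF \<sigma>] by simp
  have "(\<Prod>i<?n. (\<alpha>s ! i) (vs ! \<sigma> i)) = (\<Prod>j<?n. (\<alpha>s ! ?\<tau> j) (vs ! j))"
    using re[of "\<lambda>i j. (\<alpha>s ! i) (vs ! j)"] by simp
  also have "\<dots> = (\<Prod>j<?n. \<Sum>m\<in>UNIV. (\<alpha>s ! ?\<tau> j) (ax m) * of_real (vs ! j $ m))"
  proof (rule prod.cong[OF refl])
    fix j assume "j \<in> {..<?n}"
    then have "?\<tau> j < ?n" using permutes_in_image[OF permutes_inv[OF \<sigma>], of j] by simp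
    then have "linear (\<alpha>s ! ?\<tau> j)" using lin by simp
    from linear_axis_expansion[OF this, of "vs ! j"]
    show "(\<alpha>s ! ?\<tau> j) (vs ! j) = (\<Sum>m\<in>UNIV. (\<alpha>s ! ?\<tau> j) (ax m) * of_real (vs ! j $ m))"
      by (simp add: mult.commute)
  qed
  also have "\<dots> = (\<Sum>I\<in>idx ?n. \<Prod>j<?n. (\<alpha>s ! ?\<tau> j) (ax (I ! j)) * of_real (vs ! j $ (I ! j)))"
    by (rule prod_sum_tup) simp
  also have "\<dots> = (\<Sum>I\<in>idx ?n. (\<Prod>i<?n. (\<alpha>s ! i) (ax (I ! \<sigma> i))) * cmono (map cv vs) I)"
  proof (rule sum.cong[OF refl])
    fix I assume "I \<in> idx ?n"
    then show "(\<Prod>j<?n. (\<alpha>s ! ?\<tau> j) (ax (I ! j)) * of_real (vs ! j $ (I ! j)))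
       = (\<Prod>i<?n. (\<alpha>s ! i) (ax (I ! \<sigma> i))) * cmono (map cv vs) I"
      using re[of "\<lambda>i j. (\<alpha>s ! i) (ax (I ! j))"] by (simp add: prod.distrib in_idx cmono_prod l)
  qed
  finally show ?thesis .
qed

lemma cmp_wedge:
  "length I = length \<alpha>s ==> cmp (wedge \<alpha>s) I
    = (\<Sum>\<sigma> | \<sigma> permutes {..<length \<alpha>s}. of_int (sign \<sigma>) * (\<Prod>i<length \<alpha>s. (\<alpha>s ! i) (ax (I ! \<sigma> i))))"
  unfolding cmp_def wedge_def
  by (auto intro!: sum.cong prod.cong simp: permutes_in_image[of _ "{..<length \<alpha>s}", unfolded lessThan_iff])

lemma tensor_of_cmp_wedge:
  fixes \<alpha>s :: "(vec7 => complex) list"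
  assumes lin: "\<And>\<alpha>. \<alpha> \<in> set \<alpha>s ==> linear \<alpha>"
  shows "tensor_of (length \<alpha>s) (cmp (wedge \<alpha>s)) = wedge \<alpha>s"
proof (rule ext)
  fix vs
  show "tensor_of (length \<alpha>s) (cmp (wedge \<alpha>s)) vs = wedge \<alpha>s vs"
  proof (cases "length vs = length \<alpha>s")
    case True
    have "wedge \<alpha>s vs = (\<Sum>\<sigma> | \<sigma> permutes {..<length \<alpha>s}. \<Sum>I\<in>idx (length \<alpha>s).
         of_int (sign \<sigma>) * (\<Prod>i<length \<alpha>s. (\<alpha>s ! i) (ax (I ! \<sigma> i))) * cmono (map cv vs) I)"
      using True by (simp add: wedge_def wedge_linear_prod[OF lin True] sum_distrib_left mult.assoc)
    also have "\<dots> = (\<Sum>I\<in>idx (length \<alpha>s). cmp (wedge \<alpha>s) I * cmono (map cv vs) I)"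
      by (subst sum.swap) (auto intro!: sum.cong simp: cmp_wedge in_idx sum_distrib_right)
    finally show ?thesis using True by (simp add: tensor_of_def ev_def)
  qed (simp add: tensor_of_def wedge_def)
qed

text \<open>If every factor is an eigenvector of M, each term of the permutation sum is multiplied
  by the product of the eigenvalues, whatever the permutation.\<close>

lemma act_cmp_wedge:
  fixes \<alpha>s :: "(vec7 => complex) list"
  assumes s: "\<And>i m. i < length \<alpha>s ==> (\<Sum>j\<in>UNIV. M m j * (\<alpha>s ! i) (ax j)) = s i * (\<alpha>s ! i) (ax m)"
    and I: "length I = length \<alpha>s"
  shows "act M (cmp (wedge \<alpha>s)) I = (\<Prod>i<length \<alpha>s. s i) * cmp (wedge \<alpha>s) I"
proof -
  let ?n = "length \<alpha>s"
  have *: "(\<Sum>J\<in>idx ?n. (\<Prod>j<?n. M (I ! j) (J ! j)) * (\<Prod>i<?n. (\<alpha>s ! i) (ax (J ! \<sigma> i))))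
     = (\<Prod>i<?n. s i) * (\<Prod>i<?n. (\<alpha>s ! i) (ax (I ! \<sigma> i)))" if \<sigma>: "\<sigma> permutes {..<?n}" for \<sigma>
  proof -
    let ?\<tau> = "Hilbert_Choice.inv \<sigma>"
    have re: "(\<Prod>j<?n. g (?\<tau> j) j) = (\<Prod>i<?n. g i (\<sigma> i))" for g :: "nat => nat => complex"
      using prod.reindex_bij_betw[OF permutes_imp_bij[OF \<sigma>], of "\<lambda>j. g (?\<tau> j) j"] permutes_inverses[OF \<sigma>] by simp
    have "(\<Sum>J\<in>idx ?n. (\<Prod>j<?n. M (I ! j) (J ! j)) * (\<Prod>i<?n. (\<alpha>s ! i) (ax (J ! \<sigma> i))))
       = (\<Sum>J\<in>idx ?n. \<Prod>j<?n. M (I ! j) (J ! j) * (\<alpha>s ! ?\<tau> j) (ax (J ! j)))"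
      using re[of "\<lambda>i j. (\<alpha>s ! i) (ax (J ! j))" for J] by (simp add: prod.distrib)
    also have "\<dots> = (\<Prod>j<?n. \<Sum>m\<in>UNIV. M (I ! j) m * (\<alpha>s ! ?\<tau> j) (ax m))"
      by (rule prod_sum_tup[symmetric]) simp
    also have "\<dots> = (\<Prod>j<?n. s (?\<tau> j) * (\<alpha>s ! ?\<tau> j) (ax (I ! j)))"
      using permutes_in_image[OF permutes_inv[OF \<sigma>]] by (intro prod.cong refl s) auto
    also have "\<dots> = (\<Prod>i<?n. s i * (\<alpha>s ! i) (ax (I ! \<sigma> i)))"
      by (rule re[of "\<lambda>i j. s i * (\<alpha>s ! i) (ax (I ! j))"])
    finally show ?thesis by (simp add: prod.distrib)
  qed
  have "act M (cmp (wedge \<alpha>s)) I = (\<Sum>J\<in>idx ?n. \<Sum>\<sigma> | \<sigma> permutes {..<?n}. of_int (sign \<sigma>) *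
      ((\<Prod>j<?n. M (I ! j) (J ! j)) * (\<Prod>i<?n. (\<alpha>s ! i) (ax (J ! \<sigma> i)))))"
    unfolding act_prod I by (auto intro!: sum.cong simp: cmp_wedge in_idx sum_distrib_left mult_ac)
  also have "\<dots> = (\<Sum>\<sigma> | \<sigma> permutes {..<?n}. of_int (sign \<sigma>) *
      (\<Sum>J\<in>idx ?n. (\<Prod>j<?n. M (I ! j) (J ! j)) * (\<Prod>i<?n. (\<alpha>s ! i) (ax (J ! \<sigma> i)))))"
    by (subst sum.swap) (simp only: sum_distrib_left)
  also have "\<dots> = (\<Prod>i<?n. s i) * cmp (wedge \<alpha>s) I"
    by (simp add: * cmp_wedge I sum_distrib_left mult_ac)
  finally show ?thesis .
qed

subsection \<open>Characterization of the bundles\<close>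

interpretation cs: vector_space cscale by (rule vector_space_cscale)

lemma sum_fun_apply: "(\<Sum>i\<in>X. f i) x = (\<Sum>i\<in>X. f i x)" for f :: "'b => 'a => 'c::comm_monoid_add"
  by (induction X rule: infinite_finite_induct) simp_all

text \<open>A description of the forms of type (p, k - p) at u that can be checked on components;
  \<open>Lambda_iff\<close> identifies it with the span of wedge products.\<close>

definition form_at :: "vec7 => nat => nat => tensor => bool"
  where "form_at u k p \<eta> \<longleftrightarrow> \<eta> = tensor_of k (cmp \<eta>) \<and> altern (cmp \<eta>) \<and> ftyped (cv u) k p (cmp \<eta>)"

lemma tensor_of_add: "tensor_of k (\<lambda>I. c I + d I) = tensor_of k c + tensor_of k d"
  by (auto simp: fun_eq_iff tensor_of_def ev_def sum.distrib distrib_right)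
lemma tensor_of_scale: "tensor_of k (\<lambda>I. a * c I) = cscale a (tensor_of k c)"
  by (auto simp: fun_eq_iff tensor_of_def ev_def cscale_def sum_distrib_left mult.assoc)
lemma tensor_of_zero: "tensor_of k (\<lambda>I. 0) = 0"
  by (auto simp: fun_eq_iff tensor_of_def ev_def)

lemma form_at_subspace: "cs.subspace {\<eta>. form_at u k p \<eta>}"
proof (rule cs.subspaceI)
  have z: "cmp (0::tensor) = (\<lambda>I. 0)" by (auto simp: fun_eq_iff cmp_def)
  show "0 \<in> {\<eta>. form_at u k p \<eta>}"
    by (simp add: form_at_def z tensor_of_zero altern_zero typed_def act_zero)
  fix \<eta> \<theta> :: tensor and a
  assume e: "\<eta> \<in> {\<eta>. form_at u k p \<eta>}"
  have s: "cmp (cscale a \<eta>) = (\<lambda>I. a * cmp \<eta> I)" by (auto simp: fun_eq_iff cmp_def cscale_def)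
  show "cscale a \<eta> \<in> {\<eta>. form_at u k p \<eta>}"
    using e by (simp add: form_at_def s tensor_of_scale altern_scale typed_def act_scale)
  assume t: "\<theta> \<in> {\<eta>. form_at u k p \<eta>}"
  have a: "cmp (\<eta> + \<theta>) = (\<lambda>I. cmp \<eta> I + cmp \<theta> I)" by (auto simp: fun_eq_iff cmp_def)
  show "\<eta> + \<theta> \<in> {\<eta>. form_at u k p \<eta>}"
    using e t by (simp add: form_at_def a tensor_of_add altern_add typed_def act_add distrib_left)
qed

lemma prod_if_lt: "(\<Prod>i<p + q. if i < p then z else (1::complex)) = z ^ p" for p q :: nat
  by (induction q) auto

lemma form_at_wedge:
  assumes u: "u \<in> S6" and \<alpha>: "set \<alpha>s \<subseteq> cotangent10 std_J u" "length \<alpha>s = p"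
    and \<beta>: "set \<beta>s \<subseteq> cotangent01 std_J u" "length \<beta>s = q"
  shows "form_at u (p + q) p (wedge (\<alpha>s @ \<beta>s))"
  unfolding form_at_def
proof (intro conjI)
  have "linear \<gamma>" if "\<gamma> \<in> set (\<alpha>s @ \<beta>s)" for \<gamma>
    using that \<alpha> \<beta> by (auto simp: cotangent10_def cotangent01_def)
  then show "wedge (\<alpha>s @ \<beta>s) = tensor_of (p + q) (cmp (wedge (\<alpha>s @ \<beta>s)))"
    using tensor_of_cmp_wedge[of "\<alpha>s @ \<beta>s"] \<alpha> \<beta> by simp
  show "altern (cmp (wedge (\<alpha>s @ \<beta>s)))" by (rule altern_cmp[OF altern_wedge_args])
  show "ftyped (cv u) (p + q) p (cmp (wedge (\<alpha>s @ \<beta>s)))"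
    unfolding typed_def
  proof (intro allI impI)
    fix I :: "7 list" and z assume I: "length I = p + q"
    have E: "Pm (cv u) (\<chi> j. \<gamma> (ax j)) $ m = \<gamma> (ax m)" "Pp (cv u) (\<chi> j. \<gamma> (ax j)) $ m = 0"
      if "\<gamma> \<in> cotangent10 std_J u" for \<gamma> m
      using Pm_Em[OF cotangent10_Em[OF u that]] Pp_Em[OF cotangent10_Em[OF u that]] by simp_all
    have F: "Pm (cv u) (\<chi> j. \<gamma> (ax j)) $ m = 0" "Pp (cv u) (\<chi> j. \<gamma> (ax j)) $ m = \<gamma> (ax m)"
      if "\<gamma> \<in> cotangent01 std_J u" for \<gamma> m
      using Pm_Ep[OF cotangent01_Ep[OF u that]] Pp_Ep[OF cotangent01_Ep[OF u that]] by simp_all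
    have Q: "(\<Sum>j\<in>UNIV. pencil z (pm (cv u)) (pp (cv u)) m j * \<gamma> (ax j))
        = z * Pm (cv u) (\<chi> j. \<gamma> (ax j)) $ m + Pp (cv u) (\<chi> j. \<gamma> (ax j)) $ m" for m and \<gamma> :: "vec7 => complex"
      by (simp add: pm_mult[symmetric] pp_mult[symmetric] sum_distrib_left sum.distrib[symmetric] algebra_simps)
    have "act (pencil z (pm (cv u)) (pp (cv u))) (cmp (wedge (\<alpha>s @ \<beta>s))) I
        = (\<Prod>i<length (\<alpha>s @ \<beta>s). if i < p then z else 1) * cmp (wedge (\<alpha>s @ \<beta>s)) I"
    proof (rule act_cmp_wedge)
      fix i m assume i: "i < length (\<alpha>s @ \<beta>s)"
      show "(\<Sum>j\<in>UNIV. pencil z (pm (cv u)) (pp (cv u)) m j * ((\<alpha>s @ \<beta>s) ! i) (ax j))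
         = (if i < p then z else 1) * ((\<alpha>s @ \<beta>s) ! i) (ax m)"
      proof (cases "i < p")
        case True
        then have "(\<alpha>s @ \<beta>s) ! i \<in> cotangent10 std_J u" using \<alpha> by (auto simp: nth_append)
        then show ?thesis unfolding Q using True E by simp
      next
        case False
        then have "(\<alpha>s @ \<beta>s) ! i \<in> cotangent01 std_J u" using \<alpha> \<beta> i by (auto simp: nth_append)
        then show ?thesis unfolding Q using False F by simp
      qed
    qed (use I \<alpha> \<beta> in simp)
    then show "act (pencil z (pm (cv u)) (pp (cv u))) (cmp (wedge (\<alpha>s @ \<beta>s))) I = z ^ p * cmp (wedge (\<alpha>s @ \<beta>s)) I"
      using \<alpha> \<beta> by (simp add: prod_if_lt)
  qed
qed

abbreviation coords :: "7 list => (vec7 => complex) list"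
  where "coords I \<equiv> map (\<lambda>i v. complex_of_real (v $ i)) I"

text \<open>An alternating tensor equals its antisymmetrization: after reindexing, each of the k!
  permutations gives the same sum.\<close>

lemma tensor_of_eq_sum_wedge:
  assumes "altern c"
  shows "tensor_of k c vs = (\<Sum>I\<in>idx k. c I * wedge (coords I) vs) / fact k"
proof (cases "length vs = k")
  case True
  let ?m = "cmono (map cv vs)"
  have *: "(\<Sum>I\<in>idx k. c I * (of_int (sign \<sigma>) * (\<Prod>i<k. complex_of_real (vs ! \<sigma> i $ (I ! i))))) = ev c (map cv vs)"
    if \<sigma>: "\<sigma> permutes {..<k}" for \<sigma>
  proof -
    let ?\<tau> = "Hilbert_Choice.inv \<sigma>"
    have "bij_betw (permute_list \<sigma>) (idx k) (idx k)"
    proof (rule bij_betw_byWitness[where f' = "permute_list ?\<tau>"])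
      show "\<forall>I\<in>idx k. permute_list ?\<tau> (permute_list \<sigma> I) = I"
      proof
        fix I :: "7 list" assume "I \<in> idx k"
        then have "permute_list (\<sigma> \<circ> ?\<tau>) I = permute_list ?\<tau> (permute_list \<sigma> I)"
          using permutes_inv[OF \<sigma>] by (intro permute_list_compose) (simp add: in_idx)
        then show "permute_list ?\<tau> (permute_list \<sigma> I) = I"
          by (simp add: permutes_inv_o(1)[OF \<sigma>] permute_list_id)
      qed
      show "\<forall>I\<in>idx k. permute_list \<sigma> (permute_list ?\<tau> I) = I"
      proof
        fix I :: "7 list" assume "I \<in> idx k"
        then have "permute_list (?\<tau> \<circ> \<sigma>) I = permute_list \<sigma> (permute_list ?\<tau> I)"
          using \<sigma> by (intro permute_list_compose) (simp add: in_idx)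
        then show "permute_list \<sigma> (permute_list ?\<tau> I) = I"
          by (simp add: permutes_inv_o(2)[OF \<sigma>] permute_list_id)
      qed
    qed (auto simp: in_idx)
    then have "(\<Sum>I\<in>idx k. c I * (of_int (sign \<sigma>) * (\<Prod>i<k. complex_of_real (vs ! \<sigma> i $ (I ! i)))))
       = (\<Sum>I\<in>idx k. c (permute_list \<sigma> I) * (of_int (sign \<sigma>) * (\<Prod>i<k. complex_of_real (vs ! \<sigma> i $ (permute_list \<sigma> I ! i)))))"
      by (rule sum.reindex_bij_betw[symmetric])
    also have "\<dots> = (\<Sum>I\<in>idx k. c I * ?m I)"
    proof (rule sum.cong[OF refl])
      fix I :: "7 list" assume "I \<in> idx k"
      then have I: "length I = k" by (simp add: in_idx)
      have "(\<Prod>i<k. complex_of_real (vs ! \<sigma> i $ (permute_list \<sigma> I ! i))) = (\<Prod>i<k. complex_of_real (vs ! \<sigma> i $ (I ! \<sigma> i)))"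
        using \<sigma> I by (intro prod.cong refl) (simp add: permute_list_nth)
      also have "\<dots> = (\<Prod>i<k. complex_of_real (vs ! i $ (I ! i)))"
        by (rule prod.reindex_bij_betw[OF permutes_imp_bij[OF \<sigma>], of "\<lambda>i. complex_of_real (vs ! i $ (I ! i))"])
      also have "\<dots> = ?m I" using True I by (simp add: cmono_prod)
      finally show "c (permute_list \<sigma> I) * (of_int (sign \<sigma>) * (\<Prod>i<k. complex_of_real (vs ! \<sigma> i $ (permute_list \<sigma> I ! i)))) = c I * ?m I"
        using altern_permute[OF assms, of \<sigma> I] \<sigma> I sign_mult_self[of \<sigma>] by (simp add: mult.assoc[symmetric] mult.commute[of _ "c I"])
    qed
    finally show ?thesis using True by (simp add: ev_def)
  qed
  have "(\<Sum>I\<in>idx k. c I * wedge (coords I) vs)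
     = (\<Sum>I\<in>idx k. \<Sum>\<sigma> | \<sigma> permutes {..<k}. c I * (of_int (sign \<sigma>) * (\<Prod>i<k. complex_of_real (vs ! \<sigma> i $ (I ! i)))))"
    using True by (auto intro!: sum.cong simp: wedge_def in_idx sum_distrib_left)
  also have "\<dots> = (\<Sum>\<sigma> | \<sigma> permutes {..<k}. ev c (map cv vs))"
    by (subst sum.swap) (simp add: *)
  also have "\<dots> = fact k * ev c (map cv vs)" by (simp add: card_permutations)
  finally show ?thesis using True by (simp add: tensor_of_def)
qed (auto simp: tensor_of_def wedge_def in_idx)

text \<open>Induction over the slots. The recursion of \<open>ftp\<close> projects the first index
  in two ways, and moving the projection to the coordinate covector turns it into a covector of type
  (1,0) or (0,1). The prefix \<gamma>s holds the covectors already treated.\<close>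

lemma typed_sum_in_Lambda:
  assumes u: "u \<in> S6"
  shows "p \<le> k ==> (\<lambda>vs. \<Sum>I\<in>idx k. ftp (cv u) p c I * wedge (\<gamma>s @ coords I) vs) \<in>
    cspan {wedge (\<gamma>s @ \<alpha>s @ \<beta>s) | \<alpha>s \<beta>s. length \<alpha>s = p \<and> set \<alpha>s \<subseteq> cotangent10 std_J u \<and>
      length \<beta>s = k - p \<and> set \<beta>s \<subseteq> cotangent01 std_J u}"
    (is "_ ==> _ \<in> cspan (?S \<gamma>s p (k - p))")
proof (induction k arbitrary: p c \<gamma>s)
  case 0
  have e: "(\<lambda>vs. \<Sum>I\<in>idx 0. ftp (cv u) p c I * wedge (\<gamma>s @ coords I) vs) = cscale (c []) (wedge (\<gamma>s @ [] @ []))"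
    using 0 by (simp add: cscale_def)
  have m: "wedge (\<gamma>s @ [] @ []) \<in> ?S \<gamma>s p (0 - p)" using 0 by force
  show ?case unfolding e by (rule cs.span_scale[OF cs.span_base[OF m]])
next
  case (Suc k)
  note uu = cv_cdot_self[OF u]
  define \<delta> where "\<delta> = (\<lambda>j v. \<Sum>i\<in>UNIV. pm (cv u) i j * complex_of_real (v $ i))"
  define \<delta>' where "\<delta>' = (\<lambda>j v. \<Sum>i\<in>UNIV. pp (cv u) i j * complex_of_real (v $ i))"
  have d: "\<delta> j \<in> cotangent10 std_J u" for j
    using Em_cotangent10[OF Pm_in_Em[OF uu, of "axis j 1"]] by (simp add: \<delta>_def cdot_def pm_def[symmetric])
  have d': "\<delta>' j \<in> cotangent01 std_J u" for j
    using Ep_cotangent01[OF Pp_in_Ep[OF uu, of "axis j 1"]] by (simp add: \<delta>'_def cdot_def pp_def[symmetric])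
  let ?T = "\<lambda>p j \<gamma>. (\<lambda>vs. \<Sum>I\<in>idx k. ftp (cv u) p (\<lambda>J. c (j # J)) I * wedge (\<gamma>s @ \<gamma> # coords I) vs)"
  have sp: "(\<Sum>i\<in>UNIV. \<Sum>I\<in>idx k. (\<Sum>j\<in>UNIV. m i j * t j I) * wedge (\<gamma>s @ (\<lambda>v. complex_of_real (v $ i)) # coords I) vs)
     = (\<Sum>j\<in>UNIV. \<Sum>I\<in>idx k. t j I * wedge (\<gamma>s @ (\<lambda>v. \<Sum>i\<in>UNIV. m i j * complex_of_real (v $ i)) # coords I) vs)"
    for m t vs
  proof -
    have "(\<Sum>i\<in>UNIV. \<Sum>I\<in>idx k. (\<Sum>j\<in>UNIV. m i j * t j I) * wedge (\<gamma>s @ (\<lambda>v. complex_of_real (v $ i)) # coords I) vs)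
      = (\<Sum>i\<in>UNIV. \<Sum>j\<in>UNIV. \<Sum>I\<in>idx k. t j I * (m i j * wedge (\<gamma>s @ (\<lambda>v. complex_of_real (v $ i)) # coords I) vs))"
      by (simp add: sum_distrib_right sum.swap[of _ "idx k"] mult_ac)
    also have "\<dots> = (\<Sum>j\<in>UNIV. \<Sum>i\<in>UNIV. \<Sum>I\<in>idx k. t j I * (m i j * wedge (\<gamma>s @ (\<lambda>v. complex_of_real (v $ i)) # coords I) vs))"
      by (rule sum.swap)
    also have "\<dots> = (\<Sum>j\<in>UNIV. \<Sum>I\<in>idx k. t j I * wedge (\<gamma>s @ (\<lambda>v. \<Sum>i\<in>UNIV. m i j * complex_of_real (v $ i)) # coords I) vs)"
      by (simp add: wedge_slot_sum sum_distrib_left sum.swap[of _ "idx k"])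
    finally show ?thesis .
  qed
  have eq: "(\<lambda>vs. \<Sum>I\<in>idx (Suc k). ftp (cv u) p c I * wedge (\<gamma>s @ coords I) vs)
     = (if p = 0 then 0 else (\<Sum>j\<in>UNIV. ?T (p - 1) j (\<delta> j))) + (\<Sum>j\<in>UNIV. ?T p j (\<delta>' j))"
  proof (rule ext)
    fix vs
    show "(\<Sum>I\<in>idx (Suc k). ftp (cv u) p c I * wedge (\<gamma>s @ coords I) vs)
     = ((if p = 0 then 0 else (\<Sum>j\<in>UNIV. ?T (p - 1) j (\<delta> j))) + (\<Sum>j\<in>UNIV. ?T p j (\<delta>' j))) vs"
      unfolding sum_idx_Suc \<delta>_def \<delta>'_def
      by (cases "p = 0") (simp_all add: sum_fun_apply distrib_right sum.distrib sp)
  qed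
  have 1: "?T (p - 1) j (\<delta> j) \<in> cspan (?S \<gamma>s p (Suc k - p))" if "p \<noteq> 0" for j
  proof -
    have "?T (p - 1) j (\<delta> j) \<in> cspan (?S (\<gamma>s @ [\<delta> j]) (p - 1) (k - (p - 1)))"
      using Suc.IH[of "p - 1" "\<lambda>J. c (j # J)" "\<gamma>s @ [\<delta> j]"] Suc.prems that by simp
    moreover have "?S (\<gamma>s @ [\<delta> j]) (p - 1) (k - (p - 1)) \<subseteq> ?S \<gamma>s p (Suc k - p)"
    proof
      fix x assume "x \<in> ?S (\<gamma>s @ [\<delta> j]) (p - 1) (k - (p - 1))"
      then obtain \<alpha>s \<beta>s where x: "x = wedge ((\<gamma>s @ [\<delta> j]) @ \<alpha>s @ \<beta>s)" "length \<alpha>s = p - 1" "set \<alpha>s \<subseteq> cotangent10 std_J u"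
        "length \<beta>s = k - (p - 1)" "set \<beta>s \<subseteq> cotangent01 std_J u" by blast
      then have "x = wedge (\<gamma>s @ (\<delta> j # \<alpha>s) @ \<beta>s)" by simp
      then show "x \<in> ?S \<gamma>s p (Suc k - p)" using x that Suc.prems d[of j]
        by (intro CollectI exI[of _ "\<delta> j # \<alpha>s"] exI[of _ \<beta>s]) auto
    qed
    ultimately show ?thesis using cs.span_mono by blast
  qed
  have 2: "?T p j (\<delta>' j) \<in> cspan (?S \<gamma>s p (Suc k - p))" for j
  proof (cases "p \<le> k")
    case True
    have "?T p j (\<delta>' j) \<in> cspan (?S (\<gamma>s @ [\<delta>' j]) p (k - p))"
      using Suc.IH[OF True, of "\<lambda>J. c (j # J)" "\<gamma>s @ [\<delta>' j]"] by simp
    moreover have "?S (\<gamma>s @ [\<delta>' j]) p (k - p) \<subseteq> cspan (?S \<gamma>s p (Suc k - p))"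
    proof
      fix x assume "x \<in> ?S (\<gamma>s @ [\<delta>' j]) p (k - p)"
      then obtain \<alpha>s \<beta>s where x: "x = wedge ((\<gamma>s @ [\<delta>' j]) @ \<alpha>s @ \<beta>s)" "length \<alpha>s = p" "set \<alpha>s \<subseteq> cotangent10 std_J u"
        "length \<beta>s = k - p" "set \<beta>s \<subseteq> cotangent01 std_J u" by blast
      \<comment> \<open>The new (0,1)-covector has to pass the p covectors of type (1,0) to reach
        its place.\<close>
      have e: "x = cscale ((-1) ^ p) (wedge (\<gamma>s @ \<alpha>s @ (\<delta>' j # \<beta>s)))"
      proof (rule ext)
        fix vs
        have "(-1) ^ p * wedge (\<gamma>s @ \<alpha>s @ \<delta>' j # \<beta>s) vs = (-1) ^ p * (-1) ^ p * wedge (\<gamma>s @ \<delta>' j # \<alpha>s @ \<beta>s) vs"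
          using altern_move[OF altern_wedge_forms, of \<gamma>s \<alpha>s "\<delta>' j" \<beta>s vs] x(2) by simp
        then show "x vs = cscale ((-1) ^ p) (wedge (\<gamma>s @ \<alpha>s @ (\<delta>' j # \<beta>s))) vs"
          by (simp add: cscale_def x(1) power_mult_distrib[symmetric])
      qed
      have m: "wedge (\<gamma>s @ \<alpha>s @ (\<delta>' j # \<beta>s)) \<in> ?S \<gamma>s p (Suc k - p)"
        using x True d'[of j] by (intro CollectI exI[of _ \<alpha>s] exI[of _ "\<delta>' j # \<beta>s"]) auto
      show "x \<in> cspan (?S \<gamma>s p (Suc k - p))" unfolding e by (rule cs.span_scale[OF cs.span_base[OF m]])
    qed
    ultimately show ?thesis using cs.span_minimal[OF _ cs.subspace_span] by blast
  next
    case False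
    then have "?T p j (\<delta>' j) = 0" by (auto simp: fun_eq_iff in_idx tp_eq_0)
    then show ?thesis by (simp add: cs.span_zero)
  qed
  have A: "(if p = 0 then 0 else (\<Sum>j\<in>UNIV. ?T (p - 1) j (\<delta> j))) \<in> cspan (?S \<gamma>s p (Suc k - p))"
  proof (cases "p = 0")
    case False
    show ?thesis unfolding if_not_P[OF False] by (rule cs.span_sum) (rule 1[OF False])
  qed (simp add: cs.span_zero)
  show ?case unfolding eq by (rule cs.span_add[OF A]) (rule cs.span_sum, rule 2)
qed

text \<open>For the converse, write the form as an antisymmetrization by
  \<open>tensor_of_eq_sum_wedge\<close>; projecting its components to their own type changes
  nothing, so \<open>typed_sum_in_Lambda\<close> applies.\<close>

theorem Lambda_iff:
  assumes u: "u \<in> S6"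
  shows "\<eta> \<in> Lambda std_J p q u \<longleftrightarrow> form_at u (p + q) p \<eta>"
proof
  assume "\<eta> \<in> Lambda std_J p q u"
  moreover have "Lambda std_J p q u \<subseteq> {\<eta>. form_at u (p + q) p \<eta>}"
    unfolding Lambda_def by (rule cs.span_minimal[OF _ form_at_subspace]) (auto intro!: form_at_wedge[OF u])
  ultimately show "form_at u (p + q) p \<eta>" by auto
next
  assume f: "form_at u (p + q) p \<eta>"
  let ?k = "p + q"
  have "\<eta> vs = cscale (1 / fact ?k) (\<lambda>vs. \<Sum>I\<in>idx ?k. ftp (cv u) p (cmp \<eta>) I * wedge ([] @ coords I) vs) vs" for vs
  proof -
    have "\<eta> vs = tensor_of ?k (cmp \<eta>) vs" using f by (simp add: form_at_def)
    also have "\<dots> = (\<Sum>I\<in>idx ?k. cmp \<eta> I * wedge (coords I) vs) / fact ?k"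
      by (rule tensor_of_eq_sum_wedge) (use f in \<open>simp add: form_at_def\<close>)
    also have "(\<Sum>I\<in>idx ?k. cmp \<eta> I * wedge (coords I) vs) = (\<Sum>I\<in>idx ?k. ftp (cv u) p (cmp \<eta>) I * wedge (coords I) vs)"
      using f by (intro sum.cong refl) (simp add: typed_tp_same[of _ _ ?k] form_at_def in_idx)
    finally show ?thesis by (simp add: cscale_def)
  qed
  then have "\<eta> = cscale (1 / fact ?k) (\<lambda>vs. \<Sum>I\<in>idx ?k. ftp (cv u) p (cmp \<eta>) I * wedge ([] @ coords I) vs)" by (rule ext)
  also have "\<dots> \<in> Lambda std_J p q u"
    using cs.span_scale[OF typed_sum_in_Lambda[OF u, of p ?k "cmp \<eta>" "[]"], of "1 / fact ?k"]
    by (simp add: Lambda_def)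
  finally show "\<eta> \<in> Lambda std_J p q u" .
qed

section \<open>Smooth forms and their differentials in components\<close>

lemma ev_scale: "ev c (map (\<lambda>z. a *s f z) zs) = a ^ length zs * ev c (map f zs)"
  by (induction zs arbitrary: c) (simp_all add: ev_Cons sum_distrib_left mult_ac)

lemma ev_sum: "ev (\<lambda>I. \<Sum>x\<in>X. c x I) zs = (\<Sum>x\<in>X. ev (c x) zs)"
  by (simp add: ev_def sum_distrib_right sum.swap[of _ X])
lemma ev_cscale: "ev (\<lambda>I. k * c I) zs = k * ev c zs"
  by (simp add: ev_def sum_distrib_left mult.assoc)

text \<open>At z = 1 the pencil is the orthogonal projection to the tangent space.\<close>

abbreviation tanmat :: "cvec => 7 => 7 => complex" where "tanmat u \<equiv> pencil 1 (pm u) (pp u)"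

lemma tanmat_eq: "tanmat u i j = (if i = j then 1 else 0) - u $ i * u $ j"
  by (simp add: pm_add_pp)

text \<open>Expresses that the tensor vanishes as soon as one argument is normal; compare
  \<open>tang_kills\<close> and \<open>tang_if_kills\<close>.\<close>

definition tang :: "cvec => nat => (7 list => complex) => bool"
  where "tang u k c \<longleftrightarrow> (\<forall>I. length I = k \<longrightarrow> act (tanmat u) c I = c I)"

lemma ftyped_tang: "ftyped u k p c ==> tang u k c"
proof -
  assume h: "ftyped u k p c"
  have "act (tanmat u) c I = 1 ^ p * c I" if "length I = k" for I using h that unfolding typed_def by blast
  then show ?thesis by (simp only: tang_def power_one mult_1) simp
qed

lemma cv_tproj: "cv (tproj u v) = cv v - (cv u \<odot> cv v) *s cv u"
proof -
  have "complex_of_real (u \<bullet> v) = cv u \<odot> cv v" by (simp add: inner_vec_def cdot_def)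
  then show ?thesis by (simp add: tproj_def vec_eq_iff)
qed

lemma tang_ev:
  assumes "tang (cv u) (length vs) c"
  shows "ev c (map cv (map (tproj u) vs)) = ev c (map cv vs)"
proof -
  have "(\<chi> j. \<Sum>i\<in>UNIV. z $ i * tanmat (cv u) i j) = z - (cv u \<odot> z) *s cv u" for z
    unfolding tanmat_eq
    by (simp add: vec_eq_iff right_diff_distrib sum_subtractf if_one_mult cdot_def sum_distrib_right sum_distrib_left mult_ac)
  then have "ev (act (tanmat (cv u)) c) (map cv vs) = ev c (map cv (map (tproj u) vs))"
    unfolding ev_act by (simp add: comp_def cv_tproj)
  moreover have "ev (act (tanmat (cv u)) c) (map cv vs) = ev c (map cv vs)"
    by (rule ev_cong) (use assms in \<open>simp add: tang_def\<close>)
  ultimately show ?thesis by simp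
qed

text \<open>The differential of \<open>retr\<close> is the tangential projection divided by the
  norm. The k slots produce the power of the norm, and the projections are absorbed by
  \<open>tang\<close>.\<close>

lemma pull_eq:
  assumes "x \<noteq> 0" and "\<omega> (retr x) = tensor_of k c" and "tang (cv (retr x)) k c"
  shows "pull \<omega> x vs = of_real (inverse (norm x) ^ k) * tensor_of k c vs"
proof (cases "length vs = k")
  case True
  have "cv (frechet_derivative retr (at x) v) = of_real (inverse (norm x)) *s cv (tproj (retr x) v)" for v
    unfolding frechet_derivative_retr[OF assms(1)] tproj_def by (rule cv_scaleR)
  then have "pull \<omega> x vs = ev c (map (\<lambda>v. of_real (inverse (norm x)) *s cv (tproj (retr x) v)) vs)"
    using True by (simp add: pull_def assms(2) tensor_of_def comp_def)
  also have "\<dots> = of_real (inverse (norm x)) ^ k * ev c (map cv (map (tproj (retr x)) vs))"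
    using True by (simp only: ev_scale) (simp add: comp_def)
  finally show ?thesis using tang_ev[of "retr x" vs c] assms(3) True by (simp add: tensor_of_def)
qed (simp add: pull_def assms(2) tensor_of_def)

lemma smooth_on_scaled:
  assumes "sm h" shows "smooth_on (\<lambda>x::vec7. of_real (inverse (norm x) ^ k) * h (retr x)) (- {0})"
proof -
  have p: "smooth_on (\<lambda>x::vec7. inverse (norm x) ^ k) (- {0})"
  proof (induction k)
    case 0 then show ?case by (simp add: smooth_on_def Ck_on_const)
  next
    case (Suc k)
    show ?case
      using smooth_on_bilinear[OF bounded_bilinear_mult open_minus0 smooth_on_inverse_norm Suc] by simp
  qed
  show ?thesis
    by (rule smooth_on_bilinear[OF bounded_bilinear_mult open_minus0
          smooth_on_bounded_linear[OF bounded_linear_of_real open_minus0 p] assms[unfolded sm_def]])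
qed

lemma frechet_derivative_scaled:
  assumes h: "sm h" and u: "u \<in> S6"
  shows "frechet_derivative (\<lambda>x. of_real (inverse (norm x) ^ k) * h (retr x)) (at u) v
    = (\<Sum>j\<in>UNIV. of_real (v $ j) * (sder j h u - of_nat k * of_real (u $ j) * h u))"
proof -
  have u0: "u \<noteq> 0" and n: "norm u = 1" and r: "retr u = u"
    using u by (auto simp: S6_nonzero mem_sphere retr_S6)
  have "((\<lambda>x. inverse (norm x)) has_derivative (\<lambda>h. - (inverse (norm u) * (h \<bullet> sgn u) * inverse (norm u)))) (at u)"
    by (rule Deriv.has_derivative_inverse[OF _ norm_has_derivative]) (use u0 in auto)
  from has_derivative_power[OF this, of k]
  have "((\<lambda>x. inverse (norm x) ^ k) has_derivative (\<lambda>h. - (of_nat k * (h \<bullet> u)))) (at u)"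
    by (rule has_derivative_eq_rhs) (auto simp: n sgn_div_norm fun_eq_iff)
  from bounded_linear.has_derivative[OF bounded_linear_of_real this]
  have "((\<lambda>x. complex_of_real (inverse (norm x) ^ k)) has_derivative (\<lambda>h. of_real (- (of_nat k * (h \<bullet> u))))) (at u)" .
  from has_derivative_mult[OF this sm_has_derivative[OF h u0]]
  have "((\<lambda>x. of_real (inverse (norm x) ^ k) * h (retr x)) has_derivative
     (\<lambda>v. (\<Sum>j\<in>UNIV. of_real (v $ j) * sder j h u) - of_nat k * of_real (v \<bullet> u) * h u)) (at u)"
    by (rule has_derivative_eq_rhs) (simp add: fun_eq_iff n r sm_frechet_sder[OF h u0])
  from frechet_derivative_eq[OF this] show ?thesis
    by (simp add: inner_vec_def right_diff_distrib sum_subtractf sum_distrib_left sum_distrib_right mult_ac)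
qed

lemma sm_cmono: "(\<And>z. z \<in> set zs ==> smv z) ==> sm (\<lambda>u. cmono (map (\<lambda>z. z u) zs) I)"
proof (induction zs arbitrary: I)
  case (Cons z zs)
  then show ?case by (cases I) (auto intro!: sm_const sm_mult smvD)
qed (simp add: sm_const)

lemma sm_ev:
  assumes "\<And>I. length I = length zs ==> sm (\<lambda>u. c u I)" "\<And>z. z \<in> set zs ==> smv z"
  shows "sm (\<lambda>u. ev (c u) (map (\<lambda>z. z u) zs))"
  unfolding ev_def length_map by (intro sm_sum sm_mult sm_cmono assms) (auto simp: in_idx)

lemma sm_tensor_of:
  assumes "\<And>I. length I = k ==> sm (\<lambda>u. c u I)"
  shows "sm (\<lambda>u. tensor_of k (c u) vs)"
proof (cases "length vs = k")
  case True
  have "sm (\<lambda>u. ev (c u) (map (\<lambda>z. z u) (map (\<lambda>v u. cv v) vs)))"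
    by (rule sm_ev) (use assms True in \<open>auto intro: smv_const\<close>)
  then show ?thesis using True by (simp add: tensor_of_def comp_def)
qed (simp add: tensor_of_def sm_const)

text \<open>Powers of the norm are smooth off the origin, so by \<open>pull_eq\<close> the pullback
  and the components extended with degree 0 are smooth simultaneously.\<close>

lemma smooth_tensor_iff:
  assumes "\<And>u. u \<in> S6 ==> \<omega> u = tensor_of k (c u)" "\<And>u. u \<in> S6 ==> tang (cv u) k (c u)"
  shows "smooth_tensor \<omega> \<longleftrightarrow> (\<forall>I. length I = k \<longrightarrow> sm (\<lambda>u. c u I))"
proof
  assume s: "smooth_tensor \<omega>"
  show "\<forall>I. length I = k \<longrightarrow> sm (\<lambda>u. c u I)"
  proof (intro allI impI)
    fix I :: "7 list" assume I: "length I = k"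
    have S: "smooth_on (\<lambda>x. of_real (norm x ^ k) * pull \<omega> x (map ax I)) (- {0})"
    proof (rule smooth_on_bilinear[OF bounded_bilinear_mult open_minus0])
      have "smooth_on (\<lambda>x::vec7. norm x ^ k) (- {0})"
        by (induction k) (auto simp: smooth_on_def Ck_on_const intro!: Ck_on_bilinear[OF bounded_bilinear_mult] smooth_on_norm[unfolded smooth_on_def, rule_format])
      then show "smooth_on (\<lambda>x::vec7. complex_of_real (norm x ^ k)) (- {0})"
        by (rule smooth_on_bounded_linear[OF bounded_linear_of_real open_minus0])
      show "smooth_on (\<lambda>x. pull \<omega> x (map ax I)) (- {0})" using s by (simp add: smooth_tensor_def)
    qed
    have e: "of_real (norm x ^ k) * pull \<omega> x (map ax I) = c (retr x) I" if "x \<in> - {0}" for x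
      using that pull_eq[of x \<omega> k "c (retr x)" "map ax I"] assms[OF retr_in_S6, of x] cmp_tensor_of[of k "c (retr x)" I] I
      by (simp add: cmp_def field_simps)
    show "sm (\<lambda>u. c u I)" unfolding sm_def by (rule iffD1[OF smooth_on_cong[OF open_minus0 e] S])
  qed
next
  assume s: "\<forall>I. length I = k \<longrightarrow> sm (\<lambda>u. c u I)"
  show "smooth_tensor \<omega>" unfolding smooth_tensor_def
  proof
    fix vs
    have S: "smooth_on (\<lambda>x. of_real (inverse (norm x) ^ k) * tensor_of k (c (retr x)) vs) (- {0})"
      by (rule smooth_on_scaled) (rule sm_tensor_of, use s in simp)
    have e: "pull \<omega> x vs = of_real (inverse (norm x) ^ k) * tensor_of k (c (retr x)) vs" if "x \<in> - {0}" for x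
      using that by (intro pull_eq assms retr_in_S6) auto
    show "smooth_on (\<lambda>x. pull \<omega> x vs) (- {0})" by (rule iffD2[OF smooth_on_cong[OF open_minus0 e] S])
  qed
qed

lemma form_at_tang: "form_at u k p \<eta> ==> tang (cv u) k (cmp \<eta>)"
  by (auto simp: form_at_def intro: ftyped_tang)

lemma form_atI:
  assumes "altern c" "ftyped (cv u) k p c"
  shows "form_at u k p (tensor_of k c)"
proof -
  have "altern (cmp (tensor_of k c))"
    unfolding altern_def cmp_tensor_of
  proof (intro allI)
    fix xs ys and a b
    show "(if length (xs @ a # b # ys) = k then c (xs @ a # b # ys) else 0)
      = - (if length (xs @ b # a # ys) = k then c (xs @ b # a # ys) else 0)"
      by (simp add: alternD[OF assms(1), of xs a b ys])
  qed
  moreover have "act M (cmp (tensor_of k c)) I = act M c I" if "length I = k" for M I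
    by (rule act_cong) (simp add: cmp_tensor_of that)
  ultimately show ?thesis using assms(2) by (simp add: form_at_def tensor_of_cmp_tensor_of typed_def cmp_tensor_of)
qed

theorem Omega_iff:
  "\<omega> \<in> Omega std_J p q \<longleftrightarrow> (\<forall>u\<in>S6. form_at u (p + q) p (\<omega> u)) \<and> (\<forall>u. u \<notin> S6 \<longrightarrow> \<omega> u = 0)
    \<and> (\<forall>I. sm (\<lambda>u. cmp (\<omega> u) I))"
proof -
  have "smooth_tensor \<omega> \<longleftrightarrow> (\<forall>I. sm (\<lambda>u. cmp (\<omega> u) I))" if f: "\<forall>u\<in>S6. form_at u (p + q) p (\<omega> u)"
  proof -
    have "sm (\<lambda>u. cmp (\<omega> u) I)" if "length I \<noteq> p + q" for I
      using sm_cong[of "\<lambda>u. cmp (\<omega> u) I" "\<lambda>u. 0"] f that unfolding form_at_def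
      by (metis cmp_tensor_of sm_const)
    moreover have "smooth_tensor \<omega> \<longleftrightarrow> (\<forall>I. length I = p + q \<longrightarrow> sm (\<lambda>u. cmp (\<omega> u) I))"
    proof (rule smooth_tensor_iff)
      show "\<omega> u = tensor_of (p + q) (cmp (\<omega> u))" if "u \<in> S6" for u using f that by (simp only: form_at_def)
      show "tang (cv u) (p + q) (cmp (\<omega> u))" if "u \<in> S6" for u using f that form_at_tang by blast
    qed
    ultimately show ?thesis by blast
  qed
  moreover have "\<omega> \<in> Omega std_J p q \<longleftrightarrow> (\<forall>u\<in>S6. form_at u (p + q) p (\<omega> u)) \<and> (\<forall>u. u \<notin> S6 \<longrightarrow> \<omega> u = 0) \<and> smooth_tensor \<omega>"
    unfolding Omega_def sections_def zero_fun_def by (simp add: Lambda_iff)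
  ultimately show ?thesis by blast
qed

definition mkfield :: "nat => (vec7 => 7 list => complex) => tensor_field"
  where "mkfield k c u = (if u \<in> S6 then tensor_of k (c u) else 0)"

lemma cmp_mkfield: "u \<in> S6 ==> length I = k ==> cmp (mkfield k c u) I = c u I"
  by (simp add: mkfield_def cmp_tensor_of)

lemma mkfield_Omega:
  assumes "\<And>u. u \<in> S6 ==> altern (c u)" "\<And>u. u \<in> S6 ==> ftyped (cv u) (p + q) p (c u)"
    "\<And>I. length I = p + q ==> sm (\<lambda>u. c u I)"
  shows "mkfield (p + q) c \<in> Omega std_J p q"
  unfolding Omega_iff
proof (intro conjI ballI allI impI)
  show "form_at u (p + q) p (mkfield (p + q) c u)" if "u \<in> S6" for u
    using that assms by (simp add: mkfield_def form_atI)
  show "mkfield (p + q) c u = 0" if "u \<notin> S6" for u using that by (simp add: mkfield_def)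
  fix I :: "7 list"
  show "sm (\<lambda>u. cmp (mkfield (p + q) c u) I)"
  proof (cases "length I = p + q")
    case True
    then show ?thesis using sm_cong[of "\<lambda>u. cmp (mkfield (p + q) c u) I" "\<lambda>u. c u I"] assms(3) cmp_mkfield by simp
  next
    case False
    then show ?thesis using sm_cong[of "\<lambda>u. cmp (mkfield (p + q) c u) I" "\<lambda>u. 0"]
      by (simp add: mkfield_def cmp_tensor_of sm_const)
  qed
qed

subsection \<open>The exterior derivative\<close>

lemma drop_nth_0 [simp]: "drop_nth 0 (x # xs) = xs"
  and drop_nth_Suc [simp]: "drop_nth (Suc i) (x # xs) = x # drop_nth i xs"
  by (simp_all add: drop_nth_def)

lemma length_drop_nth: "i < length xs ==> length (drop_nth i xs) = length xs - 1"
  by (simp add: drop_nth_def)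

lemma map_drop_nth: "map f (drop_nth i xs) = drop_nth i (map f xs)"
  by (simp add: drop_nth_def take_map drop_map)

text \<open>Signed sum over the entry that is moved to the front: the combinatorial part of the
  exterior derivative and of the wedge product with a covector.\<close>

definition antis :: "('a => 'a list => complex) => 'a list => complex"
  where "antis T L = (\<Sum>i<length L. (-1) ^ i * T (L ! i) (drop_nth i L))"

lemma antis_Nil [simp]: "antis T [] = 0" by (simp add: antis_def)

lemma antis_Cons: "antis T (x # L) = T x L - antis (\<lambda>j J. T j (x # J)) L"
  by (simp add: antis_def sum.lessThan_Suc_shift sum_negf del: sum.lessThan_Suc)

lemma antis_minus: "antis (\<lambda>j J. - T j J) L = - antis T L"
  by (simp add: antis_def sum_negf)

lemma antis_sum: "antis (\<lambda>j J. \<Sum>m\<in>X. a m * T m j J) L = (\<Sum>m\<in>X. a m * antis (T m) L)"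
proof -
  have "antis (\<lambda>j J. \<Sum>m\<in>X. a m * T m j J) L = (\<Sum>i<length L. \<Sum>m\<in>X. a m * ((-1) ^ i * T m (L ! i) (drop_nth i L)))"
    by (simp add: antis_def sum_distrib_left mult_ac)
  also have "\<dots> = (\<Sum>m\<in>X. \<Sum>i<length L. a m * ((-1) ^ i * T m (L ! i) (drop_nth i L)))" by (rule sum.swap)
  finally show ?thesis by (simp add: antis_def sum_distrib_left)
qed

lemma antis_cong: "(\<And>j J. T j J = S j J) ==> antis T L = antis S L" by (simp add: antis_def)

lemma altern_antis:
  assumes "\<And>j. altern (T j)" shows "altern (antis T)"
proof -
  have "antis T (xs @ a # b # ys) = - antis T (xs @ b # a # ys)" if "\<And>j. altern (T j)" for xs a b ys
    using that
  proof (induction xs arbitrary: T)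
    case Nil
    have "antis (\<lambda>j J. T j (a # b # J)) ys = antis (\<lambda>j J. - T j (b # a # J)) ys"
      by (rule antis_cong) (use alternD[OF Nil, of _ "[]" a b] in \<open>simp only: append_Nil\<close>)
    then show ?case by (simp add: antis_Cons antis_minus)
  next
    case (Cons x xs)
    have "antis (\<lambda>j J. T j (x # J)) (xs @ a # b # ys) = - antis (\<lambda>j J. T j (x # J)) (xs @ b # a # ys)"
      by (rule Cons.IH) (rule altern_Cons[OF Cons.prems])
    then show ?case using alternD[OF Cons.prems, of x xs a b ys] by (simp add: antis_Cons)
  qed
  then show ?thesis unfolding altern_def[of "antis T"] using assms by blast
qed

lemma sum_insert_nth: "i \<le> k ==> (\<Sum>L\<in>idx (Suc k). f (L ! i) (drop_nth i L)) = (\<Sum>j\<in>UNIV. \<Sum>I\<in>idx k. f j I)"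
proof (induction i arbitrary: k f)
  case 0 show ?case by (simp add: sum_idx_Suc)
next
  case (Suc i)
  then obtain l where k: "k = Suc l" "i \<le> l" by (cases k) auto
  have "(\<Sum>L\<in>idx (Suc k). f (L ! Suc i) (drop_nth (Suc i) L)) = (\<Sum>a\<in>UNIV. \<Sum>j\<in>UNIV. \<Sum>I\<in>idx l. f j (a # I))"
    unfolding sum_idx_Suc[of _ k] using Suc.IH[OF k(2), of "\<lambda>j I. f j (_ # I)"] by (simp add: k(1))
  also have "\<dots> = (\<Sum>j\<in>UNIV. \<Sum>a\<in>UNIV. \<Sum>I\<in>idx l. f j (a # I))" by (rule sum.swap)
  finally show ?case by (simp add: k(1) sum_idx_Suc[of _ l])
qed

lemma cmono_split:
  "i < length zs ==> length I = length zs ==> cmono zs I = zs ! i $ (I ! i) * cmono (drop_nth i zs) (drop_nth i I)"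
proof (induction i arbitrary: zs I)
  case 0 then show ?case by (cases zs; cases I) auto
next
  case (Suc i) then show ?case by (cases zs; cases I) auto
qed

text \<open>The pullback of a \<open>k\<close>-form along \<^const>\<open>retr\<close> has components homogeneous of degree \<open>-k\<close>,
  which gives the normal term in \<open>dterm\<close>.\<close>

definition dterm :: "nat => (vec7 => 7 list => complex) => vec7 => 7 => 7 list => complex"
  where "dterm k c u j J = sder j (\<lambda>u. c u J) u - of_nat k * of_real (u $ j) * c u J"

definition dcomp :: "nat => (vec7 => 7 list => complex) => vec7 => 7 list => complex"
  where "dcomp k c u = antis (dterm k c u)"

text \<open>By \<open>pull_eq\<close> the pullback has the components times a power of the norm,
  which explains \<open>dterm\<close>. Expanding all arguments in coordinates moves the signed sum
  from the arguments to the indices.\<close>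

lemma ext_deriv_comps:
  assumes c: "\<And>u. u \<in> S6 ==> \<omega> u = tensor_of k (c u)" and t: "\<And>u. u \<in> S6 ==> tang (cv u) k (c u)"
    and s: "\<And>I. length I = k ==> sm (\<lambda>u. c u I)" and u: "u \<in> S6"
  shows "ext_deriv \<omega> u = tensor_of (Suc k) (dcomp k c u)"
proof (rule ext)
  fix vs
  have fd: "frechet_derivative (\<lambda>y. pull \<omega> y ws) (at u) v
     = (\<Sum>j\<in>UNIV. of_real (v $ j) * (sder j (\<lambda>u. tensor_of k (c u) ws) u - of_nat k * of_real (u $ j) * tensor_of k (c u) ws))"
    for ws v
  proof -
    let ?g = "\<lambda>x. of_real (inverse (norm x) ^ k) * tensor_of k (c (retr x)) ws"
    have e: "pull \<omega> x ws = ?g x" if "x \<in> - {0}" for x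
      using that by (intro pull_eq c t retr_in_S6) auto
    have sg: "smooth_on ?g (- {0})" by (rule smooth_on_scaled) (rule sm_tensor_of[OF s])
    have "(?g has_derivative frechet_derivative ?g (at u)) (at u)"
      using smooth_on_imp_has_derivative[OF sg] S6_nonzero[OF u] by simp
    then have "((\<lambda>x. pull \<omega> x ws) has_derivative frechet_derivative ?g (at u)) (at u)"
      by (rule has_derivative_transform_within_open[OF _ open_minus0]) (use e S6_nonzero[OF u] in auto)
    from frechet_derivative_eq[OF this] show ?thesis
      using frechet_derivative_scaled[OF sm_tensor_of[OF s] u] by simp
  qed
  show "ext_deriv \<omega> u vs = tensor_of (Suc k) (dcomp k c u) vs"
  proof (cases "length vs = Suc k")
    case False
    have "tensor_of k d (drop_nth i vs) = 0" if "i < length vs" for i d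
      using that False by (simp add: tensor_of_def length_drop_nth)
    then show ?thesis using u False by (simp add: ext_deriv_def ext_deriv_flat_def fd sder_const tensor_of_def)
  next
    case True
    let ?E = "dterm k c u"
    have expand: "(\<Sum>j\<in>UNIV. of_real (v $ j) * (sder j (\<lambda>u. tensor_of k (c u) ws) u - of_nat k * of_real (u $ j) * tensor_of k (c u) ws))
       = (\<Sum>j\<in>UNIV. \<Sum>I\<in>idx k. ?E j I * (cv v $ j * cmono (map cv ws) I))" if "length ws = k" for v ws
    proof -
      have "sder j (\<lambda>u. tensor_of k (c u) ws) u = (\<Sum>I\<in>idx k. sder j (\<lambda>u. c u I) u * cmono (map cv ws) I)" for j
      proof -
        have "sder j (\<lambda>u. c u I * cmono (map cv ws) I) u = sder j (\<lambda>u. c u I) u * cmono (map cv ws) I" if "I \<in> idx k" for I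
          using sder_cmult[OF s u, of I j "cmono (map cv ws) I"] that by (simp add: in_idx mult.commute)
        moreover have "sder j (\<lambda>u. \<Sum>I\<in>idx k. c u I * cmono (map cv ws) I) u = (\<Sum>I\<in>idx k. sder j (\<lambda>u. c u I * cmono (map cv ws) I) u)"
          by (rule sder_sum[OF u]) (intro sm_mult sm_const s, simp add: in_idx)
        ultimately show ?thesis
          using that by (simp add: tensor_of_def ev_def)
      qed
      then show ?thesis
        using that by (simp add: dterm_def tensor_of_def ev_def sum_distrib_left sum_subtractf[symmetric] algebra_simps)
    qed
    have "ext_deriv \<omega> u vs = (\<Sum>i<Suc k. (-1) ^ i * (\<Sum>j\<in>UNIV. \<Sum>I\<in>idx k. ?E j I * (cv (vs ! i) $ j * cmono (map cv (drop_nth i vs)) I)))"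
      using u True by (simp add: ext_deriv_def ext_deriv_flat_def fd expand length_drop_nth del: cv_nth sum.lessThan_Suc)
    also have "\<dots> = (\<Sum>i<Suc k. (-1) ^ i * (\<Sum>L\<in>idx (Suc k). ?E (L ! i) (drop_nth i L) * cmono (map cv vs) L))"
    proof (rule sum.cong[OF refl])
      fix i assume "i \<in> {..<Suc k}"
      then have i: "i \<le> k" by simp
      have "(\<Sum>j\<in>UNIV. \<Sum>I\<in>idx k. ?E j I * (cv (vs ! i) $ j * cmono (map cv (drop_nth i vs)) I))
         = (\<Sum>L\<in>idx (Suc k). ?E (L ! i) (drop_nth i L) * (cv (vs ! i) $ (L ! i) * cmono (map cv (drop_nth i vs)) (drop_nth i L)))"
        by (rule sum_insert_nth[OF i, symmetric, of "\<lambda>j I. ?E j I * (cv (vs ! i) $ j * cmono (map cv (drop_nth i vs)) I)"])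
      also have "\<dots> = (\<Sum>L\<in>idx (Suc k). ?E (L ! i) (drop_nth i L) * cmono (map cv vs) L)"
        by (rule sum.cong[OF refl])
          (use True i in \<open>simp add: in_idx cmono_split[of i "map cv vs"] map_drop_nth del: cv_nth\<close>)
      finally show "(-1) ^ i * (\<Sum>j\<in>UNIV. \<Sum>I\<in>idx k. ?E j I * (cv (vs ! i) $ j * cmono (map cv (drop_nth i vs)) I))
         = (-1) ^ i * (\<Sum>L\<in>idx (Suc k). ?E (L ! i) (drop_nth i L) * cmono (map cv vs) L)" by simp
    qed
    also have "\<dots> = (\<Sum>L\<in>idx (Suc k). dcomp k c u L * cmono (map cv vs) L)"
      unfolding sum_distrib_left
      by (subst sum.swap) (auto intro!: sum.cong simp: dcomp_def antis_def in_idx sum_distrib_right mult.assoc simp del: sum.lessThan_Suc)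
    finally show ?thesis using True by (simp add: tensor_of_def ev_def)
  qed
qed

lemma altern_dcomp:
  assumes s: "\<And>I. sm (\<lambda>u. c u I)" and a: "\<And>u. u \<in> S6 ==> altern (c u)" and u: "u \<in> S6"
  shows "altern (dcomp k c u)"
  unfolding dcomp_def
proof (rule altern_antis)
  fix j
  show "altern (dterm k c u j)" unfolding altern_def
  proof (intro allI)
    fix xs ys and x y
    have "sder j (\<lambda>u. c u (xs @ x # y # ys)) u = sder j (\<lambda>u. - c u (xs @ y # x # ys)) u"
      by (rule sder_cong[OF alternD[OF a] S6_nonzero[OF u]])
    also have "\<dots> = - sder j (\<lambda>u. c u (xs @ y # x # ys)) u" by (rule sder_minus[OF s u])
    finally show "dterm k c u j (xs @ x # y # ys) = - dterm k c u j (xs @ y # x # ys)"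
      unfolding dterm_def alternD[OF a[OF u], of xs x y ys] by simp
  qed
qed

lemma tang_kills:
  assumes "tang u k c" "length xs + Suc (length ys) = k" "u \<odot> u = 1"
  shows "(\<Sum>m\<in>UNIV. u $ m * c (xs @ m # ys)) = 0"
proof -
  have z: "(\<Sum>m\<in>UNIV. u $ m * act (tanmat u) d (xs @ m # ys)) = 0" for d
  proof (induction xs arbitrary: d)
    case Nil
    have "(\<Sum>m\<in>UNIV. u $ m * (\<Sum>j\<in>UNIV. tanmat u m j * t j)) = (\<Sum>j\<in>UNIV. (\<Sum>m\<in>UNIV. u $ m * tanmat u m j) * t j)" for t
      by (simp only: sum_distrib_left sum_distrib_right mult.assoc) (rule sum.swap)
    moreover have "(\<Sum>m\<in>UNIV. u $ m * tanmat u m j) = 0" for j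
      unfolding tanmat_eq using assms(3)
      by (simp add: right_diff_distrib sum_subtractf if_one_mult cdot_def mult.assoc[symmetric] sum_distrib_right[symmetric])
    ultimately show ?case by simp
  next
    case (Cons x xs)
    have "(\<Sum>m\<in>UNIV. u $ m * act (tanmat u) d ((x # xs) @ m # ys))
       = (\<Sum>j\<in>UNIV. tanmat u x j * (\<Sum>m\<in>UNIV. u $ m * act (tanmat u) (\<lambda>J. d (j # J)) (xs @ m # ys)))"
    proof -
      let ?a = "\<lambda>j m. act (tanmat u) (\<lambda>J. d (j # J)) (xs @ m # ys)"
      have "(\<Sum>m\<in>UNIV. u $ m * act (tanmat u) d ((x # xs) @ m # ys)) = (\<Sum>m\<in>UNIV. \<Sum>j\<in>UNIV. tanmat u x j * (u $ m * ?a j m))"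
        by (simp only: append_Cons act.simps sum_distrib_left mult.left_commute)
      also have "\<dots> = (\<Sum>j\<in>UNIV. \<Sum>m\<in>UNIV. tanmat u x j * (u $ m * ?a j m))" by (rule sum.swap)
      finally show ?thesis by (simp only: sum_distrib_left)
    qed
    then show ?case by (simp only: Cons.IH) simp
  qed
  have "c (xs @ m # ys) = act (tanmat u) c (xs @ m # ys)" for m
    using assms(1,2) by (simp add: tang_def)
  then show ?thesis using z[of c] by simp
qed

text \<open>The projections are removed slot by slot. Each involves a contraction with u, which
  alternation moves to the first slot.\<close>

lemma tang_if_kills:
  assumes "altern c" "\<And>I. length I = k ==> (\<Sum>m\<in>UNIV. u $ m * c (m # I)) = 0"
  shows "tang u (Suc k) c"
proof -
  have "act (tanmat u) (\<lambda>J. c (P @ J)) L = c (P @ L)" if "length P + length L = Suc k" for P L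
    using that
  proof (induction L arbitrary: P)
    case (Cons i L)
    have "act (tanmat u) (\<lambda>J. c (P @ J)) (i # L) = (\<Sum>j\<in>UNIV. tanmat u i j * c (P @ j # L))"
      using Cons.IH[of "P @ [_]"] Cons.prems by simp
    also have "\<dots> = c (P @ i # L) - u $ i * (\<Sum>j\<in>UNIV. u $ j * c (P @ j # L))"
      unfolding tanmat_eq by (simp add: left_diff_distrib sum_subtractf if_one_mult sum_distrib_left mult.assoc)
    also have "(\<Sum>j\<in>UNIV. u $ j * c (P @ j # L)) = (-1) ^ length P * (\<Sum>j\<in>UNIV. u $ j * c (j # P @ L))"
      using altern_move[OF assms(1), of "[]" P _ L] by (simp add: sum_distrib_left mult_ac)
    also have "(\<Sum>j\<in>UNIV. u $ j * c (j # P @ L)) = 0" using assms(2) Cons.prems by simp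
    finally show ?case by simp
  qed simp
  from this[of "[]"] show ?thesis by (simp add: tang_def)
qed

text \<open>Contract the first slot with the normal. If this slot carries the derivative, Euler's
  relation leaves the degree term -k c; if it does not, each of the k positions of the derivative
  gives -c by \<open>2\<close>, and these terms enter with the opposite sign.\<close>

lemma tang_dcomp:
  assumes s: "\<And>I. sm (\<lambda>u. c u I)" and a: "\<And>u. u \<in> S6 ==> altern (c u)"
    and t: "\<And>u. u \<in> S6 ==> tang (cv u) k (c u)" and u: "u \<in> S6"
  shows "tang (cv u) (Suc k) (dcomp k c u)"
proof (rule tang_if_kills[OF altern_dcomp[OF s a u]])
  fix I :: "7 list" assume I: "length I = k"
  note uu = cv_cdot_self[OF u]
  have uu': "(\<Sum>m\<in>UNIV. complex_of_real (u $ m) * complex_of_real (u $ m)) = 1" using uu by (simp add: cdot_def)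
  have 1: "(\<Sum>m\<in>UNIV. cv u $ m * dterm k c u m I) = - of_nat k * c u I"
  proof -
    have "(\<Sum>m\<in>UNIV. cv u $ m * dterm k c u m I) = (\<Sum>m\<in>UNIV. of_real (u $ m) * sder m (\<lambda>u. c u I) u)
        - of_nat k * c u I * (\<Sum>m\<in>UNIV. complex_of_real (u $ m) * complex_of_real (u $ m))"
      by (simp add: dterm_def right_diff_distrib sum_subtractf sum_distrib_left mult_ac)
    then show ?thesis using sder_euler[OF s u, of I] uu' by simp
  qed
  \<comment> \<open>The product rule for the identity that c vanishes with the normal in its first
    slot.\<close>
  have 2: "(\<Sum>m\<in>UNIV. cv u $ m * dterm k c u j (m # J)) = - c u (j # J)" if J: "Suc (length J) = k" for j J
  proof -
    have "(\<Sum>m\<in>UNIV. of_real (v $ m) * c v (m # J)) = 0" if "v \<in> S6" for v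
      using tang_kills[OF t[OF that], of "[]" J] J cv_cdot_self[OF that] by simp
    then have "sder j (\<lambda>v. \<Sum>m\<in>UNIV. of_real (v $ m) * c v (m # J)) u = sder j (\<lambda>v. 0) u"
      by (rule sder_cong[OF _ S6_nonzero[OF u]])
    then have "(\<Sum>m\<in>UNIV. of_real (u $ m) * sder j (\<lambda>v. c v (m # J)) u + sder j (\<lambda>v. of_real (v $ m)) u * c u (m # J)) = 0"
      by (simp add: sder_const sder_sum[OF u] sm_mult sm_coord s sder_mult u)
    moreover have "(\<Sum>m\<in>UNIV. sder j (\<lambda>v. of_real (v $ m)) u * c u (m # J)) = c u (j # J) - of_real (u $ j) * (\<Sum>m\<in>UNIV. cv u $ m * c u (m # J))"
      by (simp add: sder_coord[OF u] left_diff_distrib sum_subtractf sum_distrib_left mult.assoc if_distrib[of of_real] if_one_mult cong: if_cong)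
    moreover have z: "(\<Sum>m\<in>UNIV. cv u $ m * c u (m # J)) = 0"
      using tang_kills[OF t[OF u], of "[]" J] J uu by simp
    ultimately have "(\<Sum>m\<in>UNIV. of_real (u $ m) * sder j (\<lambda>v. c v (m # J)) u) = - c u (j # J)"
      by (simp add: sum.distrib eq_neg_iff_add_eq_0)
    moreover have "(\<Sum>m\<in>UNIV. cv u $ m * dterm k c u j (m # J))
        = (\<Sum>m\<in>UNIV. of_real (u $ m) * sder j (\<lambda>v. c v (m # J)) u) - of_nat k * of_real (u $ j) * (\<Sum>m\<in>UNIV. cv u $ m * c u (m # J))"
      by (simp add: dterm_def right_diff_distrib sum_subtractf sum_distrib_left mult_ac)
    ultimately show ?thesis using z by simp
  qed
  have 3: "antis (\<lambda>j J. \<Sum>m\<in>UNIV. cv u $ m * dterm k c u j (m # J)) I = - (\<Sum>i<k. c u I)"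
  proof -
    have "(-1) ^ i * (\<Sum>m\<in>UNIV. cv u $ m * dterm k c u (I ! i) (m # drop_nth i I)) = - c u I" if "i < k" for i
    proof -
      have "c u I = c u (take i I @ I ! i # drop (Suc i) I)" using id_take_nth_drop[of i I] that I by simp
      also have "\<dots> = (-1) ^ i * c u (I ! i # drop_nth i I)"
        using altern_move[OF a[OF u], of "[]" "take i I"] that I by (simp add: drop_nth_def)
      finally show ?thesis using 2[of "drop_nth i I"] that I by (simp add: length_drop_nth)
    qed
    then show ?thesis using I by (simp add: antis_def sum_negf del: sum_constant)
  qed
  have "(\<Sum>m\<in>UNIV. cv u $ m * dcomp k c u (m # I))
     = (\<Sum>m\<in>UNIV. cv u $ m * dterm k c u m I) - antis (\<lambda>j J. \<Sum>m\<in>UNIV. cv u $ m * dterm k c u j (m # J)) I"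
    by (simp add: dcomp_def antis_Cons antis_sum right_diff_distrib sum_subtractf)
  then show "(\<Sum>m\<in>UNIV. cv u $ m * dcomp k c u (m # I)) = 0" unfolding 1 3 by simp
qed

subsection \<open>The operator dbar in components\<close>

text \<open>The parts \<open>ftp\<close> provide a decomposition, since they add up to the value of
  the pencil at z = 1. It is unique because \<open>ftp\<close> extracts the summand of a given
  weight.\<close>

lemma type_proj_eq:
  assumes u: "u \<in> S6" and \<eta>: "\<eta> = tensor_of (p + q) c" and a: "altern c" and t: "tang (cv u) (p + q) c"
  shows "type_proj std_J p q u \<eta> = tensor_of (p + q) (ftp (cv u) p c)"
proof -
  let ?n = "p + q"
  have cs: "cmp \<eta> I = c I" if "length I = ?n" for I using that \<eta> by (simp add: cmp_tensor_of)
  show ?thesis unfolding type_proj_def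
  proof (rule the_equality)
    let ?c = "\<lambda>a. tensor_of ?n (ftp (cv u) a c)"
    have "?c a' \<in> Lambda std_J a' (?n - a') u" if "a' \<le> ?n" for a'
      using form_atI[OF altern_tp[OF a] ftyped_ftp[OF cv_cdot_self[OF u]], of ?n a'] that by (simp add: Lambda_iff[OF u])
    moreover have "\<eta> = (\<Sum>a\<le>?n. ?c a)"
    proof (rule ext)
      fix vs
      show "\<eta> vs = (\<Sum>a\<le>?n. ?c a) vs"
      proof (cases "length vs = ?n")
        case True
        have "ev c (map cv vs) = ev (\<lambda>I. \<Sum>a\<le>?n. ftp (cv u) a c I) (map cv vs)"
          using t True act_pencil[of 1 "pm (cv u)" "pp (cv u)" c] by (intro ev_cong) (simp add: tang_def)
        then show ?thesis using True \<eta> by (simp add: tensor_of_def sum_fun_apply ev_sum)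
      qed (simp add: \<eta> tensor_of_def sum_fun_apply)
    qed
    ultimately show "\<exists>c'. (\<forall>a\<le>?n. c' a \<in> Lambda std_J a (?n - a) u) \<and> \<eta> = (\<Sum>a\<le>?n. c' a)
        \<and> tensor_of ?n (ftp (cv u) p c) = c' p" by (intro exI[of _ ?c]) simp
  next
    fix \<alpha> assume "\<exists>c. (\<forall>a\<le>?n. c a \<in> Lambda std_J a (?n - a) u) \<and> \<eta> = (\<Sum>a\<le>?n. c a) \<and> \<alpha> = c p"
    then obtain d where d: "\<And>a. a \<le> ?n ==> d a \<in> Lambda std_J a (?n - a) u" "\<eta> = (\<Sum>a\<le>?n. d a)" "\<alpha> = d p" by blast
    have f: "form_at u ?n a (d a)" if "a \<le> ?n" for a using d(1)[OF that] that by (simp add: Lambda_iff[OF u])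
    have "cmp (d p) I = ftp (cv u) p c I" if I: "length I = ?n" for I
    proof -
      have "ftp (cv u) p c I = ftp (cv u) p (\<lambda>J. \<Sum>a\<le>?n. cmp (d a) J) I"
        by (rule tp_cong) (use cs I d(2) in \<open>simp add: cmp_def sum_fun_apply\<close>)
      also have "\<dots> = (\<Sum>a\<le>?n. if a = p then cmp (d p) I else 0)"
        unfolding tp_sum
      proof (rule sum.cong[OF refl])
        fix a assume "a \<in> {..?n}"
        then have "ftyped (cv u) ?n a (cmp (d a))" "a \<le> ?n" using f by (auto simp: form_at_def)
        then show "ftp (cv u) p (cmp (d a)) I = (if a = p then cmp (d p) I else 0)"
          using typed_tp_same typed_tp_other I by auto
      qed
      finally show ?thesis by simp
    qed
    then have "tensor_of ?n (cmp (d p)) = tensor_of ?n (ftp (cv u) p c)" by (rule tensor_of_cong)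
    then show "\<alpha> = tensor_of ?n (ftp (cv u) p c)" using f[of p] d(3) by (simp add: form_at_def)
  qed
qed

lemma sm_tp:
  assumes "\<And>i j. sm (\<lambda>u. M u i j)" "\<And>i j. sm (\<lambda>u. N u i j)"
  shows "(\<And>J. length J = length I ==> sm (\<lambda>u. c u J)) ==> sm (\<lambda>u. tp (M u) (N u) p (c u) I)"
proof (induction I arbitrary: c p)
  case Nil then show ?case by (cases "p = 0") (auto intro: sm_const)
next
  case (Cons i I)
  have "sm (\<lambda>u. tp (M u) (N u) p (\<lambda>J. c u (j # J)) I)" for p j
    by (rule Cons.IH) (simp add: Cons.prems)
  then show ?case by (cases "p = 0") (auto intro!: sm_intros assms)
qed

lemma sm_act:
  assumes "\<And>i j. sm (\<lambda>u. M u i j)"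
  shows "(\<And>J. length J = length I ==> sm (\<lambda>u. c u J)) ==> sm (\<lambda>u. act (M u) (c u) I)"
proof (induction I arbitrary: c)
  case (Cons i I)
  have "sm (\<lambda>u. act (M u) (\<lambda>J. c u (j # J)) I)" for j
    by (rule Cons.IH) (simp add: Cons.prems)
  then show ?case by (auto intro!: sm_intros assms)
qed simp

lemma sm_dcomp: "(\<And>I. sm (\<lambda>u. c u I)) ==> sm (\<lambda>u. dcomp k c u L)"
  unfolding dcomp_def antis_def dterm_def by (intro sm_intros sm_sder)

abbreviation fcomp :: "tensor_field => vec7 => 7 list => complex" where "fcomp \<omega> u \<equiv> cmp (\<omega> u)"

lemma Omega_comps:
  assumes "\<omega> \<in> Omega std_J p q"
  shows "\<And>I. sm (\<lambda>u. fcomp \<omega> u I)" "\<And>u. u \<in> S6 ==> altern (fcomp \<omega> u)"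
    "\<And>u. u \<in> S6 ==> ftyped (cv u) (p + q) p (fcomp \<omega> u)" "\<And>u. u \<in> S6 ==> tang (cv u) (p + q) (fcomp \<omega> u)"
    "\<And>u. u \<in> S6 ==> \<omega> u = tensor_of (p + q) (fcomp \<omega> u)" "\<And>u. u \<notin> S6 ==> \<omega> u = 0"
  using assms form_at_tang unfolding Omega_iff form_at_def by blast+

theorem dbar_eq:
  assumes "\<omega> \<in> Omega std_J p q"
  shows "dbar std_J p q \<omega> = mkfield (p + Suc q) (\<lambda>u. ftp (cv u) p (dcomp (p + q) (fcomp \<omega>) u))"
proof (rule ext)
  fix u
  note o = Omega_comps[OF assms]
  show "dbar std_J p q \<omega> u = mkfield (p + Suc q) (\<lambda>u. ftp (cv u) p (dcomp (p + q) (fcomp \<omega>) u)) u"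
  proof (cases "u \<in> S6")
    case True
    have "ext_deriv \<omega> u = tensor_of (p + Suc q) (dcomp (p + q) (fcomp \<omega>) u)"
      using ext_deriv_comps[OF o(5,4,1) True] by simp
    then show ?thesis using True
      by (simp add: dbar_def mkfield_def type_proj_eq[OF True _ altern_dcomp[OF o(1,2) True]] tang_dcomp[OF o(1,2,4) True, simplified])
  qed (simp add: dbar_def mkfield_def zero_fun_def)
qed

lemma dbar_Omega:
  assumes "\<omega> \<in> Omega std_J p q" shows "dbar std_J p q \<omega> \<in> Omega std_J p (Suc q)"
  unfolding dbar_eq[OF assms]
  by (rule mkfield_Omega)
    (auto intro!: altern_tp altern_dcomp ftyped_ftp cv_cdot_self sm_tp sm_pm sm_pp sm_dcomp Omega_comps[OF assms])

section \<open>Integration over the sphere\<close>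

text \<open>Integration over the round sphere; the volume density of a metric will be part of the
  integrand.\<close>

definition sph_int :: "(vec7 => complex) => complex"
  where "sph_int f = 7 * (LINT x:ball 0 1|lborel. f (retr x))"

lemma sm_bounded:
  assumes "sm f" obtains B where "\<And>x. norm (f (retr x)) \<le> B"
proof -
  have "compact (f ` S6)" by (intro compact_continuous_image sm_continuous_S6 assms) simp
  then obtain B where B: "\<And>u. u \<in> S6 ==> norm (f u) \<le> B"
    using compact_imp_bounded bounded_iff by (metis imageI)
  \<comment> \<open>\<open>retr 0\<close> is 0, a point off the sphere, so the value of f there
    enters the bound.\<close>
  have "norm (f (retr x)) \<le> max B (norm (f 0))" for x
    using B[OF retr_in_S6, of x] by (cases "x = 0") (auto simp: retr_def le_max_iff_disj)
  then show ?thesis using that by blast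
qed

lemma sm_measurable: "sm f ==> (\<lambda>x. f (retr x)) \<in> borel_measurable borel"
proof -
  assume "sm f"
  \<comment> \<open>The extension may jump at the origin. Both branches are continuous on their
    parts, the second part being a single point.\<close>
  then have "(\<lambda>x::vec7. if x \<in> - {0} then f (retr x) else f (retr x)) \<in> borel_measurable borel"
    by (intro borel_measurable_continuous_on_if sm_continuous) auto
  then show ?thesis by simp
qed

lemma sm_set_integrable:
  assumes "sm f" shows "set_integrable lborel (ball 0 1) (\<lambda>x. f (retr x))"
proof -
  obtain B where "\<And>x. norm (f (retr x)) \<le> B" using sm_bounded[OF assms] by blast
  then show ?thesis unfolding set_integrable_def
    by (intro integrableI_bounded_set_indicator[of _ _ _ B])
      (use sm_measurable[OF assms] emeasure_lborel_ball_finite[of 0 1] in auto)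
qed

lemma sph_int_add: "sm f ==> sm g ==> sph_int (\<lambda>u. f u + g u) = sph_int f + sph_int g"
  by (simp add: sph_int_def set_integral_add sm_set_integrable distrib_left)

lemma sph_int_cmult: "sph_int (\<lambda>u. c * f u) = c * sph_int f"
  by (simp add: sph_int_def)

lemma sph_int_minus: "sph_int (\<lambda>u. - f u) = - sph_int f"
  using sph_int_cmult[of "-1" f] by simp

lemma sph_int_diff: "sm f ==> sm g ==> sph_int (\<lambda>u. f u - g u) = sph_int f - sph_int g"
  using sph_int_add[of f "\<lambda>u. - g u"] by (simp add: sm_minus sph_int_minus)

lemma sph_int_zero: "sph_int (\<lambda>u. 0) = 0" by (simp add: sph_int_def)

lemma sph_int_sum: "(\<And>i. i \<in> I ==> sm (f i)) ==> sph_int (\<lambda>u. \<Sum>i\<in>I. f i u) = (\<Sum>i\<in>I. sph_int (f i))"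
  by (induction I rule: infinite_finite_induct) (simp_all add: sph_int_zero sph_int_add sm_sum)

lemma indicator_ball_measurable: "indicat_real (ball (0::vec7) 1) \<in> borel_measurable borel"
  by (intro borel_measurable_indicator borel_open open_ball)

lemma AE_nonzero: "AE x in lborel. x \<noteq> (0::vec7)"
  by (rule AE_lborel_singleton)

lemma sph_int_cong: "(\<And>u. u \<in> S6 ==> f u = g u) ==> sm f ==> sm g ==> sph_int f = sph_int g"
proof -
  assume e: "\<And>u. u \<in> S6 ==> f u = g u" and s: "sm f" "sm g"
  have "(LINT x:ball 0 1|lborel. f (retr x)) = (LINT x:ball 0 1|lborel. g (retr x))"
    unfolding set_lebesgue_integral_def
    by (rule integral_cong_AE)
      (use AE_nonzero sm_measurable s in \<open>auto intro!: borel_measurable_scaleR indicator_ball_measurable simp: e retr_in_S6 elim!: eventually_mono\<close>)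
  then show ?thesis by (simp add: sph_int_def)
qed

lemma sph_int_cnj:
  assumes "sm f" shows "sph_int (\<lambda>u. cnj (f u)) = cnj (sph_int f)"
proof -
  have "(LINT x:ball 0 1|lborel. cnj (f (retr x))) = (LINT x|lborel. cnj (indicator (ball 0 1) x *\<^sub>R f (retr x)))"
    unfolding set_lebesgue_integral_def by (simp add: scaleR_conv_of_real)
  also have "\<dots> = cnj (LINT x:ball 0 1|lborel. f (retr x))"
    unfolding set_lebesgue_integral_def
    by (rule integral_bounded_linear[OF bounded_linear_cnj sm_set_integrable[OF assms, unfolded set_integrable_def]])
  finally show ?thesis by (simp add: sph_int_def)
qed

text \<open>If f were nonzero at u, its extension would be nonzero on a small ball inside the unit
  ball, and this has positive measure.\<close>

lemma sph_int_pos_zero: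
  assumes f: "sm f" and h: "\<And>u. u \<in> S6 ==> f u = of_real (h u)" "\<And>u. u \<in> S6 ==> h u \<ge> 0"
    and z: "sph_int f = 0" and u: "u \<in> S6"
  shows "f u = 0"
proof (rule ccontr)
  assume fu: "f u \<noteq> 0"
  let ?H = "\<lambda>x. indicator (ball 0 1) x *\<^sub>R Re (f (retr x))"
  have i: "integrable lborel ?H"
    using integrable_Re[OF sm_set_integrable[OF f, unfolded set_integrable_def]] by simp
  have "(LINT x|lborel. ?H x) = Re (LINT x:ball 0 1|lborel. f (retr x))"
    using integral_Re[OF sm_set_integrable[OF f, unfolded set_integrable_def]]
    by (simp add: set_lebesgue_integral_def)
  also have "\<dots> = 0" using z by (simp add: sph_int_def)
  finally have z: "(LINT x|lborel. ?H x) = 0" .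
  have "AE x in lborel. ?H x \<ge> 0"
    using AE_nonzero by eventually_elim (use h retr_in_S6 in \<open>auto simp: indicator_def\<close>)
  from integral_nonneg_eq_0_iff_AE[OF i this] z have ae: "AE x in lborel. ?H x = 0" by simp
  have c: "continuous_on (- {0}) (\<lambda>x. f (retr x))" by (rule sm_continuous[OF f])
  have "open (- {0} \<inter> (\<lambda>x. f (retr x)) -` (- {0}))"
    by (rule continuous_open_preimage[OF c]) auto
  then have op: "open (ball 0 1 \<inter> (- {0} \<inter> (\<lambda>x. f (retr x)) -` (- {0})))" (is "open ?U") by auto
  \<comment> \<open>The point u lies on the boundary of the ball; its half is interior and has the
    same retraction.\<close>
  have "(1/2) *\<^sub>R u \<in> ?U" using u fu retr_scaleR[of "1/2" u] retr_S6[OF u] by (auto simp: mem_sphere)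
  then obtain e where e: "e > 0" "ball ((1/2) *\<^sub>R u) e \<subseteq> ?U" using op open_contains_ball by metis
  have nz: "f (retr x) \<noteq> 0 ==> x \<noteq> 0 ==> Re (f (retr x)) \<noteq> 0" for x
    using h(1)[OF retr_in_S6, of x] by auto
  have "AE x in lborel. x \<notin> ball ((1/2) *\<^sub>R u) e"
  proof (rule eventually_mono[OF ae], rule notI)
    fix x assume H: "?H x = 0" and x: "x \<in> ball ((1/2) *\<^sub>R u) e"
    have xU: "x \<in> ball 0 1" "x \<noteq> 0" "f (retr x) \<noteq> 0" using subsetD[OF e(2) x] by auto
    then have "Re (f (retr x)) = 0" using H by (simp add: indicator_def)
    then show False using nz xU by blast
  qed
  then have "emeasure lborel (ball ((1/2) *\<^sub>R u) e) = 0"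
    using AE_iff_null_sets[of "ball ((1/2) *\<^sub>R u) e" lborel] by (auto simp: null_sets_def)
  then show False using content_ball_pos[OF e(1), of "(1/2) *\<^sub>R u"] by (simp add: measure_def)
qed

subsection \<open>Rotation invariance\<close>

text \<open>Rotation by the angle t in the plane of the i-th and j-th axes. These rotations preserve
  the ball and Lebesgue measure, and their infinitesimal generators yield the integration by
  parts.\<close>

definition rot :: "7 => 7 => real => vec7 => vec7"
  where "rot i j t x = x + (cos t - 1) *\<^sub>R (x $ i *\<^sub>R ax i + x $ j *\<^sub>R ax j) + sin t *\<^sub>R (x $ i *\<^sub>R ax j - x $ j *\<^sub>R ax i)"

lemma rot_0: "rot i j 0 x = x" by (simp add: rot_def)

lemma linear_rot: "linear (rot i j t)"
  by (rule linearI) (simp_all add: rot_def algebra_simps)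

lemma norm_rot: "i \<noteq> j ==> norm (rot i j t x) = norm x"
proof -
  assume ij: "i \<noteq> j"
  define n where "n = (x $ i)\<^sup>2 + (x $ j)\<^sup>2"
  let ?P = "x $ i *\<^sub>R ax i + x $ j *\<^sub>R ax j" and ?Q = "x $ i *\<^sub>R ax j - x $ j *\<^sub>R ax i"
  have aa: "ax i \<bullet> ax j = 0" "ax j \<bullet> ax i = 0" "ax i \<bullet> ax i = 1" "ax j \<bullet> ax j = 1"
    using ij by (simp_all add: inner_axis_axis)
  have e: "x \<bullet> ?P = n" "x \<bullet> ?Q = 0" "?P \<bullet> ?P = n" "?Q \<bullet> ?Q = n" "?P \<bullet> ?Q = 0"
    unfolding n_def inner_add_left inner_add_right inner_diff_left inner_diff_right inner_scaleR_left inner_scaleR_right aa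
    by (simp_all add: inner_axis power2_eq_square algebra_simps)
  define P where "P = ?P" define Q where "Q = ?Q"
  have e': "x \<bullet> P = n" "P \<bullet> x = n" "x \<bullet> Q = 0" "Q \<bullet> x = 0" "P \<bullet> P = n" "Q \<bullet> Q = n" "P \<bullet> Q = 0" "Q \<bullet> P = 0"
    using e by (simp_all only: P_def Q_def inner_commute)
  have "n * (cos t * cos t) + n * (sin t * sin t) = n"
  proof -
    have "n * (cos t * cos t) + n * (sin t * sin t) = n * ((cos t)\<^sup>2 + (sin t)\<^sup>2)"
      by (simp only: power2_eq_square distrib_left)
    then show ?thesis by (simp only: sin_cos_squared_add2 mult_1_right)
  qed
  then have "rot i j t x \<bullet> rot i j t x = x \<bullet> x"
    unfolding rot_def P_def[symmetric] Q_def[symmetric]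
    by (simp add: inner_add_left inner_add_right e' algebra_simps)
  then show ?thesis by (simp add: norm_eq_sqrt_inner)
qed

lemma rot_component: "i \<noteq> j ==> rot i j t x $ i = cos t * x $ i - sin t * x $ j"
  "i \<noteq> j ==> rot i j t x $ j = cos t * x $ j + sin t * x $ i"
  by (simp_all add: rot_def axis_def algebra_simps)

lemma rot_rot: "i \<noteq> j ==> rot i j (- t) (rot i j t x) = x"
proof -
  assume ij: "i \<noteq> j"
  have sc: "sin t * (sin t * y) = y - cos t * (cos t * y)" for y
    using sin_squared_eq[of t] by (simp add: power2_eq_square mult.assoc[symmetric] left_diff_distrib)
  have "rot i j (- t) (rot i j t x) $ k = x $ k" for k
  proof (cases "k = i \<or> k = j")
    case True
    then show ?thesis using ij by (auto simp: rot_component algebra_simps sc)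
  next
    case False
    then show ?thesis by (simp add: rot_def axis_def)
  qed
  then show ?thesis by (simp add: vec_eq_iff)
qed

lemma orthogonal_rot: "i \<noteq> j ==> orthogonal_transformation (rot i j t)"
  by (simp add: orthogonal_transformation linear_rot norm_rot)

lemma measurable_rot: "rot i j t \<in> borel_measurable borel"
  by (intro borel_measurable_continuous_onI linear_continuous_on linear_linear[THEN iffD2] linear_rot)

lemma distr_rot:
  assumes "i \<noteq> j" shows "distr lborel borel (rot i j t) = lborel"
proof (rule lborel_eqI[symmetric])
  fix l u :: vec7 assume lu: "\<And>b. b \<in> Basis ==> l \<bullet> b \<le> u \<bullet> b"
  have "rot i j t -` box l u = rot i j (- t) ` box l u"
  proof (intro equalityI subsetI)
    fix x assume "x \<in> rot i j t -` box l u"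
    then show "x \<in> rot i j (- t) ` box l u" using rot_rot[OF assms, of t x] by (intro image_eqI[of _ _ "rot i j t x"]) auto
  next
    fix x assume "x \<in> rot i j (- t) ` box l u"
    then show "x \<in> rot i j t -` box l u" using rot_rot[OF assms, of "-t"] by auto
  qed
  then have "emeasure (distr lborel borel (rot i j t)) (box l u) = emeasure lborel (rot i j (- t) ` box l u)"
    using measurable_rot[of i j t] by (simp add: emeasure_distr)
  also have "\<dots> = emeasure lebesgue (rot i j (- t) ` box l u)"
  proof -
    have "rot i j (- t) ` box l u = rot i j t -` box l u" using \<open>rot i j t -` box l u = rot i j (- t) ` box l u\<close> by simp
    also have "\<dots> \<in> sets borel" using measurable_sets[OF measurable_rot[of i j t], of "box l u"] by simp
    finally show ?thesis by simp
  qed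
  also have "\<dots> = measure lebesgue (rot i j (- t) ` box l u)"
    by (rule emeasure_eq_measure2) (rule measurable_orthogonal_image[OF orthogonal_rot[OF assms]], simp)
  also have "measure lebesgue (rot i j (- t) ` box l u) = measure lebesgue (box l u)"
    by (rule measure_orthogonal_image[OF orthogonal_rot[OF assms]]) simp
  finally show "emeasure (distr lborel borel (rot i j t)) (box l u) = ennreal (\<Prod>b\<in>Basis. (u - l) \<bullet> b)"
    using lu by (simp add: measure_lborel_box)
qed simp

lemma integral_rot:
  fixes f :: "vec7 => complex"
  assumes "i \<noteq> j" "f \<in> borel_measurable borel"
  shows "(LINT x:ball 0 1|lborel. f (rot i j t x)) = (LINT x:ball 0 1|lborel. f x)"
proof -
  have m: "rot i j t \<in> measurable lborel borel" using measurable_rot[of i j t] by simp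
  have "(LINT x:ball 0 1|lborel. f x) = (LINT x|distr lborel borel (rot i j t). indicator (ball 0 1) x *\<^sub>R f x)"
    by (simp add: set_lebesgue_integral_def distr_rot[OF assms(1)])
  also have "\<dots> = (LINT x|lborel. indicator (ball 0 1) (rot i j t x) *\<^sub>R f (rot i j t x))"
    by (rule integral_distr[OF m]) (intro borel_measurable_scaleR indicator_ball_measurable assms(2))
  also have "\<dots> = (LINT x:ball 0 1|lborel. f (rot i j t x))"
    by (simp add: set_lebesgue_integral_def indicator_def norm_rot[OF assms(1)])
  finally show ?thesis by simp
qed

lemma rot_nonzero: "i \<noteq> j ==> x \<noteq> 0 ==> rot i j t x \<noteq> 0"
  using norm_rot[of i j t x] by auto

lemma retr_nth: "retr x $ k = x $ k / norm x"
  by (simp add: retr_def divide_inverse mult.commute)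

lemma rot_vector_derivative:
  assumes f: "sm f" and ij: "i \<noteq> j" and x: "x \<noteq> 0"
  shows "((\<lambda>s. f (retr (rot i j s x))) has_vector_derivative
     (let u = retr (rot i j s x) in of_real (u $ i) * sder j f u - of_real (u $ j) * sder i f u)) (at s)"
proof -
  let ?y = "rot i j s x"
  let ?v = "?y $ i *\<^sub>R ax j - ?y $ j *\<^sub>R ax i"
  have y: "?y \<noteq> 0" by (rule rot_nonzero[OF ij x])
  have "((\<lambda>s. rot i j s x) has_derivative
      (\<lambda>h. h *\<^sub>R (- sin s *\<^sub>R (x $ i *\<^sub>R ax i + x $ j *\<^sub>R ax j) + cos s *\<^sub>R (x $ i *\<^sub>R ax j - x $ j *\<^sub>R ax i)))) (at s)"
    unfolding rot_def by (auto intro!: derivative_eq_intros simp: scaleR_add_right algebra_simps)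
  moreover have "- sin s *\<^sub>R (x $ i *\<^sub>R ax i + x $ j *\<^sub>R ax j) + cos s *\<^sub>R (x $ i *\<^sub>R ax j - x $ j *\<^sub>R ax i) = ?v"
    by (simp add: rot_component[OF ij] algebra_simps)
  ultimately have "((\<lambda>s. rot i j s x) has_derivative (\<lambda>h. h *\<^sub>R ?v)) (at s)" by simp
  from has_derivative_compose[OF this sm_has_derivative[OF f y]]
  have d: "((\<lambda>s. f (retr (rot i j s x))) has_derivative (\<lambda>h. frechet_derivative (\<lambda>x. f (retr x)) (at ?y) (h *\<^sub>R ?v))) (at s)" .
  have "frechet_derivative (\<lambda>x. f (retr x)) (at ?y) (h *\<^sub>R ?v) = h *\<^sub>R (\<Sum>k\<in>UNIV. of_real (?v $ k) * sder k f ?y)" for h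
    unfolding linear_cmul[OF has_derivative_linear[OF sm_has_derivative[OF f y]]]
    unfolding sm_frechet_sder[OF f y] by (rule refl)
  moreover have "(\<Sum>k\<in>UNIV. of_real (?v $ k) * sder k f ?y) = of_real (?y $ i) * sder j f ?y - of_real (?y $ j) * sder i f ?y"
    by (simp add: axis_def of_real_diff left_diff_distrib sum_subtractf if_distrib[of of_real] if_distrib[of "\<lambda>x. _ * x"] if_distrib[of "\<lambda>x. x * _"] cong: if_cong)
  moreover have "\<dots> = (let u = retr ?y in of_real (u $ i) * sder j f u - of_real (u $ j) * sder i f u)"
    unfolding Let_def sder_retr[OF f y] retr_nth using y by (simp add: scaleR_conv_of_real)
  ultimately show ?thesis using d unfolding has_vector_derivative_def by simp
qed

text \<open>The integrand is the derivative of f along the rotations. Difference quotients in the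
  angle integrate to 0 by invariance; dominated convergence applies, with a bound from the mean
  value inequality.\<close>

lemma sph_int_rotational:
  assumes f: "sm f" shows "sph_int (\<lambda>u. of_real (u $ i) * sder j f u - of_real (u $ j) * sder i f u) = 0"
proof (cases "i = j")
  case True then show ?thesis by (simp add: sph_int_zero)
next
  case ij: False
  define g where "g = (\<lambda>u. of_real (u $ i) * sder j f u - of_real (u $ j) * sder i f u)"
  have g: "sm g" unfolding g_def by (intro sm_intros sm_sder f)
  obtain B where B: "\<And>x. norm (g (retr x)) \<le> B" using sm_bounded[OF g] by blast
  have dv: "((\<lambda>s. f (retr (rot i j s x))) has_vector_derivative g (retr (rot i j s x))) (at s)" if "x \<noteq> 0" for x s
    using rot_vector_derivative[OF f ij that, of s] by (simp add: g_def Let_def)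
  let ?s = "\<lambda>n x. indicator (ball 0 1) x *\<^sub>R (of_nat (Suc n) * (f (retr (rot i j (1 / of_nat (Suc n)) x)) - f (retr x)))"
  have m: "(\<lambda>x. f (retr (rot i j t x))) \<in> borel_measurable borel" for t
    using measurable_compose[OF measurable_rot sm_measurable[OF f]] by simp
  have lim: "(\<lambda>n. integral\<^sup>L lborel (?s n)) \<longlonglongrightarrow> integral\<^sup>L lborel (\<lambda>x. indicator (ball 0 1) x *\<^sub>R g (retr x))"
  proof (rule integral_dominated_convergence[where w = "\<lambda>x. indicator (ball 0 1) x *\<^sub>R B"])
    show "(\<lambda>x. indicator (ball 0 1) x *\<^sub>R g (retr x)) \<in> borel_measurable lborel"
      using sm_measurable[OF g] by (auto intro!: borel_measurable_scaleR indicator_ball_measurable)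
    show "?s n \<in> borel_measurable lborel" for n
      using m sm_measurable[OF f]
      by (auto intro!: borel_measurable_scaleR indicator_ball_measurable borel_measurable_times borel_measurable_diff)
    show "integrable lborel (\<lambda>x. indicator (ball 0 1) x *\<^sub>R B :: real)"
      by (rule integrableI_bounded_set_indicator[of _ _ _ "\<bar>B\<bar>"]) (use emeasure_lborel_ball_finite[of 0 1] in auto)
    show "AE x in lborel. (\<lambda>n. ?s n x) \<longlonglongrightarrow> indicator (ball 0 1) x *\<^sub>R g (retr x)"
      using AE_nonzero
    proof eventually_elim
      fix x :: vec7 assume x: "x \<noteq> 0"
      have t0: "((\<lambda>n. 1 / of_nat (Suc n)) \<longlongrightarrow> (0::real)) sequentially" by (rule LIMSEQ_Suc[OF lim_1_over_n])
      let ?F = "\<lambda>s. f (retr (rot i j s x))"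
      have A: "((\<lambda>h. norm (?F h - f (retr x) - h *\<^sub>R g (retr x)) / norm h) \<longlongrightarrow> 0) (at 0)"
        using dv[OF x, of 0] unfolding has_vector_derivative_def has_derivative_at by (simp add: rot_0)
      have "((\<lambda>h. norm ((?F h - f (retr x)) /\<^sub>R h - g (retr x))) \<longlongrightarrow> 0) (at 0)"
      proof (rule Lim_transform_eventually[OF A])
        have "norm (?F h - f (retr x) - h *\<^sub>R g (retr x)) / norm h = norm ((?F h - f (retr x)) /\<^sub>R h - g (retr x))"
          if "h \<noteq> 0" for h
        proof -
          have "(?F h - f (retr x)) /\<^sub>R h - g (retr x) = (?F h - f (retr x) - h *\<^sub>R g (retr x)) /\<^sub>R h"
            using that by (simp add: scaleR_diff_right)
          then show ?thesis by (simp only: norm_scaleR) (simp add: divide_inverse mult.commute)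
        qed
        then show "\<forall>\<^sub>F h in at 0. norm (?F h - f (retr x) - h *\<^sub>R g (retr x)) / norm h = norm ((?F h - f (retr x)) /\<^sub>R h - g (retr x))"
          by (auto simp: eventually_at_filter)
      qed
      then have "((\<lambda>s. (f (retr (rot i j s x)) - f (retr x)) /\<^sub>R s) \<longlongrightarrow> g (retr x)) (at 0)"
        by (rule LIM_zero_cancel[OF tendsto_norm_zero_cancel])
      moreover have "filterlim (\<lambda>n. 1 / of_nat (Suc n)) (at (0::real)) sequentially"
        using t0 by (intro filterlim_atI) (auto intro!: always_eventually)
      ultimately have "(\<lambda>n. (f (retr (rot i j (1 / of_nat (Suc n)) x)) - f (retr x)) /\<^sub>R (1 / of_nat (Suc n))) \<longlonglongrightarrow> g (retr x)"
        by (rule filterlim_compose)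
      then have "(\<lambda>n. of_nat (Suc n) * (f (retr (rot i j (1 / of_nat (Suc n)) x)) - f (retr x))) \<longlonglongrightarrow> g (retr x)"
        by (simp add: scaleR_conv_of_real)
      then show "(\<lambda>n. ?s n x) \<longlonglongrightarrow> indicator (ball 0 1) x *\<^sub>R g (retr x)" by (rule tendsto_scaleR[OF tendsto_const])
    qed
    show "AE x in lborel. norm (?s n x) \<le> indicator (ball 0 1) x *\<^sub>R B" for n
      using AE_nonzero
    proof eventually_elim
      fix x :: vec7 assume x: "x \<noteq> 0"
      let ?t = "1 / real (Suc n)"
      have "norm (f (retr (rot i j ?t x)) - f (retr (rot i j 0 x))) \<le> B * norm (?t - 0)"
      proof (rule differentiable_bound[of UNIV _ "\<lambda>s h. h *\<^sub>R g (retr (rot i j s x))"])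
        show "((\<lambda>s. f (retr (rot i j s x))) has_derivative (\<lambda>h. h *\<^sub>R g (retr (rot i j s x)))) (at s within UNIV)" for s
          using dv[OF x, of s] by (simp add: has_vector_derivative_def)
        show "onorm (\<lambda>h. h *\<^sub>R g (retr (rot i j s x))) \<le> B" for s
        proof (rule onorm_bound)
          show "0 \<le> B" by (rule order.trans[OF norm_ge_zero B])
          show "norm (h *\<^sub>R g (retr (rot i j s x))) \<le> B * norm h" for h :: real
            using mult_right_mono[OF B[of "rot i j s x"] abs_ge_zero[of h]] by (simp add: mult.commute)
        qed
      qed auto
      then have "norm (f (retr (rot i j ?t x)) - f (retr x)) \<le> B * ?t" by (simp add: rot_0)
      then have "real (Suc n) * norm (f (retr (rot i j ?t x)) - f (retr x)) \<le> real (Suc n) * (B * ?t)"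
        by (rule mult_left_mono) simp
      also have "\<dots> = B" by simp
      finally have "norm (of_nat (Suc n) * (f (retr (rot i j ?t x)) - f (retr x))) \<le> B"
        unfolding norm_mult norm_of_nat .
      then show "norm (?s n x) \<le> indicator (ball 0 1) x *\<^sub>R B" by (simp add: indicator_def del: of_nat_Suc)
    qed
  qed
  have "integral\<^sup>L lborel (?s n) = 0" for n
  proof -
    let ?t = "1 / real (Suc n)"
    have i1: "set_integrable lborel (ball 0 1) (\<lambda>x. f (retr (rot i j ?t x)))"
    proof -
      obtain C where "\<And>x. norm (f (retr x)) \<le> C" using sm_bounded[OF f] by blast
      then show ?thesis unfolding set_integrable_def
        by (intro integrableI_bounded_set_indicator[of _ _ _ C]) (use m emeasure_lborel_ball_finite[of 0 1] in auto)
    qed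
    have "integral\<^sup>L lborel (?s n) = (LINT x:ball 0 1|lborel. of_nat (Suc n) * (f (retr (rot i j ?t x)) - f (retr x)))"
      by (simp only: set_lebesgue_integral_def)
    also have "\<dots> = of_nat (Suc n) * ((LINT x:ball 0 1|lborel. f (retr (rot i j ?t x))) - (LINT x:ball 0 1|lborel. f (retr x)))"
      using i1 sm_set_integrable[OF f] by (simp add: set_integral_diff del: of_nat_Suc)
    also have "\<dots> = 0" using integral_rot[OF ij sm_measurable[OF f], of ?t] by simp
    finally show ?thesis .
  qed
  with lim have "(LINT x:ball 0 1|lborel. g (retr x)) = 0"
    unfolding set_lebesgue_integral_def by (simp add: LIMSEQ_const_iff)
  then show ?thesis by (simp add: sph_int_def g_def)
qed

text \<open>The divergence theorem for the tangential part of a coordinate field; 6 is the mean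
  curvature of the sphere. It arises as 7 - 1: every summand \<open>?R j\<close> contributes -
  \<open>u $ i\<close> times f, and the one with j = i also contributes + \<open>u $ i\<close> times
  f.\<close>

theorem sph_int_sder:
  assumes f: "sm f" shows "sph_int (sder i f) = 6 * sph_int (\<lambda>u. of_real (u $ i) * f u)"
proof -
  \<comment> \<open>The derivative of \<open>u $ j\<close> times f along the rotation in the plane
    of j and i.\<close>
  let ?R = "\<lambda>j u. of_real (u $ j) * sder i (\<lambda>u. of_real (u $ j) * f u) u - of_real (u $ i) * sder j (\<lambda>u. of_real (u $ j) * f u) u"
  have sR: "sm (?R j)" for j by (intro sm_intros sm_sder f)
  have e: "sder i f u = (\<Sum>j\<in>UNIV. ?R j u) + 6 * (of_real (u $ i) * f u)" if u: "u \<in> S6" for u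
  proof -
    have uu: "(\<Sum>j\<in>UNIV. complex_of_real (u $ j) * complex_of_real (u $ j)) = 1"
      using cv_cdot_self[OF u] by (simp add: cdot_def)
    have "?R j u = of_real (u $ j) * of_real (u $ j) * sder i f u - of_real (u $ i) * (of_real (u $ j) * sder j f u)
        + (if i = j then of_real (u $ j) * f u else 0) - of_real (u $ i) * f u" for j
      unfolding sder_mult[OF sm_coord f u] sder_coord[OF u] by (simp add: algebra_simps)
    then have "(\<Sum>j\<in>UNIV. ?R j u) = (\<Sum>j\<in>UNIV. of_real (u $ j) * of_real (u $ j)) * sder i f u
       - of_real (u $ i) * (\<Sum>j\<in>UNIV. of_real (u $ j) * sder j f u)
       + of_real (u $ i) * f u - 7 * (of_real (u $ i) * f u)"
      by (simp add: sum.distrib sum_subtractf sum_distrib_left sum_distrib_right)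
    then show ?thesis using uu sder_euler[OF f u] by (simp add: algebra_simps)
  qed
  have "sph_int (sder i f) = sph_int (\<lambda>u. (\<Sum>j\<in>UNIV. ?R j u) + 6 * (of_real (u $ i) * f u))"
    by (rule sph_int_cong[OF e]) (intro sm_intros sm_sder f | assumption)+
  also have "\<dots> = sph_int (\<lambda>u. \<Sum>j\<in>UNIV. ?R j u) + sph_int (\<lambda>u. 6 * (of_real (u $ i) * f u))"
    by (rule sph_int_add) (intro sm_intros sm_sder f)+
  also have "sph_int (\<lambda>u. \<Sum>j\<in>UNIV. ?R j u) = (\<Sum>j\<in>UNIV. sph_int (?R j))"
    by (rule sph_int_sum[OF sR])
  also have "\<dots> = 0" by (intro sum.neutral ballI sph_int_rotational) (intro sm_intros f)
  finally show ?thesis by (simp add: sph_int_cmult)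
qed

section \<open>Compatible metrics\<close>

lemma tproj_tangent: "u \<in> S6 ==> tproj u v \<in> tangent u"
  by (simp add: tangent_def tproj_def inner_diff_right mem_sphere dot_square_norm)

lemma tangent_subspace: "subspace (tangent u)"
  unfolding tangent_def by (rule subspace_hyperplane)

lemma tproj_of_tangent: "v \<in> tangent u ==> tproj u v = v"
  by (simp add: tangent_def tproj_def)

lemma tproj_u: "u \<in> S6 ==> tproj u u = 0"
  by (simp add: tproj_def mem_sphere dot_square_norm)

lemma linear_tproj: "linear (tproj u)"
  by (rule linearI) (simp_all add: tproj_def inner_add_right algebra_simps)

lemma std_J_tangent: "std_J u v \<in> tangent u"
proof -
  have "u \<bullet> xcross u v = 0" by (simp add: inner_vec_def sum_7 xcross_nth algebra_simps)
  then show ?thesis by (simp add: tangent_def std_J_def cross7_eq)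
qed

lemma std_J_square: "u \<in> S6 ==> v \<in> tangent u ==> std_J u (std_J u v) = - v"
proof -
  assume u: "u \<in> S6" and v: "v \<in> tangent u"
  have "cv u \<odot> cv v = of_real (u \<bullet> v)" by (simp add: cdot_def inner_vec_def)
  then have "cv (xcross u (xcross u v)) = - cv v"
    using v by (simp add: cv_xcross xcross_unit[OF cv_cdot_self[OF u]] tangent_def)
  then show ?thesis by (simp add: std_J_def cross7_eq vec_eq_iff flip: of_real_minus)
qed

locale metric_on_S6 =
  fixes g :: metric
  assumes compatible: "compatible_metric std_J g"
begin

lemma g_sym: "u \<in> S6 ==> v \<in> tangent u ==> w \<in> tangent u ==> g u v w = g u w v"
  and g_add_right: "u \<in> S6 ==> v \<in> tangent u ==> w \<in> tangent u ==> w' \<in> tangent u ==> g u v (w + w') = g u v w + g u v w'"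
  and g_scale_right: "u \<in> S6 ==> v \<in> tangent u ==> w \<in> tangent u ==> g u v (c *\<^sub>R w) = c * g u v w"
  and g_pos: "u \<in> S6 ==> v \<in> tangent u ==> v \<noteq> 0 ==> g u v v > 0"
  and g_J: "u \<in> S6 ==> v \<in> tangent u ==> w \<in> tangent u ==> g u (std_J u v) (std_J u w) = g u v w"
  and g_smooth: "smooth_on (\<lambda>x. g (retr x) (frechet_derivative retr (at x) v)
      (frechet_derivative retr (at x) w)) (- {0})"
  using compatible unfolding compatible_metric_def riemannian_metric_def by blast+

lemma g_zero_right: "u \<in> S6 ==> v \<in> tangent u ==> g u v 0 = 0"
  using g_scale_right[of u v 0 0] subspace_0[OF tangent_subspace] by simp

lemma g_sum_right:
  assumes "u \<in> S6" "v \<in> tangent u" "\<And>b. b \<in> B ==> f b \<in> tangent u"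
  shows "g u v (\<Sum>b\<in>B. c b *\<^sub>R f b) = (\<Sum>b\<in>B. c b * g u v (f b))"
  using assms(3)
proof (induction B rule: infinite_finite_induct)
  case (insert b B)
  have "(\<Sum>b\<in>B. c b *\<^sub>R f b) \<in> tangent u"
    by (intro subspace_sum[OF tangent_subspace] subspace_scale[OF tangent_subspace]) (use insert in auto)
  then show ?case using insert assms
    by (simp add: g_add_right g_scale_right subspace_scale[OF tangent_subspace])
qed (simp_all add: g_zero_right assms)

lemma g_scale_left: "u \<in> S6 ==> v \<in> tangent u ==> w \<in> tangent u ==> g u (c *\<^sub>R w) v = c * g u w v"
  using g_sym g_scale_right subspace_scale[OF tangent_subspace] by metis

definition onset :: "vec7 => vec7 set => bool"
  where "onset u B \<longleftrightarrow> B \<subseteq> tangent u \<and> finite B \<and> (\<forall>v\<in>B. \<forall>w\<in>B. g u v w = (if v = w then 1 else 0))"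

lemma onb_iff: "is_orthonormal_basis g u B \<longleftrightarrow> onset u B \<and> card B = 6"
  by (auto simp: is_orthonormal_basis_def onset_def)

lemma onset_coeff:
  assumes "u \<in> S6" "onset u B" "b \<in> B"
  shows "g u b (\<Sum>b\<in>B. c b *\<^sub>R b) = c b"
proof -
  have "g u b (\<Sum>b\<in>B. c b *\<^sub>R b) = (\<Sum>b'\<in>B. c b' * g u b b')"
    using assms by (intro g_sum_right) (auto simp: onset_def)
  also have "\<dots> = (\<Sum>b'\<in>B. if b' = b then c b' else 0)"
    using assms by (intro sum.cong) (auto simp: onset_def)
  finally show ?thesis using assms by (simp add: onset_def)
qed

lemma onset_independent:
  assumes "u \<in> S6" "onset u B" shows "independent B"
proof (rule independent_if_scalars_zero)
  show "finite B" using assms by (simp add: onset_def)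
  fix c b assume "(\<Sum>x\<in>B. c x *\<^sub>R x) = 0" "b \<in> B"
  then show "c b = 0" using onset_coeff[OF assms \<open>b \<in> B\<close>, of c] g_zero_right[OF assms(1), of b] assms(2)
    by (auto simp: onset_def)
qed

lemma dim_tangent: "u \<in> S6 ==> dim (tangent u) = 6"
  unfolding tangent_def using dim_hyperplane[of u] S6_nonzero[of u] by simp

text \<open>Gram-Schmidt, one vector at a time: fewer than six vectors cannot span the tangent
  space.\<close>

lemma ex_onset: "u \<in> S6 ==> n \<le> 6 ==> \<exists>B. onset u B \<and> card B = n"
proof (induction n)
  case 0 then show ?case by (intro exI[of _ "{}"]) (simp add: onset_def)
next
  case (Suc n)
  then obtain B where B: "onset u B" "card B = n" by auto
  note u = Suc.prems(1)
  have Bt: "B \<subseteq> tangent u" "finite B" using B by (auto simp: onset_def)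
  have "\<not> tangent u \<subseteq> span B"
  proof
    assume "tangent u \<subseteq> span B"
    then have "dim (tangent u) \<le> card B" by (rule span_card_ge_dim[OF Bt(1) _ Bt(2)])
    then show False using dim_tangent[OF u] B(2) Suc.prems(2) by simp
  qed
  then obtain v where v: "v \<in> tangent u" "v \<notin> span B" by blast
  let ?s = "\<Sum>b\<in>B. g u v b *\<^sub>R b"
  define w where "w = v - ?s"
  have st: "?s \<in> tangent u" "?s \<in> span B"
    using Bt by (auto intro!: subspace_sum[OF tangent_subspace] subspace_scale[OF tangent_subspace])
      (rule span_sum, rule span_scale, rule span_base)
  have w: "w \<in> tangent u" "w \<noteq> 0" unfolding w_def using v st subspace_diff[OF tangent_subspace] by auto
  have wb: "g u b w = 0" if "b \<in> B" for b
  proof -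
    have bt: "b \<in> tangent u" using that Bt by blast
    have "g u b w = g u b v + g u b ((-1) *\<^sub>R ?s)"
      unfolding w_def using g_add_right[OF u bt v(1), of "(-1) *\<^sub>R ?s"] subspace_scale[OF tangent_subspace st(1), of "-1"] by simp
    also have "g u b ((-1) *\<^sub>R ?s) = - g u b ?s" using g_scale_right[OF u bt st(1), of "-1"] by simp
    also have "g u b ?s = g u v b" by (rule onset_coeff[OF u B(1) that])
    finally show ?thesis using g_sym[OF u bt v(1)] by simp
  qed
  define e where "e = (1 / sqrt (g u w w)) *\<^sub>R w"
  have gp: "g u w w > 0" by (rule g_pos[OF u w])
  have e: "e \<in> tangent u" unfolding e_def using w subspace_scale[OF tangent_subspace] by blast
  have ee: "g u e e = 1"
    unfolding e_def using w gp subspace_scale[OF tangent_subspace w(1)]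
    by (simp add: g_scale_right[OF u] g_scale_left[OF u] del: scaleR_scaleR)
  have be: "g u b e = 0" if "b \<in> B" for b
    unfolding e_def using wb[OF that] g_scale_right[OF u _ w(1)] that Bt by auto
  have eb: "g u e b = 0" if "b \<in> B" for b using be[OF that] g_sym[OF u e] that Bt by auto
  have "e \<notin> B" using be[of e] ee by auto
  then have "onset u (insert e B) \<and> card (insert e B) = Suc n"
    using B Bt e ee be eb by (auto simp: onset_def)
  then show ?case by blast
qed

lemma ex_onb: "u \<in> S6 ==> \<exists>B. is_orthonormal_basis g u B"
  using ex_onset[of u 6] by (simp add: onb_iff)

lemma onb_expansion:
  assumes u: "u \<in> S6" and B: "is_orthonormal_basis g u B" and v: "v \<in> tangent u"
  shows "v = (\<Sum>b\<in>B. g u v b *\<^sub>R b)"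
proof -
  have o: "onset u B" and c: "card B = 6" using B by (auto simp: onb_iff)
  have f: "finite B" and Bt: "B \<subseteq> tangent u" using o by (auto simp: onset_def)
  have "tangent u \<subseteq> span B"
    by (rule card_ge_dim_independent[OF Bt onset_independent[OF u o]]) (simp add: c dim_tangent[OF u])
  then obtain c where c: "v = (\<Sum>b\<in>B. c b *\<^sub>R b)" using v span_finite[OF f] by auto
  have "c b = g u v b" if "b \<in> B" for b
    using onset_coeff[OF u o that, of c] c that Bt g_sym[OF u v, of b] by auto
  then show ?thesis using c by (metis (no_types, lifting) sum.cong)
qed

text \<open>The matrix in \<open>vol_density\<close>. Declaring u a unit normal makes it invertible
  on all of \<open>vec7\<close>.\<close>

definition gm :: "vec7 => real ^ 7 ^ 7"
  where "gm u = (\<chi> i j. g u (tproj u (axis i 1)) (tproj u (axis j 1)) + u $ i * u $ j)"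

text \<open>The inverse metric on the tangent space, as the sum of b b^T over an orthonormal
  basis.\<close>

definition bmat :: "vec7 set => 7 => 7 => real" where "bmat B i j = (\<Sum>b\<in>B. b $ i * b $ j)"

definition bmat' :: "vec7 => vec7 set => real ^ 7 ^ 7"
  where "bmat' u B = (\<chi> i j. bmat B i j + u $ i * u $ j)"

lemma vec_axis_expansion: "v = (\<Sum>j\<in>UNIV. v $ j *\<^sub>R ax j)"
  using basis_expansion[of v] by (simp only: scalar_mult_eq_scaleR)

lemma g_tproj_sum:
  assumes "u \<in> S6" "w \<in> tangent u"
  shows "(\<Sum>j\<in>UNIV. g u w (tproj u (ax j)) * v $ j) = g u w (tproj u v)"
proof -
  have "tproj u v = (\<Sum>j\<in>UNIV. v $ j *\<^sub>R tproj u (ax j))"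
    by (subst vec_axis_expansion[of v]) (simp only: linear_sum[OF linear_tproj] linear_cmul[OF linear_tproj])
  then show ?thesis
    using g_sum_right[OF assms, of UNIV "\<lambda>j. tproj u (ax j)" "\<lambda>j. v $ j"] tproj_tangent[OF assms(1)]
    by (simp only: mult.commute)
qed

lemma gm_mult:
  assumes u: "u \<in> S6"
  shows "(\<Sum>j\<in>UNIV. gm u $ i $ j * v $ j) = g u (tproj u (ax i)) (tproj u v) + u $ i * (u \<bullet> v)"
  using g_tproj_sum[OF u tproj_tangent[OF u], of "ax i" v]
  by (simp add: gm_def distrib_right sum.distrib inner_vec_def sum_distrib_left mult.assoc)

lemma gm_bmat':
  assumes u: "u \<in> S6" and B: "is_orthonormal_basis g u B"
  shows "gm u ** bmat' u B = mat 1"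
proof -
  have Bt: "B \<subseteq> tangent u" using B by (simp add: is_orthonormal_basis_def)
  have "(\<Sum>j\<in>UNIV. gm u $ i $ j * (bmat B j k + u $ j * u $ k)) = (if i = k then 1 else 0)" for i k
  proof -
    have "(\<Sum>j\<in>UNIV. gm u $ i $ j * (bmat B j k + u $ j * u $ k))
       = (\<Sum>b\<in>B. (\<Sum>j\<in>UNIV. gm u $ i $ j * b $ j) * b $ k) + (\<Sum>j\<in>UNIV. gm u $ i $ j * u $ j) * u $ k"
      by (simp add: bmat_def distrib_left sum.distrib sum_distrib_left sum_distrib_right sum.swap[of _ B] mult.assoc)
    also have "(\<Sum>b\<in>B. (\<Sum>j\<in>UNIV. gm u $ i $ j * b $ j) * b $ k) = (\<Sum>b\<in>B. g u (tproj u (ax i)) b *\<^sub>R b) $ k"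
    proof -
      have "(\<Sum>j\<in>UNIV. gm u $ i $ j * b $ j) = g u (tproj u (ax i)) b" if "b \<in> B" for b
      proof -
        have "b \<in> tangent u" using that Bt by blast
        then show ?thesis unfolding gm_mult[OF u] tproj_of_tangent[OF \<open>b \<in> tangent u\<close>] by (simp add: tangent_def)
      qed
      then show ?thesis by simp
    qed
    also have "(\<Sum>b\<in>B. g u (tproj u (ax i)) b *\<^sub>R b) = tproj u (ax i)"
      by (rule onb_expansion[OF u B tproj_tangent[OF u], symmetric])
    also have "(\<Sum>j\<in>UNIV. gm u $ i $ j * u $ j) = u $ i"
      using g_zero_right[OF u tproj_tangent[OF u]] u by (simp add: gm_mult[OF u] tproj_u[OF u] mem_sphere dot_square_norm)
    finally show ?thesis by (simp add: tproj_def inner_axis) (simp add: axis_def)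
  qed
  then show ?thesis by (simp add: matrix_matrix_mult_def mat_def bmat'_def vec_eq_iff)
qed

text \<open>Up to the normal part \<open>bmat B\<close> is the inverse of \<open>gm\<close>, in
  which the basis does not occur.\<close>

lemma bmat_unique:
  assumes u: "u \<in> S6" and B: "is_orthonormal_basis g u B" and B': "is_orthonormal_basis g u B'"
  shows "bmat B = bmat B'"
proof -
  have "bmat' u B ** gm u = mat 1" by (rule iffD1[OF matrix_left_right_inverse gm_bmat'[OF u B]])
  moreover have "bmat' u B = bmat' u B ** (gm u ** bmat' u B')" by (simp only: gm_bmat'[OF u B'] matrix_mul_rid)
  ultimately have "bmat' u B = bmat' u B'" by (simp only: matrix_mul_assoc matrix_mul_lid)
  then show ?thesis by (simp add: bmat'_def vec_eq_iff fun_eq_iff)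
qed

lemma onb_J:
  assumes u: "u \<in> S6" and B: "is_orthonormal_basis g u B"
  shows "is_orthonormal_basis g u (std_J u ` B)" and "inj_on (std_J u) B"
proof -
  have Bt: "B \<subseteq> tangent u" using B by (simp add: is_orthonormal_basis_def)
  show inj: "inj_on (std_J u) B"
    using std_J_square[OF u] Bt by (intro inj_onI) (metis minus_equation_iff subsetD)
  show "is_orthonormal_basis g u (std_J u ` B)"
    using B inj g_J[OF u] std_J_tangent Bt
    by (auto simp: is_orthonormal_basis_def card_image inj_on_eq_iff subset_iff)
qed

definition onb :: "vec7 => vec7 set" where "onb u = (SOME B. is_orthonormal_basis g u B)"

lemma onb: "u \<in> S6 ==> is_orthonormal_basis g u (onb u)"
  unfolding onb_def by (rule someI_ex[OF ex_onb])

text \<open>The inverse metric, which raises indices; \<open>cgm\<close> lowers them again.\<close>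

definition cs :: "vec7 => 7 => 7 => complex" where "cs u i j = of_real (bmat (onb u) i j)"
definition cgm :: "vec7 => 7 => 7 => complex" where "cgm u i j = of_real (gm u $ i $ j)"

lemma cs_sym: "cs u i j = cs u j i"
  by (simp add: cs_def bmat_def mult.commute)

lemma cs_normal: "u \<in> S6 ==> (\<Sum>j\<in>UNIV. cs u i j * cv u $ j) = 0"
proof -
  assume u: "u \<in> S6"
  have "(\<Sum>j\<in>UNIV. b $ j * u $ j) = 0" if "b \<in> onb u" for b
    using onb[OF u] that by (auto simp: is_orthonormal_basis_def tangent_def inner_vec_def mult.commute)
  then have "(\<Sum>j\<in>UNIV. bmat (onb u) i j * u $ j) = 0"
    by (simp add: bmat_def sum_distrib_right sum.swap[of _ "onb u"] mult.assoc sum_distrib_left[symmetric])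
  then show ?thesis by (simp add: cs_def flip: of_real_mult of_real_sum)
qed

text \<open>The inverse metric is degenerate along the normal, so the product is the tangential
  projection instead of the identity.\<close>

lemma cgm_cs: "u \<in> S6 ==> (\<Sum>j\<in>UNIV. cgm u i j * cs u j k) = tanmat (cv u) i k"
  and cs_cgm: "u \<in> S6 ==> (\<Sum>j\<in>UNIV. cs u i j * cgm u j k) = tanmat (cv u) i k"
proof -
  assume u: "u \<in> S6"
  have gs: "gm u $ i $ j = gm u $ j $ i" for i j
    using g_sym[OF u tproj_tangent[OF u] tproj_tangent[OF u]] by (simp add: gm_def mult.commute)
  have gu: "(\<Sum>j\<in>UNIV. gm u $ i $ j * u $ j) = u $ i" for i
    using g_zero_right[OF u tproj_tangent[OF u]] u by (simp add: gm_mult[OF u] tproj_u[OF u] mem_sphere dot_square_norm)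
  have "(\<Sum>j\<in>UNIV. gm u $ i $ j * (bmat (onb u) j k + u $ j * u $ k)) = (if i = k then 1 else 0)" for i k
    using gm_bmat'[OF u onb[OF u]] by (simp add: matrix_matrix_mult_def mat_def bmat'_def vec_eq_iff)
  then have e: "(\<Sum>j\<in>UNIV. gm u $ i $ j * bmat (onb u) j k) = (if i = k then 1 else 0) - u $ i * u $ k" for i k
    by (simp add: distrib_left sum.distrib mult.assoc[symmetric] sum_distrib_right[symmetric] gu eq_diff_eq)
  show 1: "(\<Sum>j\<in>UNIV. cgm u i j * cs u j k) = tanmat (cv u) i k" for i k
    using arg_cong[OF e[of i k], of complex_of_real] unfolding tanmat_eq cgm_def cs_def
    by (simp split: if_splits)
  have "(\<Sum>j\<in>UNIV. cs u i j * cgm u j k) = (\<Sum>j\<in>UNIV. cgm u k j * cs u j i)"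
    by (simp add: cgm_def gs[of _ k] cs_sym[of u i] mult.commute)
  then show "(\<Sum>j\<in>UNIV. cs u i j * cgm u j k) = tanmat (cv u) i k"
    unfolding 1 tanmat_eq by (simp add: mult.commute eq_commute[of i])
qed

text \<open>Compatibility makes the image of an orthonormal basis under J orthonormal. The inverse
  metric can be computed from either basis, and J J = -1 turns the comparison into
  commutation.\<close>

lemma cs_J_commute:
  assumes u: "u \<in> S6"
  shows "(\<Sum>k\<in>UNIV. cs u i k * (cv u \<otimes> axis j 1) $ k) = (\<Sum>k\<in>UNIV. (cv u \<otimes> axis k 1) $ i * cs u k j)"
proof -
  let ?B = "onb u" and ?J = "\<lambda>i k. xcross u (ax k) $ i"
  have J: "std_J u v $ i = (\<Sum>k\<in>UNIV. ?J i k * v $ k)" for v i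
  proof -
    have l: "linear (xcross u)"
      by (rule linearI) (simp_all add: vec_eq_iff forall_7 xcross_nth algebra_simps)
    have "xcross u v = (\<Sum>k\<in>UNIV. v $ k *\<^sub>R xcross u (ax k))"
      by (subst vec_axis_expansion[of v]) (simp only: linear_sum[OF l] linear_cmul[OF l])
    then show ?thesis by (simp add: std_J_def cross7_eq mult.commute)
  qed
  have anti: "?J i k = - ?J k i" for i k
  proof -
    have "xcross u v \<bullet> w = - (xcross u w \<bullet> v)" for v w
      by (simp add: inner_vec_def sum_7 xcross_nth algebra_simps)
    from this[of "ax k" "ax i"] show ?thesis by (simp add: inner_axis)
  qed
  have JS: "(\<Sum>k\<in>UNIV. ?J i k * bmat B k j) = (\<Sum>b\<in>B. std_J u b $ i * b $ j)" for B i j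
    by (simp add: bmat_def J sum_distrib_left sum_distrib_right sum.swap[of _ B] mult.assoc)
  have "(\<Sum>k\<in>UNIV. ?J i k * bmat ?B k j) = (\<Sum>k\<in>UNIV. ?J i k * bmat (std_J u ` ?B) k j)"
    using bmat_unique[OF u onb[OF u] onb_J(1)[OF u onb[OF u]]] by simp
  also have "\<dots> = (\<Sum>b\<in>?B. std_J u (std_J u b) $ i * std_J u b $ j)"
    unfolding JS by (subst sum.reindex[OF onb_J(2)[OF u onb[OF u]]]) simp
  also have "\<dots> = (\<Sum>b\<in>?B. - (std_J u b $ j * b $ i))"
    using onb[OF u] std_J_square[OF u] by (intro sum.cong) (auto simp: is_orthonormal_basis_def subset_iff)
  also have "\<dots> = (\<Sum>k\<in>UNIV. bmat ?B i k * ?J k j)"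
    unfolding sum_negf JS[symmetric] anti[of j] by (simp add: sum_negf bmat_def mult.commute)
  finally have e: "(\<Sum>k\<in>UNIV. ?J i k * bmat ?B k j) = (\<Sum>k\<in>UNIV. bmat ?B i k * ?J k j)" .
  have c: "(cv u \<otimes> axis k 1) $ i = of_real (?J i k)" for i k
    using cv_xcross[of u "ax k"] by (metis cv_axis cv_nth)
  show ?thesis
    using arg_cong[OF e, of complex_of_real] by (simp add: c cs_def)
qed

lemma cs_pm: "u \<in> S6 ==> (\<Sum>k\<in>UNIV. cs u i k * pm (cv u) k j) = (\<Sum>k\<in>UNIV. pm (cv u) i k * cs u k j)"
  and cs_pp: "u \<in> S6 ==> (\<Sum>k\<in>UNIV. cs u i k * pp (cv u) k j) = (\<Sum>k\<in>UNIV. pp (cv u) i k * cs u k j)"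
proof -
  assume u: "u \<in> S6"
  let ?J = "\<lambda>i k. (cv u \<otimes> axis k 1) $ i"
  have d: "cv u \<odot> axis k 1 = cv u $ k" for k by (rule cdot_axis)
  have pmJ: "pm (cv u) i k = ((if i = k then 1 else 0) - cv u $ i * cv u $ k + \<i> * ?J i k) / 2"
    and ppJ: "pp (cv u) i k = ((if i = k then 1 else 0) - cv u $ i * cv u $ k + (- \<i>) * ?J i k) / 2" for i k
    unfolding pm_def pp_def Pm_def Pp_def d by (simp_all add: axis_def mult.commute)
  have n1: "(\<Sum>k\<in>UNIV. cs u i k * (cv u $ k * x)) = 0" for x
    using cs_normal[OF u, of i] by (simp only: mult.assoc[symmetric] sum_distrib_right[symmetric]) simp
  have n2: "(\<Sum>k\<in>UNIV. x * cv u $ k * cs u k j) = 0" for x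
    using cs_normal[OF u, of j] by (simp only: mult.assoc sum_distrib_left[symmetric] cs_sym[of u _ j] mult.commute[of "cv u $ _"]) simp
  have L: "(\<Sum>k\<in>UNIV. cs u i k * (((if k = j then 1 else 0) - cv u $ k * cv u $ j + s * ?J k j) / 2))
      = (cs u i j + s * (\<Sum>k\<in>UNIV. cs u i k * ?J k j)) / 2" for s
    using n1[of "cv u $ j"]
    by (simp add: right_diff_distrib distrib_left sum.distrib sum_subtractf sum_divide_distrib[symmetric] if_one_mult sum_distrib_left mult.left_commute del: cv_nth)
  have R: "(\<Sum>k\<in>UNIV. ((if i = k then 1 else 0) - cv u $ i * cv u $ k + s * ?J i k) / 2 * cs u k j)
      = (cs u i j + s * (\<Sum>k\<in>UNIV. ?J i k * cs u k j)) / 2" for s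
    using n2[of "cv u $ i"]
    by (simp add: left_diff_distrib distrib_right sum.distrib sum_subtractf sum_divide_distrib[symmetric] if_one_mult sum_distrib_left mult.assoc del: cv_nth)
  show "(\<Sum>k\<in>UNIV. cs u i k * pm (cv u) k j) = (\<Sum>k\<in>UNIV. pm (cv u) i k * cs u k j)"
    unfolding pmJ L R cs_J_commute[OF u] ..
  show "(\<Sum>k\<in>UNIV. cs u i k * pp (cv u) k j) = (\<Sum>k\<in>UNIV. pp (cv u) i k * cs u k j)"
    unfolding ppJ L R cs_J_commute[OF u] ..
qed

lemma sm_gm: "sm (\<lambda>u. of_real (gm u $ i $ j))"
proof -
  let ?h = "\<lambda>u. g u (tproj u (ax i)) (tproj u (ax j))"
  have "smooth_on (\<lambda>x. norm x * (norm x * g (retr x) (frechet_derivative retr (at x) (ax i)) (frechet_derivative retr (at x) (ax j)))) (- {0})"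
    by (intro smooth_on_bilinear[OF bounded_bilinear_mult open_minus0] smooth_on_norm g_smooth)
  moreover have "norm x * (norm x * g (retr x) (frechet_derivative retr (at x) (ax i)) (frechet_derivative retr (at x) (ax j))) = ?h (retr x)"
    if "x \<in> - {0}" for x
  proof -
    have x: "x \<noteq> 0" using that by simp
    note r = retr_in_S6[OF x]
    have e: "frechet_derivative retr (at x) v = inverse (norm x) *\<^sub>R tproj (retr x) v" for v
      by (simp add: frechet_derivative_retr[OF x] tproj_def)
    note t = tproj_tangent[OF r]
    have "g (retr x) (inverse (norm x) *\<^sub>R tproj (retr x) (ax i)) (inverse (norm x) *\<^sub>R tproj (retr x) (ax j))
       = inverse (norm x) * (inverse (norm x) * ?h (retr x))"
      using g_scale_right[OF r subspace_scale[OF tangent_subspace t] t] g_scale_left[OF r t t] by (metis (no_types, lifting))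
    then show ?thesis unfolding e using x by (simp add: field_simps)
  qed
  ultimately have "smooth_on (\<lambda>x. ?h (retr x)) (- {0})"
    using smooth_on_cong[OF open_minus0, of _ "\<lambda>x. ?h (retr x)"] by (metis (no_types, lifting))
  then have "sm (\<lambda>u. complex_of_real (?h u) + of_real (u $ i) * of_real (u $ j))"
    by (intro sm_intros sm_of_real)
  then show ?thesis by (simp add: gm_def)
qed

lemma sm_det:
  assumes "\<And>i j. sm (\<lambda>u. of_real (A u $ i $ j))"
  shows "sm (\<lambda>u. complex_of_real (det (A u :: real ^ 7 ^ 7)))"
  unfolding det_def of_real_sum of_real_mult of_real_prod by (intro sm_intros assms)

text \<open>The inverse of \<open>gm\<close> is Q Q^T, where the columns of Q are u and an
  orthonormal basis. Its determinant is a square.\<close>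

lemma det_gm_pos: assumes u: "u \<in> S6" shows "det (gm u) > 0"
proof -
  let ?B = "onb u"
  have B: "?B \<subseteq> tangent u" "finite ?B" "card ?B = 6" using onb[OF u] by (auto simp: is_orthonormal_basis_def)
  have nu: "u \<notin> ?B" using B(1) u by (auto simp: tangent_def mem_sphere dot_square_norm)
  have "card (UNIV :: 7 set) = card (insert u ?B)" using B nu by simp
  then obtain h where h: "bij_betw h (UNIV :: 7 set) (insert u ?B)"
    using finite_same_card_bij[of "UNIV :: 7 set" "insert u ?B"] B by auto
  define Q :: "real ^ 7 ^ 7" where "Q = (\<chi> i j. h j $ i)"
  have "Q ** transpose Q = bmat' u ?B"
  proof -
    have "(\<Sum>j\<in>UNIV. h j $ i * h j $ k) = (\<Sum>b\<in>insert u ?B. b $ i * b $ k)" for i k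
      using sum.reindex_bij_betw[OF h, of "\<lambda>b. b $ i * b $ k"] by simp
    then show ?thesis using B nu
      by (simp add: Q_def matrix_matrix_mult_def transpose_def bmat'_def bmat_def vec_eq_iff add.commute)
  qed
  then have "det (bmat' u ?B) = det Q * det Q" by (metis det_mul det_transpose)
  moreover have "det (gm u) * det (bmat' u ?B) = 1"
    using arg_cong[OF gm_bmat'[OF u onb[OF u]], of det] by (simp add: det_mul)
  ultimately have "det (gm u) * (det Q * det Q) = 1" by simp
  then show ?thesis using mult_nonpos_nonneg[of "det (gm u)" "det Q * det Q"] by (intro ccontr[of "0 < _"]) auto
qed

lemma vol_density_eq: "vol_density g u = sqrt (det (gm u))"
  by (simp add: vol_density_def gm_def)

lemma vol_density_pos: "u \<in> S6 ==> vol_density g u > 0"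
  by (simp add: vol_density_eq det_gm_pos)

lemma sm_vol_density: "sm (\<lambda>u. complex_of_real (vol_density g u))"
  unfolding vol_density_eq by (intro sm_sqrt sm_det sm_gm det_gm_pos)

lemma sm_cgm: "sm (\<lambda>u. cgm u i j)" unfolding cgm_def by (rule sm_gm)

text \<open>The bases \<open>onb u\<close> are chosen pointwise, without any continuity. Cramer's
  rule expresses the inverse metric by determinants with smooth entries instead.\<close>

lemma sm_cs: "sm (\<lambda>u. cs u i k)"
proof -
  let ?A = "\<lambda>u. (\<chi> r l. if l = i then axis k 1 $ r else gm u $ r $ l) :: real ^ 7 ^ 7"
  have "cs u i k = of_real (det (?A u)) / of_real (det (gm u)) - of_real (u $ i) * of_real (u $ k)" if u: "u \<in> S6" for u
  proof -
    have "gm u *v (\<chi> j. bmat' u (onb u) $ j $ k) = axis k 1"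
      using gm_bmat'[OF u onb[OF u]]
      by (simp add: matrix_vector_mult_def matrix_matrix_mult_def mat_def vec_eq_iff axis_def)
    then have "(\<chi> j. bmat' u (onb u) $ j $ k) = (\<chi> j. det (\<chi> r l. if l = j then axis k 1 $ r else gm u $ r $ l) / det (gm u))"
      using cramer[of "gm u"] det_gm_pos[OF u] by simp
    then have "bmat' u (onb u) $ i $ k = det (?A u) / det (gm u)" by (simp add: vec_eq_iff)
    then have "bmat (onb u) i k = det (?A u) / det (gm u) - u $ i * u $ k" by (simp add: bmat'_def eq_diff_eq)
    then show ?thesis by (simp add: cs_def)
  qed
  moreover have "sm (\<lambda>u. of_real (det (?A u)) / of_real (det (gm u)) - of_real (u $ i) * of_real (u $ k))"
  proof (intro sm_diff sm_divide sm_mult sm_coord sm_det sm_gm)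
    show "sm (\<lambda>u. complex_of_real (?A u $ r $ l))" for r l
      by (cases "l = i") (simp_all add: sm_const sm_gm)
    show "complex_of_real (det (gm u)) \<noteq> 0" if "u \<in> S6" for u using det_gm_pos[OF that] by simp
  qed
  ultimately show ?thesis using sm_cong by (metis (no_types, lifting))
qed

subsection \<open>The inner product of forms in components\<close>

lemma cmono_cv_cnj: "cnj (cmono (map cv vs) I) = cmono (map cv vs) I"
  by (induction "map cv vs" I arbitrary: vs rule: cmono.induct) auto

text \<open>Inserting a sum of b b^T in each slot and multiplying out gives a sum over lists of
  basis vectors.\<close>

lemma act_cs:
  assumes u: "u \<in> S6"
  shows "act (cs u) c I = (\<Sum>vs\<in>tup (onb u) (length I). cmono (map cv vs) I * ev c (map cv vs))"
proof -
  let ?n = "length I"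
  have fB: "finite (onb u)" using onb[OF u] by (simp add: is_orthonormal_basis_def)
  have "(\<Prod>j<?n. cs u (I ! j) (J ! j)) = (\<Sum>vs\<in>tup (onb u) ?n. cmono (map cv vs) I * cmono (map cv vs) J)" if "J \<in> idx ?n" for J
  proof -
    have "(\<Prod>j<?n. cs u (I ! j) (J ! j)) = (\<Prod>j<?n. \<Sum>b\<in>onb u. cv b $ (I ! j) * cv b $ (J ! j))"
      by (simp add: cs_def bmat_def)
    also have "\<dots> = (\<Sum>vs\<in>tup (onb u) ?n. \<Prod>j<?n. cv (vs ! j) $ (I ! j) * cv (vs ! j) $ (J ! j))"
      by (rule prod_sum_tup[OF fB])
    also have "\<dots> = (\<Sum>vs\<in>tup (onb u) ?n. cmono (map cv vs) I * cmono (map cv vs) J)"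
      using that by (intro sum.cong refl) (simp add: tup_def cmono_prod prod.distrib)
    finally show ?thesis .
  qed
  then have "act (cs u) c I = (\<Sum>J\<in>idx ?n. \<Sum>vs\<in>tup (onb u) ?n. cmono (map cv vs) I * (c J * cmono (map cv vs) J))"
    by (simp add: act_prod sum_distrib_left sum_distrib_right mult_ac)
  also have "\<dots> = (\<Sum>vs\<in>tup (onb u) ?n. \<Sum>J\<in>idx ?n. cmono (map cv vs) I * (c J * cmono (map cv vs) J))"
    by (rule sum.swap)
  also have "\<dots> = (\<Sum>vs\<in>tup (onb u) ?n. cmono (map cv vs) I * ev c (map cv vs))"
    by (intro sum.cong refl) (simp add: ev_def tup_def sum_distrib_left)
  finally show ?thesis .
qed

lemma cnj_ev: "cnj (ev c (map cv vs)) = ev (\<lambda>I. cnj (c I)) (map cv vs)"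
  by (simp add: ev_def cmono_cv_cnj)

lemma sum_act_cs:
  assumes u: "u \<in> S6"
  shows "(\<Sum>I\<in>idx k. a I * act (cs u) (\<lambda>I. cnj (b I)) I)
    = (\<Sum>vs\<in>tup (onb u) k. ev a (map cv vs) * cnj (ev b (map cv vs)))"
proof -
  have "(\<Sum>I\<in>idx k. a I * act (cs u) (\<lambda>I. cnj (b I)) I)
     = (\<Sum>I\<in>idx k. \<Sum>vs\<in>tup (onb u) k. a I * cmono (map cv vs) I * cnj (ev b (map cv vs)))"
    by (intro sum.cong refl) (simp add: act_cs[OF u] in_idx cnj_ev sum_distrib_left mult.assoc)
  also have "\<dots> = (\<Sum>vs\<in>tup (onb u) k. \<Sum>I\<in>idx k. a I * cmono (map cv vs) I * cnj (ev b (map cv vs)))"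
    by (rule sum.swap)
  also have "\<dots> = (\<Sum>vs\<in>tup (onb u) k. ev a (map cv vs) * cnj (ev b (map cv vs)))"
    by (intro sum.cong refl) (simp add: ev_def tup_def sum_distrib_right)
  finally show ?thesis .
qed

text \<open>The sum over lists of basis vectors becomes a contraction with the inverse metric, which
  depends smoothly on u.\<close>

lemma form_inner_eq:
  assumes u: "u \<in> S6"
  shows "form_inner g k u (tensor_of k a) (tensor_of k b) = (\<Sum>I\<in>idx k. a I * act (cs u) (\<lambda>I. cnj (b I)) I) / fact k"
  unfolding sum_act_cs[OF u] form_inner_def onb_def[symmetric] Let_def
  by (intro arg_cong2[of _ _ _ _ "(/)"] sum.cong refl) (auto simp: tup_def tensor_of_def)

lemma form_inner_self:
  assumes u: "u \<in> S6"
  shows "(\<Sum>I\<in>idx k. a I * act (cs u) (\<lambda>I. cnj (a I)) I) = of_real (\<Sum>vs\<in>tup (onb u) k. (cmod (ev a (map cv vs)))\<^sup>2)"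
  unfolding sum_act_cs[OF u] by (simp only: of_real_sum complex_norm_square)

lemma cnj_act: "cnj (act M c I) = act (\<lambda>i j. cnj (M i j)) (\<lambda>I. cnj (c I)) I"
  by (induction I arbitrary: c) simp_all

lemma act_cgm_cs:
  assumes u: "u \<in> S6" and t: "tang (cv u) k c" and I: "length I = k"
  shows "act (cgm u) (act (cs u) (\<lambda>J. cnj (c J))) I = cnj (c I)"
    and "act (cs u) (act (cgm u) (\<lambda>J. cnj (c J))) I = cnj (c I)"
proof -
  have "cnj (act (tanmat (cv u)) c I) = act (tanmat (cv u)) (\<lambda>J. cnj (c J)) I"
    by (simp add: cnj_act cnj_pm cnj_pp add.commute)
  then have "act (tanmat (cv u)) (\<lambda>J. cnj (c J)) I = cnj (c I)" using t I by (simp add: tang_def)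
  then show "act (cgm u) (act (cs u) (\<lambda>J. cnj (c J))) I = cnj (c I)"
    "act (cs u) (act (cgm u) (\<lambda>J. cnj (c J))) I = cnj (c I)"
    unfolding act_act cgm_cs[OF u] cs_cgm[OF u] by simp_all
qed

text \<open>A vanishing sum of squares makes the tensor vanish on all lists of basis vectors, so
  raising all its indices gives 0; lowering them recovers the components.\<close>

lemma form_inner_self_zero:
  assumes u: "u \<in> S6" and t: "tang (cv u) k a" and I: "length I = k"
    and z: "(\<Sum>I\<in>idx k. a I * act (cs u) (\<lambda>I. cnj (a I)) I) = 0"
  shows "a I = 0"
proof -
  have f: "finite (tup (onb u) k)" using onb[OF u] by (intro finite_tup) (simp add: is_orthonormal_basis_def)
  have "(\<Sum>vs\<in>tup (onb u) k. (cmod (ev a (map cv vs)))\<^sup>2) = 0"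
    using z unfolding form_inner_self[OF u] of_real_eq_0_iff .
  then have e: "ev a (map cv vs) = 0" if "vs \<in> tup (onb u) k" for vs
    using that f by (simp add: sum_nonneg_eq_0_iff)
  have "act (cs u) (\<lambda>I. cnj (a I)) J = 0" if "length J = k" for J
    unfolding act_cs[OF u] that using e by (intro sum.neutral) (simp add: cnj_ev[symmetric])
  then have "act (cgm u) (act (cs u) (\<lambda>J. cnj (a J))) I = act (cgm u) (\<lambda>J. 0) I"
    using I by (intro act_cong) simp
  then show ?thesis using act_cgm_cs(1)[OF u t I] by (simp add: act_zero)
qed

end

section \<open>The formal adjoint of dbar\<close>

lemma sph_int_nonneg:
  assumes f: "sm f" and h: "\<And>u. u \<in> S6 ==> f u = of_real (h u)" "\<And>u. u \<in> S6 ==> h u \<ge> 0"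
  shows "Re (sph_int f) \<ge> 0"
proof -
  have "Re (LINT x:ball 0 1|lborel. f (retr x)) = (LINT x|lborel. indicator (ball 0 1) x *\<^sub>R Re (f (retr x)))"
    using integral_Re[OF sm_set_integrable[OF f, unfolded set_integrable_def]]
    by (simp add: set_lebesgue_integral_def)
  also have "\<dots> \<ge> 0"
  proof (rule integral_nonneg_AE)
    show "AE x in lborel. 0 \<le> indicator (ball 0 1) x *\<^sub>R Re (f (retr x))"
      using AE_nonzero by eventually_elim (use h retr_in_S6 in \<open>auto simp: indicator_def\<close>)
  qed
  finally show ?thesis by (simp add: sph_int_def)
qed

lemma pm_transpose_fun: "(\<lambda>i j. pm u j i) = pp u" and pp_transpose_fun: "(\<lambda>i j. pp u j i) = pm u"
  by (intro ext pm_transpose pp_transpose)+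

lemma tanmat_commute: "pencil 1 (pp u) (pm u) = tanmat u"
  by (simp add: add.commute)

lemma cnj_tp: "cnj (tp M N p c I) = tp (\<lambda>i j. cnj (M i j)) (\<lambda>i j. cnj (N i j)) p (\<lambda>I. cnj (c I)) I"
  by (induction I arbitrary: p c) simp_all

text \<open>Coefficients that are paired with forms of type \<open>(p,k-p)\<close> carry the transposed projections.\<close>

abbreviation dtyped :: "cvec => nat => nat => (7 list => complex) => bool"
  where "dtyped u \<equiv> typed (pp u) (pm u)"

lemma dtyped_tang: "dtyped u k p c ==> tang u k c"
proof -
  assume h: "dtyped u k p c"
  have "act (pencil 1 (pp u) (pm u)) c I = 1 ^ p * c I" if "length I = k" for I using h that unfolding typed_def by blast
  then show ?thesis unfolding tanmat_commute by (simp only: tang_def power_one mult_1) simp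
qed

text \<open>The type projection is moved to K by transposition and acts there as the
  identity.\<close>

lemma sum_ftp_dtyped:
  assumes "dtyped u k p K" "p \<le> k"
  shows "(\<Sum>L\<in>idx k. ftp u p c L * K L) = (\<Sum>L\<in>idx k. c L * K L)"
proof -
  have "(\<Sum>L\<in>idx k. ftp u p c L * K L) = (\<Sum>L\<in>idx k. K L * ftp u p c L)" by (simp add: mult.commute)
  also have "\<dots> = (\<Sum>L\<in>idx k. tp (pp u) (pm u) p K L * c L)"
    unfolding tp_transpose pm_transpose_fun pp_transpose_fun ..
  also have "\<dots> = (\<Sum>L\<in>idx k. c L * K L)"
    using assms by (intro sum.cong refl) (simp add: typed_tp_same in_idx mult.commute)
  finally show ?thesis .
qed

text \<open>Moving an entry to the front of K produces the same sign as in \<open>antis\<close>, so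
  all k + 1 positions contribute equally.\<close>

lemma sum_antis_altern:
  assumes "altern K"
  shows "(\<Sum>L\<in>idx (Suc k). antis T L * K L) = of_nat (Suc k) * (\<Sum>j\<in>UNIV. \<Sum>J\<in>idx k. T j J * K (j # J))"
proof -
  have "antis T L * K L = (\<Sum>i<Suc k. T (L ! i) (drop_nth i L) * K (L ! i # drop_nth i L))" if L: "L \<in> idx (Suc k)" for L
  proof -
    have st: "(-1) ^ i * T (L ! i) (drop_nth i L) * K L = T (L ! i) (drop_nth i L) * K (L ! i # drop_nth i L)" if "i < Suc k" for i
    proof -
      have "K L = K (take i L @ L ! i # drop (Suc i) L)" using id_take_nth_drop[of i L] that L by (simp add: in_idx)
      also have "\<dots> = (-1) ^ i * K (L ! i # drop_nth i L)"
        using altern_move[OF assms, of "[]" "take i L"] that L by (simp add: drop_nth_def in_idx)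
      finally have "(-1) ^ i * T (L ! i) (drop_nth i L) * K L
          = ((-1) ^ i * (-1) ^ i) * (T (L ! i) (drop_nth i L) * K (L ! i # drop_nth i L))" by (simp only: mult_ac)
      then show ?thesis by (simp add: power_mult_distrib[symmetric])
    qed
    have "length L = Suc k" using L by (simp add: in_idx)
    then show ?thesis unfolding antis_def sum_distrib_right by (auto intro!: sum.cong st simp del: sum.lessThan_Suc)
  qed
  then have "(\<Sum>L\<in>idx (Suc k). antis T L * K L) = (\<Sum>L\<in>idx (Suc k). \<Sum>i<Suc k. T (L ! i) (drop_nth i L) * K (L ! i # drop_nth i L))"
    by (rule sum.cong[OF refl])
  also have "\<dots> = (\<Sum>i<Suc k. \<Sum>L\<in>idx (Suc k). T (L ! i) (drop_nth i L) * K (L ! i # drop_nth i L))" by (rule sum.swap)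
  also have "\<dots> = (\<Sum>i<Suc k. \<Sum>j\<in>UNIV. \<Sum>J\<in>idx k. T j J * K (j # J))"
    by (rule sum.cong[OF refl]) (use sum_insert_nth[of _ k "\<lambda>j J. T j J * K (j # J)"] in simp)
  finally show ?thesis by simp
qed

text \<open>The formal transpose of \<open>dcomp\<close>: a flat divergence in the first slot. The
  factor k + 1 comes from \<open>sum_antis_altern\<close>.\<close>

definition divg :: "nat => (vec7 => 7 list => complex) => vec7 => 7 list => complex"
  where "divg k K u J = - of_nat (Suc k) * (\<Sum>j\<in>UNIV. sder j (\<lambda>u. K u (j # J)) u)"

text \<open>Integration by parts. The mean curvature term of \<open>sph_int_sder\<close> drops out because
  \<open>K\<close> is tangential.\<close>

lemma sph_int_dcomp:
  assumes c: "\<And>I. sm (\<lambda>u. c u I)" and K: "\<And>I. sm (\<lambda>u. K u I)"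
    and a: "\<And>u. u \<in> S6 ==> altern (K u)" and t: "\<And>u. u \<in> S6 ==> tang (cv u) (Suc k) (K u)"
  shows "sph_int (\<lambda>u. \<Sum>L\<in>idx (Suc k). dcomp k c u L * K u L) = sph_int (\<lambda>u. \<Sum>J\<in>idx k. c u J * divg k K u J)"
proof -
  let ?D = "\<lambda>u. \<Sum>L\<in>idx (Suc k). dcomp k c u L * K u L" and ?G = "\<lambda>u. \<Sum>J\<in>idx k. c u J * divg k K u J"
  let ?b = "\<lambda>u. \<Sum>j\<in>UNIV. \<Sum>J\<in>idx k. of_nat (Suc k) * sder j (\<lambda>u. c u J * K u (j # J)) u"
  have uK: "(\<Sum>j\<in>UNIV. of_real (u $ j) * K u (j # J)) = 0" if "u \<in> S6" "J \<in> idx k" for u J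
    using tang_kills[OF t[OF that(1)], of "[]" J] that cv_cdot_self[of u] by (simp add: in_idx)
  have e: "?D u = ?b u + ?G u" if u: "u \<in> S6" for u
  proof -
    have "?D u = of_nat (Suc k) * (\<Sum>j\<in>UNIV. \<Sum>J\<in>idx k. dterm k c u j J * K u (j # J))"
      unfolding dcomp_def by (rule sum_antis_altern[OF a[OF u]])
    also have "(\<Sum>j\<in>UNIV. \<Sum>J\<in>idx k. dterm k c u j J * K u (j # J))
       = (\<Sum>j\<in>UNIV. \<Sum>J\<in>idx k. sder j (\<lambda>u. c u J) u * K u (j # J)) - of_nat k * (\<Sum>J\<in>idx k. c u J * (\<Sum>j\<in>UNIV. of_real (u $ j) * K u (j # J)))"
    proof -
      have "(\<Sum>j\<in>UNIV. \<Sum>J\<in>idx k. of_nat k * (c u J * (of_real (u $ j) * K u (j # J))))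
         = (\<Sum>J\<in>idx k. \<Sum>j\<in>UNIV. of_nat k * (c u J * (of_real (u $ j) * K u (j # J))))" by (rule sum.swap)
      moreover have "dterm k c u j J * K u (j # J) = sder j (\<lambda>u. c u J) u * K u (j # J)
          - of_nat k * (c u J * (of_real (u $ j) * K u (j # J)))" for j J
        by (simp add: dterm_def algebra_simps)
      ultimately show ?thesis by (simp only: sum_subtractf sum_distrib_left)
    qed
    also have "(\<Sum>J\<in>idx k. c u J * (\<Sum>j\<in>UNIV. of_real (u $ j) * K u (j # J))) = 0"
      using uK[OF u] by simp
    also have "(\<Sum>j\<in>UNIV. \<Sum>J\<in>idx k. sder j (\<lambda>u. c u J) u * K u (j # J))
       = (\<Sum>j\<in>UNIV. \<Sum>J\<in>idx k. sder j (\<lambda>u. c u J * K u (j # J)) u - c u J * sder j (\<lambda>u. K u (j # J)) u)"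
      by (simp add: sder_mult[OF c K u])
    also have "\<dots> = (\<Sum>j\<in>UNIV. \<Sum>J\<in>idx k. sder j (\<lambda>u. c u J * K u (j # J)) u) - (\<Sum>J\<in>idx k. \<Sum>j\<in>UNIV. c u J * sder j (\<lambda>u. K u (j # J)) u)"
      by (simp only: sum_subtractf sum.swap[of _ "idx k" UNIV])
    finally show ?thesis
      by (simp only: divg_def right_diff_distrib sum_distrib_left sum_negf mult.left_commute mult_minus_left
          mult_minus_right mult_zero_right diff_0_right minus_diff_eq diff_minus_eq_add add_uminus_conv_diff)
  qed
  have sb: "sm ?b" by (intro sm_intros sm_sder c K)
  have sd: "sm ?G" unfolding divg_def by (intro sm_intros sm_sder c K)
  have "sph_int ?D = sph_int (\<lambda>u. ?b u + ?G u)"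
    by (rule sph_int_cong[OF e]) (intro sm_sum sm_mult sm_dcomp c K sm_add sb sd | assumption)+
  also have "\<dots> = sph_int ?b + sph_int ?G" by (rule sph_int_add[OF sb sd])
  also have "sph_int ?b = 0"
  proof -
    have "sph_int ?b = (\<Sum>j\<in>UNIV. \<Sum>J\<in>idx k. of_nat (Suc k) * (6 * sph_int (\<lambda>u. of_real (u $ j) * (c u J * K u (j # J)))))"
      by (simp only: sph_int_sum sm_sum sm_mult sm_const sm_sder c K sph_int_cmult sph_int_sder)
    also have "\<dots> = sph_int (\<lambda>u. \<Sum>j\<in>UNIV. \<Sum>J\<in>idx k. of_nat (Suc k) * (6 * (of_real (u $ j) * (c u J * K u (j # J)))))"
      by (simp only: sph_int_sum sm_sum sm_mult sm_const sm_coord c K sph_int_cmult)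
    also have "\<dots> = sph_int (\<lambda>u. 0)"
    proof (rule sph_int_cong)
      fix u assume u: "u \<in> S6"
      have "(\<Sum>j\<in>UNIV. \<Sum>J\<in>idx k. of_nat (Suc k) * (6 * (of_real (u $ j) * (c u J * K u (j # J)))))
         = (\<Sum>J\<in>idx k. \<Sum>j\<in>UNIV. of_nat (Suc k) * (6 * (of_real (u $ j) * (c u J * K u (j # J)))))" by (rule sum.swap)
      also have "\<dots> = (\<Sum>J\<in>idx k. of_nat (Suc k) * (6 * (c u J * (\<Sum>j\<in>UNIV. of_real (u $ j) * K u (j # J)))))"
        by (simp only: sum_distrib_left mult.left_commute)
      also have "\<dots> = 0" using uK[OF u] by simp
      finally show "(\<Sum>j\<in>UNIV. \<Sum>J\<in>idx k. of_nat (Suc k) * (6 * (of_real (u $ j) * (c u J * K u (j # J))))) = 0" .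
    qed (intro sm_intros c K)+
    finally show ?thesis by (simp add: sph_int_zero)
  qed
  finally show ?thesis by simp
qed

lemma sm_divg: "(\<And>I. sm (\<lambda>u. K u I)) ==> sm (\<lambda>u. divg k K u J)"
  unfolding divg_def by (intro sm_intros sm_sder)

lemma altern_divg:
  assumes K: "\<And>I. sm (\<lambda>u. K u I)" and a: "\<And>u. u \<in> S6 ==> altern (K u)" and u: "u \<in> S6"
  shows "altern (divg k K u)"
proof -
  have "altern (\<lambda>J. sder j (\<lambda>u. K u (j # J)) u)" for j
    unfolding altern_def
  proof (intro allI)
    fix xs ys and x y
    have "sder j (\<lambda>u. K u (j # xs @ x # y # ys)) u = sder j (\<lambda>u. - K u (j # xs @ y # x # ys)) u"
      by (rule sder_cong[OF _ S6_nonzero[OF u]]) (rule alternD[OF altern_Cons[OF a]])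
    then show "sder j (\<lambda>u. K u (j # xs @ x # y # ys)) u = - sder j (\<lambda>u. K u (j # xs @ y # x # ys)) u"
      by (simp only: sder_minus[OF K u])
  qed
  then show ?thesis unfolding divg_def[abs_def] by (intro altern_scale altern_sum)
qed

lemma typed_scale: "typed M N k p c ==> typed M N k p (\<lambda>I. a * c I)"
  by (simp add: typed_def act_scale)

context metric_on_S6
begin

text \<open>The conjugate of a form with all indices raised, times the volume density. Pairing with
  it is the integrand of the L2 product, so the dependence on the metric is concentrated
  here.\<close>

definition dual :: "nat => (vec7 => 7 list => complex) => vec7 => 7 list => complex"
  where "dual k c u I = of_real (vol_density g u) / fact k * act (cs u) (\<lambda>I. cnj (c u I)) I"

lemma sm_dual: "(\<And>I. sm (\<lambda>u. c u I)) ==> sm (\<lambda>u. dual k c u I)"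
  unfolding dual_def divide_inverse by (intro sm_intros sm_vol_density sm_act sm_cs)

lemma altern_cnj: "altern c ==> altern (\<lambda>I. cnj (c I))"
  unfolding altern_def[of "\<lambda>I. cnj (c I)"] using alternD[of c] by (metis complex_cnj_minus)

lemma altern_dual: "altern (c u) ==> altern (dual k c u)"
  unfolding dual_def[abs_def] by (intro altern_scale altern_act altern_cnj)

lemma typed_cnj:
  assumes "ftyped (cv u) k p c" shows "dtyped (cv u) k p (\<lambda>I. cnj (c I))"
  unfolding typed_def
proof (intro allI impI)
  fix I :: "7 list" and z assume I: "length I = k"
  have "act (pencil z (pp (cv u)) (pm (cv u))) (\<lambda>I. cnj (c I)) I = cnj (act (pencil (cnj z) (pm (cv u)) (pp (cv u))) c I)"
    by (simp add: cnj_act cnj_pm cnj_pp)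
  also have "\<dots> = cnj (cnj z ^ p * c I)" using assms I unfolding typed_def by simp
  finally show "act (pencil z (pp (cv u)) (pm (cv u))) (\<lambda>I. cnj (c I)) I = z ^ p * cnj (c I)" by simp
qed

lemma typed_act_cs:
  assumes u: "u \<in> S6" and t: "dtyped (cv u) k p c" shows "dtyped (cv u) k p (act (cs u) c)"
  unfolding typed_def
proof (intro allI impI)
  fix I :: "7 list" and z assume I: "length I = k"
  let ?Q = "pencil z (pp (cv u)) (pm (cv u))"
  have "(\<Sum>k\<in>UNIV. ?Q i k * cs u k j) = (\<Sum>k\<in>UNIV. cs u i k * ?Q k j)" for i j
  proof -
    have "(\<Sum>k\<in>UNIV. ?Q i k * cs u k j) = z * (\<Sum>k\<in>UNIV. pp (cv u) i k * cs u k j) + (\<Sum>k\<in>UNIV. pm (cv u) i k * cs u k j)"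
      by (simp add: distrib_right sum.distrib sum_distrib_left mult.assoc)
    also have "\<dots> = (\<Sum>k\<in>UNIV. cs u i k * ?Q k j)"
      unfolding cs_pp[OF u, symmetric] cs_pm[OF u, symmetric]
      by (simp add: distrib_left sum.distrib sum_distrib_left mult.left_commute)
    finally show ?thesis .
  qed
  then have "act ?Q (act (cs u) c) I = act (cs u) (act ?Q c) I" unfolding act_act by simp
  also have "\<dots> = act (cs u) (\<lambda>J. z ^ p * c J) I"
    using t I by (intro act_cong) (simp add: typed_def)
  finally show "act ?Q (act (cs u) c) I = z ^ p * act (cs u) c I" by (simp add: act_scale)
qed

lemma dtyped_dual: "u \<in> S6 ==> ftyped (cv u) k p (c u) ==> dtyped (cv u) k p (dual k' c u)"
  unfolding dual_def[abs_def] by (intro typed_scale typed_act_cs typed_cnj)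

lemma L2_inner_eq:
  assumes \<phi>: "\<And>u. u \<in> S6 ==> \<phi> u = tensor_of k (a u)" and \<psi>: "\<And>u. u \<in> S6 ==> \<psi> u = tensor_of k (b u)"
    and a: "\<And>I. sm (\<lambda>u. a u I)" and b: "\<And>I. sm (\<lambda>u. b u I)"
  shows "L2_inner g k \<phi> \<psi> = sph_int (\<lambda>u. \<Sum>I\<in>idx k. a u I * dual k b u I)"
proof -
  let ?f = "\<lambda>u. \<Sum>I\<in>idx k. a u I * dual k b u I"
  have e: "of_real (vol_density g u) * form_inner g k u (\<phi> u) (\<psi> u) = ?f u" if "u \<in> S6" for u
    by (simp add: form_inner_eq[OF that] \<phi>[OF that] \<psi>[OF that] dual_def sum_distrib_left sum_divide_distrib mult_ac)
  have f: "sm ?f" by (intro sm_intros sm_dual a b)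
  have f': "sm (\<lambda>u. of_real (vol_density g u) * form_inner g k u (\<phi> u) (\<psi> u))"
    by (rule iffD2[OF sm_cong[OF e] f])
  show ?thesis
    using sph_int_cong[OF e f' f] by (simp add: L2_inner_def sphere_integral_def sph_int_def)
qed

lemma L2_Omega:
  assumes "\<phi> \<in> Omega std_J p q" "\<psi> \<in> Omega std_J p' q'" "p + q = k" "p' + q' = k"
  shows "L2_inner g k \<phi> \<psi> = sph_int (\<lambda>u. \<Sum>I\<in>idx k. fcomp \<phi> u I * dual k (fcomp \<psi>) u I)"
  using Omega_comps[OF assms(1)] Omega_comps[OF assms(2)] assms(3,4)
  by (intro L2_inner_eq) auto

lemma sum_dual_eq:
  "u \<in> S6 ==> (\<Sum>I\<in>idx k. a I * dual k b u I)
    = of_real (vol_density g u) / fact k * (\<Sum>vs\<in>tup (onb u) k. ev a (map cv vs) * cnj (ev (b u) (map cv vs)))"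
  unfolding sum_act_cs[symmetric] by (simp add: dual_def sum_distrib_left mult_ac)

lemma L2_cnj:
  assumes "\<phi> \<in> Omega std_J p q" "\<psi> \<in> Omega std_J p q"
  shows "L2_inner g (p + q) \<phi> \<psi> = cnj (L2_inner g (p + q) \<psi> \<phi>)"
proof -
  note s = Omega_comps(1)[OF assms(1)] Omega_comps(1)[OF assms(2)]
  have e: "(\<Sum>I\<in>idx (p + q). fcomp \<phi> u I * dual (p + q) (fcomp \<psi>) u I)
     = cnj (\<Sum>I\<in>idx (p + q). fcomp \<psi> u I * dual (p + q) (fcomp \<phi>) u I)" if "u \<in> S6" for u
    unfolding sum_dual_eq[OF that] by (simp add: mult.commute)
  have "L2_inner g (p + q) \<phi> \<psi> = sph_int (\<lambda>u. cnj (\<Sum>I\<in>idx (p + q). fcomp \<psi> u I * dual (p + q) (fcomp \<phi>) u I))"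
    unfolding L2_Omega[OF assms refl refl] by (rule sph_int_cong[OF e]) (intro sm_sum sm_mult sm_dual sm_cnj s | assumption)+
  also have "\<dots> = cnj (L2_inner g (p + q) \<psi> \<phi>)"
    unfolding L2_Omega[OF assms(2,1) refl refl] by (rule sph_int_cnj) (intro sm_sum sm_mult sm_dual s)
  finally show ?thesis .
qed

lemma sum_dual_self:
  assumes u: "u \<in> S6"
  shows "(\<Sum>I\<in>idx k. c u I * dual k c u I)
    = of_real (vol_density g u / fact k * (\<Sum>vs\<in>tup (onb u) k. (cmod (ev (c u) (map cv vs)))\<^sup>2))"
proof -
  have "(\<Sum>I\<in>idx k. c u I * dual k c u I) = of_real (vol_density g u) / fact k * (\<Sum>I\<in>idx k. c u I * act (cs u) (\<lambda>I. cnj (c u I)) I)"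
    unfolding dual_def by (simp only: sum_distrib_left mult.left_commute)
  then show ?thesis using form_inner_self[OF u, of "c u" k] by simp
qed

lemma sum_dual_self_nonneg: "u \<in> S6 ==> 0 \<le> vol_density g u / fact k * (\<Sum>vs\<in>tup (onb u) k. (cmod (ev c (map cv vs)))\<^sup>2)"
  using vol_density_pos[of u] by (intro mult_nonneg_nonneg divide_nonneg_nonneg sum_nonneg) auto

lemma L2_self:
  assumes \<phi>: "\<phi> \<in> Omega std_J p q"
  shows "0 \<le> Re (L2_inner g (p + q) \<phi> \<phi>)" "Im (L2_inner g (p + q) \<phi> \<phi>) = 0"
    and "L2_inner g (p + q) \<phi> \<phi> = 0 ==> \<phi> = 0"
proof -
  let ?k = "p + q"
  note o = Omega_comps[OF \<phi>]
  let ?f = "\<lambda>u. \<Sum>I\<in>idx ?k. fcomp \<phi> u I * dual ?k (fcomp \<phi>) u I"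
  have f: "sm ?f" by (intro sm_intros sm_dual o(1))
  show "0 \<le> Re (L2_inner g ?k \<phi> \<phi>)"
    unfolding L2_Omega[OF \<phi> \<phi> refl refl] by (rule sph_int_nonneg[OF f sum_dual_self sum_dual_self_nonneg])
  show "Im (L2_inner g ?k \<phi> \<phi>) = 0"
    using arg_cong[OF L2_cnj[OF \<phi> \<phi>], of Im] by simp
  assume "L2_inner g ?k \<phi> \<phi> = 0"
  then have z: "sph_int ?f = 0" unfolding L2_Omega[OF \<phi> \<phi> refl refl] .
  have "\<phi> u = 0" for u
  proof (cases "u \<in> S6")
    case True
    have fu: "?f u = 0" by (rule sph_int_pos_zero[OF f sum_dual_self sum_dual_self_nonneg z True])
    then have "of_real (vol_density g u) / fact ?k * (\<Sum>I\<in>idx ?k. fcomp \<phi> u I * act (cs u) (\<lambda>I. cnj (fcomp \<phi> u I)) I) = 0"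
      by (simp add: dual_def sum_distrib_left mult_ac)
    then have "(\<Sum>I\<in>idx ?k. fcomp \<phi> u I * act (cs u) (\<lambda>I. cnj (fcomp \<phi> u I)) I) = 0"
      using vol_density_pos[OF True] by simp
    then have "fcomp \<phi> u I = 0" if "length I = ?k" for I
      by (rule form_inner_self_zero[OF True o(4)[OF True] that])
    then have "tensor_of ?k (fcomp \<phi> u) = tensor_of ?k (\<lambda>I. 0)" by (rule tensor_of_cong)
    then show ?thesis using o(5)[OF True] by (simp add: tensor_of_zero)
  qed (rule o(6))
  then show "\<phi> = 0" by (auto simp: fun_eq_iff)
qed

text \<open>The dual of a form of type (p, q + 1) has pure type, and pairing with it performs the
  type projection. So dbar may be replaced by the exterior derivative.\<close>

lemma L2_dbar:
  assumes \<theta>: "\<theta> \<in> Omega std_J p q" and \<phi>: "\<phi> \<in> Omega std_J p (Suc q)"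
  shows "L2_inner g (p + Suc q) (dbar std_J p q \<theta>) \<phi>
    = sph_int (\<lambda>u. \<Sum>L\<in>idx (Suc (p + q)). dcomp (p + q) (fcomp \<theta>) u L * dual (Suc (p + q)) (fcomp \<phi>) u L)"
proof -
  let ?k = "p + q" and ?K = "dual (Suc (p + q)) (fcomp \<phi>)"
  note o = Omega_comps[OF \<theta>] and o' = Omega_comps[OF \<phi>] and d = dbar_Omega[OF \<theta>]
  have e: "(\<Sum>L\<in>idx (Suc ?k). fcomp (dbar std_J p q \<theta>) u L * ?K u L) = (\<Sum>L\<in>idx (Suc ?k). dcomp ?k (fcomp \<theta>) u L * ?K u L)"
    if u: "u \<in> S6" for u
  proof -
    have "(\<Sum>L\<in>idx (Suc ?k). fcomp (dbar std_J p q \<theta>) u L * ?K u L) = (\<Sum>L\<in>idx (Suc ?k). ftp (cv u) p (dcomp ?k (fcomp \<theta>) u) L * ?K u L)"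
      unfolding dbar_eq[OF \<theta>] by (intro sum.cong refl) (simp add: cmp_mkfield[OF u] in_idx)
    also have "\<dots> = (\<Sum>L\<in>idx (Suc ?k). dcomp ?k (fcomp \<theta>) u L * ?K u L)"
      using o'(3)[OF u] by (intro sum_ftp_dtyped dtyped_dual[OF u]) simp_all
    finally show ?thesis .
  qed
  show ?thesis
    unfolding L2_Omega[OF d \<phi> refl refl] unfolding add_Suc_right
    by (rule sph_int_cong[OF e]) (intro sm_sum sm_mult sm_dual o'(1) sm_dcomp o(1) Omega_comps(1)[OF d] | assumption)+
qed

text \<open>Integration by parts turns the left side into a pairing with the divergence of the dual.
  It remains to write this pairing as an L2 product: undo \<open>dual\<close> by lowering indices,
  dividing by the density and conjugating, and project to type (p,q).\<close>

lemma adjoint_exists: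
  assumes \<phi>: "\<phi> \<in> Omega std_J p (Suc q)"
  shows "\<exists>\<psi>\<in>Omega std_J p q. \<forall>\<theta>\<in>Omega std_J p q.
    L2_inner g (p + Suc q) (dbar std_J p q \<theta>) \<phi> = L2_inner g (p + q) \<theta> \<psi>"
proof -
  let ?k = "p + q"
  note o = Omega_comps[OF \<phi>]
  define K where "K = dual (Suc ?k) (fcomp \<phi>)"
  have sK: "sm (\<lambda>u. K u I)" for I unfolding K_def by (intro sm_dual o(1))
  have aK: "altern (K u)" if "u \<in> S6" for u unfolding K_def by (rule altern_dual[where c = "fcomp \<phi>", OF o(2)[OF that]])
  have tK: "tang (cv u) (Suc ?k) (K u)" if "u \<in> S6" for u
    unfolding K_def using dtyped_tang[OF dtyped_dual[OF that, of "Suc ?k" p]] o(3)[OF that] by simp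
  \<comment> \<open>Cancels the density, the factorial and the inverse metric that
    \<open>dual\<close> introduces.\<close>
  define X where "X = (\<lambda>u I. fact ?k / of_real (vol_density g u) * act (cgm u) (divg ?k K u) I)"
  have sX: "sm (\<lambda>u. X u I)" for I
    unfolding X_def using vol_density_pos
    by (intro sm_mult sm_divide sm_const sm_vol_density sm_act sm_cgm sm_divg sK) force
  have aX: "altern (X u)" if "u \<in> S6" for u
    unfolding X_def by (intro altern_scale altern_act altern_divg sK aK that)
  define c where "c = (\<lambda>u. ftp (cv u) p (\<lambda>I. cnj (X u I)))"
  have \<psi>: "mkfield ?k c \<in> Omega std_J p q"
  proof (rule mkfield_Omega)
    show "altern (c u)" if "u \<in> S6" for u unfolding c_def by (intro altern_tp altern_cnj aX that)
    show "ftyped (cv u) ?k p (c u)" if "u \<in> S6" for u unfolding c_def by (rule ftyped_ftp[OF cv_cdot_self[OF that]])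
    show "sm (\<lambda>u. c u I)" for I unfolding c_def by (intro sm_tp sm_pm sm_pp sm_cnj sX)
  qed
  have "L2_inner g (p + Suc q) (dbar std_J p q \<theta>) \<phi> = L2_inner g ?k \<theta> (mkfield ?k c)" if \<theta>: "\<theta> \<in> Omega std_J p q" for \<theta>
  proof -
    note t = Omega_comps[OF \<theta>]
    have e: "(\<Sum>J\<in>idx ?k. fcomp \<theta> u J * divg ?k K u J) = (\<Sum>J\<in>idx ?k. fcomp \<theta> u J * dual ?k (fcomp (mkfield ?k c)) u J)"
      if u: "u \<in> S6" for u
    proof -
      let ?v = "complex_of_real (vol_density g u)"
      have v: "?v \<noteq> 0" using vol_density_pos[OF u] by simp
      have 1: "dual ?k (fcomp (mkfield ?k c)) u J = ?v / fact ?k * tp (pp (cv u)) (pm (cv u)) p (act (cs u) (X u)) J"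
        if J: "J \<in> idx ?k" for J
      proof -
        have "act (cs u) (\<lambda>I. cnj (fcomp (mkfield ?k c) u I)) J = act (cs u) (tp (pp (cv u)) (pm (cv u)) p (X u)) J"
        proof (rule act_cong)
          fix I :: "7 list" assume "length I = length J"
          then have "fcomp (mkfield ?k c) u I = c u I" using J by (intro cmp_mkfield[OF u]) (simp add: in_idx)
          then show "cnj (fcomp (mkfield ?k c) u I) = tp (pp (cv u)) (pm (cv u)) p (X u) I"
            by (simp add: c_def cnj_tp cnj_pm cnj_pp)
        qed
        also have "\<dots> = tp (pp (cv u)) (pm (cv u)) p (act (cs u) (X u)) J"
          by (rule tp_act_commute[OF cs_pp[OF u] cs_pm[OF u]])
        finally show ?thesis by (simp add: dual_def)
      qed
      have "(\<Sum>J\<in>idx ?k. fcomp \<theta> u J * dual ?k (fcomp (mkfield ?k c)) u J)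
         = ?v / fact ?k * (\<Sum>J\<in>idx ?k. fcomp \<theta> u J * tp (pp (cv u)) (pm (cv u)) p (act (cs u) (X u)) J)"
        by (simp add: 1 sum_distrib_left mult_ac)
      \<comment> \<open>As \<theta> has type (p,q), it absorbs the type projection; being
        tangential, it also absorbs the \<open>tanmat\<close> that \<open>cs\<close> and
        \<open>cgm\<close> leave behind.\<close>
      also have "(\<Sum>J\<in>idx ?k. fcomp \<theta> u J * tp (pp (cv u)) (pm (cv u)) p (act (cs u) (X u)) J)
         = (\<Sum>J\<in>idx ?k. fcomp \<theta> u J * act (cs u) (X u) J)"
        unfolding tp_transpose pm_transpose_fun pp_transpose_fun
        using t(3)[OF u] by (intro sum.cong refl) (simp add: typed_tp_same[of _ _ ?k] in_idx)
      also have "\<dots> = fact ?k / ?v * (\<Sum>J\<in>idx ?k. fcomp \<theta> u J * act (tanmat (cv u)) (divg ?k K u) J)"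
        unfolding X_def act_scale act_act cs_cgm[OF u] by (simp only: sum_distrib_left mult.left_commute)
      also have "(\<Sum>J\<in>idx ?k. fcomp \<theta> u J * act (tanmat (cv u)) (divg ?k K u) J) = (\<Sum>J\<in>idx ?k. fcomp \<theta> u J * divg ?k K u J)"
      proof -
        have tr: "(\<lambda>i j. tanmat (cv u) j i) = tanmat (cv u)"
          unfolding tanmat_eq by (auto simp: fun_eq_iff mult.commute)
        show ?thesis unfolding act_transpose tr
          using t(4)[OF u] by (intro sum.cong refl) (simp add: tang_def in_idx)
      qed
      finally show ?thesis using v by simp
    qed
    have "L2_inner g (p + Suc q) (dbar std_J p q \<theta>) \<phi> = sph_int (\<lambda>u. \<Sum>J\<in>idx ?k. fcomp \<theta> u J * divg ?k K u J)"
      unfolding L2_dbar[OF \<theta> \<phi>] K_def[symmetric] by (rule sph_int_dcomp[OF t(1) sK aK tK])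
    also have "\<dots> = L2_inner g ?k \<theta> (mkfield ?k c)"
      unfolding L2_Omega[OF \<theta> \<psi> refl refl]
      by (rule sph_int_cong[OF e]) (intro sm_sum sm_mult t(1) sm_divg sK sm_dual Omega_comps(1)[OF \<psi>] | assumption)+
    finally show ?thesis .
  qed
  with \<psi> show ?thesis by blast
qed

lemma Omega_lin:
  assumes "\<phi> \<in> Omega std_J p q" "\<psi> \<in> Omega std_J p q"
  shows "(\<lambda>u. \<phi> u - \<psi> u) \<in> Omega std_J p q" "\<phi> + \<psi> \<in> Omega std_J p q"
proof -
  have m: "form_at u (p + q) p (\<phi> u)" "form_at u (p + q) p (\<psi> u)" if "u \<in> S6" for u
    using assms that by (auto simp: Omega_iff)
  have "form_at u (p + q) p (\<phi> u - \<psi> u)" "form_at u (p + q) p (\<phi> u + \<psi> u)" if "u \<in> S6" for u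
    using cs.subspace_diff[OF form_at_subspace, of "\<phi> u" u "p + q" p "\<psi> u"]
      cs.subspace_add[OF form_at_subspace, of "\<phi> u" u "p + q" p "\<psi> u"] m[OF that] by simp_all
  moreover have "cmp (\<phi> u - \<psi> u) I = cmp (\<phi> u) I - cmp (\<psi> u) I" "cmp (\<phi> u + \<psi> u) I = cmp (\<phi> u) I + cmp (\<psi> u) I" for u I
    by (simp_all add: cmp_def)
  ultimately show "(\<lambda>u. \<phi> u - \<psi> u) \<in> Omega std_J p q" "\<phi> + \<psi> \<in> Omega std_J p q"
    using assms unfolding Omega_iff by (auto intro: sm_diff sm_add)
qed

lemma dual_diff: "dual k (\<lambda>u I. a u I - b u I) u I = dual k a u I - dual k b u I"
  using act_add[of "cs u" "\<lambda>I. cnj (a u I)" "\<lambda>I. - cnj (b u I)" I]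
  by (simp add: dual_def act_minus right_diff_distrib)

lemma L2_diff_right:
  assumes "\<theta> \<in> Omega std_J p q" "\<phi> \<in> Omega std_J p q" "\<psi> \<in> Omega std_J p q"
  shows "L2_inner g (p + q) \<theta> (\<lambda>u. \<phi> u - \<psi> u) = L2_inner g (p + q) \<theta> \<phi> - L2_inner g (p + q) \<theta> \<psi>"
proof -
  have d: "cmp (\<phi> u - \<psi> u) I = cmp (\<phi> u) I - cmp (\<psi> u) I" for u I by (simp add: cmp_def)
  note s = Omega_comps(1)[OF assms(1)] Omega_comps(1)[OF assms(2)] Omega_comps(1)[OF assms(3)]
  show ?thesis
    unfolding L2_Omega[OF assms(1) Omega_lin(1)[OF assms(2,3)] refl refl] L2_Omega[OF assms(1,2) refl refl]
      L2_Omega[OF assms(1,3) refl refl] d dual_diff right_diff_distrib sum_subtractf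
    by (rule sph_int_diff) (intro sm_sum sm_mult sm_dual s)+
qed

lemma L2_add_left:
  assumes "\<theta> \<in> Omega std_J p q" "\<phi> \<in> Omega std_J p q" "\<psi> \<in> Omega std_J p q"
  shows "L2_inner g (p + q) (\<phi> + \<psi>) \<theta> = L2_inner g (p + q) \<phi> \<theta> + L2_inner g (p + q) \<psi> \<theta>"
proof -
  have d: "cmp ((\<phi> + \<psi>) u) I = cmp (\<phi> u) I + cmp (\<psi> u) I" for u I by (simp add: cmp_def)
  note s = Omega_comps(1)[OF assms(1)] Omega_comps(1)[OF assms(2)] Omega_comps(1)[OF assms(3)]
  show ?thesis
    unfolding L2_Omega[OF Omega_lin(2)[OF assms(2,3)] assms(1) refl refl] L2_Omega[OF assms(2,1) refl refl]
      L2_Omega[OF assms(3,1) refl refl] d distrib_right sum.distrib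
    by (rule sph_int_add) (intro sm_sum sm_mult sm_dual s)+
qed

lemma zero_Omega: "0 \<in> Omega std_J p q"
  unfolding Omega_iff using cs.subspace_0[OF form_at_subspace] by (auto simp: cmp_def sm_const)

lemma L2_zero_right: "\<theta> \<in> Omega std_J p q ==> L2_inner g (p + q) \<theta> 0 = 0"
  using L2_diff_right[of \<theta> p q 0 0] zero_Omega by (simp add: zero_fun_def)

lemma L2_zero_left: "\<theta> \<in> Omega std_J p q ==> L2_inner g (p + q) 0 \<theta> = 0"
  using L2_add_left[of \<theta> p q 0 0] zero_Omega by simp

text \<open>The description in \<open>dbar_adj\<close> has a unique solution, since the difference
  of two solutions is orthogonal to itself.\<close>

lemma dbar_adj:
  assumes \<phi>: "\<phi> \<in> Omega std_J p (Suc q)"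
  shows "dbar_adj std_J g p q \<phi> \<in> Omega std_J p q"
    and "\<theta> \<in> Omega std_J p q ==> L2_inner g (p + Suc q) (dbar std_J p q \<theta>) \<phi> = L2_inner g (p + q) \<theta> (dbar_adj std_J g p q \<phi>)"
proof -
  let ?P = "\<lambda>\<psi>. \<psi> \<in> Omega std_J p q \<and> (\<forall>\<theta>\<in>Omega std_J p q.
    L2_inner g (p + Suc q) (dbar std_J p q \<theta>) \<phi> = L2_inner g (p + q) \<theta> \<psi>)"
  obtain \<psi> where \<psi>: "?P \<psi>" using adjoint_exists[OF \<phi>] by blast
  have "\<psi>' = \<psi>" if \<psi>': "?P \<psi>'" for \<psi>'
  proof -
    have o: "\<psi> \<in> Omega std_J p q" "\<psi>' \<in> Omega std_J p q" using \<psi> \<psi>' by blast+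
    let ?d = "\<lambda>u. \<psi>' u - \<psi> u"
    have d: "?d \<in> Omega std_J p q" by (rule Omega_lin(1)[OF o(2,1)])
    have "L2_inner g (p + q) ?d \<psi>' = L2_inner g (p + q) ?d \<psi>" using \<psi> \<psi>' d by metis
    then have "L2_inner g (p + q) ?d ?d = 0" by (simp add: L2_diff_right[OF d o(2,1)])
    from L2_self(3)[OF d this] show ?thesis by (auto simp: fun_eq_iff)
  qed
  then have un: "\<And>\<psi>'. ?P \<psi>' ==> \<psi>' = \<psi>" .
  have "?P (THE \<psi>. ?P \<psi>)" by (rule theI[of ?P, OF \<psi> un])
  then have P: "?P (dbar_adj std_J g p q \<phi>)" unfolding dbar_adj_def .
  then show "dbar_adj std_J g p q \<phi> \<in> Omega std_J p q" by blast
  show "\<theta> \<in> Omega std_J p q ==> L2_inner g (p + Suc q) (dbar std_J p q \<theta>) \<phi> = L2_inner g (p + q) \<theta> (dbar_adj std_J g p q \<phi>)"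
    using P by blast
qed

text \<open>In degree q = 0 the Laplacian has one term, and pairing it with \<phi> gives the squared
  norm of dbar \<phi>.\<close>

theorem harmonic_0:
  assumes \<phi>: "\<phi> \<in> Omega std_J p 0" and h: "dbar_laplacian std_J g p 0 \<phi> = 0"
  shows "dbar std_J p 0 \<phi> = 0"
proof -
  note d = dbar_Omega[OF \<phi>]
  have "dbar_adj std_J g p 0 (dbar std_J p 0 \<phi>) = 0" using h by (simp add: dbar_laplacian_def)
  then have "L2_inner g (p + Suc 0) (dbar std_J p 0 \<phi>) (dbar std_J p 0 \<phi>) = 0"
    using dbar_adj(2)[OF d \<phi>] L2_zero_right[OF \<phi>] by simp
  then show ?thesis by (rule L2_self(3)[OF d])
qed

text \<open>Pairing the Laplacian with \<phi> gives the sum of the squared norms of the adjoint and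
  of dbar \<phi>, so both vanish.\<close>

theorem harmonic_Suc:
  assumes \<phi>: "\<phi> \<in> Omega std_J p (Suc q)" and h: "dbar_laplacian std_J g p (Suc q) \<phi> = 0"
  shows "dbar_adj std_J g p q \<phi> = 0"
proof -
  let ?A = "dbar_adj std_J g p q \<phi>" and ?D = "dbar std_J p (Suc q) \<phi>"
  let ?B = "dbar_adj std_J g p (Suc q) ?D"
  note d = dbar_Omega[OF \<phi>] and a = dbar_adj(1)[OF \<phi>]
  note b = dbar_adj(1)[OF d] and da = dbar_Omega[OF dbar_adj(1)[OF \<phi>]]
  have "dbar std_J p q ?A + ?B = 0" using h by (simp add: dbar_laplacian_def)
  then have "L2_inner g (p + Suc q) (dbar std_J p q ?A) \<phi> + L2_inner g (p + Suc q) ?B \<phi> = 0"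
    using L2_add_left[OF \<phi> da b] L2_zero_left[OF \<phi>] by simp
  moreover have "L2_inner g (p + Suc q) (dbar std_J p q ?A) \<phi> = L2_inner g (p + q) ?A ?A"
    by (rule dbar_adj(2)[OF \<phi> a])
  moreover have "L2_inner g (p + Suc q) ?B \<phi> = cnj (L2_inner g (p + Suc (Suc q)) ?D ?D)"
    unfolding L2_cnj[OF b \<phi>] dbar_adj(2)[OF d \<phi>] ..
  ultimately have s: "L2_inner g (p + q) ?A ?A + cnj (L2_inner g (p + Suc (Suc q)) ?D ?D) = 0" by simp
  have "Re (L2_inner g (p + q) ?A ?A) = 0"
    using arg_cong[OF s, of Re] L2_self(1)[OF a] L2_self(1)[OF d] by simp
  then have "L2_inner g (p + q) ?A ?A = 0" using L2_self(2)[OF a] by (simp add: complex_eq_iff)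
  then show ?thesis by (rule L2_self(3)[OF a])
qed

end

section \<open>Evaluation on vectors of pure type\<close>

lemma ev_append: "ev c (xs @ ys) = ev (\<lambda>J. ev (\<lambda>I. c (I @ J)) xs) ys"
proof (induction xs arbitrary: c)
  case (Cons x xs)
  show ?case by (simp add: ev_Cons Cons.IH ev_sum ev_cscale)
qed simp

lemma ev_slot: "ev c (xs @ z # ys) = (\<Sum>i\<in>UNIV. z $ i * ev (\<lambda>J. ev (\<lambda>I. c (I @ i # J)) xs) ys)"
  by (simp add: ev_append ev_Cons)

lemma ev_slot_add: "ev c (xs @ (a + b) # ys) = ev c (xs @ a # ys) + ev c (xs @ b # ys)"
  by (simp add: ev_slot distrib_right sum.distrib)

lemma ev_slot_scale: "ev c (xs @ (k *s a) # ys) = k * ev c (xs @ a # ys)"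
  by (simp add: ev_slot sum_distrib_left mult.assoc)

lemma ev_slot_zero: "ev c (xs @ 0 # ys) = 0"
  by (simp add: ev_slot)

lemma ev_update:
  "i < length zs ==> ev c (zs[i := a + b]) = ev c (zs[i := a]) + ev c (zs[i := b])"
  "i < length zs ==> ev c (zs[i := k *s a]) = k * ev c (zs[i := a])"
  "i < length zs ==> ev c (zs[i := 0]) = 0"
  by (simp_all only: upd_conv_take_nth_drop ev_slot_add ev_slot_scale ev_slot_zero)

lemma ev_minus: "ev (\<lambda>I. - c I) zs = - ev c zs"
  using ev_cscale[of "-1" c zs] by simp

lemma altern_ev:
  assumes "altern c" shows "altern (ev c)"
  unfolding altern_def
proof (intro allI)
  fix xs ys and a b :: cvec
  let ?d = "\<lambda>J. ev (\<lambda>I. c (I @ J)) xs"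
  have d: "?d (i # j # J) = - ?d (j # i # J)" for i j J
  proof -
    have "(\<lambda>I. c (I @ i # j # J)) = (\<lambda>I. - c (I @ j # i # J))" by (intro ext alternD assms)
    then show ?thesis by (simp only: ev_minus)
  qed
  have "ev ?d (a # b # ys) = (\<Sum>i\<in>UNIV. \<Sum>j\<in>UNIV. a $ i * (b $ j * ev (\<lambda>J. ?d (i # j # J)) ys))"
    by (simp add: ev_Cons sum_distrib_left)
  also have "\<dots> = (\<Sum>j\<in>UNIV. \<Sum>i\<in>UNIV. a $ i * (b $ j * ev (\<lambda>J. ?d (i # j # J)) ys))" by (rule sum.swap)
  also have "\<dots> = (\<Sum>j\<in>UNIV. \<Sum>i\<in>UNIV. - (b $ j * (a $ i * ev (\<lambda>J. ?d (j # i # J)) ys)))"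
  proof (intro sum.cong refl)
    fix i j
    have "ev (\<lambda>J. ?d (i # j # J)) ys = - ev (\<lambda>J. ?d (j # i # J)) ys" unfolding d[of i j] by (rule ev_minus)
    then show "a $ i * (b $ j * ev (\<lambda>J. ?d (i # j # J)) ys) = - (b $ j * (a $ i * ev (\<lambda>J. ?d (j # i # J)) ys))"
      by (simp only: mult_minus_right mult.left_commute)
  qed
  also have "\<dots> = - ev ?d (b # a # ys)"
    by (simp add: ev_Cons sum_distrib_left sum_negf)
  finally show "ev c (xs @ a # b # ys) = - ev c (xs @ b # a # ys)" unfolding ev_append .
qed

definition cder :: "cvec => (vec7 => 7 list => complex) => vec7 => 7 list => complex"
  where "cder a c u J = dder a (\<lambda>u. c u J) u"

lemma sm_ev_fields:
  assumes "\<And>I. sm (\<lambda>u. c u I)" "\<And>Z. Z \<in> set Zs ==> smv Z"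
  shows "sm (\<lambda>u. ev (c u) (map (\<lambda>Z. Z u) Zs))"
  by (rule sm_ev) (use assms in auto)

text \<open>The product rule, separating the derivative of the components from those of the argument
  fields. Identities for arguments of pure type can be differentiated with it.\<close>

lemma dder_ev:
  assumes "\<And>I. sm (\<lambda>u. c u I)" "\<And>Z. Z \<in> set Zs ==> smv Z" "u \<in> S6"
  shows "dder a (\<lambda>u. ev (c u) (map (\<lambda>Z. Z u) Zs)) u = ev (cder a c u) (map (\<lambda>Z. Z u) Zs)
    + (\<Sum>i<length Zs. ev (c u) ((map (\<lambda>Z. Z u) Zs)[i := vder a (Zs ! i) u]))"
  using assms(1,2)
proof (induction Zs arbitrary: c)
  case Nil
  then show ?case by (simp add: cder_def)
next
  case (Cons Z Zs)
  let ?zs = "map (\<lambda>Z. Z u) Zs" and ?c = "\<lambda>m v J. c v (m # J)"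
  have Z: "smv Z" and s: "\<And>I. sm (\<lambda>u. c u I)" using Cons.prems by auto
  have se: "sm (\<lambda>u. ev (?c m u) (map (\<lambda>Z. Z u) Zs))" for m
    by (rule sm_ev_fields) (use Cons.prems in auto)
  have ih: "dder a (\<lambda>u. ev (?c m u) (map (\<lambda>Z. Z u) Zs)) u = ev (cder a (?c m) u) ?zs
      + (\<Sum>i<length Zs. ev (?c m u) (?zs[i := vder a (Zs ! i) u]))" for m
    by (rule Cons.IH) (use Cons.prems in auto)
  have "dder a (\<lambda>u. ev (c u) (map (\<lambda>Z. Z u) (Z # Zs))) u
     = dder a (\<lambda>u. \<Sum>m\<in>UNIV. Z u $ m * ev (?c m u) (map (\<lambda>Z. Z u) Zs)) u"
    by (simp add: ev_Cons)
  also have "\<dots> = (\<Sum>m\<in>UNIV. Z u $ m * dder a (\<lambda>u. ev (?c m u) (map (\<lambda>Z. Z u) Zs)) u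
      + vder a Z u $ m * ev (?c m u) ?zs)"
    by (simp add: dder_sum[OF assms(3) sm_mult[OF smvD[OF Z] se]] dder_mult[OF smvD[OF Z] se assms(3)])
  also have "\<dots> = (\<Sum>m\<in>UNIV. Z u $ m * ev (cder a (?c m) u) ?zs)
      + ((\<Sum>m\<in>UNIV. vder a Z u $ m * ev (?c m u) ?zs)
      + (\<Sum>m\<in>UNIV. \<Sum>i<length Zs. Z u $ m * ev (?c m u) (?zs[i := vder a (Zs ! i) u])))"
    by (simp add: ih distrib_left sum.distrib sum_distrib_left algebra_simps)
  also have "(\<Sum>m\<in>UNIV. \<Sum>i<length Zs. Z u $ m * ev (?c m u) (?zs[i := vder a (Zs ! i) u]))
     = (\<Sum>i<length Zs. \<Sum>m\<in>UNIV. Z u $ m * ev (?c m u) (?zs[i := vder a (Zs ! i) u]))" by (rule sum.swap)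
  also have "(\<Sum>m\<in>UNIV. Z u $ m * ev (cder a (?c m) u) ?zs) = ev (cder a c u) (Z u # ?zs)"
    by (simp add: ev_Cons cder_def[abs_def])
  finally show ?case
    by (simp add: ev_Cons sum.lessThan_Suc_shift del: sum.lessThan_Suc)
qed

definition pure :: "cvec => bool list => cvec list => bool"
  where "pure u = list_all2 (\<lambda>b z. z \<in> (if b then Em u else Ep u))"

lemma pure_simps [simp]:
  "pure u [] []" "pure u (b # bs) (z # zs) \<longleftrightarrow> z \<in> (if b then Em u else Ep u) \<and> pure u bs zs"
  by (simp_all add: pure_def)

lemma pure_length: "pure u bs zs ==> length bs = length zs"
  by (simp add: pure_def list_all2_lengthD)

lemma pure_append: "pure u bs zs ==> pure u bs' zs' ==> pure u (bs @ bs') (zs @ zs')"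
  by (simp add: pure_def list_all2_appendI)

lemma pure_replicate:
  "set zs \<subseteq> Em u ==> pure u (replicate (length zs) True) zs" "set zs \<subseteq> Ep u ==> pure u (replicate (length zs) False) zs"
  by (induction zs) auto

lemma pure_update:
  "pure u bs zs ==> z \<in> (if b then Em u else Ep u) ==> pure u (bs[i := b]) (zs[i := z])"
  by (simp add: pure_def list_all2_update_cong)

lemma count_replicate: "count_list (replicate n x) y = (if x = y then n else 0)"
  by (induction n) auto

lemma ev_pure:
  "pure u bs zs ==> ev c (map (\<lambda>x. a *s Pm u x + b *s Pp u x) zs)
    = a ^ count_list bs True * b ^ count_list bs False * ev c zs"
proof (induction bs arbitrary: zs c)
  case Nil
  then show ?case by (simp add: pure_def)
next
  case (Cons t bs)
  then obtain z zs' where zs: "zs = z # zs'" by (cases zs) (auto simp: pure_def)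
  with Cons.prems have p: "pure u bs zs'" and z: "z \<in> (if t then Em u else Ep u)" by simp_all
  have z': "a *s Pm u z + b *s Pp u z = (if t then a else b) *s z"
    using z by (auto simp: Pm_Em Pp_Em Pm_Ep Pp_Ep)
  have "ev c (map (\<lambda>x. a *s Pm u x + b *s Pp u x) zs)
     = (\<Sum>i\<in>UNIV. (if t then a else b) * z $ i * (a ^ count_list bs True * b ^ count_list bs False * ev (\<lambda>I. c (i # I)) zs'))"
    unfolding zs list.map ev_Cons Cons.IH[OF p] z' by simp
  also have "\<dots> = (if t then a else b) * (a ^ count_list bs True * b ^ count_list bs False) * ev c zs"
    unfolding zs ev_Cons by (simp add: sum_distrib_left mult_ac)
  finally show ?case by (cases t) (simp_all add: mult_ac)
qed

lemma ev_pencil: "ev (act (pencil z (pm u) (pp u)) c) zs = ev c (map (\<lambda>x. 1 *s Pm u x + z *s Pp u x) zs)"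
proof -
  have "(\<chi> j. \<Sum>i\<in>UNIV. x $ i * (z * pm u i j + pp u i j)) = 1 *s Pm u x + z *s Pp u x" for x
  proof -
    have "(\<Sum>i\<in>UNIV. x $ i * (z * pm u i j + pp u i j)) = z * (\<Sum>i\<in>UNIV. x $ i * pm u i j) + (\<Sum>i\<in>UNIV. x $ i * pp u i j)" for j
      by (simp add: distrib_left sum.distrib sum_distrib_left mult.left_commute)
    then show ?thesis by (simp add: vec_eq_iff pm_mult' pp_mult' add.commute)
  qed
  then show ?thesis unfolding ev_act by simp
qed

lemma ev_pencil': "ev (act (pencil z (pp u) (pm u)) c) zs = ev c (map (\<lambda>x. z *s Pm u x + 1 *s Pp u x) zs)"
proof -
  have "(\<chi> j. \<Sum>i\<in>UNIV. x $ i * (z * pp u i j + pm u i j)) = z *s Pm u x + 1 *s Pp u x" for x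
  proof -
    have "(\<Sum>i\<in>UNIV. x $ i * (z * pp u i j + pm u i j)) = z * (\<Sum>i\<in>UNIV. x $ i * pp u i j) + (\<Sum>i\<in>UNIV. x $ i * pm u i j)" for j
      by (simp add: distrib_left sum.distrib sum_distrib_left mult.left_commute)
    then show ?thesis by (simp add: vec_eq_iff pm_mult' pp_mult')
  qed
  then show ?thesis unfolding ev_act by simp
qed

lemma ev_tp_coeff:
  assumes "\<And>z. ev (act (pencil z M N) c) zs = z ^ m * ev c zs" "m \<le> length zs"
  shows "ev (tp M N p c) zs = (if p = m then ev c zs else 0)"
proof (cases "p \<le> length zs")
  case True
  show ?thesis
  proof (rule poly_coeff_eq[where n = "length zs" and a = "\<lambda>q. ev (tp M N q c) zs" and b = "\<lambda>q. if q = m then ev c zs else 0"])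
    fix z
    have "(\<Sum>q\<le>length zs. z ^ q * ev (tp M N q c) zs) = ev (\<lambda>I. \<Sum>q\<le>length zs. z ^ q * tp M N q c I) zs"
      by (simp add: ev_sum ev_cscale)
    also have "\<dots> = ev (act (pencil z M N) c) zs"
      by (rule ev_cong) (simp add: act_pencil)
    also have "\<dots> = (\<Sum>q\<le>length zs. z ^ q * (if q = m then ev c zs else 0))"
      using assms(2) by (simp add: assms(1) if_distrib[of "\<lambda>x. z ^ _ * x"] cong: if_cong)
    finally show "(\<Sum>q\<le>length zs. z ^ q * ev (tp M N q c) zs) = (\<Sum>q\<le>length zs. z ^ q * (if q = m then ev c zs else 0))" .
  qed (rule True)
next
  case False
  then have "ev (tp M N p c) zs = ev (\<lambda>I. 0) zs" by (intro ev_cong tp_eq_0) simp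
  then show ?thesis using False assms(2) by (auto simp: ev_def)
qed

lemma count_le_pure: "pure u bs zs ==> count_list bs b \<le> length zs"
  using pure_length[of u bs zs] count_le_length[of bs b] by simp

text \<open>A covector of type (1,0) vanishes on E-, so p counts the arguments in E+. In
  \<open>ev_dtp\<close> the two eigenspaces are exchanged.\<close>

lemma ev_ftp: "pure u bs zs ==> ev (ftp u p c) zs = (if p = count_list bs False then ev c zs else 0)"
  by (rule ev_tp_coeff) (simp_all only: ev_pencil ev_pure power_one mult_1 count_le_pure)

lemma ev_dtp: "pure u bs zs ==> ev (tp (pp u) (pm u) p c) zs = (if p = count_list bs True then ev c zs else 0)"
  by (rule ev_tp_coeff) (simp_all only: ev_pencil' ev_pure power_one mult_1_right count_le_pure)

lemma dtyped_ev:
  assumes "dtyped u k p c" "p \<le> k" "pure u bs zs" "length zs = k" "count_list bs True \<noteq> p"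
  shows "ev c zs = 0"
proof -
  have "ev c zs = ev (tp (pp u) (pm u) p c) zs" using assms by (intro ev_cong) (simp add: typed_tp_same)
  then show ?thesis using assms(5) ev_dtp[OF assms(3), of p c] by simp
qed

lemma tang_ev_zero:
  assumes "tang u k c" "u \<odot> u = 1" "length xs + Suc (length ys) = k"
  shows "ev c (xs @ u # ys) = 0"
proof -
  have "ev c (xs @ u # ys) = ev (\<lambda>J. ev (\<lambda>I. \<Sum>i\<in>UNIV. u $ i * c (I @ i # J)) xs) ys"
    by (simp add: ev_slot ev_sum ev_cscale)
  also have "\<dots> = ev (\<lambda>J. ev (\<lambda>I. 0) xs) ys"
    using assms by (intro ev_cong tang_kills) auto
  finally show ?thesis by (simp add: ev_def)
qed

text \<open>Every argument is a sum of two pure vectors up to a normal part, which c kills.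
  Alternation then sorts the pure vectors, E- before E+.\<close>

lemma pure_zero:
  assumes a: "altern c" and t: "tang u k c" and u: "u \<odot> u = 1"
    and H: "\<And>ws cs. set ws \<subseteq> Em u ==> set cs \<subseteq> Ep u ==> length ws + length cs = k ==> ev c (ws @ cs) = 0"
    and I: "length I = k"
  shows "c I = 0"
proof -
  \<comment> \<open>The lists ws and cs collect the pure vectors already sorted, and xs the
    arguments still to be split.\<close>
  have *: "ev c (ws @ cs @ map (\<lambda>x. 1 *s Pm u x + 1 *s Pp u x) xs) = 0"
    if "set ws \<subseteq> Em u" "set cs \<subseteq> Ep u" "length ws + length cs + length xs = k" for ws cs xs
    using that
  proof (induction xs arbitrary: ws cs)
    case Nil
    then show ?case using H by simp
  next
    case (Cons x xs)
    let ?r = "map (\<lambda>x. 1 *s Pm u x + 1 *s Pp u x) xs"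
    have "ev c (ws @ cs @ map (\<lambda>x. 1 *s Pm u x + 1 *s Pp u x) (x # xs))
       = ev c ((ws @ cs) @ (Pm u x + Pp u x) # ?r)" by simp
    also have "\<dots> = ev c (ws @ cs @ Pm u x # ?r) + ev c (ws @ cs @ Pp u x # ?r)"
      unfolding ev_slot_add by simp
    also have "ev c (ws @ cs @ Pm u x # ?r) = (-1) ^ length cs * ev c ((ws @ [Pm u x]) @ cs @ ?r)"
      unfolding altern_move[OF altern_ev[OF a]] by simp
    also have "ev c ((ws @ [Pm u x]) @ cs @ ?r) = 0"
      by (rule Cons.IH) (use Cons.prems Pm_in_Em[OF u] in auto)
    also have "ev c (ws @ cs @ Pp u x # ?r) = ev c (ws @ (cs @ [Pp u x]) @ ?r)" by simp
    also have "\<dots> = 0"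
      by (rule Cons.IH) (use Cons.prems Pp_in_Ep[OF u] in auto)
    finally show ?case by simp
  qed
  have "c I = act (tanmat u) c I" using t I by (simp add: tang_def)
  also have "\<dots> = ev (act (tanmat u) c) (map (\<lambda>i. axis i 1) I)" by (simp only: ev_axes)
  also have "\<dots> = 0" unfolding ev_pencil using *[of "[]" "[]" "map (\<lambda>i. axis i 1) I"] I by simp
  finally show ?thesis .
qed

lemma tp_full: "tp M N (length I) c I = act M c I"
proof (induction I arbitrary: c)
  case (Cons i I)
  have "tp M N (Suc (length I)) d I = 0" for d by (rule tp_eq_0) simp
  then show ?case by (simp add: Cons.IH)
qed simp

lemma typed_full: "typed M N k k c ==> length I = k ==> act M c I = c I"
  using typed_tp_same[of M N k k c I] tp_full[of M N I c] by simp

lemma act_eq_ev: "act M c I = ev c (map (\<lambda>i. \<chi> j. M i j) I)"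
proof -
  have "(\<chi> j. \<Sum>k\<in>UNIV. axis i 1 $ k * M k j) = (\<chi> j. M i j)" for i
    by (simp add: vec_eq_iff axis_def if_one_mult if_distrib[of "\<lambda>x. x * _"] cong: if_cong)
  then show ?thesis using ev_axes[of "act M c" I] unfolding ev_act by (simp add: o_def)
qed

lemma row_pm: "(\<chi> j. pm u i j) = Pp u (axis i 1)" and row_pp: "(\<chi> j. pp u i j) = Pm u (axis i 1)"
  using pm_transpose[of u] pp_transpose[of u] by (simp_all add: vec_eq_iff pm_def pp_def)

lemma act_pm_eq_ev: "act (pm u) c I = ev c (map (\<lambda>i. Pp u (axis i 1)) I)"
  and act_pp_eq_ev: "act (pp u) c I = ev c (map (\<lambda>i. Pm u (axis i 1)) I)"
  unfolding act_eq_ev row_pm row_pp by simp_all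

lemma ev_act_pm: "ev (act (pm u) c) zs = ev c (map (Pp u) zs)"
  and ev_act_pp: "ev (act (pp u) c) zs = ev c (map (Pm u) zs)"
  unfolding ev_act by (simp_all add: pm_mult' pp_mult' vec_lambda_eta)

section \<open>Contractions with the associative form\<close>

lemma sum_idx_2: "(\<Sum>I\<in>idx (Suc (Suc 0)). f I) = (\<Sum>i\<in>UNIV. \<Sum>j\<in>UNIV. f [i, j])"
  and sum_idx_3: "(\<Sum>I\<in>idx (Suc (Suc (Suc 0))). f I) = (\<Sum>i\<in>UNIV. \<Sum>j\<in>UNIV. \<Sum>k\<in>UNIV. f [i, j, k])"
  by (simp_all add: sum_idx_Suc)

text \<open>The contraction of the associative form with d; \<open>phi3\<close> holds the components
  of the form itself.\<close>

definition phi2 :: "cvec => 7 list => complex"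
  where "phi2 d J = (axis (J ! 0) 1 \<otimes> axis (J ! 1) 1) \<odot> d"

definition phi3 :: "7 list => complex"
  where "phi3 J = (axis (J ! 0) 1 \<otimes> axis (J ! 1) 1) \<odot> axis (J ! 2) 1"

lemma ev_phi2: "ev (phi2 d) [a, b] = (a \<otimes> b) \<odot> d"
proof -
  have "(a \<otimes> b) \<odot> d = ((\<Sum>i\<in>UNIV. a $ i *s axis i 1) \<otimes> (\<Sum>j\<in>UNIV. b $ j *s axis j 1)) \<odot> d"
    by (simp only: sum_axis)
  also have "\<dots> = (\<Sum>i\<in>UNIV. a $ i * (\<Sum>j\<in>UNIV. b $ j * phi2 d [i, j]))"
    unfolding xcross_sum_left xcross_scale_left cdot_sum_left cdot_scale_left
    unfolding xcross_sum_right xcross_scale_right cdot_sum_left cdot_scale_left by (simp add: phi2_def)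
  finally show ?thesis by (simp add: ev_Cons)
qed

lemma ev_phi3: "ev phi3 [a, b, c] = (a \<otimes> b) \<odot> c"
proof -
  have "phi3 [i, j, k] = phi2 (axis k 1) [i, j]" for i j k by (simp add: phi3_def phi2_def)
  then have "ev phi3 [a, b, c] = (\<Sum>i\<in>UNIV. \<Sum>j\<in>UNIV. \<Sum>k\<in>UNIV. a $ i * (b $ j * (c $ k * phi2 (axis k 1) [i, j])))"
    by (simp add: ev_Cons sum_distrib_left)
  also have "\<dots> = (\<Sum>i\<in>UNIV. \<Sum>k\<in>UNIV. \<Sum>j\<in>UNIV. a $ i * (b $ j * (c $ k * phi2 (axis k 1) [i, j])))"
    by (rule sum.cong[OF refl]) (rule sum.swap)
  also have "\<dots> = (\<Sum>k\<in>UNIV. \<Sum>i\<in>UNIV. \<Sum>j\<in>UNIV. a $ i * (b $ j * (c $ k * phi2 (axis k 1) [i, j])))"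
    by (rule sum.swap)
  also have "\<dots> = (\<Sum>k\<in>UNIV. c $ k * ev (phi2 (axis k 1)) [a, b])"
    by (simp add: ev_Cons sum_distrib_left mult_ac)
  also have "\<dots> = (a \<otimes> b) \<odot> c"
    unfolding ev_phi2 cdot_axis by (simp add: cdot_def mult.commute)
  finally show ?thesis .
qed

text \<open>A Binet-Cauchy identity, obtained by cyclic rotation of the triple product; the factor 2
  is that of \<open>Ep_Em_Em_cross\<close>.\<close>

lemma Ep_cross_dot_Em_cross:
  assumes "c \<in> Ep u" "c' \<in> Ep u" "y \<in> Em u" "y' \<in> Em u"
  shows "(c \<otimes> c') \<odot> (y \<otimes> y') = 2 * ((c \<odot> y) * (c' \<odot> y')) - 2 * ((c \<odot> y') * (c' \<odot> y))"
proof -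
  have "(c \<otimes> c') \<odot> (y \<otimes> y') = (c' \<otimes> (y \<otimes> y')) \<odot> c" by (rule xcross_dot_cyc)
  also have "\<dots> = 2 * (c' \<odot> y') * (y \<odot> c) - 2 * (c' \<odot> y) * (y' \<odot> c)"
    unfolding Ep_Em_Em_cross[OF assms(2-4)] by (simp add: cdot_linear)
  finally show ?thesis by (simp add: cdot_commute[of y] cdot_commute[of y'] mult_ac)
qed

text \<open>Cramer's rule for the complex volume form on \<open>Ep\<close>.\<close>

lemma Ep_volume_scale:
  assumes c: "c1 \<in> Ep u" "c2 \<in> Ep u" "c3 \<in> Ep u" and y: "y \<in> Em u"
  shows "((c1 \<otimes> c2) \<odot> c3) *s y = (c3 \<odot> y) *s (c1 \<otimes> c2) + (c1 \<odot> y) *s (c2 \<otimes> c3) + (c2 \<odot> y) *s (c3 \<otimes> c1)"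
proof -
  let ?x = "c1 \<otimes> c2"
  have x: "?x \<in> Em u" by (rule Ep_cross[OF c(1,2)])
  have 1: "c3 \<otimes> (y \<otimes> ?x) = (2 * (y \<odot> c2)) *s (c3 \<otimes> c1) + (2 * (y \<odot> c1)) *s (c2 \<otimes> c3)"
    unfolding Em_Ep_Ep_cross[OF y c(1,2)] xcross_linear xcross_anticommute[of c3 c2] by simp
  have ii: "\<i> * a * \<i> * b = - (a * b)" for a b by (simp add: complex_eq_iff algebra_simps)
  have 2: "y \<otimes> (c3 \<otimes> ?x) = (- (c3 \<odot> ?x)) *s y"
    unfolding Ep_Em_cross[OF c(3) x] xcross_scale_right xcross_anticommute[of y u] EmD[OF y]
    by (simp add: vec_eq_iff ii)
  have 3: "c3 \<otimes> (y \<otimes> ?x) + y \<otimes> (c3 \<otimes> ?x) = (- 2 * (c3 \<odot> y)) *s ?x + (c3 \<odot> ?x) *s y"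
    using xcross_double[of c3 y ?x] Em_Em_dot[OF y x] by simp
  have h: "2 * (((c1 \<otimes> c2) \<odot> c3) * y $ n)
      = 2 * ((c3 \<odot> y) * ?x $ n + (c1 \<odot> y) * (c2 \<otimes> c3) $ n + (c2 \<odot> y) * (c3 \<otimes> c1) $ n)" for n
  proof -
    have "2 * (y \<odot> c2) * (c3 \<otimes> c1) $ n + 2 * (y \<odot> c1) * (c2 \<otimes> c3) $ n + - (c3 \<odot> ?x) * y $ n
        = - 2 * (c3 \<odot> y) * ?x $ n + (c3 \<odot> ?x) * y $ n"
      using arg_cong[OF 3, of "\<lambda>v. v $ n"] unfolding 1 2 by simp
    then show ?thesis
      unfolding cdot_commute[of ?x c3] cdot_commute[of c1 y] cdot_commute[of c2 y] by algebra
  qed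
  show ?thesis
    unfolding vec_eq_iff using h by (simp only: mult_cancel_left vector_add_component vector_smult_component) simp
qed

text \<open>The right side is twice the 3 x 3 determinant of the pairings. Absorb the first volume
  into y1 by \<open>Ep_volume_scale\<close> and expand the remaining products.\<close>

lemma Ep_volume_Em_volume:
  assumes c: "c1 \<in> Ep u" "c2 \<in> Ep u" "c3 \<in> Ep u" and y: "y1 \<in> Em u" "y2 \<in> Em u" "y3 \<in> Em u"
  shows "((c1 \<otimes> c2) \<odot> c3) * ((y1 \<otimes> y2) \<odot> y3) = 2 *
    ((c3 \<odot> y1) * ((c1 \<odot> y2) * (c2 \<odot> y3)) - (c3 \<odot> y1) * ((c2 \<odot> y2) * (c1 \<odot> y3))
    + (c1 \<odot> y1) * ((c2 \<odot> y2) * (c3 \<odot> y3)) - (c1 \<odot> y1) * ((c3 \<odot> y2) * (c2 \<odot> y3))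
    + (c2 \<odot> y1) * ((c3 \<odot> y2) * (c1 \<odot> y3)) - (c2 \<odot> y1) * ((c1 \<odot> y2) * (c3 \<odot> y3)))"
proof -
  have "(y1 \<otimes> y2) \<odot> y3 = y1 \<odot> (y2 \<otimes> y3)" unfolding xcross_dot_cyc[of y1] by (rule cdot_commute)
  then have "((c1 \<otimes> c2) \<odot> c3) * ((y1 \<otimes> y2) \<odot> y3) = (((c1 \<otimes> c2) \<odot> c3) *s y1) \<odot> (y2 \<otimes> y3)"
    by (simp add: cdot_scale_left)
  also have "\<dots> = (c3 \<odot> y1) * ((c1 \<otimes> c2) \<odot> (y2 \<otimes> y3)) + (c1 \<odot> y1) * ((c2 \<otimes> c3) \<odot> (y2 \<otimes> y3))
      + (c2 \<odot> y1) * ((c3 \<otimes> c1) \<odot> (y2 \<otimes> y3))"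
    unfolding Ep_volume_scale[OF c y(1)] by (simp add: cdot_linear)
  finally show ?thesis
    unfolding Ep_cross_dot_Em_cross[OF c(1,2) y(2,3)] Ep_cross_dot_Em_cross[OF c(2,3) y(2,3)]
      Ep_cross_dot_Em_cross[OF c(3,1) y(2,3)]
    by (simp add: algebra_simps)
qed

lemma dot_Pm_axis: "c \<in> Ep u ==> c \<odot> Pm u (axis j 1) = c $ j"
  and dot_Pp_axis: "c \<in> Em u ==> c \<odot> Pp u (axis j 1) = c $ j"
  by (simp_all add: Pm_dot[symmetric] Pp_dot[symmetric] Pp_Ep Pm_Em cdot_axis)

text \<open>\<open>Ep\<close> is three-dimensional, so a trivector is determined by its contraction with
  the volume form.\<close>

lemma trivector_eq:
  assumes a: "altern T" and u: "u \<odot> u = 1" and c: "c1 \<in> Ep u" "c2 \<in> Ep u" "c3 \<in> Ep u"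
  shows "12 * ev T [c1, c2, c3] = ((c1 \<otimes> c2) \<odot> c3) * (\<Sum>J\<in>idx 3. phi3 J * act (pm u) T J)"
proof -
  let ?y = "\<lambda>i. Pm u (axis i 1)"
  note A = alternD[OF altern_ev[OF a], of "[]", simplified] alternD[OF altern_ev[OF a], of "[_]" _ _ "[]", simplified]
  have t: "ev T [a, b, d] = (\<Sum>i\<in>UNIV. \<Sum>j\<in>UNIV. \<Sum>k\<in>UNIV. a $ i * (b $ j * d $ k) * T [i, j, k])" for a b d
    by (simp add: ev_Cons sum_distrib_left mult_ac)
  have "(\<Sum>J\<in>idx 3. phi3 J * act (pm u) T J) = (\<Sum>J\<in>idx 3. act (pp u) phi3 J * T J)"
    unfolding act_transpose pm_transpose_fun ..
  also have "\<dots> = (\<Sum>i\<in>UNIV. \<Sum>j\<in>UNIV. \<Sum>k\<in>UNIV. ((?y i \<otimes> ?y j) \<odot> ?y k) * T [i, j, k])"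
    unfolding act_pp_eq_ev numeral_3_eq_3 sum_idx_3 by (simp add: ev_phi3)
  finally have "((c1 \<otimes> c2) \<odot> c3) * (\<Sum>J\<in>idx 3. phi3 J * act (pm u) T J)
     = (\<Sum>i\<in>UNIV. \<Sum>j\<in>UNIV. \<Sum>k\<in>UNIV. (((c1 \<otimes> c2) \<odot> c3) * ((?y i \<otimes> ?y j) \<odot> ?y k)) * T [i, j, k])"
    by (simp only: sum_distrib_left mult.assoc)
  also have "\<dots> = (\<Sum>i\<in>UNIV. \<Sum>j\<in>UNIV. \<Sum>k\<in>UNIV. (2 *
    (c3 $ i * (c1 $ j * c2 $ k) - c3 $ i * (c2 $ j * c1 $ k)
    + c1 $ i * (c2 $ j * c3 $ k) - c1 $ i * (c3 $ j * c2 $ k)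
    + c2 $ i * (c3 $ j * c1 $ k) - c2 $ i * (c1 $ j * c3 $ k))) * T [i, j, k])"
    by (intro sum.cong refl) (simp only: Ep_volume_Em_volume[OF c Pm_in_Em[OF u] Pm_in_Em[OF u] Pm_in_Em[OF u]]
        dot_Pm_axis[OF c(1)] dot_Pm_axis[OF c(2)] dot_Pm_axis[OF c(3)])
  also have "\<dots> = 2 * (ev T [c3, c1, c2] - ev T [c3, c2, c1] + ev T [c1, c2, c3] - ev T [c1, c3, c2]
      + ev T [c2, c3, c1] - ev T [c2, c1, c3])"
    unfolding t by (simp only: sum_subtractf sum.distrib left_diff_distrib distrib_right right_diff_distrib distrib_left
        sum_distrib_left mult.assoc)
  \<comment> \<open>By alternation each of the six signed terms equals the evaluation on c1, c2,
    c3.\<close>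
  also have "\<dots> = 12 * ev T [c1, c2, c3]"
    using A(1)[of c3 c1 "[c2]"] A(1)[of c2 c1 "[c3]"] A(1)[of c3 c2 "[c1]"]
      A(2)[of c1 c3 c2] A(2)[of c2 c3 c1] by simp
  finally show ?thesis by simp
qed

text \<open>The cross product identifies bivectors with vectors in complex dimension 3. Components
  in E-, as for (2,0)-forms, give a vector of E+, and conversely.\<close>

definition biv :: "(7 list => complex) => cvec"
  where "biv B = (\<Sum>j\<in>UNIV. \<Sum>k\<in>UNIV. B [j, k] *s (axis j 1 \<otimes> axis k 1))"

lemma biv_dot: "biv B \<odot> d = (\<Sum>J\<in>idx (Suc (Suc 0)). phi2 d J * B J)"
  by (simp add: biv_def sum_idx_2 cdot_sum_left cdot_scale_left phi2_def mult.commute)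

lemma biv_dot_pm:
  assumes "\<And>J. length J = 2 ==> act (pm u) B J = B J"
  shows "biv B \<odot> d = (\<Sum>i\<in>UNIV. \<Sum>j\<in>UNIV. ((Pm u (axis i 1) \<otimes> Pm u (axis j 1)) \<odot> d) * B [i, j])"
proof -
  have "biv B \<odot> d = (\<Sum>J\<in>idx (Suc (Suc 0)). phi2 d J * act (pm u) B J)"
    unfolding biv_dot by (intro sum.cong refl) (simp add: assms in_idx)
  then show ?thesis
    unfolding act_transpose pm_transpose_fun act_pp_eq_ev sum_idx_2 by (simp add: ev_phi2)
qed

lemma biv_Ep:
  assumes "\<And>J. length J = 2 ==> act (pm u) B J = B J" and u: "u \<odot> u = 1"
  shows "biv B \<in> Ep u"
proof -
  have "Pp u (biv B) \<odot> d = biv B \<odot> d" for d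
  proof -
    have *: "(Pm u (axis i 1) \<otimes> Pm u (axis j 1)) \<odot> Pm u d = (Pm u (axis i 1) \<otimes> Pm u (axis j 1)) \<odot> d" for i j
      unfolding Pp_dot[symmetric] Pp_Ep[OF Em_cross[OF Pm_in_Em[OF u] Pm_in_Em[OF u]]] ..
    show ?thesis by (simp only: Pp_dot biv_dot_pm[OF assms(1)] *)
  qed
  then have "Pp u (biv B) = biv B" by (rule cdot_ext)
  then show ?thesis using Pp_in_Ep[OF u, of "biv B"] by simp
qed

text \<open>Recovers B from its vector. The 4 is the factor 2 of
  \<open>Ep_cross_dot_Em_cross\<close> times 2 from alternation.\<close>

lemma biv_dot_cross:
  assumes pm: "\<And>J. length J = 2 ==> act (pm u) B J = B J" and a: "altern B" and u: "u \<odot> u = 1"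
    and c: "c \<in> Ep u" "c' \<in> Ep u"
  shows "biv B \<odot> (c \<otimes> c') = 4 * ev B [c, c']"
proof -
  have "(Pm u (axis i 1) \<otimes> Pm u (axis j 1)) \<odot> (c \<otimes> c') * B [i, j]
     = 2 * (c $ i * (c' $ j * B [i, j])) - 2 * (c' $ i * (c $ j * B [i, j]))" for i j
    unfolding cdot_commute[of _ "c \<otimes> c'"] Ep_cross_dot_Em_cross[OF c Pm_in_Em[OF u] Pm_in_Em[OF u]]
      dot_Pm_axis[OF c(1)] dot_Pm_axis[OF c(2)] by (simp add: algebra_simps)
  then have "biv B \<odot> (c \<otimes> c') = 2 * ev B [c, c'] - 2 * ev B [c', c]"
    by (simp add: biv_dot_pm[OF pm] ev_Cons sum_subtractf sum_distrib_left)
  then show ?thesis using alternD[OF altern_ev[OF a], of "[]" c' c "[]"] by simp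
qed

lemma pm_uminus: "pm (- u) = pp u" and pp_uminus: "pp (- u) = pm u"
  by (simp_all add: fun_eq_iff pm_def pp_def Pp_eq_Pm_uminus_apply)

lemma biv_Em:
  assumes "\<And>J. length J = 2 ==> act (pp u) B J = B J" "u \<odot> u = 1"
  shows "biv B \<in> Em u"
  using biv_Ep[of "- u" B] assms by (simp add: pm_uminus Ep_uminus cdot_linear)

lemma biv_dot_cross':
  assumes "\<And>J. length J = 2 ==> act (pp u) B J = B J" "altern B" "u \<odot> u = 1" "c \<in> Em u" "c' \<in> Em u"
  shows "biv B \<odot> (c \<otimes> c') = 4 * ev B [c, c']"
  using biv_dot_cross[of "- u" B c c'] assms by (simp add: pm_uminus Ep_uminus cdot_linear)

section \<open>Vanishing of harmonic forms\<close>

text \<open>In mixed directions the derivative of a projected constant field is normal, so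
  tangential tensors kill it. In directions of its own type the derivative changes type instead, see
  \<open>vder_Pp_Ep_dir\<close>.\<close>

lemma vder_Pp_Em_dir:
  assumes "u \<in> S6" "w \<in> Em (cv u)" "c \<in> Ep (cv u)"
  shows "vder w (\<lambda>u. Pp (cv u) c) u = (- (w \<odot> c)) *s cv u"
  unfolding vder_Pp[OF assms(1) Em_dot_u[OF assms(2)]] Em_Ep_cross[OF assms(2,3)] Ep_dot_u[OF assms(3)]
  by (simp add: vec_eq_iff algebra_simps)

lemma vder_Pm_Ep_dir:
  assumes "u \<in> S6" "c \<in> Ep (cv u)" "w \<in> Em (cv u)"
  shows "vder c (\<lambda>u. Pm (cv u) w) u = (- (c \<odot> w)) *s cv u"
  unfolding vder_Pm[OF assms(1) Ep_dot_u[OF assms(2)]] Ep_Em_cross[OF assms(2,3)] Em_dot_u[OF assms(3)]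
  by (simp add: vec_eq_iff algebra_simps)

lemma vder_Pp_Ep_dir:
  assumes "u \<in> S6" "a \<in> Ep (cv u)" "c \<in> Ep (cv u)"
  shows "vder a (\<lambda>u. Pp (cv u) c) u = (- \<i> / 2) *s (a \<otimes> c)"
  unfolding vder_Pp[OF assms(1) Ep_dot_u[OF assms(2)]] Ep_Ep_dot[OF assms(2,3)] Ep_dot_u[OF assms(3)]
  by (simp add: vec_eq_iff)

lemma smv_Pm_const: "smv (\<lambda>u. Pm (cv u) a)" and smv_Pp_const: "smv (\<lambda>u. Pp (cv u) a)"
  by (intro smv_Pm smv_Pp smv_const)+

lemma ev_antis:
  assumes "length zs = Suc k"
  shows "ev (antis T) zs = (\<Sum>i<Suc k. (-1) ^ i * ev (\<lambda>J. \<Sum>j\<in>UNIV. zs ! i $ j * T j J) (drop_nth i zs))"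
proof -
  let ?t = "\<lambda>i L. (-1) ^ i * (T (L ! i) (drop_nth i L) * (zs ! i $ (L ! i) * cmono (drop_nth i zs) (drop_nth i L)))"
  let ?f = "\<lambda>i j J. (-1) ^ i * (T j J * (zs ! i $ j * cmono (drop_nth i zs) J))"
  have "ev (antis T) zs = (\<Sum>L\<in>idx (Suc k). \<Sum>i<Suc k. ?t i L)"
    unfolding ev_def assms
  proof (intro sum.cong refl)
    fix L :: "7 list" assume "L \<in> idx (Suc k)"
    then have L: "length L = Suc k" by (simp add: in_idx)
    have "cmono zs L = zs ! i $ (L ! i) * cmono (drop_nth i zs) (drop_nth i L)" if "i < Suc k" for i
      by (rule cmono_split) (use that L assms in auto)
    then show "antis T L * cmono zs L = (\<Sum>i<Suc k. ?t i L)"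
      unfolding antis_def L sum_distrib_right by (intro sum.cong refl) (simp add: mult.assoc)
  qed
  also have "\<dots> = (\<Sum>i<Suc k. \<Sum>L\<in>idx (Suc k). ?t i L)"
    by (rule sum.swap)
  also have "\<dots> = (\<Sum>i<Suc k. (-1) ^ i * ev (\<lambda>J. \<Sum>j\<in>UNIV. zs ! i $ j * T j J) (drop_nth i zs))"
  proof (intro sum.cong refl)
    fix i assume i: "i \<in> {..<Suc k}"
    then have l: "length (drop_nth i zs) = k" using assms by (simp add: length_drop_nth)
    have "(\<Sum>L\<in>idx (Suc k). ?t i L)
       = (\<Sum>j\<in>UNIV. \<Sum>J\<in>idx k. ?f i j J)"
      by (rule sum_insert_nth[where f = "?f i"]) (use i in simp)
    also have "\<dots> = (\<Sum>J\<in>idx k. \<Sum>j\<in>UNIV. ?f i j J)"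
      by (rule sum.swap)
    finally show "(\<Sum>L\<in>idx (Suc k). ?t i L)
       = (-1) ^ i * ev (\<lambda>J. \<Sum>j\<in>UNIV. zs ! i $ j * T j J) (drop_nth i zs)"
      unfolding ev_def l by (simp add: sum_distrib_left sum_distrib_right mult_ac)
  qed
  finally show ?thesis .
qed

text \<open>On tangential arguments the degree term of \<open>dterm\<close> drops out, and the
  invariant formula for the exterior derivative remains.\<close>

lemma ev_dcomp:
  assumes "length zs = Suc k" "\<And>z. z \<in> set zs ==> cv u \<odot> z = 0"
  shows "ev (dcomp k c u) zs = (\<Sum>i<Suc k. (-1) ^ i * ev (cder (zs ! i) c u) (drop_nth i zs))"
proof -
  have "(\<Sum>j\<in>UNIV. zs ! i $ j * dterm k c u j J) = cder (zs ! i) c u J" if "i < Suc k" for i J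
  proof -
    have "(\<Sum>j\<in>UNIV. zs ! i $ j * dterm k c u j J) = cder (zs ! i) c u J - of_nat k * c u J * (cv u \<odot> zs ! i)"
      by (simp add: dterm_def cder_def dder_def cdot_def right_diff_distrib sum_subtractf sum_distrib_left mult_ac)
    then show ?thesis using assms that by simp
  qed
  then show ?thesis unfolding dcomp_def ev_antis[OF assms(1)] by (intro sum.cong refl) simp
qed

lemma ev_act_same: "(\<And>I. length I = length zs ==> act M c I = c I) ==> ev (act M c) zs = ev c zs"
  by (rule ev_cong)

lemma Omega_zeroI:
  assumes "\<phi> \<in> Omega std_J p q" "\<And>u I. u \<in> S6 ==> length I = p + q ==> fcomp \<phi> u I = 0"
  shows "\<phi> = 0"
proof
  fix u
  show "\<phi> u = 0 u"
  proof (cases "u \<in> S6")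
    case True
    have "tensor_of (p + q) (fcomp \<phi> u) = tensor_of (p + q) (\<lambda>I. 0)" by (rule tensor_of_cong) (rule assms(2)[OF True])
    then show ?thesis using Omega_comps(5)[OF assms(1) True] by (simp add: tensor_of_zero)
  qed (use Omega_comps(6)[OF assms(1)] in simp)
qed

text \<open>A (p,0)-form vanishes as soon as one argument lies in E-. Differentiating this along E+
  moves the argument in the normal direction, which the form kills as well, so the derivative of the
  components must vanish.\<close>

lemma cder_Ep_Em:
  assumes s: "\<And>I. sm (\<lambda>u. c u I)" and t: "\<And>u. u \<in> S6 ==> ftyped (cv u) p p (c u)" and u: "u \<in> S6"
    and a: "a \<in> Ep (cv u)" and w: "w \<in> Em (cv u)" and l: "Suc (length r) = p"
  shows "ev (cder a c u) (w # r) = 0"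
proof -
  have u1: "cv u \<odot> cv u = 1" by (rule cv_cdot_self[OF u])
  let ?Zs = "(\<lambda>v. Pm (cv v) w) # map (\<lambda>x v. x) r"
  have r: "map (\<lambda>Z. Z v) ?Zs = Pm (cv v) w # r" for v by (simp add: o_def)
  have sZ: "smv Z" if "Z \<in> set ?Zs" for Z using that smv_Pm_const smv_const by auto
  have z: "ev (c v) (map (\<lambda>Z. Z v) ?Zs) = 0" if v: "v \<in> S6" for v
  proof -
    have v1: "cv v \<odot> cv v = 1" by (rule cv_cdot_self[OF v])
    have "ev (c v) (Pm (cv v) w # r) = ev (act (pm (cv v)) (c v)) (Pm (cv v) w # r)"
      by (rule ev_act_same[symmetric]) (use typed_full[OF t[OF v]] l in auto)
    also have "\<dots> = ev (c v) ([] @ 0 # map (Pp (cv v)) r)"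
      unfolding ev_act_pm by (simp add: Pp_Em[OF Pm_in_Em[OF v1]])
    finally show ?thesis unfolding r ev_slot_zero .
  qed
  have "0 = dder a (\<lambda>v. ev (c v) (map (\<lambda>Z. Z v) ?Zs)) u"
    using dder_cong[where a = a, OF z u] by (simp add: dder_const)
  also have "\<dots> = ev (cder a c u) (map (\<lambda>Z. Z u) ?Zs)
      + (\<Sum>i<length ?Zs. ev (c u) ((map (\<lambda>Z. Z u) ?Zs)[i := vder a (?Zs ! i) u]))"
    by (rule dder_ev[OF s sZ u])
  also have "(\<Sum>i<length ?Zs. ev (c u) ((map (\<lambda>Z. Z u) ?Zs)[i := vder a (?Zs ! i) u])) = 0"
  proof (rule sum.neutral, rule ballI)
    fix i assume i: "i \<in> {..<length ?Zs}"
    show "ev (c u) ((map (\<lambda>Z. Z u) ?Zs)[i := vder a (?Zs ! i) u]) = 0"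
    proof (cases i)
      case 0
      have "ev (c u) ((map (\<lambda>Z. Z u) ?Zs)[i := vder a (?Zs ! i) u]) = - (a \<odot> w) * ev (c u) ([] @ cv u # r)"
        using ev_slot_scale[of "c u" "[]" "- (a \<odot> w)" "cv u" r]
        unfolding r 0 by (simp add: vder_Pm_Ep_dir[OF u a w])
      also have "ev (c u) ([] @ cv u # r) = 0"
        by (rule tang_ev_zero[OF ftyped_tang[OF t[OF u]] u1]) (use l in simp)
      finally show ?thesis by simp
    next
      case (Suc n)
      then have "vder a (?Zs ! i) u = 0" using i by (simp add: vder_const)
      then show ?thesis using i ev_update(3)[of i "map (\<lambda>Z. Z u) ?Zs" "c u"] by simp
    qed
  qed
  finally show ?thesis unfolding r using Pm_Em[OF w] by simp
qed

text \<open>Evaluate dbar \<phi> on one vector of E- and p vectors of E+. The terms that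
  differentiate along E+ vanish by \<open>cder_Ep_Em\<close>.\<close>

lemma holomorphic_cder:
  assumes \<phi>: "\<phi> \<in> Omega std_J p 0" and d: "dbar std_J p 0 \<phi> = 0" and u: "u \<in> S6"
    and w: "w \<in> Em (cv u)" and cs: "set cs \<subseteq> Ep (cv u)" "length cs = p"
  shows "ev (cder w (fcomp \<phi>) u) cs = 0"
proof -
  let ?c = "fcomp \<phi>"
  have u1: "cv u \<odot> cv u = 1" by (rule cv_cdot_self[OF u])
  note o = Omega_comps[OF \<phi>, unfolded add_0_right]
  have "ftp (cv u) p (dcomp p ?c u) L = 0" if "length L = Suc p" for L
    using dbar_eq[OF \<phi>] cmp_mkfield[OF u, of L "p + Suc 0" "\<lambda>u. ftp (cv u) p (dcomp p ?c u)"] d that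
    by (simp add: cmp_def)
  then have "ev (ftp (cv u) p (dcomp p ?c u)) (w # cs) = ev (\<lambda>I. 0) (w # cs)"
    using cs by (intro ev_cong) simp
  moreover have "ev (ftp (cv u) p (dcomp p ?c u)) (w # cs) = ev (dcomp p ?c u) (w # cs)"
    using ev_ftp[of "cv u" "True # replicate p False" "w # cs" p] pure_replicate(2)[OF cs(1)] w cs(2)
    by (simp add: count_replicate)
  moreover have "ev (cder (cs ! m) ?c u) (w # drop_nth m cs) = 0" if m: "m < p" for m
    by (rule cder_Ep_Em[where c = ?c, OF o(1) o(3) u _ w]) (use cs m in \<open>auto simp: length_drop_nth\<close>)
  moreover have "ev (dcomp p ?c u) (w # cs) = (\<Sum>i<Suc p. (-1) ^ i * ev (cder ((w # cs) ! i) ?c u) (drop_nth i (w # cs)))"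
    by (rule ev_dcomp) (use cs w in \<open>auto dest: Em_dot_u Ep_dot_u\<close>)
  ultimately show ?thesis by (simp add: ev_def[of "\<lambda>I. 0"] sum.lessThan_Suc_shift del: sum.lessThan_Suc)
qed

lemma vec1_dot: "vder w (\<lambda>u. \<chi> i. c u [i]) u \<odot> x = ev (cder w c u) [x]"
  by (simp add: cdot_def ev_Cons cder_def mult.commute)

lemma Pm_vec1: "Pm u (\<chi> i. c [i]) = (\<chi> i. act (pm u) c [i])" and Pp_vec1: "Pp u (\<chi> i. c [i]) = (\<chi> i. act (pp u) c [i])"
  by (simp_all add: vec_eq_iff pm_mult[symmetric] pp_mult[symmetric])

theorem holomorphic_1_forms:
  assumes \<phi>: "\<phi> \<in> Omega std_J 1 0" and d: "dbar std_J 1 0 \<phi> = 0"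
  shows "\<phi> = 0"
proof (rule Omega_zeroI[OF \<phi>])
  fix u :: vec7 and I :: "7 list" assume u: "u \<in> S6" and I: "length I = 1 + 0"
  note o = Omega_comps[OF \<phi>, unfolded add_0_right]
  let ?F = "\<lambda>u. \<chi> i. fcomp \<phi> u [i]"
  have "?F u = 0"
  proof (rule E_minus_section_zero[OF _ _ _ u])
    show "smv ?F" using o(1) by (simp add: smv_def)
    show "?F v \<in> Em (cv v)" if v: "v \<in> S6" for v
    proof -
      have "Pm (cv v) (?F v) = ?F v"
        unfolding Pm_vec1 using typed_full[OF o(3)[OF v]] by (simp del: act.simps)
      then show ?thesis using Pm_in_Em[OF cv_cdot_self[OF v], of "?F v"] by simp
    qed
    show "vder w ?F v \<odot> c = 0" if "v \<in> S6" "w \<in> Em (cv v)" "c \<in> Ep (cv v)" for v w c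
      unfolding vec1_dot[of w "fcomp \<phi>" v c] by (rule holomorphic_cder[OF \<phi> d that(1,2)]) (use that in auto)
  qed
  then show "fcomp \<phi> u I = 0" using I by (cases I) (auto simp: vec_eq_iff)
qed

lemma smv_biv: "(\<And>I. sm (\<lambda>u. c u I)) ==> smv (\<lambda>u. biv (c u))"
  unfolding smv_def biv_def by (simp add: sm_sum sm_mult sm_const)

lemma ev_fields_2:
  assumes "\<And>I. sm (\<lambda>u. c u I)" "smv A" "smv B" "u \<in> S6"
  shows "dder a (\<lambda>u. ev (c u) [A u, B u]) u
    = ev (cder a c u) [A u, B u] + (ev (c u) [vder a A u, B u] + ev (c u) [A u, vder a B u])"
  using dder_ev[of c "[A, B]" u a] assms by auto

text \<open>Differentiates the relation between a bivector and its vector when all terms with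
  derivatives of A and B vanish. It serves the (2,0)-forms and the contracted duals of
  (2,3)-forms.\<close>

lemma dder_biv_cross:
  assumes F: "smv F" and c: "\<And>I. sm (\<lambda>u. c u I)" and A: "smv A" and B: "smv B" and u: "u \<in> S6"
    and eq: "\<And>v. v \<in> S6 ==> F v \<odot> (A v \<otimes> B v) = 4 * ev (c v) [A v, B v]"
    and d: "ev (cder w c u) [A u, B u] = 0" "ev (c u) [vder w A u, B u] = 0" "ev (c u) [A u, vder w B u] = 0"
    and z: "F u \<odot> (A u \<otimes> vder w B u) = 0" "F u \<odot> (vder w A u \<otimes> B u) = 0"
  shows "vder w F u \<odot> (A u \<otimes> B u) = 0"
proof -
  have "vder w F u \<odot> (A u \<otimes> B u) = dder w (\<lambda>v. F v \<odot> (A v \<otimes> B v)) u"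
    unfolding dder_cdot[OF F smv_xcross[OF A B] u] vder_xcross[OF A B u] using z by (simp add: cdot_linear)
  also have "\<dots> = dder w (\<lambda>v. 4 * ev (c v) [A v, B v]) u" by (rule dder_cong[OF eq u])
  also have "\<dots> = 4 * dder w (\<lambda>v. ev (c v) [A v, B v]) u"
    by (rule dder_cmult[OF _ u]) (use sm_ev_fields[of c "[A, B]"] c A B in auto)
  finally show ?thesis unfolding ev_fields_2[OF c A B u] d by simp
qed

theorem holomorphic_2_forms:
  assumes \<phi>: "\<phi> \<in> Omega std_J 2 0" and d: "dbar std_J 2 0 \<phi> = 0"
  shows "\<phi> = 0"
proof (rule Omega_zeroI[OF \<phi>])
  fix u :: vec7 and I :: "7 list" assume u: "u \<in> S6" and I: "length I = 2 + 0"
  note o = Omega_comps[OF \<phi>, unfolded add_0_right]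
  let ?c = "fcomp \<phi>"
  let ?F = "\<lambda>u. biv (?c u)"
  have pm: "act (pm (cv v)) (?c v) J = ?c v J" if "v \<in> S6" "length J = 2" for v J
    by (rule typed_full[OF o(3)[OF that(1)] that(2)])
  have FE: "?F v \<in> Ep (cv v)" if v: "v \<in> S6" for v
    by (rule biv_Ep[OF pm[OF v] cv_cdot_self[OF v]])
  have cross: "?F v \<odot> (x \<otimes> y) = 4 * ev (?c v) [x, y]" if v: "v \<in> S6" "x \<in> Ep (cv v)" "y \<in> Ep (cv v)" for v x y
    by (rule biv_dot_cross[OF pm[OF v(1)] o(2)[OF v(1)] cv_cdot_self[OF v(1)] v(2,3)])
  have sF: "smv ?F" by (rule smv_biv[OF o(1)])
  have "?F u = 0"
  proof (rule E_plus_section_zero[OF sF FE _ u])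
    fix v w c assume v: "v \<in> S6" and w: "w \<in> Em (cv v)" and c: "c \<in> Em (cv v)"
    have v1: "cv v \<odot> cv v = 1" by (rule cv_cdot_self[OF v])
    show "vder w ?F v \<odot> c = 0"
    \<comment> \<open>In the mirror image the products of E+ generate E-, so c may be taken as such
      a product.\<close>
    proof (rule Ep_generated[of "- cv v" c "\<lambda>c. vder w ?F v \<odot> c"])
      show "- cv v \<odot> - cv v = 1" using v1 by (simp add: cdot_linear)
      show "c \<in> Ep (- cv v)" using c by (simp add: Em_uminus)
      fix a b assume "a \<in> Em (- cv v)" "b \<in> Em (- cv v)"
      then have ab: "a \<in> Ep (cv v)" "b \<in> Ep (cv v)" by (simp_all add: Ep_uminus)
      let ?A = "\<lambda>v. Pp (cv v) a" and ?B = "\<lambda>v. Pp (cv v) b"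
      have AB: "?A v = a" "?B v = b" using ab by (simp_all add: Pp_Ep)
      note sA = smv_Pp_const[of a] and sB = smv_Pp_const[of b]
      have F0: "?F v \<odot> (cv v \<otimes> x) = 0" "?F v \<odot> (x \<otimes> cv v) = 0" if "x \<in> Ep (cv v)" for x
        unfolding xcross_anticommute[of x "cv v"] EpD[OF that] using Ep_Ep_dot[OF FE[OF v] that] by (simp_all add: cdot_linear)
      have c0: "ev (?c v) [cv v, x] = 0" "ev (?c v) [x, cv v] = 0" for x
        using tang_ev_zero[OF o(4)[OF v] v1, of "[]" "[x]"] tang_ev_zero[OF o(4)[OF v] v1, of "[x]" "[]"] by simp_all
      have "vder w ?F v \<odot> (?A v \<otimes> ?B v) = 0"
      proof (rule dder_biv_cross[where c = ?c, OF sF o(1) sA sB v])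
        show "?F v' \<odot> (?A v' \<otimes> ?B v') = 4 * ev (?c v') [?A v', ?B v']" if "v' \<in> S6" for v'
          by (rule cross[OF that]) (rule Pp_in_Ep[OF cv_cdot_self[OF that]])+
      qed (use holomorphic_cder[OF \<phi> d v w, of "[a, b]"] ab c0 F0
          ev_slot_scale[of "?c v" "[]" "- (w \<odot> a)" "cv v" "[b]"] ev_slot_scale[of "?c v" "[a]" "- (w \<odot> b)" "cv v" "[]"]
          in \<open>simp_all add: AB vder_Pp_Em_dir[OF v w] cdot_linear xcross_linear\<close>)
      then show "vder w ?F v \<odot> (a \<otimes> b) = 0" unfolding AB .
    qed (simp_all add: cdot_linear)
  qed
  then have "ev (?c u) [x, y] = 0" if "x \<in> Ep (cv u)" "y \<in> Ep (cv u)" for x y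
    using cross[OF u that] by (simp add: cdot_linear)
  then have "act (pm (cv u)) (?c u) [i, j] = 0" for i j
    unfolding act_pm_eq_ev using Pp_in_Ep[OF cv_cdot_self[OF u]] by simp
  moreover obtain i j where "I = [i, j]" using I by (auto simp: length_Suc_conv numeral_2_eq_2)
  ultimately show "?c u I = 0" using pm[OF u, of I] by simp
qed

section \<open>Contracting the dual of a (p,3)-form with the volume form\<close>

lemma ev_append': "ev c (xs @ ys) = ev (\<lambda>I. ev (\<lambda>J. c (I @ J)) ys) xs"
  by (induction xs arbitrary: c) (simp_all add: ev_Cons)

lemma ev_axis_Cons: "ev c (axis j 1 # zs) = ev (\<lambda>I. c (j # I)) zs"
  by (simp add: ev_Cons axis_def if_one_mult if_distrib[of "\<lambda>x. x * _"] cong: if_cong)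

text \<open>Contracts the last three slots of K with the complex volume form. The dual of a
  (p,3)-form is nonzero only on p vectors of E- together with three of E+, and
  \<open>vcon_eq\<close> shows that the contraction determines these values.\<close>

definition vcon :: "(vec7 => 7 list => complex) => vec7 => 7 list => complex"
  where "vcon K u I = (\<Sum>J\<in>idx 3. phi3 J * act (pm (cv u)) (\<lambda>J. K u (I @ J)) J)"

lemma ev_vcon: "ev (vcon K u) zs = (\<Sum>J\<in>idx 3. phi3 J * ev (K u) (zs @ map (\<lambda>i. Pp (cv u) (axis i 1)) J))"
  unfolding vcon_def[abs_def] act_pm_eq_ev ev_append' by (simp add: ev_sum ev_cscale)

lemma sm_vcon:
  assumes "\<And>I. sm (\<lambda>u. K u I)" shows "sm (\<lambda>u. vcon K u I)"
  unfolding vcon_def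
proof (rule sm_sum, rule sm_mult[OF sm_const])
  show "sm (\<lambda>u. act (pm (cv u)) (\<lambda>J. K u (I @ J)) J)" for J
    by (rule sm_act[OF sm_pm assms])
qed

lemma altern_appended: "altern c ==> altern (\<lambda>I. c (I @ J))" "altern c ==> altern (\<lambda>J. c (I @ J))"
proof -
  assume a: "altern c"
  show "altern (\<lambda>I. c (I @ J))"
    unfolding altern_def append_assoc append_Cons by (intro allI) (rule alternD[OF a])
  have "c (I @ xs @ x # y # ys) = - c (I @ xs @ y # x # ys)" for xs x y ys
    using alternD[OF a, of "I @ xs" x y ys] unfolding append_assoc .
  then show "altern (\<lambda>J. c (I @ J))" unfolding altern_def by (intro allI)
qed

lemma altern_ev_appended:
  assumes "altern c" shows "altern (\<lambda>I. ev (\<lambda>J. c (I @ J)) zs)" "altern (\<lambda>J. ev (\<lambda>I. c (I @ J)) zs)"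
proof -
  have "altern (\<lambda>I. \<Sum>J\<in>idx (length zs). cmono zs J * c (I @ J))" "altern (\<lambda>J. \<Sum>I\<in>idx (length zs). cmono zs I * c (I @ J))"
    by (intro altern_sum altern_scale altern_appended assms)+
  then show "altern (\<lambda>I. ev (\<lambda>J. c (I @ J)) zs)" "altern (\<lambda>J. ev (\<lambda>I. c (I @ J)) zs)"
    unfolding ev_def by (simp_all only: mult.commute)
qed

lemma altern_vcon: "altern (K u) ==> altern (vcon K u)"
  unfolding vcon_def[abs_def] act_pm_eq_ev by (intro altern_sum altern_scale altern_ev_appended)

lemma dtyped_vcon:
  assumes u: "u \<in> S6" and K: "dtyped (cv u) (p + 3) p (K u)"
  shows "dtyped (cv u) p p (vcon K u)"
  unfolding typed_def
proof (intro allI impI)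
  fix I :: "7 list" and z assume I: "length I = p"
  have u1: "cv u \<odot> cv u = 1" by (rule cv_cdot_self[OF u])
  let ?f = "\<lambda>x. z *s Pm (cv u) x + 1 *s Pp (cv u) x" and ?e = "map (\<lambda>i. axis i 1) I :: cvec list"
  let ?r = "\<lambda>J. map (\<lambda>i. Pp (cv u) (axis i 1)) J"
  have r: "?r J = map ?f (?r J)" for J
    by (simp add: Pm_Ep[OF Pp_in_Ep[OF u1]] Pp_Ep[OF Pp_in_Ep[OF u1]])
  have "ev (K u) (map ?f ?e @ ?r J) = z ^ p * ev (K u) (?e @ ?r J)" if J: "J \<in> idx 3" for J
  proof -
    have "ev (K u) (map ?f ?e @ ?r J) = ev (K u) (map ?f (?e @ ?r J))" by (subst r) simp
    also have "\<dots> = ev (act (pencil z (pp (cv u)) (pm (cv u))) (K u)) (?e @ ?r J)" by (simp only: ev_pencil')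
    also have "\<dots> = ev (\<lambda>L. z ^ p * K u L) (?e @ ?r J)"
      using K I J unfolding typed_def by (intro ev_cong) (simp add: in_idx)
    finally show ?thesis by (simp add: ev_cscale)
  qed
  then have "ev (vcon K u) (map ?f ?e) = z ^ p * ev (vcon K u) ?e"
    unfolding ev_vcon sum_distrib_left by (intro sum.cong refl) simp
  moreover have "act (pencil z (pp (cv u)) (pm (cv u))) (vcon K u) I = ev (vcon K u) (map ?f ?e)"
    unfolding ev_pencil'[symmetric] ev_axes ..
  ultimately show "act (pencil z (pp (cv u)) (pm (cv u))) (vcon K u) I = z ^ p * vcon K u I"
    by (simp only: ev_axes)
qed

lemma vcon_eq:
  assumes u: "u \<in> S6" and a: "altern (K u)" and c: "c1 \<in> Ep (cv u)" "c2 \<in> Ep (cv u)" "c3 \<in> Ep (cv u)"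
  shows "12 * ev (K u) (ws @ [c1, c2, c3]) = ((c1 \<otimes> c2) \<odot> c3) * ev (vcon K u) ws"
  using trivector_eq[OF altern_ev_appended(2)[OF a, of ws] cv_cdot_self[OF u] c]
  unfolding act_pm_eq_ev ev_append[symmetric] ev_vcon .

text \<open>Puts an axis vector into the first slot, in which the divergence is taken. Its E- part
  would exceed the type of K and its normal part is killed; the E+ part gives component j of the
  product by \<open>vcon_eq\<close>. The sign comes from moving this slot past ws.\<close>

lemma ev_axis_cross:
  assumes u: "u \<in> S6" and a: "altern (K u)" and t: "dtyped (cv u) (p + 3) p (K u)"
    and ws: "set ws \<subseteq> Em (cv u)" "length ws = p" and c: "c1 \<in> Ep (cv u)" "c2 \<in> Ep (cv u)"
  shows "12 * ev (K u) (axis j 1 # ws @ [c1, c2]) = (-1) ^ p * ((c1 \<otimes> c2) $ j * ev (vcon K u) ws)"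
proof -
  let ?e = "axis j 1 :: cvec"
  have u1: "cv u \<odot> cv u = 1" by (rule cv_cdot_self[OF u])
  have "ev (K u) (ws @ ?e # [c1, c2]) = (-1) ^ p * ev (K u) (?e # ws @ [c1, c2])"
    using altern_move[OF altern_ev[OF a], of "[]" ws ?e "[c1, c2]"] ws by simp
  then have 1: "ev (K u) (?e # ws @ [c1, c2]) = (-1) ^ p * ev (K u) (ws @ ?e # [c1, c2])"
    by (simp add: power_mult_distrib[symmetric] mult.assoc[symmetric])
  have m: "ev (K u) (ws @ Pm (cv u) ?e # [c1, c2]) = 0"
    by (rule dtyped_ev[OF t _ pure_append[OF pure_replicate(1)[OF ws(1)], of "[True, False, False]"]])
      (use ws c Pm_in_Em[OF u1] in \<open>auto simp: count_replicate\<close>)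
  have n: "ev (K u) (ws @ cv u # [c1, c2]) = 0"
    by (rule tang_ev_zero[OF dtyped_tang[OF t] u1]) (use ws in simp)
  have "ev (K u) (ws @ ?e # [c1, c2]) = ev (K u) (ws @ (Pm (cv u) ?e + Pp (cv u) ?e + (cv u \<odot> ?e) *s cv u) # [c1, c2])"
    by (simp only: Pm_Pp_decomp)
  also have "\<dots> = ev (K u) (ws @ [Pp (cv u) ?e, c1, c2])"
    unfolding ev_slot_add ev_slot_scale m n by simp
  finally have "12 * ev (K u) (ws @ ?e # [c1, c2]) = ((Pp (cv u) ?e \<otimes> c1) \<odot> c2) * ev (vcon K u) ws"
    using vcon_eq[where K = K, OF u a Pp_in_Ep[OF u1, of ?e] c] by simp
  also have "(Pp (cv u) ?e \<otimes> c1) \<odot> c2 = (c1 \<otimes> c2) $ j"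
    unfolding xcross_dot_cyc[of "Pp (cv u) ?e"] by (rule dot_Pp_axis[OF Ep_cross[OF c]])
  finally show ?thesis unfolding 1 by (simp only: mult.left_commute)
qed

lemma linear_functional_eq_sum:
  fixes L :: "cvec => complex"
  assumes add: "\<And>a b. L (a + b) = L a + L b" and scale: "\<And>k a. L (k *s a) = k * L a"
  shows "L x = (\<Sum>i\<in>UNIV. x $ i * L (axis i 1))"
proof -
  have 0: "L 0 = 0" using scale[of 0 0] by simp
  have "L (\<Sum>i\<in>X. f i) = (\<Sum>i\<in>X. L (f i))" if "finite X" for f and X :: "7 set"
    using that by (induction X rule: finite_induct) (simp_all add: add 0)
  then have "L (\<Sum>i\<in>UNIV. x $ i *s axis i 1) = (\<Sum>i\<in>UNIV. L (x $ i *s axis i 1))" by simp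
  then show ?thesis by (simp only: sum_axis scale)
qed

text \<open>The projections are transposes of each other, so the E- part of the trace is a sum of
  values of A on pairs from E- and E+, and the E+ part a sum over the opposite pairs. A vanishes on
  both.\<close>

lemma trace_zero:
  fixes A :: "cvec => cvec => complex"
  assumes l: "\<And>a b y. A (a + b) y = A a y + A b y" "\<And>k a y. A (k *s a) y = k * A a y"
    and r: "\<And>x a b. A x (a + b) = A x a + A x b" "\<And>k x a. A x (k *s a) = k * A x a"
    and u: "u \<odot> u = 1" and n: "\<And>y. A u y = 0"
    and mp: "\<And>x y. x \<in> Em u ==> y \<in> Ep u ==> A x y = 0" and pm: "\<And>x y. x \<in> Ep u ==> y \<in> Em u ==> A x y = 0"
  shows "(\<Sum>j\<in>UNIV. A (axis j 1) (axis j 1)) = 0"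
proof -
  let ?M = "\<lambda>i j. A (axis i 1) (axis j 1)"
  have A: "A x y = (\<Sum>i\<in>UNIV. \<Sum>j\<in>UNIV. x $ i * y $ j * ?M i j)" for x y
    using linear_functional_eq_sum[of "\<lambda>x. A x y" x, OF l] linear_functional_eq_sum[of "A (axis _ 1)" y, OF r]
    by (simp add: sum_distrib_left mult.assoc)
  \<comment> \<open>Idempotence splits M into two factors; one projects the first argument, and the
    other, transposed, the second argument.\<close>
  have *: "(\<Sum>j\<in>UNIV. A (P (axis j 1)) (axis j 1)) = 0"
    if P: "\<And>i j. P (axis j 1) $ i = M i j" and Q: "\<And>i j. Q (axis j 1) $ i = M j i"
      and M: "\<And>i j. (\<Sum>k\<in>UNIV. M i k * M k j) = M i j" and z: "\<And>k. A (P (axis k 1)) (Q (axis k 1)) = 0" for P Q M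
  proof -
    have "A (P (axis j 1)) (axis j 1) = (\<Sum>i\<in>UNIV. M i j * ?M i j)" for j
      using linear_functional_eq_sum[of "\<lambda>x. A x (axis j 1)" "P (axis j 1)", OF l] by (simp add: P)
    then have "(\<Sum>j\<in>UNIV. A (P (axis j 1)) (axis j 1)) = (\<Sum>j\<in>UNIV. \<Sum>i\<in>UNIV. (\<Sum>k\<in>UNIV. M i k * M k j) * ?M i j)"
      by (simp add: M)
    also have "\<dots> = (\<Sum>j\<in>UNIV. \<Sum>i\<in>UNIV. \<Sum>k\<in>UNIV. M i k * M k j * ?M i j)" by (simp add: sum_distrib_right)
    also have "\<dots> = (\<Sum>j\<in>UNIV. \<Sum>k\<in>UNIV. \<Sum>i\<in>UNIV. M i k * M k j * ?M i j)" by (rule sum.cong[OF refl]) (rule sum.swap)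
    also have "\<dots> = (\<Sum>k\<in>UNIV. \<Sum>j\<in>UNIV. \<Sum>i\<in>UNIV. M i k * M k j * ?M i j)" by (rule sum.swap)
    also have "\<dots> = (\<Sum>k\<in>UNIV. \<Sum>i\<in>UNIV. \<Sum>j\<in>UNIV. M i k * M k j * ?M i j)" by (rule sum.cong[OF refl]) (rule sum.swap)
    also have "\<dots> = (\<Sum>k\<in>UNIV. A (P (axis k 1)) (Q (axis k 1)))" unfolding A[of "P _"] P Q ..
    finally show ?thesis by (simp add: z)
  qed
  have "(\<Sum>j\<in>UNIV. A (axis j 1) (axis j 1)) = (\<Sum>j\<in>UNIV. A (Pm u (axis j 1)) (axis j 1))
     + (\<Sum>j\<in>UNIV. A (Pp u (axis j 1)) (axis j 1))"
    unfolding sum.distrib[symmetric]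
  proof (intro sum.cong refl)
    fix j
    have "A (axis j 1) (axis j 1) = A (Pm u (axis j 1) + Pp u (axis j 1) + (u \<odot> axis j 1) *s u) (axis j 1)"
      by (simp only: Pm_Pp_decomp)
    then show "A (axis j 1) (axis j 1) = A (Pm u (axis j 1)) (axis j 1) + A (Pp u (axis j 1)) (axis j 1)"
      by (simp add: l n)
  qed
  also have "(\<Sum>j\<in>UNIV. A (Pm u (axis j 1)) (axis j 1)) = 0"
    by (rule *[of "Pm u" "pm u" "Pp u", OF _ _ pm_pm[OF u]])
      (simp_all add: pm_def[symmetric] pp_def[symmetric] pm_transpose mp Pm_in_Em[OF u] Pp_in_Ep[OF u])
  also have "(\<Sum>j\<in>UNIV. A (Pp u (axis j 1)) (axis j 1)) = 0"
    by (rule *[of "Pp u" "pp u" "Pm u", OF _ _ pp_pp[OF u]])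
      (simp_all add: pm_def[symmetric] pp_def[symmetric] pp_transpose pm Pm_in_Em[OF u] Pp_in_Ep[OF u])
  finally show ?thesis by simp
qed

lemma replicate_update: "i < p ==> (replicate p x)[i := y] = replicate i x @ y # replicate (p - Suc i) x"
  by (simp add: upd_conv_take_nth_drop min_def)

lemma count_update_Em:
  "i < p ==> count_list ((replicate p True @ bs)[i := False]) True < p + count_list bs True"
  by (simp add: list_update_append replicate_update count_replicate)

text \<open>Differentiate \<open>ev_axis_cross\<close> and take the trace over \<open>j\<close>. All terms with derivatives of
  the arguments drop out for reasons of type.\<close>

lemma vcon_parallel:
  assumes sK: "\<And>I. sm (\<lambda>u. K u I)" and aK: "\<And>u. u \<in> S6 ==> altern (K u)"
    and tK: "\<And>u. u \<in> S6 ==> dtyped (cv u) (p + 3) p (K u)"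
    and div: "\<And>u ws c c'. u \<in> S6 ==> set ws \<subseteq> Em (cv u) ==> length ws = p ==> c \<in> Ep (cv u) ==> c' \<in> Ep (cv u)
      ==> ev (\<lambda>J. \<Sum>j\<in>UNIV. sder j (\<lambda>u. K u (j # J)) u) (ws @ [c, c']) = 0"
    and u: "u \<in> S6" and a: "a \<in> Em (cv u)" and ws: "set ws \<subseteq> Em (cv u)" "length ws = p"
  shows "ev (cder a (vcon K) u) ws = 0"
proof -
  have u1: "cv u \<odot> cv u = 1" by (rule cv_cdot_self[OF u])
  define Ws where "Ws = map (\<lambda>w v. Pm (cv v) w) ws"
  have Wv: "map (\<lambda>Z. Z v) Ws = map (Pm (cv v)) ws" for v by (simp add: Ws_def)
  have Wu: "map (Pm (cv u)) ws = ws" using ws by (intro map_idI) (auto simp: Pm_Em)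
  have lW: "length Ws = p" using ws by (simp add: Ws_def)
  have sW: "smv Z" if "Z \<in> set Ws" for Z using that smv_Pm_const by (auto simp: Ws_def)
  define G where "G = (\<lambda>v. ev (vcon K v) (map (\<lambda>Z. Z v) Ws))"
  have sG: "sm G" unfolding G_def by (rule sm_ev_fields[OF sm_vcon[OF sK] sW])
  have Wpure: "set (map (\<lambda>Z. Z v) Ws) \<subseteq> Em (cv v)" if "v \<in> S6" for v
    unfolding Wv using Pm_in_Em[OF cv_cdot_self[OF that]] by auto
  \<comment> \<open>Along E- the argument fields have derivatives in E+, on which the contraction
    vanishes.\<close>
  have step1: "dder b G u = ev (cder b (vcon K) u) ws" if b: "b \<in> Em (cv u)" for b
  proof -
    have "dder b G u = ev (cder b (vcon K) u) ws + (\<Sum>i<length Ws. ev (vcon K u) (ws[i := vder b (Ws ! i) u]))"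
      using dder_ev[where c = "vcon K" and Zs = Ws and a = b, OF sm_vcon[OF sK] sW u] unfolding Wv Wu G_def .
    also have "(\<Sum>i<length Ws. ev (vcon K u) (ws[i := vder b (Ws ! i) u])) = 0"
    proof (rule sum.neutral, rule ballI)
      fix i assume "i \<in> {..<length Ws}"
      then have i: "i < length ws" by (simp add: Ws_def)
      have w: "ws ! i \<in> Em (cv u)" using ws i by auto
      have "vder b (Ws ! i) u = (\<i> / 2) *s (b \<otimes> ws ! i)"
        using i Em_const_field[OF u b w] by (simp add: Ws_def)
      then have z: "Pm (cv u) (vder b (Ws ! i) u) = 0"
        using Pm_Ep[OF Em_cross[OF b w]] by (simp add: Pm_scale)
      have "ev (vcon K u) (ws[i := vder b (Ws ! i) u]) = ev (act (pp (cv u)) (vcon K u)) (ws[i := vder b (Ws ! i) u])"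
        by (rule ev_act_same[symmetric]) (use typed_full[OF dtyped_vcon[where K = K, OF u tK[OF u]]] ws in auto)
      also have "\<dots> = ev (vcon K u) (ws[i := 0])"
        unfolding ev_act_pp map_update Wu z ..
      finally show "ev (vcon K u) (ws[i := vder b (Ws ! i) u]) = 0" using ev_update(3)[OF i] by simp
    qed
    finally show ?thesis by simp
  qed
  \<comment> \<open>The products of E+ generate E-, so it suffices to differentiate G in these
    directions, where \<open>fX\<close> relates it to the divergence.\<close>
  have step2: "dder (c1 \<otimes> c2) G u = 0" if c: "c1 \<in> Ep (cv u)" "c2 \<in> Ep (cv u)" for c1 c2
  proof -
    let ?C1 = "\<lambda>v. Pp (cv v) c1" and ?C2 = "\<lambda>v. Pp (cv v) c2"
    define Zs where "Zs = Ws @ [?C1, ?C2]"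
    define zs where "zs = ws @ [c1, c2]"
    have Cu: "?C1 u = c1" "?C2 u = c2" using c by (simp_all add: Pp_Ep)
    have Zu: "map (\<lambda>Z. Z u) Zs = zs" unfolding Zs_def zs_def map_append Wv Wu using Cu by simp
    have lZ: "length Zs = p + 2" "length zs = p + 2" using lW ws by (simp_all add: Zs_def zs_def)
    have sZ: "smv Z" if "Z \<in> set Zs" for Z using that sW smv_Pp_const by (auto simp: Zs_def)
    define f where "f = (\<lambda>j v. ev (\<lambda>J. K v (j # J)) (map (\<lambda>Z. Z v) Zs))"
    have sf: "sm (f j)" for j unfolding f_def by (rule sm_ev_fields) (use sK sZ in auto)
    define X where "X = (\<lambda>v. ?C1 v \<otimes> ?C2 v)"
    have sX: "smv X" unfolding X_def by (intro smv_xcross smv_Pp_const)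
    have fX: "12 * f j v = (-1) ^ p * (X v $ j * G v)" if v: "v \<in> S6" for v j
    proof -
      have "f j v = ev (K v) (axis j 1 # map (\<lambda>Z. Z v) Ws @ [?C1 v, ?C2 v])"
        unfolding f_def ev_axis_Cons by (simp add: Zs_def)
      then show ?thesis
        using ev_axis_cross[where K = K, OF v aK[OF v] tK[OF v] Wpure[OF v] _
            Pp_in_Ep[OF cv_cdot_self[OF v], of c1] Pp_in_Ep[OF cv_cdot_self[OF v], of c2]] lW
        by (simp add: X_def G_def)
    qed
    have F: "(\<Sum>j\<in>UNIV. dder (axis j 1) (f j) u) = 0"
    proof -
      have "(\<Sum>j\<in>UNIV. dder (axis j 1) (f j) u) = (\<Sum>j\<in>UNIV. ev (cder (axis j 1) (\<lambda>v J. K v (j # J)) u) zs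
          + (\<Sum>i<p + 2. ev (\<lambda>J. K u (j # J)) (zs[i := vder (axis j 1) (Zs ! i) u])))"
        unfolding f_def by (intro sum.cong refl, subst dder_ev) (use sK sZ u Zu lZ in auto)
      also have "\<dots> = (\<Sum>j\<in>UNIV. ev (cder (axis j 1) (\<lambda>v J. K v (j # J)) u) zs)
          + (\<Sum>j\<in>UNIV. \<Sum>i<p + 2. ev (K u) (axis j 1 # zs[i := vder (axis j 1) (Zs ! i) u]))"
        unfolding ev_axis_Cons by (rule sum.distrib)
      also have "(\<Sum>j\<in>UNIV. ev (cder (axis j 1) (\<lambda>v J. K v (j # J)) u) zs)
          = ev (\<lambda>J. \<Sum>j\<in>UNIV. sder j (\<lambda>u. K u (j # J)) u) zs"
        by (simp add: ev_sum cder_def[abs_def] dder_axis)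
      also have "\<dots> = 0" unfolding zs_def by (rule div[OF u ws c])
      also have "(\<Sum>j\<in>UNIV. \<Sum>i<p + 2. ev (K u) (axis j 1 # zs[i := vder (axis j 1) (Zs ! i) u]))
          = (\<Sum>i<p + 2. \<Sum>j\<in>UNIV. ev (K u) (axis j 1 # zs[i := vder (axis j 1) (Zs ! i) u]))" by (rule sum.swap)
      also have "\<dots> = 0"
      proof (rule sum.neutral, rule ballI)
        fix i assume "i \<in> {..<p + 2}"
        then have i: "i < length zs" "i < length Zs" by (simp_all add: lZ)
        have sZi: "smv (Zs ! i)" using sZ i by simp
        have ku: "ev (K u) (y # zs[i := k *s cv u]) = 0" for y k
        proof -
          have "ev (K u) (y # zs[i := k *s cv u]) = k * ev (K u) ((y # take i zs) @ cv u # drop (Suc i) zs)"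
            using i ev_slot_scale[of "K u" "y # take i zs" k "cv u"] by (simp add: upd_conv_take_nth_drop)
          also have "ev (K u) ((y # take i zs) @ cv u # drop (Suc i) zs) = 0"
            by (rule tang_ev_zero[OF dtyped_tang[OF tK[OF u]] u1]) (use i lZ in simp)
          finally show ?thesis by simp
        qed
        have kp: "ev (K u) (y # zs[i := z]) = 0"
          if "pure (cv u) (b # bs) (y # zs[i := z])" "count_list (b # bs) True \<noteq> p" for y z b bs
          by (rule dtyped_ev[OF tK[OF u] _ that(1) _ that(2)]) (use lZ in auto)
        have pz: "pure (cv u) (replicate p True @ [False, False]) zs"
          unfolding zs_def using pure_append[OF pure_replicate(1)[OF ws(1)], of "[False, False]" "[c1, c2]"] ws c by simp
        have C: "(i < p \<and> Zs ! i = (\<lambda>v. Pm (cv v) (ws ! i)) \<and> ws ! i \<in> Em (cv u)) \<or>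
            ((i = p \<or> i = Suc p) \<and> (\<exists>c\<in>Ep (cv u). Zs ! i = (\<lambda>v. Pp (cv v) c)))"
        proof (cases "i < p")
          case True
          then show ?thesis using ws by (auto simp: Zs_def nth_append Ws_def)
        next
          case False
          then have "i = p \<or> i = Suc p" using i lZ by auto
          then show ?thesis using lW c by (auto simp: Zs_def nth_append)
        qed
        let ?A = "\<lambda>x y. ev (K u) (y # zs[i := vder x (Zs ! i) u])"
        show "(\<Sum>j\<in>UNIV. ?A (axis j 1) (axis j 1)) = 0"
        proof (rule trace_zero[where A = ?A and u = "cv u"])
          fix x y k b
          show "?A (x + b) y = ?A x y + ?A b y"
            using ev_update(1)[of "Suc i" "y # zs"] i by (simp add: vder_dir_add)
          show "?A (k *s x) y = k * ?A x y"
            using ev_update(2)[of "Suc i" "y # zs"] i by (simp add: vder_dir_scale)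
          show "?A x (y + b) = ?A x y + ?A x b"
            using ev_slot_add[of "K u" "[]" y b] by simp
          show "?A x (k *s y) = k * ?A x y"
            using ev_slot_scale[of "K u" "[]" k y] by simp
          show "?A (cv u) y = 0"
            using ku[of y 0] by (simp add: vder_normal[OF sZi u])
        next
          fix x y assume x: "x \<in> Em (cv u)" and y: "y \<in> Ep (cv u)"
          have *: "?A x y = 0"
            if c': "c' \<in> Ep (cv u)" "Zs ! i = (\<lambda>v. Pp (cv v) c')" for c'
            unfolding c'(2) vder_Pp_Em_dir[OF u x c'(1)] by (rule ku)
          show "?A x y = 0"
            using C
          proof (elim disjE conjE bexE)
            assume ip: "i < p" and Z: "Zs ! i = (\<lambda>v. Pm (cv v) (ws ! i))" and w: "ws ! i \<in> Em (cv u)"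
            \<comment> \<open>An argument of E- is replaced by one of E+, and y adds none, so fewer
              than p vectors of E- are left.\<close>
            have "vder x (Zs ! i) u \<in> Ep (cv u)"
              unfolding Z Em_const_field[OF u x w] by (rule Ep_scale[OF Em_cross[OF x w]])
            then have "pure (cv u) (False # (replicate p True @ [False, False])[i := False]) (y # zs[i := vder x (Zs ! i) u])"
              using y by (simp add: pure_update[OF pz])
            then show ?thesis by (rule kp) (use count_update_Em[OF ip, of "[False, False]"] in simp)
          qed (use * in blast)+
        next
          fix x y assume x: "x \<in> Ep (cv u)" and y: "y \<in> Em (cv u)"
          have *: "?A x y = 0"
            if ip: "i = p \<or> i = Suc p" and c': "c' \<in> Ep (cv u)" "Zs ! i = (\<lambda>v. Pp (cv v) c')" for c'
          proof -
            \<comment> \<open>An argument of E+ is replaced by one of E-; together with y this makes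
              p + 2 vectors of E-, too many for the type of K.\<close>
            have "vder x (Zs ! i) u \<in> Em (cv u)"
              unfolding c'(2) vder_Pp_Ep_dir[OF u x c'(1)] by (rule Em_scale[OF Ep_cross[OF x c'(1)]])
            then have "pure (cv u) (True # (replicate p True @ [False, False])[i := True]) (y # zs[i := vder x (Zs ! i) u])"
              using y by (simp add: pure_update[OF pz])
            then show ?thesis by (rule kp) (use ip in \<open>auto simp: list_update_append count_replicate\<close>)
          qed
          show "?A x y = 0"
            using C
          proof (elim disjE conjE bexE)
            assume Z: "Zs ! i = (\<lambda>v. Pm (cv v) (ws ! i))" and w: "ws ! i \<in> Em (cv u)"
            show ?thesis unfolding Z vder_Pm_Ep_dir[OF u x w] by (rule ku)
          qed (use * in blast)+
        qed (rule u1)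
      qed
      finally show ?thesis by simp
    qed
    \<comment> \<open>The field X has vanishing flat divergence, so the trace of the product rule
      leaves no multiple of G itself.\<close>
    have T: "(\<Sum>j\<in>UNIV. vder (axis j 1) X u \<odot> axis j 1) = 0"
    proof (rule trace_zero[where A = "\<lambda>x y. vder x X u \<odot> y" and u = "cv u"])
      note vX = vder_xcross[OF smv_Pp_const[of c1] smv_Pp_const[of c2] u, folded X_def, unfolded Cu]
      fix x y
      show "x \<in> Em (cv u) ==> y \<in> Ep (cv u) ==> vder x X u \<odot> y = 0"
        unfolding vX using Ep_Ep_dot[of _ "cv u" y]
        by (simp add: vder_Pp_Em_dir[OF u _ c(1)] vder_Pp_Em_dir[OF u _ c(2)] xcross_linear cdot_linear
            xcross_anticommute[of c1 "cv u"] EpD[OF c(1)] EpD[OF c(2)] c)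
      show "vder x X u \<odot> y = 0" if x: "x \<in> Ep (cv u)" and y: "y \<in> Em (cv u)"
        unfolding vX vder_Pp_Ep_dir[OF u x c(1)] vder_Pp_Ep_dir[OF u x c(2)] xcross_linear cdot_linear
          Ep_Em_cross[OF c(1) Ep_cross[OF x c(2)]] Em_Ep_cross[OF Ep_cross[OF x c(1)] c(2)]
        by (simp add: Em_dot_u[OF y])
    qed (simp_all add: vder_dir_add vder_dir_scale cdot_linear u1 vder_normal[OF sX u])
    have "12 * (\<Sum>j\<in>UNIV. dder (axis j 1) (f j) u) = (\<Sum>j\<in>UNIV. (-1) ^ p * (X u $ j * dder (axis j 1) G u + vder (axis j 1) X u $ j * G u))"
      unfolding sum_distrib_left
    proof (intro sum.cong refl)
      fix j
      have "12 * dder (axis j 1) (f j) u = dder (axis j 1) (\<lambda>v. 12 * f j v) u" by (rule dder_cmult[OF sf u, symmetric])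
      also have "\<dots> = dder (axis j 1) (\<lambda>v. (-1) ^ p * (X v $ j * G v)) u" by (rule dder_cong[OF fX u])
      also have "\<dots> = (-1) ^ p * (X u $ j * dder (axis j 1) G u + vder (axis j 1) X u $ j * G u)"
        by (simp add: dder_cmult[OF sm_mult[OF smvD[OF sX] sG] u] dder_mult[OF smvD[OF sX] sG u])
      finally show "12 * dder (axis j 1) (f j) u = (-1) ^ p * (X u $ j * dder (axis j 1) G u + vder (axis j 1) X u $ j * G u)" .
    qed
    also have "\<dots> = (-1) ^ p * (dder (X u) G u + (\<Sum>j\<in>UNIV. vder (axis j 1) X u \<odot> axis j 1) * G u)"
      by (simp only: sum_distrib_left[symmetric] sum.distrib sum_distrib_right[symmetric] dder_axis dder_def[of "X u"] cdot_axis)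
    finally have "dder (X u) G u = 0" unfolding F T by simp
    then show ?thesis by (simp add: X_def Cu)
  qed
  have "dder a G u = 0"
  proof (rule Ep_generated[of "- cv u" a "\<lambda>a. dder a G u"])
    show "dder (x \<otimes> y) G u = 0" if "x \<in> Em (- cv u)" "y \<in> Em (- cv u)" for x y
      using that by (intro step2) (simp_all add: Ep_uminus)
  qed (use a u1 in \<open>simp_all add: Em_uminus cdot_linear dder_dir_add dder_dir_scale\<close>)
  then show ?thesis using step1[OF a] by simp
qed

lemma dual_holomorphic_1:
  assumes s: "\<And>I. sm (\<lambda>u. c u I)" and t: "\<And>u. u \<in> S6 ==> dtyped (cv u) 1 1 (c u)"
    and d: "\<And>u w x. u \<in> S6 ==> w \<in> Em (cv u) ==> x \<in> Em (cv u) ==> ev (cder w c u) [x] = 0"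
    and u: "u \<in> S6"
  shows "c u [i] = 0"
proof -
  let ?F = "\<lambda>u. \<chi> i. c u [i]"
  have "?F u = 0"
  proof (rule E_plus_section_zero[OF _ _ _ u])
    show "smv ?F" using s by (simp add: smv_def)
    show "?F v \<in> Ep (cv v)" if v: "v \<in> S6" for v
    proof -
      have "Pp (cv v) (?F v) = ?F v"
        unfolding Pp_vec1 using typed_full[OF t[OF v]] by (simp del: act.simps)
      then show ?thesis using Pp_in_Ep[OF cv_cdot_self[OF v], of "?F v"] by simp
    qed
    show "vder w ?F v \<odot> x = 0" if "v \<in> S6" "w \<in> Em (cv v)" "x \<in> Em (cv v)" for v w x
      unfolding vec1_dot[of w c v x] by (rule d[OF that])
  qed
  then show ?thesis by (simp add: vec_eq_iff)
qed

lemma dual_holomorphic_2: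
  assumes s: "\<And>I. sm (\<lambda>u. c u I)" and al: "\<And>u. u \<in> S6 ==> altern (c u)" and t: "\<And>u. u \<in> S6 ==> dtyped (cv u) 2 2 (c u)"
    and d: "\<And>u w x y. u \<in> S6 ==> w \<in> Em (cv u) ==> x \<in> Em (cv u) ==> y \<in> Em (cv u) ==> ev (cder w c u) [x, y] = 0"
    and u: "u \<in> S6"
  shows "c u [i, j] = 0"
proof -
  let ?F = "\<lambda>u. biv (c u)"
  have pp: "act (pp (cv v)) (c v) J = c v J" if "v \<in> S6" "length J = 2" for v J
    by (rule typed_full[OF t[OF that(1)] that(2)])
  have FE: "?F v \<in> Em (cv v)" if v: "v \<in> S6" for v
    by (rule biv_Em[OF pp[OF v] cv_cdot_self[OF v]])
  have cross: "?F v \<odot> (x \<otimes> y) = 4 * ev (c v) [x, y]" if v: "v \<in> S6" "x \<in> Em (cv v)" "y \<in> Em (cv v)" for v x y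
    by (rule biv_dot_cross'[OF pp[OF v(1)] al[OF v(1)] cv_cdot_self[OF v(1)] v(2,3)])
  have sF: "smv ?F" by (rule smv_biv[OF s])
  have "?F u = 0"
  proof (rule E_minus_section_zero[OF sF FE _ u])
    fix v w x assume v: "v \<in> S6" and w: "w \<in> Em (cv v)" and x: "x \<in> Ep (cv v)"
    have v1: "cv v \<odot> cv v = 1" by (rule cv_cdot_self[OF v])
    show "vder w ?F v \<odot> x = 0"
    proof (rule Ep_generated[OF v1 x, of "\<lambda>x. vder w ?F v \<odot> x"])
      fix a b assume ab: "a \<in> Em (cv v)" "b \<in> Em (cv v)"
      let ?A = "\<lambda>v. Pm (cv v) a" and ?B = "\<lambda>v. Pm (cv v) b"
      have AB: "?A v = a" "?B v = b" using ab by (simp_all add: Pm_Em)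
      note sA = smv_Pm_const[of a] and sB = smv_Pm_const[of b]
      have c0: "ev (c v) [x, y] = 0" if "x \<in> Ep (cv v) \<or> y \<in> Ep (cv v)" for x y
      proof -
        have "ev (c v) [x, y] = ev (act (pp (cv v)) (c v)) [x, y]"
          by (rule ev_act_same[symmetric]) (simp add: pp[OF v])
        also have "\<dots> = ev (c v) [Pm (cv v) x, Pm (cv v) y]" unfolding ev_act_pp by simp
        finally show ?thesis
          using that ev_slot_zero[of "c v" "[]"] ev_slot_zero[of "c v" "[_]"] by (auto simp: Pm_Ep)
      qed
      have wE: "(\<i> / 2) *s (w \<otimes> y) \<in> Ep (cv v)" if "y \<in> Em (cv v)" for y
        by (rule Ep_scale[OF Em_cross[OF w that]])
      have "vder w ?F v \<odot> (?A v \<otimes> ?B v) = 0"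
      proof (rule dder_biv_cross[where c = c, OF sF s sA sB v])
        show "?F v' \<odot> (?A v' \<otimes> ?B v') = 4 * ev (c v') [?A v', ?B v']" if "v' \<in> S6" for v'
          by (rule cross[OF that]) (rule Pm_in_Em[OF cv_cdot_self[OF that]])+
        show "?F v \<odot> (?A v \<otimes> vder w ?B v) = 0" "?F v \<odot> (vder w ?A v \<otimes> ?B v) = 0"
          unfolding AB Em_const_field[OF v w ab(1)] Em_const_field[OF v w ab(2)]
            Em_Ep_cross[OF ab(1) wE[OF ab(2)]] Ep_Em_cross[OF wE[OF ab(1)] ab(2)]
          using Em_dot_u[OF FE[OF v]] by (simp_all add: cdot_linear cdot_commute[of "?F v"])
      qed (use d[OF v w ab] c0 wE ab in \<open>simp_all add: AB Em_const_field[OF v w]\<close>)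
      then show "vder w ?F v \<odot> (a \<otimes> b) = 0" unfolding AB .
    qed (simp_all add: cdot_linear)
  qed
  then have "ev (c u) [x, y] = 0" if "x \<in> Em (cv u)" "y \<in> Em (cv u)" for x y
    using cross[OF u that] by (simp add: cdot_linear)
  then have "act (pp (cv u)) (c u) [i, j] = 0"
    unfolding act_pp_eq_ev using Pm_in_Em[OF cv_cdot_self[OF u]] by simp
  then show ?thesis using pp[OF u, of "[i, j]"] by simp
qed

text \<open>The contraction has vanishing (0,1)-derivative and is therefore 0. This kills K on p
  vectors of E- and three of E+ by \<open>vcon_eq\<close>; on all other pure arguments K vanishes by
  type.\<close>

lemma divergence_free_zero:
  assumes p: "p = 1 \<or> p = 2"
    and sK: "\<And>I. sm (\<lambda>u. K u I)" and aK: "\<And>u. u \<in> S6 ==> altern (K u)"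
    and tK: "\<And>u. u \<in> S6 ==> dtyped (cv u) (p + 3) p (K u)"
    and div: "\<And>u ws c c'. u \<in> S6 ==> set ws \<subseteq> Em (cv u) ==> length ws = p ==> c \<in> Ep (cv u) ==> c' \<in> Ep (cv u)
      ==> ev (\<lambda>J. \<Sum>j\<in>UNIV. sder j (\<lambda>u. K u (j # J)) u) (ws @ [c, c']) = 0"
    and u: "u \<in> S6" and I: "length I = p + 3"
  shows "K u I = 0"
proof -
  have u1: "cv u \<odot> cv u = 1" by (rule cv_cdot_self[OF u])
  note par = vcon_parallel[where K = K and p = p, OF sK aK tK div]
  note tv = dtyped_vcon[where K = K and p = p, OF _ tK] and av = altern_vcon[where K = K, OF aK]
  have v0: "vcon K u I = 0" if lI: "length I = p" for I
    using p
  proof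
    assume p: "p = 1"
    then obtain i where "I = [i]" using lI by (auto simp: length_Suc_conv)
    moreover have "vcon K u [i] = 0"
      by (rule dual_holomorphic_1[where c = "vcon K", OF sm_vcon[OF sK] tv[unfolded p] _ u]) (use par p in auto)
    ultimately show ?thesis by simp
  next
    assume p: "p = 2"
    then obtain i j where "I = [i, j]" using lI by (auto simp: length_Suc_conv numeral_2_eq_2)
    moreover have "vcon K u [i, j] = 0"
      by (rule dual_holomorphic_2[where c = "vcon K", OF sm_vcon[OF sK] av tv[unfolded p] _ u]) (use par p in auto)
    ultimately show ?thesis by simp
  qed
  show ?thesis
  proof (rule pure_zero[OF aK[OF u] dtyped_tang[OF tK[OF u]] u1 _ I])
    fix ws cs assume ws: "set ws \<subseteq> Em (cv u)" and cs: "set cs \<subseteq> Ep (cv u)" and l: "length ws + length cs = p + 3"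
    show "ev (K u) (ws @ cs) = 0"
    proof (cases "length ws = p")
      case True
      then obtain c1 c2 c3 where c: "cs = [c1, c2, c3]" using l by (auto simp: length_Suc_conv numeral_3_eq_3)
      have "ev (vcon K u) ws = ev (\<lambda>I. 0) ws" by (rule ev_cong) (simp add: v0 True)
      then show ?thesis
        using vcon_eq[where K = K and ws = ws, OF u aK[OF u], of c1 c2 c3] cs unfolding c by (simp add: ev_def[of "\<lambda>I. 0"])
    next
      case False
      then show ?thesis
        by (intro dtyped_ev[OF tK[OF u] _ pure_append[OF pure_replicate(1)[OF ws] pure_replicate(2)[OF cs]]])
          (use l in \<open>auto simp: count_replicate\<close>)
    qed
  qed
qed

context metric_on_S6
begin

text \<open>Test the adjoint relation with the conjugate of the (p,q)-part of the divergence. The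
  pairing becomes the integral of a sum of squared moduli, whose vanishing is pointwise.\<close>

theorem dbar_adj_zero_divg:
  assumes \<phi>: "\<phi> \<in> Omega std_J p (Suc q)" and adj: "dbar_adj std_J g p q \<phi> = 0" and u: "u \<in> S6" and J: "length J = p + q"
  shows "tp (pp (cv u)) (pm (cv u)) p (divg (p + q) (dual (Suc (p + q)) (fcomp \<phi>)) u) J = 0"
proof -
  let ?k = "p + q"
  let ?K = "dual (Suc ?k) (fcomp \<phi>)"
  let ?d = "\<lambda>u. divg ?k ?K u"
  note o = Omega_comps[OF \<phi>]
  have sK: "sm (\<lambda>u. ?K u I)" for I by (rule sm_dual[OF o(1)])
  have aK: "altern (?K u)" if "u \<in> S6" for u by (rule altern_dual[where c = "fcomp \<phi>", OF o(2)[OF that]])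
  have tK: "tang (cv u) (Suc ?k) (?K u)" if "u \<in> S6" for u
    using dtyped_tang[OF dtyped_dual[where c = "fcomp \<phi>", OF that, of "Suc ?k" p]] o(3)[OF that] by simp
  have sd: "sm (\<lambda>u. ?d u I)" for I by (rule sm_divg[OF sK])
  define c where "c = (\<lambda>u. ftp (cv u) p (\<lambda>I. cnj (?d u I)))"
  have ac: "altern (c u)" if "u \<in> S6" for u
    unfolding c_def by (rule altern_tp[OF altern_cnj[OF altern_divg[OF sK aK that]]])
  have tc: "ftyped (cv u) ?k p (c u)" if "u \<in> S6" for u unfolding c_def by (rule ftyped_ftp[OF cv_cdot_self[OF that]])
  have sc: "sm (\<lambda>u. c u I)" for I
    unfolding c_def by (rule sm_tp[OF sm_pm sm_pp sm_cnj[OF sd]])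
  have cc: "cnj (c u I) = tp (pp (cv u)) (pm (cv u)) p (?d u) I" for u I
    unfolding c_def by (simp add: cnj_tp cnj_pm cnj_pp)
  have \<theta>: "mkfield ?k c \<in> Omega std_J p q" by (rule mkfield_Omega) (use ac tc sc in auto)
  let ?h = "\<lambda>u. \<Sum>J\<in>idx ?k. (cmod (c u J))\<^sup>2"
  let ?f = "\<lambda>u. \<Sum>J\<in>idx ?k. fcomp (mkfield ?k c) u J * ?d u J"
  have fh: "?f u = of_real (?h u)" if u: "u \<in> S6" for u
  proof -
    have "?f u = (\<Sum>J\<in>idx ?k. c u J * ?d u J)"
      by (intro sum.cong refl) (simp add: cmp_mkfield[OF u] in_idx)
    also have "\<dots> = (\<Sum>J\<in>idx ?k. ftp (cv u) p (c u) J * ?d u J)"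
      using tc[OF u] by (intro sum.cong refl) (simp add: typed_tp_same[of _ _ ?k] in_idx)
    also have "\<dots> = (\<Sum>J\<in>idx ?k. ?d u J * ftp (cv u) p (c u) J)" by (simp only: mult.commute)
    also have "\<dots> = (\<Sum>J\<in>idx ?k. cnj (c u J) * c u J)"
      unfolding tp_transpose pm_transpose_fun pp_transpose_fun cc ..
    also have "\<dots> = of_real (?h u)" unfolding of_real_sum complex_norm_square by (simp only: mult.commute)
    finally show ?thesis .
  qed
  have sf: "sm ?f" by (intro sm_sum sm_mult Omega_comps(1)[OF \<theta>] sd)
  have "sph_int ?f = sph_int (\<lambda>u. \<Sum>L\<in>idx (Suc ?k). dcomp ?k (fcomp (mkfield ?k c)) u L * ?K u L)"
    by (rule sph_int_dcomp[OF Omega_comps(1)[OF \<theta>] sK aK tK, symmetric])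
  also have "\<dots> = L2_inner g (p + Suc q) (dbar std_J p q (mkfield ?k c)) \<phi>"
    by (rule L2_dbar[OF \<theta> \<phi>, symmetric])
  also have "\<dots> = L2_inner g ?k (mkfield ?k c) (dbar_adj std_J g p q \<phi>)" by (rule dbar_adj(2)[OF \<phi> \<theta>])
  also have "\<dots> = 0" unfolding adj by (rule L2_zero_right[OF \<theta>])
  finally have z: "sph_int ?f = 0" .
  have "?f u = 0" by (rule sph_int_pos_zero[OF sf fh _ z u]) (auto intro!: sum_nonneg)
  then have "?h u = 0" using fh[OF u] by (simp only: of_real_eq_0_iff)
  then have "c u J = 0" using J by (subst (asm) sum_nonneg_eq_0_iff) (auto simp: finite_tup in_idx)
  then show ?thesis unfolding cc[symmetric] by simp
qed

theorem harmonic_p3_zero: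
  assumes p: "p = 1 \<or> p = 2" and \<phi>: "\<phi> \<in> Omega std_J p 3" and h: "dbar_laplacian std_J g p 3 \<phi> = 0"
  shows "\<phi> = 0"
proof -
  have \<phi>': "\<phi> \<in> Omega std_J p (Suc 2)" using \<phi> by (simp add: numeral_3_eq_3 numeral_2_eq_2)
  have adj: "dbar_adj std_J g p 2 \<phi> = 0" by (rule harmonic_Suc[OF \<phi>']) (use h in \<open>simp add: numeral_3_eq_3 numeral_2_eq_2\<close>)
  note o = Omega_comps[OF \<phi>]
  let ?K = "dual (Suc (p + 2)) (fcomp \<phi>)"
  have "?K u I = 0" if u: "u \<in> S6" and I: "length I = p + 3" for u I
  proof (rule divergence_free_zero[where K = ?K, OF p _ _ _ _ u I])
    show "sm (\<lambda>u. ?K u I)" for I by (rule sm_dual[OF o(1)])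
    show "altern (?K u)" if "u \<in> S6" for u by (rule altern_dual[where c = "fcomp \<phi>", OF o(2)[OF that]])
    show "dtyped (cv u) (p + 3) p (?K u)" if "u \<in> S6" for u
      by (rule dtyped_dual[where c = "fcomp \<phi>", OF that o(3)[OF that]])
    fix u ws c c' assume u: "u \<in> S6" and ws: "set ws \<subseteq> Em (cv u)" "length ws = p" and c: "c \<in> Ep (cv u)" "c' \<in> Ep (cv u)"
    let ?D = "\<lambda>J. \<Sum>j\<in>UNIV. sder j (\<lambda>u. ?K u (j # J)) u" and ?d = "divg (p + 2) ?K u"
    have "ev ?d (ws @ [c, c']) = ev (tp (pp (cv u)) (pm (cv u)) p ?d) (ws @ [c, c'])"
      using ev_dtp[OF pure_append[OF pure_replicate(1)[OF ws(1)], of "[False, False]" "[c, c']"], of p ?d] ws c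
      by (simp add: count_replicate)
    also have "\<dots> = ev (\<lambda>J. 0) (ws @ [c, c'])"
      by (rule ev_cong, rule dbar_adj_zero_divg[OF \<phi>' adj u]) (use ws in simp)
    finally have "ev ?d (ws @ [c, c']) = 0" by (simp add: ev_def)
    moreover have "ev ?d (ws @ [c, c']) = - of_nat (Suc (p + 2)) * ev ?D (ws @ [c, c'])"
      unfolding divg_def[abs_def] by (rule ev_cscale)
    ultimately show "ev ?D (ws @ [c, c']) = 0" by (simp del: of_nat_Suc)
  qed
  then have K0: "dual (p + 3) (fcomp \<phi>) u I = 0" if "u \<in> S6" "length I = p + 3" for u I
    using that by (simp add: numeral_3_eq_3 numeral_2_eq_2)
  have "L2_inner g (p + 3) \<phi> \<phi> = sph_int (\<lambda>u. \<Sum>I\<in>idx (p + 3). fcomp \<phi> u I * dual (p + 3) (fcomp \<phi>) u I)"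
    by (rule L2_Omega[OF \<phi> \<phi> refl refl])
  also have "\<dots> = sph_int (\<lambda>u. 0)"
    by (rule sph_int_cong) (auto simp: K0 in_idx intro!: sm_sum sm_mult sm_dual o(1) sm_const)
  finally have "L2_inner g (p + 3) \<phi> \<phi> = 0" by (simp add: sph_int_zero)
  then show ?thesis by (rule L2_self(3)[OF \<phi>])
qed

end

section \<open>Hodge numbers\<close>

lemma cdim_zero: "V \<subseteq> {0} ==> cdim V = 0"
proof -
  interpret vector_space cscale2 by (rule vector_space_cscale2)
  assume V: "V \<subseteq> {0}"
  then have s: "V \<subseteq> span {}" by simp
  have "dim V = 0" using dim_le_card[OF s] by simp
  moreover have "\<exists>B. finite B \<and> V \<subseteq> span B" using s by (intro exI[of _ "{}"]) simp
  ultimately show ?thesis unfolding cdim_def by (simp add: zero_enat_def)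
qed

theorem hodge_numbers_zero:
  assumes "compatible_metric std_J g"
  shows "hodge_number std_J g 1 0 = 0" "hodge_number std_J g 2 0 = 0"
    "hodge_number std_J g 2 3 = 0" "hodge_number std_J g 1 3 = 0"
proof -
  interpret metric_on_S6 g using assms by (rule metric_on_S6.intro)
  show "hodge_number std_J g 1 0 = 0" "hodge_number std_J g 2 0 = 0"
    unfolding hodge_number_def
    using holomorphic_1_forms[OF _ harmonic_0] holomorphic_2_forms[OF _ harmonic_0] by (auto intro!: cdim_zero)
  show "hodge_number std_J g 2 3 = 0" "hodge_number std_J g 1 3 = 0"
    unfolding hodge_number_def using harmonic_p3_zero by (auto intro!: cdim_zero)
qed

section \<open>The complex volume form\<close>

text \<open>The cut-off at other lengths is what makes the array alternating on lists of every
  length.\<close>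

definition phi3a :: "7 list => complex" where "phi3a J = (if length J = 3 then phi3 J else 0)"

text \<open>The (3,0)-part of the associative form.\<close>

definition vcomp :: "vec7 => 7 list => complex" where "vcomp u = ftp (cv u) 3 phi3a"

definition volform :: tensor_field where "volform = mkfield 3 vcomp"

lemma altern_phi3a: "altern phi3a"
  unfolding altern_def
proof (intro allI)
  fix xs ys and a b :: 7
  have 1: "phi3 [a, b, c] = - phi3 [b, a, c]" for c
    unfolding phi3_def by (simp add: xcross_anticommute[of "axis b 1" "axis a 1"] cdot_minus_left)
  have 2: "phi3 [c, a, b] = - phi3 [c, b, a]" for c
    unfolding phi3_def by (simp add: xcross_dot_swap[of "axis c 1" "axis a 1"])
  show "phi3a (xs @ a # b # ys) = - phi3a (xs @ b # a # ys)"
  proof (cases "length xs + length ys = 1")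
    case True
    then consider c where "xs = []" "ys = [c]" | c where "xs = [c]" "ys = []"
      by (cases xs; cases ys) auto
    then show ?thesis
      by cases (simp_all only: append_Nil append_Cons phi3a_def 1[of _] 2[of _], simp_all add: 1 2)
  next
    case False
    then show ?thesis by (simp add: phi3a_def)
  qed
qed

lemma ev_phi3a: "ev phi3a [a, b, c] = (a \<otimes> b) \<odot> c"
proof -
  have "ev phi3a [a, b, c] = ev phi3 [a, b, c]" by (rule ev_cong) (simp add: phi3a_def)
  then show ?thesis by (simp only: ev_phi3)
qed

lemma vcomp_act: "length J = 3 ==> vcomp u J = act (pm (cv u)) phi3a J"
  unfolding vcomp_def using tp_full[of "pm (cv u)" "pp (cv u)" J phi3a] by simp

lemma vcomp_other: "length J \<noteq> 3 ==> vcomp u J = 0"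
proof -
  assume J: "length J \<noteq> 3"
  have "vcomp u J = ftp (cv u) 3 (\<lambda>J. 0 * phi3a J) J"
    unfolding vcomp_def by (rule tp_cong) (use J in \<open>simp add: phi3a_def\<close>)
  then show ?thesis unfolding tp_scale by simp
qed

lemma altern_vcomp: "altern (vcomp u)"
  unfolding vcomp_def by (rule altern_tp[OF altern_phi3a])

lemma ftyped_vcomp: "u \<in> S6 ==> ftyped (cv u) 3 3 (vcomp u)"
  unfolding vcomp_def by (rule ftyped_ftp[OF cv_cdot_self])

lemma sm_vcomp: "sm (\<lambda>u. vcomp u J)"
  unfolding vcomp_def by (rule sm_tp[OF sm_pm sm_pp sm_const])

lemma ev_vcomp: "ev (vcomp u) [x, y, z] = (Pp (cv u) x \<otimes> Pp (cv u) y) \<odot> Pp (cv u) z"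
proof -
  have "ev (vcomp u) [x, y, z] = ev (act (pm (cv u)) phi3a) [x, y, z]" by (rule ev_cong) (simp add: vcomp_act)
  then show ?thesis unfolding ev_act_pm by (simp add: ev_phi3a)
qed

lemma volform_eq: "u \<in> S6 ==> volform u = tensor_of 3 (vcomp u)"
  by (simp add: volform_def mkfield_def)

text \<open>Otherwise E- and E+ would pair to 0, as products of E+ generate E-. Both projections
  would then vanish and every vector would be a multiple of the normal, which fails for two
  different axes.\<close>

lemma ex_Ep_volume_nonzero:
  assumes u: "u \<in> S6"
  shows "\<exists>c1\<in>Ep (cv u). \<exists>c2\<in>Ep (cv u). \<exists>c3\<in>Ep (cv u). (c1 \<otimes> c2) \<odot> c3 \<noteq> 0"
proof (rule ccontr)
  assume "\<not> ?thesis"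
  then have z: "(c1 \<otimes> c2) \<odot> c3 = 0" if "c1 \<in> Ep (cv u)" "c2 \<in> Ep (cv u)" "c3 \<in> Ep (cv u)" for c1 c2 c3
    using that by blast
  have u1: "cv u \<odot> cv u = 1" by (rule cv_cdot_self[OF u])
  have d: "x \<odot> c = 0" if x: "x \<in> Em (cv u)" and c: "c \<in> Ep (cv u)" for x c
  proof (rule Ep_generated[of "- cv u" x "\<lambda>x. x \<odot> c"])
    show "- cv u \<odot> - cv u = 1" by (simp add: cdot_linear u1)
    show "x \<in> Ep (- cv u)" using x by (simp add: Em_uminus)
    fix a b assume "a \<in> Em (- cv u)" "b \<in> Em (- cv u)"
    then have "a \<in> Ep (cv u)" "b \<in> Ep (cv u)" by (simp_all add: Ep_uminus)
    then show "(a \<otimes> b) \<odot> c = 0" using z c by blast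
  qed (simp_all add: cdot_linear)
  have Pp0: "Pp (cv u) a = 0" for a
  proof (rule cdot_ext)
    fix b
    have "Pp (cv u) a \<odot> b = Pp (cv u) (Pp (cv u) a) \<odot> b" by (simp add: Pp_Ep[OF Pp_in_Ep[OF u1]])
    also have "\<dots> = Pm (cv u) b \<odot> Pp (cv u) a" unfolding Pp_dot[of _ "Pp (cv u) a"] by (rule cdot_commute)
    finally show "Pp (cv u) a \<odot> b = 0 \<odot> b" using d[OF Pm_in_Em[OF u1] Pp_in_Ep[OF u1]] by (simp add: cdot_linear)
  qed
  have "Pm (cv u) a = 0" for a
    using arg_cong[OF vcnj_Pm[of u a], of vcnj] Pp0[of "vcnj a"] by (simp add: vec_eq_iff)
  then have a: "(cv u \<odot> a) *s cv u = a" for a using Pm_Pp_decomp[of "cv u" a] Pp0 by simp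
  have b: "complex_of_real (u $ i) *s cv u = axis i 1" for i using a[of "axis i 1"] unfolding cdot_axis cv_nth .
  have "complex_of_real (u $ 1) * complex_of_real (u $ 1) = 1" "complex_of_real (u $ 2) * complex_of_real (u $ 2) = 1"
    "complex_of_real (u $ 1) * complex_of_real (u $ 2) = 0"
    using arg_cong[OF b[of 1], of "\<lambda>v. v $ 1"] arg_cong[OF b[of 2], of "\<lambda>v. v $ 2"]
      arg_cong[OF b[of 1], of "\<lambda>v. v $ 2"] by (simp_all add: axis_def)
  then show False by auto
qed

lemma Ep_volume_nonzero:
  assumes u: "u \<in> S6"
  obtains c1 c2 c3 where "c1 \<in> Ep (cv u)" "c2 \<in> Ep (cv u)" "c3 \<in> Ep (cv u)" "(c1 \<otimes> c2) \<odot> c3 \<noteq> 0"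
  using ex_Ep_volume_nonzero[OF u] by blast

text \<open>The value is the constant of \<open>trivector_eq\<close>, applied to the associative
  form and three vectors of nonzero volume.\<close>

lemma vol_contract:
  assumes u: "u \<in> S6" shows "(\<Sum>J\<in>idx 3. phi3 J * vcomp u J) = 12"
proof -
  obtain c1 c2 c3 where c: "c1 \<in> Ep (cv u)" "c2 \<in> Ep (cv u)" "c3 \<in> Ep (cv u)" and n: "(c1 \<otimes> c2) \<odot> c3 \<noteq> 0"
    by (rule Ep_volume_nonzero[OF u])
  have "(\<Sum>J\<in>idx 3. phi3 J * vcomp u J) = (\<Sum>J\<in>idx 3. phi3 J * act (pm (cv u)) phi3a J)"
    by (intro sum.cong refl) (simp add: vcomp_act in_idx)
  then show ?thesis
    using trivector_eq[OF altern_phi3a cv_cdot_self[OF u] c] n unfolding ev_phi3a by simp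
qed

text \<open>By \<open>trivector_eq\<close> a (3,0)-form is a multiple of the volume form, with a
  twelfth of its contraction with \<open>phi3\<close> as coefficient.\<close>

lemma Lambda_30:
  assumes u: "u \<in> S6" shows "Lambda std_J 3 0 u = range (\<lambda>k. cscale k (volform u))"
proof (intro equalityI subsetI)
  fix \<eta> assume "\<eta> \<in> Lambda std_J 3 0 u"
  then have \<eta>: "form_at u 3 3 \<eta>" using Lambda_iff[OF u, of \<eta> 3 0] by simp
  let ?T = "cmp \<eta>" and ?k = "(\<Sum>J\<in>idx 3. phi3 J * act (pm (cv u)) (cmp \<eta>) J) / 12"
  have u1: "cv u \<odot> cv u = 1" by (rule cv_cdot_self[OF u])
  have "?T J = ?k * vcomp u J" if J: "length J = 3" for J
  proof -
    obtain i j k where J': "J = [i, j, k]" using J by (auto simp: length_Suc_conv numeral_3_eq_3)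
    let ?P = "\<lambda>i. Pp (cv u) (axis i 1)"
    have act3: "act (pm (cv u)) c J = ev c [?P i, ?P j, ?P k]" for c
      unfolding act_pm_eq_ev J' by simp
    have "12 * ?T J = 12 * act (pm (cv u)) ?T J"
      using typed_full[of "pm (cv u)" "pp (cv u)" 3 ?T J] \<eta> J by (simp add: form_at_def)
    also have "\<dots> = ((?P i \<otimes> ?P j) \<odot> ?P k) * (12 * ?k)"
      unfolding act3 using trivector_eq[of ?T "cv u" "?P i" "?P j" "?P k"] \<eta> u1 Pp_in_Ep[OF u1]
      by (simp add: form_at_def)
    also have "(?P i \<otimes> ?P j) \<odot> ?P k = vcomp u J"
      unfolding vcomp_act[OF J] act3 ev_phi3a ..
    finally show ?thesis by (simp add: mult.commute)
  qed
  then have "tensor_of 3 ?T = tensor_of 3 (\<lambda>J. ?k * vcomp u J)" by (rule tensor_of_cong)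
  moreover have "\<eta> = tensor_of 3 ?T" using \<eta> by (simp add: form_at_def)
  ultimately have "\<eta> = cscale ?k (volform u)" unfolding volform_eq[OF u] tensor_of_scale by simp
  then show "\<eta> \<in> range (\<lambda>k. cscale k (volform u))" by blast
next
  fix \<eta> assume "\<eta> \<in> range (\<lambda>k. cscale k (volform u))"
  then obtain k where \<eta>: "\<eta> = cscale k (volform u)" by blast
  have "form_at u 3 3 (volform u)"
    unfolding volform_eq[OF u] by (rule form_atI[OF altern_vcomp ftyped_vcomp[OF u]])
  then have "form_at u 3 3 \<eta>" using cs.subspace_scale[OF form_at_subspace, of _ u 3 3 k] by (simp add: \<eta>)
  then show "\<eta> \<in> Lambda std_J 3 0 u" using Lambda_iff[OF u, of \<eta> 3 0] by simp
qed

text \<open>Differentiate the volume of three fields of type (1,0) along E-. Their derivatives are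
  normal, and the triple product of a normal vector with two vectors of E+ vanishes by
  isotropy.\<close>

lemma cder_vcomp:
  assumes u: "u \<in> S6" and w: "w \<in> Em (cv u)" and c: "c1 \<in> Ep (cv u)" "c2 \<in> Ep (cv u)" "c3 \<in> Ep (cv u)"
  shows "ev (cder w vcomp u) [c1, c2, c3] = 0"
proof -
  let ?C = "\<lambda>c v. Pp (cv v) c"
  note s = smv_Pp_const
  note D = vder_Pp_Em_dir[OF u w c(1)] vder_Pp_Em_dir[OF u w c(2)] vder_Pp_Em_dir[OF u w c(3)]
  have u1: "cv u \<odot> cv u = 1" by (rule cv_cdot_self[OF u])
  have P: "?C c1 u = c1" "?C c2 u = c2" "?C c3 u = c3" using c by (simp_all add: Pp_Ep)
  have t: "ev (vcomp u) (xs @ cv u # ys) = 0" if "length xs + Suc (length ys) = 3" for xs ys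
    by (rule tang_ev_zero[OF ftyped_tang[OF ftyped_vcomp[OF u]] u1 that])
  have "dder w (\<lambda>v. ev (vcomp v) [?C c1 v, ?C c2 v, ?C c3 v]) u = dder w (\<lambda>v. (?C c1 v \<otimes> ?C c2 v) \<odot> ?C c3 v) u"
    by (rule dder_cong[OF _ u]) (simp add: ev_vcomp Pp_Ep[OF Pp_in_Ep[OF cv_cdot_self]])
  also have "\<dots> = 0"
    unfolding dder_cdot[OF smv_xcross[OF s s] s u] vder_xcross[OF s s u] D P xcross_linear cdot_linear
      xcross_anticommute[of c1 "cv u"] EpD[OF c(1)] EpD[OF c(2)]
    using Ep_Ep_dot[OF c(1,3)] Ep_Ep_dot[OF c(2,3)] Em_dot_u[OF Ep_cross[OF c(1,2)]]
    by (simp add: cdot_commute[of _ "cv u"])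
  finally have e1: "dder w (\<lambda>v. ev (vcomp v) [?C c1 v, ?C c2 v, ?C c3 v]) u = 0" .
  have e2: "dder w (\<lambda>v. ev (vcomp v) [?C c1 v, ?C c2 v, ?C c3 v]) u = ev (cder w vcomp u) [c1, c2, c3]
      + (ev (vcomp u) [vder w (?C c1) u, c2, c3] + ev (vcomp u) [c1, vder w (?C c2) u, c3] + ev (vcomp u) [c1, c2, vder w (?C c3) u])"
    using dder_ev[of vcomp "[?C c1, ?C c2, ?C c3]" u w] sm_vcomp s u P by auto
  have e3: "ev (vcomp u) [k *s cv u, c2, c3] = 0" "ev (vcomp u) [c1, k *s cv u, c3] = 0" "ev (vcomp u) [c1, c2, k *s cv u] = 0" for k
    using ev_slot_scale[of "vcomp u" "[]" k "cv u" "[c2, c3]"] ev_slot_scale[of "vcomp u" "[c1]" k "cv u" "[c3]"]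
      ev_slot_scale[of "vcomp u" "[c1, c2]" k "cv u" "[]"] t[of "[]" "[c2, c3]"] t[of "[c1]" "[c3]"] t[of "[c1, c2]" "[]"]
    by simp_all
  show ?thesis using e2 unfolding D e3 e1 by simp
qed

text \<open>By type it suffices to evaluate on one vector of E- and three of E+. The derivative
  along E- vanishes by \<open>cder_vcomp\<close>, and those along E+ by
  \<open>cder_Ep_Em\<close>.\<close>

lemma dbar_vcomp:
  assumes u: "u \<in> S6" and L: "length L = 4"
  shows "ftp (cv u) 3 (dcomp 3 vcomp u) L = 0"
proof -
  have u1: "cv u \<odot> cv u = 1" by (rule cv_cdot_self[OF u])
  have al: "altern (ftp (cv u) 3 (dcomp 3 vcomp u))"
    by (rule altern_tp[OF altern_dcomp[where c = vcomp, OF sm_vcomp altern_vcomp u]])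
  have ta: "tang (cv u) 4 (ftp (cv u) 3 (dcomp 3 vcomp u))"
    by (rule ftyped_tang[OF ftyped_ftp[OF u1]])
  have H: "ev (ftp (cv u) 3 (dcomp 3 vcomp u)) (ws @ cs) = 0"
    if ws: "set ws \<subseteq> Em (cv u)" and cs: "set cs \<subseteq> Ep (cv u)" and l: "length ws + length cs = 4" for ws cs
  proof -
    let ?bs = "replicate (length ws) True @ replicate (length cs) False"
    have "pure (cv u) ?bs (ws @ cs)" by (rule pure_append[OF pure_replicate(1)[OF ws] pure_replicate(2)[OF cs]])
    moreover have "count_list ?bs False = length cs" by (simp add: count_replicate)
    ultimately have e: "ev (ftp (cv u) 3 (dcomp 3 vcomp u)) (ws @ cs) = (if 3 = length cs then ev (dcomp 3 vcomp u) (ws @ cs) else 0)"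
      using ev_ftp[of "cv u" ?bs "ws @ cs" 3 "dcomp 3 vcomp u"] by simp
    show ?thesis
    proof (cases "length cs = 3")
      case True
      then obtain w c1 c2 c3 where wc: "ws = [w]" "cs = [c1, c2, c3]"
        using l by (auto simp: length_Suc_conv numeral_3_eq_3 numeral_eq_Suc)
      have w: "w \<in> Em (cv u)" and c: "c1 \<in> Ep (cv u)" "c2 \<in> Ep (cv u)" "c3 \<in> Ep (cv u)" using ws cs wc by auto
      have z: "ev (cder a vcomp u) [w, x, y] = 0" if "a \<in> Ep (cv u)" for a x y
        by (rule cder_Ep_Em[where c = vcomp, OF sm_vcomp ftyped_vcomp u that w]) simp_all
      have "ev (dcomp 3 vcomp u) [w, c1, c2, c3] = (\<Sum>i<Suc 3. (-1) ^ i * ev (cder ([w, c1, c2, c3] ! i) vcomp u) (drop_nth i [w, c1, c2, c3]))"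
        by (rule ev_dcomp) (use w c in \<open>auto dest: Em_dot_u Ep_dot_u\<close>)
      also have "\<dots> = 0"
        using cder_vcomp[OF u w c] z[OF c(1)] z[OF c(2)] z[OF c(3)] by (simp add: numeral_3_eq_3)
      finally show ?thesis using e wc by simp
    qed (use e in simp)
  qed
  show ?thesis by (rule pure_zero[where c = "ftp (cv u) 3 (dcomp 3 vcomp u)" and u = "cv u" and k = 4, OF al ta u1 H L])
qed

section \<open>The operator dbar on powers of the canonical bundle\<close>

definition cotens :: "cvec => tensor => tensor"
  where "cotens A \<kappa> = tens 1 (wedge [\<lambda>v. A \<odot> cv v]) \<kappa>"

lemma wedge_single: "wedge [\<alpha>] vs = (if length vs = 1 then \<alpha> (vs ! 0) else 0)" for \<alpha> :: "vec7 => complex"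
proof -
  have "{\<sigma>. \<sigma> permutes {..<Suc 0}} = {id}" by (auto simp: lessThan_Suc)
  then show ?thesis by (simp add: wedge_def)
qed

lemma wedge_Nil: "wedge [] vs = (if vs = [] then 1 else (0::complex))"
  by (simp add: wedge_def)

lemma cotens_Nil: "cotens A \<kappa> [] = 0" and cotens_Cons: "cotens A \<kappa> (v # vs) = (A \<odot> cv v) * \<kappa> vs"
  by (simp_all add: cotens_def tens_def wedge_single)

lemma cotens_eqI: "(\<And>v vs. (A \<odot> cv v) * \<kappa> vs = t (v # vs)) ==> t [] = 0 ==> cotens A \<kappa> = t"
proof
  fix vs assume "\<And>v vs. (A \<odot> cv v) * \<kappa> vs = t (v # vs)" "t [] = 0"
  then show "cotens A \<kappa> vs = t vs" by (cases vs) (simp_all add: cotens_Nil cotens_Cons)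
qed

definition grad :: "(vec7 => complex) => vec7 => cvec" where "grad f u = (\<chi> j. sder j f u)"

text \<open>The component vector of dbar f, because covectors of type (0,1) have components in
  E+.\<close>

definition gradp :: "(vec7 => complex) => vec7 => cvec" where "gradp f u = Pp (cv u) (grad f u)"

lemma grad_dot: "w \<odot> grad f u = dder w f u"
  by (simp add: grad_def dder_def cdot_def)

lemma gradp_dot: "w \<odot> gradp f u = dder (Pm (cv u) w) f u"
  unfolding gradp_def Pm_dot[symmetric] grad_dot ..

lemma gradp_Ep: "u \<in> S6 ==> gradp f u \<in> Ep (cv u)"
  unfolding gradp_def by (rule Pp_in_Ep[OF cv_cdot_self])

lemma ev_antis_dot:
  assumes "length zs = Suc k"
  shows "ev (antis (\<lambda>j J. A $ j * c J)) zs = (\<Sum>i<Suc k. (-1) ^ i * ((zs ! i \<odot> A) * ev c (drop_nth i zs)))"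
proof -
  have "(\<lambda>J. \<Sum>j\<in>UNIV. z $ j * (A $ j * c J)) = (\<lambda>J. (z \<odot> A) * c J)" for z
    by (simp add: cdot_def sum_distrib_right mult.assoc)
  then show ?thesis unfolding ev_antis[OF assms] by (simp only: ev_cscale)
qed

text \<open>Wedging with a covector of pure type shifts the weight: s is z for type (1,0) and 1 for
  type (0,1).\<close>

lemma ftyped_antis:
  assumes A: "\<And>z. z *s Pm u A + Pp u A = s z *s A" and c: "ftyped u k p c" and s: "\<And>z. s z * z ^ p = z ^ q"
  shows "ftyped u (Suc k) q (antis (\<lambda>j J. A $ j * c J))"
  unfolding typed_def
proof (intro allI impI)
  fix I :: "7 list" and z assume I: "length I = Suc k"
  let ?M = "pencil z (pm u) (pp u)"
  let ?r = "\<lambda>i. \<chi> j. ?M i j"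
  have r: "?r m \<odot> A = s z * A $ m" for m
  proof -
    have "?r m \<odot> A = z * (\<Sum>j\<in>UNIV. pm u m j * A $ j) + (\<Sum>j\<in>UNIV. pp u m j * A $ j)"
      by (simp add: cdot_def distrib_right sum.distrib sum_distrib_left mult.assoc)
    also have "\<dots> = (z *s Pm u A + Pp u A) $ m" by (simp add: pm_mult pp_mult)
    finally show ?thesis unfolding A by simp
  qed
  have "act ?M (antis (\<lambda>j J. A $ j * c J)) I
      = (\<Sum>i<Suc k. (-1) ^ i * ((map ?r I ! i \<odot> A) * ev c (drop_nth i (map ?r I))))"
    unfolding act_eq_ev by (rule ev_antis_dot) (simp add: I)
  also have "\<dots> = (\<Sum>i<Suc k. z ^ q * ((-1) ^ i * (A $ (I ! i) * c (drop_nth i I))))"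
  proof (intro sum.cong refl)
    fix i assume i: "i \<in> {..<Suc k}"
    have "ev c (drop_nth i (map ?r I)) = act ?M c (drop_nth i I)" unfolding act_eq_ev map_drop_nth ..
    also have "\<dots> = z ^ p * c (drop_nth i I)"
      using c i I unfolding typed_def by (simp add: length_drop_nth)
    finally have "(map ?r I ! i \<odot> A) * ev c (drop_nth i (map ?r I)) = (s z * z ^ p) * (A $ (I ! i) * c (drop_nth i I))"
      using i I by (simp add: r)
    then show "(-1) ^ i * ((map ?r I ! i \<odot> A) * ev c (drop_nth i (map ?r I))) = z ^ q * ((-1) ^ i * (A $ (I ! i) * c (drop_nth i I)))"
      unfolding s by (simp only: mult.left_commute)
  qed
  also have "\<dots> = z ^ q * antis (\<lambda>j J. A $ j * c J) I"
    unfolding antis_def I by (simp only: sum_distrib_left)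
  finally show "act ?M (antis (\<lambda>j J. A $ j * c J)) I = z ^ q * antis (\<lambda>j J. A $ j * c J) I" .
qed

lemma antis_add: "antis (\<lambda>j J. S j J + T j J) L = antis S L + antis T L"
  by (simp add: antis_def distrib_left sum.distrib)

lemma fvol_Omega:
  assumes "sm f" shows "mkfield 3 (\<lambda>u I. f u * vcomp u I) \<in> Omega std_J 3 0"
  using mkfield_Omega[of "\<lambda>u I. f u * vcomp u I" 3 0] assms
  by (simp add: altern_scale[OF altern_vcomp] typed_scale[OF ftyped_vcomp] sm_mult sm_vcomp)

text \<open>The Leibniz rule with a dbar-closed volume form. The (1,0)-part of df contributes a form
  of weight 4, which the projection to weight 3 removes.\<close>

lemma dbar_fvol:
  assumes f: "sm f" and u: "u \<in> S6"
  shows "dbar std_J 3 0 (mkfield 3 (\<lambda>u I. f u * vcomp u I)) u = tensor_of 4 (antis (\<lambda>j J. gradp f u $ j * vcomp u J))"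
proof -
  let ?\<omega> = "mkfield 3 (\<lambda>u I. f u * vcomp u I)" and ?A = "\<lambda>X. antis (\<lambda>j J. X $ j * vcomp u J)"
  have u1: "cv u \<odot> cv u = 1" by (rule cv_cdot_self[OF u])
  have c: "fcomp ?\<omega> v I = f v * vcomp v I" if "v \<in> S6" for v I
    using that by (simp add: mkfield_def cmp_tensor_of vcomp_other)
  have "grad f u = Pm (cv u) (grad f u) + gradp f u"
    using Pm_Pp_decomp[of "cv u" "grad f u"] dder_normal[OF f u] by (simp add: grad_dot gradp_def)
  then have g: "sder j f u = Pm (cv u) (grad f u) $ j + gradp f u $ j" for j
    by (metis grad_def vec_lambda_beta vector_add_component)
  have "dterm 3 (fcomp ?\<omega>) u j J = (Pm (cv u) (grad f u) $ j * vcomp u J + gradp f u $ j * vcomp u J) + f u * dterm 3 vcomp u j J" for j J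
  proof -
    have "sder j (\<lambda>u. fcomp ?\<omega> u J) u = sder j (\<lambda>u. f u * vcomp u J) u"
      by (rule sder_cong[OF c S6_nonzero[OF u]])
    then show ?thesis unfolding dterm_def c[OF u] g[symmetric] distrib_right[symmetric]
      by (simp add: sder_mult[OF f sm_vcomp u] algebra_simps)
  qed
  then have "dcomp 3 (fcomp ?\<omega>) u L = antis (\<lambda>j J. (Pm (cv u) (grad f u) $ j * vcomp u J + gradp f u $ j * vcomp u J) + f u * dterm 3 vcomp u j J) L" for L
    unfolding dcomp_def by (rule antis_cong)
  moreover have "antis (\<lambda>j J. f u * dterm 3 vcomp u j J) L = f u * dcomp 3 vcomp u L" for L
    unfolding dcomp_def antis_def by (simp only: sum_distrib_left mult.left_commute)
  ultimately have d: "dcomp 3 (fcomp ?\<omega>) u = (\<lambda>L. (?A (Pm (cv u) (grad f u)) L + ?A (gradp f u) L) + f u * dcomp 3 vcomp u L)"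
    by (intro ext) (simp only: antis_add)
  have tm: "ftyped (cv u) (Suc 3) 4 (?A (Pm (cv u) (grad f u)))"
    by (rule ftyped_antis[where s = "\<lambda>z. z", OF _ ftyped_vcomp[OF u]])
      (simp_all add: Pm_Em[OF Pm_in_Em[OF u1]] Pp_Em[OF Pm_in_Em[OF u1]] power_Suc[symmetric] del: power_Suc)
  have tp: "ftyped (cv u) (Suc 3) 3 (?A (gradp f u))"
    by (rule ftyped_antis[where s = "\<lambda>z. 1", OF _ ftyped_vcomp[OF u]])
      (simp_all add: Pm_Ep[OF gradp_Ep[OF u]] Pp_Ep[OF gradp_Ep[OF u]])
  have "ftp (cv u) 3 (dcomp 3 (fcomp ?\<omega>) u) L = ?A (gradp f u) L" if L: "length L = 4" for L
    unfolding d tp_add tp_scale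
    using typed_tp_other[OF tm, of L 3] typed_tp_same[OF tp, of L] dbar_vcomp[OF u L] L by simp
  then have "tensor_of 4 (ftp (cv u) 3 (dcomp 3 (fcomp ?\<omega>) u)) = tensor_of 4 (?A (gradp f u))"
    by (rule tensor_of_cong)
  then show ?thesis
    unfolding dbar_eq[OF fvol_Omega[OF f]] using u by (simp add: mkfield_def)
qed

lemma wedge_out_cotens:
  assumes u: "u \<in> S6"
  shows "wedge_out (cotens A (volform u)) = tensor_of 4 (antis (\<lambda>j J. A $ j * vcomp u J))"
proof
  fix vs :: "vec7 list"
  have w: "wedge_out (cotens A (volform u)) vs
      = (\<Sum>i<length vs. (-1) ^ i * ((A \<odot> cv (vs ! i)) * tensor_of 3 (vcomp u) (drop_nth i vs)))"
    unfolding wedge_out_def cotens_Cons volform_eq[OF u] ..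
  show "wedge_out (cotens A (volform u)) vs = tensor_of 4 (antis (\<lambda>j J. A $ j * vcomp u J)) vs"
  proof (cases "length vs = 4")
    case True
    then have "ev (antis (\<lambda>j J. A $ j * vcomp u J)) (map cv vs)
        = (\<Sum>i<Suc 3. (-1) ^ i * ((map cv vs ! i \<odot> A) * ev (vcomp u) (drop_nth i (map cv vs))))"
      by (intro ev_antis_dot) simp
    also have "\<dots> = (\<Sum>i<length vs. (-1) ^ i * ((A \<odot> cv (vs ! i)) * tensor_of 3 (vcomp u) (drop_nth i vs)))"
      using True by (intro sum.cong) (simp_all add: tensor_of_def length_drop_nth map_drop_nth cdot_commute)
    finally show ?thesis unfolding w using True by (simp add: tensor_of_def)
  next
    case False
    then have "tensor_of 3 (vcomp u) (drop_nth i vs) = 0" if "i < length vs" for i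
      using that by (simp add: tensor_of_def length_drop_nth)
    then show ?thesis unfolding w using False by (simp add: tensor_of_def)
  qed
qed

text \<open>Evaluate on one vector of E- and three vectors of E+ with nonzero volume: only the
  pairing of A with the former survives. This is the uniqueness required by the description in
  \<open>dbar_K1\<close>.\<close>

lemma wedge_out_inj:
  assumes u: "u \<in> S6" and A: "A \<in> Ep (cv u)" "B \<in> Ep (cv u)"
    and eq: "wedge_out (cotens A (volform u)) = wedge_out (cotens B (volform u))"
  shows "A = B"
proof (rule cdot_ext)
  fix a
  let ?w = "Pm (cv u) a"
  have w: "?w \<in> Em (cv u)" by (rule Pm_in_Em[OF cv_cdot_self[OF u]])
  obtain c1 c2 c3 where c: "c1 \<in> Ep (cv u)" "c2 \<in> Ep (cv u)" "c3 \<in> Ep (cv u)" and n: "(c1 \<otimes> c2) \<odot> c3 \<noteq> 0"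
    by (rule Ep_volume_nonzero[OF u])
  have four: "length [?w, c1, c2, c3] = Suc (Suc (Suc (Suc 0)))" by simp
  have e: "ev (antis (\<lambda>j J. X $ j * vcomp u J)) [?w, c1, c2, c3] = (?w \<odot> X) * ((c1 \<otimes> c2) \<odot> c3)" if X: "X \<in> Ep (cv u)" for X
    unfolding ev_antis_dot[where k = "Suc (Suc (Suc 0))" and zs = "[?w, c1, c2, c3]", OF four]
    using Ep_Ep_dot[OF c(1) X] Ep_Ep_dot[OF c(2) X] Ep_Ep_dot[OF c(3) X] c
    by (simp add: ev_vcomp Pp_Ep)
  have "antis (\<lambda>j J. A $ j * vcomp u J) I = antis (\<lambda>j J. B $ j * vcomp u J) I" if "length I = 4" for I
    using arg_cong[OF eq[unfolded wedge_out_cotens[OF u]], of "\<lambda>t. cmp t I"] that by (simp add: cmp_tensor_of)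
  then have "ev (antis (\<lambda>j J. A $ j * vcomp u J)) [?w, c1, c2, c3] = ev (antis (\<lambda>j J. B $ j * vcomp u J)) [?w, c1, c2, c3]"
    by (intro ev_cong) simp
  then have "?w \<odot> A = ?w \<odot> B" unfolding e[OF A(1)] e[OF A(2)] using n by simp
  then show "A \<odot> a = B \<odot> a"
    unfolding Pm_dot by (simp add: Pp_Ep[OF A(1)] Pp_Ep[OF A(2)] cdot_commute)
qed

text \<open>The canonical bundle is a line bundle, so scalars and sums can be collected in the
  (0,1)-factor and the span consists of single tensor products.\<close>

lemma T01_K_iff:
  assumes u: "u \<in> S6"
  shows "t \<in> T01_K std_J u \<longleftrightarrow> (\<exists>A\<in>Ep (cv u). t = cotens A (volform u))"
proof
  let ?S = "{cotens A (volform u) | A. A \<in> Ep (cv u)}"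
  let ?G = "{tens 1 (wedge [\<alpha>]) \<kappa> | \<alpha> \<kappa>. \<alpha> \<in> cotangent01 std_J u \<and> \<kappa> \<in> Lambda std_J 3 0 u}"
  have "cs.subspace ?S"
    unfolding cs.subspace_def
  proof (intro conjI ballI allI)
    have "(0 :: tensor) = cotens 0 (volform u)" by (rule cotens_eqI[symmetric]) (simp_all add: cdot_linear)
    then show "0 \<in> ?S" using Ep_zero by blast
  next
    fix x y assume "x \<in> ?S" "y \<in> ?S"
    then obtain A B where AB: "A \<in> Ep (cv u)" "B \<in> Ep (cv u)" "x = cotens A (volform u)" "y = cotens B (volform u)" by blast
    then have "x + y = cotens (A + B) (volform u)"
      by (intro cotens_eqI[symmetric]) (simp_all add: cotens_Nil cotens_Cons cdot_linear distrib_right)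
    then show "x + y \<in> ?S" using Ep_add[OF AB(1,2)] by blast
  next
    fix k x assume "x \<in> ?S"
    then obtain A where A: "A \<in> Ep (cv u)" "x = cotens A (volform u)" by blast
    then have "cscale k x = cotens (k *s A) (volform u)"
      by (intro cotens_eqI[symmetric]) (simp_all add: cotens_Nil cotens_Cons cdot_linear cscale_def)
    then show "cscale k x \<in> ?S" using Ep_scale[OF A(1)] by blast
  qed
  moreover have "?G \<subseteq> ?S"
  proof
    fix x assume "x \<in> ?G"
    then obtain \<alpha> k where \<alpha>: "\<alpha> \<in> cotangent01 std_J u" and x: "x = tens 1 (wedge [\<alpha>]) (cscale k (volform u))"
      unfolding Lambda_30[OF u] by blast
    let ?A = "\<chi> i. \<alpha> (ax i)"
    have "\<alpha> = (\<lambda>v. ?A \<odot> cv v)" using \<alpha> linear_dot by (auto simp: cotangent01_def)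
    then have "x = cotens ?A (cscale k (volform u))" using x unfolding cotens_def by metis
    also have "\<dots> = cotens (k *s ?A) (volform u)"
      by (rule cotens_eqI) (simp_all add: cotens_Nil cotens_Cons cdot_linear cscale_def)
    finally show "x \<in> ?S" using Ep_scale[OF cotangent01_Ep[OF u \<alpha>]] by blast
  qed
  ultimately have "T01_K std_J u \<subseteq> ?S" unfolding T01_K_def by (intro cs.span_minimal)
  then show "t \<in> T01_K std_J u ==> \<exists>A\<in>Ep (cv u). t = cotens A (volform u)" by blast
  assume "\<exists>A\<in>Ep (cv u). t = cotens A (volform u)"
  then obtain A where A: "A \<in> Ep (cv u)" and t: "t = cotens A (volform u)" by blast
  have "volform u \<in> Lambda std_J 3 0 u"
    unfolding Lambda_30[OF u] by (rule range_eqI[of _ _ 1]) (simp add: cscale_def)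
  then have "t \<in> ?G" using t Ep_cotangent01[OF A] unfolding cotens_def by blast
  then show "t \<in> T01_K std_J u" unfolding T01_K_def by (rule cs.span_base)
qed

lemma dbar_K1_fvol:
  assumes f: "sm f" and u: "u \<in> S6"
  shows "dbar_K1 std_J (mkfield 3 (\<lambda>u I. f u * vcomp u I)) u = cotens (gradp f u) (volform u)"
proof -
  let ?t = "cotens (gradp f u) (volform u)"
  have d: "dbar std_J 3 0 (mkfield 3 (\<lambda>u I. f u * vcomp u I)) u = wedge_out ?t"
    unfolding dbar_fvol[OF f u] wedge_out_cotens[OF u] ..
  have "(THE t. t \<in> T01_K std_J u \<and> wedge_out t = wedge_out ?t) = ?t"
  proof (rule the_equality)
    show "?t \<in> T01_K std_J u \<and> wedge_out ?t = wedge_out ?t"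
      using T01_K_iff[OF u] gradp_Ep[OF u] by blast
    fix t assume t: "t \<in> T01_K std_J u \<and> wedge_out t = wedge_out ?t"
    then obtain A where A: "A \<in> Ep (cv u)" "t = cotens A (volform u)" using T01_K_iff[OF u] by blast
    then have "A = gradp f u" using t by (intro wedge_out_inj[OF u A(1) gradp_Ep[OF u]]) simp
    then show "t = ?t" using A by simp
  qed
  then show ?thesis using u by (simp add: dbar_K1_def d)
qed

section \<open>Powers of the volume form\<close>

primrec vpow :: "nat => vec7 => tensor" where
  "vpow 0 u = wedge []"
| "vpow (Suc m) u = tens 3 (volform u) (vpow m u)"

primrec vpcomp :: "nat => vec7 => 7 list => complex" where
  "vpcomp 0 u I = 1"
| "vpcomp (Suc m) u I = vcomp u (take 3 I) * vpcomp m u (drop 3 I)"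

text \<open>A test array: by \<open>phipow_vpcomp\<close> its pairing with the m-th power of the
  volume form is 12^m. It shows that the power is nowhere zero and extracts coefficients
  smoothly.\<close>

primrec phipow :: "nat => 7 list => complex" where
  "phipow 0 I = 1"
| "phipow (Suc m) I = phi3 (take 3 I) * phipow m (drop 3 I)"

lemma ev_take_drop:
  assumes "length xs = 3"
  shows "ev (\<lambda>I. a (take 3 I) * b (drop 3 I)) (xs @ ys) = ev a xs * ev b ys"
proof -
  have "ev (\<lambda>I. a (take 3 (I @ J)) * b (drop 3 (I @ J))) xs = ev a xs * b J" for J
  proof -
    have "ev (\<lambda>I. a (take 3 (I @ J)) * b (drop 3 (I @ J))) xs = ev (\<lambda>I. b J * a I) xs"
      using assms by (intro ev_cong) simp
    also have "\<dots> = ev a xs * b J" unfolding ev_cscale by (rule mult.commute)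
    finally show ?thesis .
  qed
  then show ?thesis unfolding ev_append by (simp add: ev_cscale)
qed

lemma tens_tensor_of:
  "tens 3 (tensor_of 3 a) (tensor_of k b) = tensor_of (3 + k) (\<lambda>I. a (take 3 I) * b (drop 3 I))"
proof
  fix vs :: "vec7 list"
  show "tens 3 (tensor_of 3 a) (tensor_of k b) vs = tensor_of (3 + k) (\<lambda>I. a (take 3 I) * b (drop 3 I)) vs"
  proof (cases "length vs = 3 + k")
    case True
    have "map cv vs = map cv (take 3 vs) @ map cv (drop 3 vs)" by (simp flip: map_append)
    then show ?thesis
      using True ev_take_drop[of "map cv (take 3 vs)" a b "map cv (drop 3 vs)"] by (simp add: tens_def tensor_of_def)
  next
    case False
    then show ?thesis by (auto simp: tens_def tensor_of_def)
  qed
qed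

lemma wedge_Nil_tensor_of: "wedge [] = tensor_of 0 (\<lambda>I. 1)"
  by (auto simp: wedge_Nil tensor_of_def fun_eq_iff)

lemma vpow_eq: "u \<in> S6 ==> vpow m u = tensor_of (3 * m) (vpcomp m u)"
proof (induction m)
  case 0
  have "vpcomp 0 u = (\<lambda>I. 1)" by auto
  then show ?case by (simp add: wedge_Nil_tensor_of)
next
  case (Suc m)
  have "vpcomp (Suc m) u = (\<lambda>I. vcomp u (take 3 I) * vpcomp m u (drop 3 I))" by auto
  then show ?case using Suc by (simp add: volform_eq tens_tensor_of)
qed

lemma sm_vpcomp: "sm (\<lambda>u. vpcomp m u I)"
  by (induction m arbitrary: I) (simp_all add: sm_const sm_mult sm_vcomp)

lemma tang_vpcomp:
  assumes u: "u \<in> S6" shows "tang (cv u) (3 * m) (vpcomp m u)"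
proof (induction m)
  case 0
  then show ?case by (simp add: tang_def)
next
  case (Suc m)
  let ?r = "\<lambda>i. \<chi> j. tanmat (cv u) i j"
  show ?case
    unfolding tang_def
  proof (intro allI impI)
    fix I :: "7 list" assume I: "length I = 3 * Suc m"
    have I': "map ?r I = map ?r (take 3 I) @ map ?r (drop 3 I)" by (simp flip: map_append)
    have "vpcomp (Suc m) u = (\<lambda>I. vcomp u (take 3 I) * vpcomp m u (drop 3 I))" by auto
    then have "act (tanmat (cv u)) (vpcomp (Suc m) u) I
        = ev (\<lambda>I. vcomp u (take 3 I) * vpcomp m u (drop 3 I)) (map ?r (take 3 I) @ map ?r (drop 3 I))"
      unfolding act_eq_ev I' by simp
    also have "\<dots> = act (tanmat (cv u)) (vcomp u) (take 3 I) * act (tanmat (cv u)) (vpcomp m u) (drop 3 I)"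
      unfolding act_eq_ev by (rule ev_take_drop) (use I in simp)
    also have "\<dots> = vcomp u (take 3 I) * vpcomp m u (drop 3 I)"
      using ftyped_tang[OF ftyped_vcomp[OF u]] Suc I by (simp add: tang_def)
    finally show "act (tanmat (cv u)) (vpcomp (Suc m) u) I = vpcomp (Suc m) u I" by simp
  qed
qed

lemma sum_idx_take_drop:
  "(\<Sum>I\<in>idx (3 * Suc m). F (take 3 I) * G (drop 3 I)) = (\<Sum>J\<in>idx 3. F J) * (\<Sum>I\<in>idx (3 * m). G I)"
  for F G :: "7 list => complex"
proof -
  have "3 * Suc m = Suc (Suc (Suc (3 * m)))" by simp
  then have "(\<Sum>I\<in>idx (3 * Suc m). F (take 3 I) * G (drop 3 I))
      = (\<Sum>i\<in>UNIV. \<Sum>j\<in>UNIV. \<Sum>k\<in>UNIV. F [i, j, k] * (\<Sum>I\<in>idx (3 * m). G I))"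
    by (simp only: sum_idx_Suc) (simp add: numeral_3_eq_3 sum_distrib_left)
  then show ?thesis unfolding numeral_3_eq_3 sum_idx_3 by (simp only: sum_distrib_right)
qed

lemma phipow_vpcomp: "u \<in> S6 ==> (\<Sum>I\<in>idx (3 * m). phipow m I * vpcomp m u I) = 12 ^ m"
proof (induction m)
  case 0
  show ?case by simp
next
  case (Suc m)
  have "phipow (Suc m) I * vpcomp (Suc m) u I = (phi3 (take 3 I) * vcomp u (take 3 I)) * (phipow m (drop 3 I) * vpcomp m u (drop 3 I))" for I
    by simp
  then have "(\<Sum>I\<in>idx (3 * Suc m). phipow (Suc m) I * vpcomp (Suc m) u I)
      = (\<Sum>J\<in>idx 3. phi3 J * vcomp u J) * (\<Sum>I\<in>idx (3 * m). phipow m I * vpcomp m u I)"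
    using sum_idx_take_drop[of "\<lambda>J. phi3 J * vcomp u J" "\<lambda>I. phipow m I * vpcomp m u I" m] by (simp only:)
  then show ?case unfolding vol_contract[OF Suc.prems] Suc.IH[OF Suc.prems] by (simp only: power_Suc)
qed

lemma vpow_nonzero: "u \<in> S6 ==> \<exists>vs. vpow m u vs \<noteq> 0"
proof (rule ccontr)
  assume u: "u \<in> S6" and "\<not> (\<exists>vs. vpow m u vs \<noteq> 0)"
  then have "vpcomp m u I = 0" if "length I = 3 * m" for I
    using cmp_tensor_of[of "3 * m" "vpcomp m u" I] that by (simp add: vpow_eq[symmetric] cmp_def)
  then have "(\<Sum>I\<in>idx (3 * m). phipow m I * vpcomp m u I) = 0" by (simp add: in_idx)
  then show False using phipow_vpcomp[OF u] by simp
qed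

lemma tens_cscale: "tens k (cscale a x) (cscale b y) = cscale (a * b) (tens k x y)"
  by (auto simp: tens_def cscale_def)

lemma cscale_0 [simp]: "cscale k 0 = 0" and cscale_1 [simp]: "cscale 1 x = x" and cscale_cscale [simp]: "cscale a (cscale b x) = cscale (a * b) x"
  by (auto simp: cscale_def fun_eq_iff)

lemma Kpow_eq:
  assumes u: "u \<in> S6" shows "Kpow std_J m u = range (\<lambda>k. cscale k (vpow m u))"
proof (induction m)
  case 0
  have "{wedge (\<alpha>s @ \<beta>s) | \<alpha>s \<beta>s. length \<alpha>s = 0 \<and> set \<alpha>s \<subseteq> cotangent10 std_J u \<and> length \<beta>s = 0 \<and> set \<beta>s \<subseteq> cotangent01 std_J u} = {wedge []}"
    by auto
  then show ?case by (simp only: Kpow.simps Lambda_def cs.span_singleton vpow.simps)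
next
  case (Suc m)
  have "{tens 3 \<kappa> s | \<kappa> s. \<kappa> \<in> Lambda std_J 3 0 u \<and> s \<in> Kpow std_J m u} = range (\<lambda>k. cscale k (vpow (Suc m) u))"
  proof (intro equalityI subsetI)
    fix x assume "x \<in> {tens 3 \<kappa> s | \<kappa> s. \<kappa> \<in> Lambda std_J 3 0 u \<and> s \<in> Kpow std_J m u}"
    then obtain a b where "x = tens 3 (cscale a (volform u)) (cscale b (vpow m u))"
      unfolding Lambda_30[OF u] Suc by blast
    then have "x = cscale (a * b) (vpow (Suc m) u)" by (simp only: tens_cscale vpow.simps)
    then show "x \<in> range (\<lambda>k. cscale k (vpow (Suc m) u))" by blast
  next
    fix x assume "x \<in> range (\<lambda>k. cscale k (vpow (Suc m) u))"
    then obtain k where "x = cscale k (vpow (Suc m) u)" by blast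
    then have "x = tens 3 (cscale k (volform u)) (cscale 1 (vpow m u))" by (simp only: tens_cscale vpow.simps mult_1_right)
    then show "x \<in> {tens 3 \<kappa> s | \<kappa> s. \<kappa> \<in> Lambda std_J 3 0 u \<and> s \<in> Kpow std_J m u}"
      unfolding Lambda_30[OF u] Suc by blast
  qed
  then have "Kpow std_J (Suc m) u = cspan (range (\<lambda>k. cscale k (vpow (Suc m) u)))" by simp
  also have "\<dots> = cspan (cspan {vpow (Suc m) u})" unfolding cs.span_singleton ..
  finally show ?case by (simp only: cs.span_span cs.span_singleton[symmetric])
qed

section \<open>Sections of the powers and their dbar\<close>

definition fpow :: "nat => (vec7 => complex) => tensor_field"
  where "fpow m f u = (if u \<in> S6 then cscale (f u) (vpow m u) else 0)"

text \<open>The value of dbar on \<open>fpow m f\<close> that the Leibniz rule predicts when the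
  volume form is dbar-closed.\<close>

definition dpow :: "nat => (vec7 => complex) => tensor_field"
  where "dpow m f u = (if u \<in> S6 then cotens (gradp f u) (vpow m u) else 0)"

lemma fpow_eq: "u \<in> S6 ==> fpow m f u = tensor_of (3 * m) (\<lambda>I. f u * vpcomp m u I)"
  by (simp add: fpow_def vpow_eq tensor_of_scale)

lemma tang_scale: "tang u k c ==> tang u k (\<lambda>I. a * c I)"
  unfolding tang_def act_scale by simp

lemma sections_Kpow: "s \<in> sections (Kpow std_J m) \<longleftrightarrow> (\<exists>f. sm f \<and> s = fpow m f)"
proof
  assume s: "s \<in> sections (Kpow std_J m)"
  define h where "h = (\<lambda>u. SOME k. s u = cscale k (vpow m u))"
  have h: "s u = fpow m h u" if u: "u \<in> S6" for u
  proof -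
    have "s u \<in> Kpow std_J m u" using s u by (auto simp: sections_def)
    then have "\<exists>k. s u = cscale k (vpow m u)" unfolding Kpow_eq[OF u] by blast
    then have "s u = cscale (h u) (vpow m u)" unfolding h_def by (rule someI_ex)
    then show ?thesis using u by (simp add: fpow_def)
  qed
  have "smooth_tensor s" using s by (simp add: sections_def)
  then have c: "sm (\<lambda>u. h u * vpcomp m u I)" if "length I = 3 * m" for I
    using smooth_tensor_iff[of s "3 * m" "\<lambda>u I. h u * vpcomp m u I"] h fpow_eq[of _ m h] tang_scale[OF tang_vpcomp] that by simp
  \<comment> \<open>The coefficient h is chosen pointwise. Contraction with \<open>phipow\<close>
    expresses it on the sphere by the smooth components of s.\<close>
  define f where "f = (\<lambda>u. \<Sum>I\<in>idx (3 * m). phipow m I / 12 ^ m * (h u * vpcomp m u I))"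
  have "sm f" unfolding f_def by (intro sm_sum sm_mult[OF sm_const] c) (simp add: in_idx)
  moreover have fh: "f u = h u" if "u \<in> S6" for u
  proof -
    have "f u = h u / 12 ^ m * (\<Sum>I\<in>idx (3 * m). phipow m I * vpcomp m u I)"
      unfolding f_def sum_distrib_left by (intro sum.cong refl) simp
    then show ?thesis using phipow_vpcomp[OF that] by simp
  qed
  moreover have "s u = fpow m f u" for u
  proof (cases "u \<in> S6")
    case True
    then show ?thesis using h[OF True] fh[OF True] by (simp add: fpow_def)
  next
    case False
    then show ?thesis using s by (auto simp: sections_def fpow_def zero_fun_def)
  qed
  ultimately show "\<exists>f. sm f \<and> s = fpow m f" by blast
next
  assume "\<exists>f. sm f \<and> s = fpow m f"
  then obtain f where f: "sm f" and s: "s = fpow m f" by blast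
  have "smooth_tensor (fpow m f)"
    using smooth_tensor_iff[of "fpow m f" "3 * m" "\<lambda>u I. f u * vpcomp m u I"] fpow_eq[of _ m f] tang_scale[OF tang_vpcomp]
    by (simp add: sm_mult[OF f sm_vpcomp])
  then show "s \<in> sections (Kpow std_J m)"
    unfolding s sections_def using Kpow_eq by (auto simp: fpow_def zero_fun_def)
qed

lemma vpow_1: "u \<in> S6 ==> vpow 1 u = volform u"
  using tens_tensor_of[of "vcomp u" 0 "\<lambda>I. 1"]
  by (simp add: volform_eq wedge_Nil_tensor_of) (rule tensor_of_cong, simp)

lemma fpow_1: "fpow 1 f = mkfield 3 (\<lambda>u I. f u * vcomp u I)"
proof
  fix u
  show "fpow 1 f u = mkfield 3 (\<lambda>u I. f u * vcomp u I) u"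
    by (cases "u \<in> S6") (simp_all only: fpow_def mkfield_def if_True if_False vpow_1 volform_eq tensor_of_scale)
qed

lemma Omega_30: "s \<in> Omega std_J 3 0 \<longleftrightarrow> (\<exists>f. sm f \<and> s = fpow 1 f)"
proof -
  have "Lambda std_J 3 0 u = Kpow std_J 1 u" if "u \<in> S6" for u
    unfolding Lambda_30[OF that] Kpow_eq[OF that] vpow_1[OF that] ..
  then have "Omega std_J 3 0 = sections (Kpow std_J 1)" unfolding Omega_def sections_def by auto
  then show ?thesis by (simp only: sections_Kpow)
qed

lemma dbar_K1_fpow: "sm f ==> dbar_K1 std_J (fpow 1 f) = dpow 1 f"
proof
  fix u assume f: "sm f"
  show "dbar_K1 std_J (fpow 1 f) u = dpow 1 f u"
  proof (cases "u \<in> S6")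
    case True
    then show ?thesis unfolding fpow_1 dbar_K1_fvol[OF f True] dpow_def vpow_1[OF True] by simp
  next
    case False
    then show ?thesis by (simp add: dbar_K1_def dpow_def zero_fun_def)
  qed
qed

lemma gradp_add: "sm f ==> sm g ==> u \<in> S6 ==> gradp (\<lambda>u. f u + g u) u = gradp f u + gradp g u"
  unfolding gradp_def Pp_add[symmetric] by (rule arg_cong[where f = "Pp (cv u)"]) (simp add: vec_eq_iff grad_def sder_add)

lemma gradp_mult: "sm f ==> sm g ==> u \<in> S6 ==> gradp (\<lambda>u. f u * g u) u = f u *s gradp g u + g u *s gradp f u"
  unfolding gradp_def Pp_add[symmetric] Pp_scale[symmetric]
  by (rule arg_cong[where f = "Pp (cv u)"]) (simp add: vec_eq_iff grad_def sder_mult mult.commute)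

lemma fpow_add: "fpow m f + fpow m g = fpow m (\<lambda>u. f u + g u)"
  by (auto simp: fun_eq_iff fpow_def cscale_def distrib_right)

lemma dpow_add:
  assumes "sm f" "sm g" shows "dpow m f + dpow m g = dpow m (\<lambda>u. f u + g u)"
proof
  fix u
  show "(dpow m f + dpow m g) u = dpow m (\<lambda>u. f u + g u) u"
  proof (cases "u \<in> S6")
    case True
    have "cotens (gradp (\<lambda>u. f u + g u) u) (vpow m u) = cotens (gradp f u) (vpow m u) + cotens (gradp g u) (vpow m u)"
      unfolding gradp_add[OF assms True]
      by (rule cotens_eqI) (simp_all add: cotens_Nil cotens_Cons cdot_linear distrib_right)
    then show ?thesis using True by (simp add: dpow_def)
  qed (simp add: dpow_def)
qed

lemma tens_fpow: "(\<lambda>u. tens 3 (fpow 1 f u) (fpow m g u)) = fpow (Suc m) (\<lambda>u. f u * g u)"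
proof
  fix u
  show "tens 3 (fpow 1 f u) (fpow m g u) = fpow (Suc m) (\<lambda>u. f u * g u) u"
  proof (cases "u \<in> S6")
    case True
    then show ?thesis by (simp only: fpow_def vpow_1 if_True tens_cscale vpow.simps)
  next
    case False
    then show ?thesis by (simp add: fpow_def tens_def zero_fun_def)
  qed
qed

lemma dpow_leibniz:
  assumes f: "sm f" and g: "sm g"
  shows "(\<lambda>u. tens 4 (dpow 1 f u) (fpow m g u) + tens_front 3 (fpow 1 f u) (dpow m g u)) = dpow (Suc m) (\<lambda>u. f u * g u)"
proof
  fix u
  show "tens 4 (dpow 1 f u) (fpow m g u) + tens_front 3 (fpow 1 f u) (dpow m g u) = dpow (Suc m) (\<lambda>u. f u * g u) u"
  proof (cases "u \<in> S6")
    case True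
    have "cotens (gradp (\<lambda>u. f u * g u) u) (tens 3 (volform u) (vpow m u))
        = tens 4 (cotens (gradp f u) (volform u)) (cscale (g u) (vpow m u))
          + tens_front 3 (cscale (f u) (volform u)) (cotens (gradp g u) (vpow m u))"
      unfolding gradp_mult[OF f g True]
    proof (rule cotens_eqI)
      fix v :: vec7 and vs
      \<comment> \<open>The leading entry v belongs to the (0,1)-factor, so a cut after 4 entries is
        a cut after 3 entries of vs.\<close>
      have "take 4 (v # vs) = v # take 3 vs" "drop 4 (v # vs) = drop 3 vs" by (simp_all add: numeral_eq_Suc)
      then show "((f u *s gradp g u + g u *s gradp f u) \<odot> cv v) * tens 3 (volform u) (vpow m u) vs
        = (tens 4 (cotens (gradp f u) (volform u)) (cscale (g u) (vpow m u))
          + tens_front 3 (cscale (f u) (volform u)) (cotens (gradp g u) (vpow m u))) (v # vs)"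
        by (simp add: tens_def[of 3] tens_def[of 4] tens_front_def cotens_Cons cscale_def cdot_linear algebra_simps)
    qed (simp add: tens_def[of 4] tens_front_def cotens_Nil)
    then show ?thesis using True by (simp add: dpow_def fpow_def vpow_1 del: One_nat_def)
  next
    case False
    then show ?thesis by (auto simp: dpow_def fpow_def tens_def tens_front_def zero_fun_def fun_eq_iff split: list.split)
  qed
qed

text \<open>Additivity and the Leibniz rule preserve the pairs of \<open>fpow\<close> and
  \<open>dpow\<close> of one function, so the graph contains no other pairs.\<close>

lemma dbar_K_graph_fpow:
  assumes "dbar_K_graph std_J m s t"
  shows "\<exists>f. sm f \<and> s = fpow m f \<and> t = dpow m f"
  using assms
proof induction
  case (base s)
  then obtain f where "sm f" "s = fpow 1 f" using Omega_30 by blast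
  then show ?case using dbar_K1_fpow by blast
next
  case (leibniz s1 m s2 t2)
  obtain f where f: "sm f" "s1 = fpow 1 f" using leibniz.hyps(1) Omega_30 by blast
  obtain g where g: "sm g" "s2 = fpow m g" "t2 = dpow m g" using leibniz.IH by blast
  show ?case
    unfolding f(2) g(2,3) dbar_K1_fpow[OF f(1)] tens_fpow dpow_leibniz[OF f(1) g(1)]
    using sm_mult[OF f(1) g(1)] by blast
next
  case (add m s t s' t')
  then obtain f g where fg: "sm f" "s = fpow m f" "t = dpow m f" "sm g" "s' = fpow m g" "t' = dpow m g" by blast
  show ?case
    unfolding fg(2,3,5,6) fpow_add dpow_add[OF fg(1,4)] using sm_add[OF fg(1,4)] by blast
qed

text \<open>The section f vol^(m+1) is the product of vol and f vol^m, so one use of the Leibniz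
  rule per step is enough.\<close>

lemma ex_dbar_K_graph:
  assumes f: "sm f" shows "m \<ge> 1 ==> dbar_K_graph std_J m (fpow m f) (dpow m f)"
proof (induction m rule: nat_induct_at_least)
  case base
  have "fpow 1 f \<in> Omega std_J 3 0" using f Omega_30 by blast
  then show ?case using dbar_K_graph.base[of "fpow 1 f" std_J] unfolding dbar_K1_fpow[OF f] by blast
next
  case (Suc m)
  have "fpow 1 (\<lambda>u. 1) \<in> Omega std_J 3 0" using sm_const Omega_30 by blast
  from dbar_K_graph.leibniz[OF this Suc.hyps Suc.IH]
  show ?case unfolding dbar_K1_fpow[OF sm_const] tens_fpow dpow_leibniz[OF sm_const f] by simp
qed

lemma fpow_inj: "fpow m f = fpow m g ==> u \<in> S6 ==> f u = g u"
proof -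
  assume e: "fpow m f = fpow m g" and u: "u \<in> S6"
  obtain vs where "vpow m u vs \<noteq> 0" using vpow_nonzero[OF u] by blast
  then show ?thesis using fun_cong[OF fun_cong[OF e, of u], of vs] u by (simp add: fpow_def cscale_def)
qed

text \<open>The section determines f on the sphere, hence also its gradient there; so the graph is
  single-valued over it.\<close>

lemma dbar_K_fpow:
  assumes f: "sm f" and m: "m \<ge> 1"
  shows "dbar_K std_J m (fpow m f) = dpow m f"
  unfolding dbar_K_def
proof (rule the_equality[where a = "dpow m f"])
  show "dbar_K_graph std_J m (fpow m f) (dpow m f)" by (rule ex_dbar_K_graph[OF f m])
  fix t assume "dbar_K_graph std_J m (fpow m f) t"
  then obtain g where g: "fpow m f = fpow m g" "t = dpow m g" using dbar_K_graph_fpow by blast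
  have "gradp g u = gradp f u" if "u \<in> S6" for u
  proof -
    have "grad g u = grad f u"
      unfolding grad_def vec_eq_iff using sder_cong[OF fpow_inj[OF g(1)[symmetric]] S6_nonzero[OF that]] by simp
    then show ?thesis by (simp add: gradp_def)
  qed
  then show "t = dpow m f" unfolding g(2) by (auto simp: fun_eq_iff dpow_def)
qed

text \<open>The powers of the volume form are nowhere zero, so vanishing means that f is annihilated
  by all (0,1)-vectors, and then f is constant.\<close>

lemma dpow_zero_iff:
  assumes f: "sm f"
  shows "dpow m f = 0 \<longleftrightarrow> (\<exists>c. \<forall>u\<in>S6. f u = c)"
proof
  assume z: "dpow m f = 0"
  have "dder w f u = 0" if u: "u \<in> S6" and w: "w \<in> Em (cv u)" for u w
  proof -
    obtain vs where vs: "vpow m u vs \<noteq> 0" using vpow_nonzero[OF u] by blast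
    have "gradp f u \<odot> cv v = 0" for v
      using fun_cong[OF fun_cong[OF z, of u], of "v # vs"] u vs by (simp add: dpow_def cotens_Cons)
    then have "gradp f u $ i = 0" for i by (metis cv_axis cdot_axis(1))
    then have "gradp f u = 0" by (simp add: vec_eq_iff)
    then show ?thesis using gradp_dot[of w f u] Pm_Em[OF w] by (simp add: cdot_linear)
  qed
  then obtain c where "\<And>u. u \<in> S6 ==> f u = c" using Em_constant_function[OF f] by blast
  then show "\<exists>c. \<forall>u\<in>S6. f u = c" by blast
next
  assume "\<exists>c. \<forall>u\<in>S6. f u = c"
  then obtain c where c: "\<And>u. u \<in> S6 ==> f u = c" by blast
  have "gradp f u = 0" if "u \<in> S6" for u
  proof -
    have "grad f u = 0"
      unfolding grad_def vec_eq_iff using sder_cong[OF c S6_nonzero[OF that]] by (simp add: sder_const)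
    then show ?thesis by (simp add: gradp_def Pp_zero)
  qed
  then have "dpow m f u = 0" for u
    by (auto simp: dpow_def intro!: cotens_eqI simp: cdot_linear)
  then show "dpow m f = 0" by (simp add: fun_eq_iff)
qed

theorem plurigenus_1:
  assumes m: "m \<ge> 1" shows "plurigenus std_J m = 1"
proof -
  interpret c2: vector_space cscale2 by (rule vector_space_cscale2)
  let ?x = "fpow m (\<lambda>u. 1)" and ?V = "{s \<in> sections (Kpow std_J m). dbar_K std_J m s = 0}"
  have sc: "cscale2 k ?x = fpow m (\<lambda>u. k)" for k
    by (auto simp: fun_eq_iff cscale2_def fpow_def cscale_def)
  have "?V = range (\<lambda>k. cscale2 k ?x)"
  proof (intro equalityI subsetI)
    fix s assume s: "s \<in> ?V"
    then obtain f where f: "sm f" "s = fpow m f" using sections_Kpow by blast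
    then have "dpow m f = 0" using s dbar_K_fpow[OF f(1) m] by simp
    then obtain c where "\<forall>u\<in>S6. f u = c" using dpow_zero_iff[OF f(1)] by blast
    then have "s = cscale2 c ?x" unfolding f(2) sc by (auto simp: fun_eq_iff fpow_def)
    then show "s \<in> range (\<lambda>k. cscale2 k ?x)" by blast
  next
    fix s assume "s \<in> range (\<lambda>k. cscale2 k ?x)"
    then obtain k where s: "s = fpow m (\<lambda>u. k)" unfolding sc by blast
    then have "s \<in> sections (Kpow std_J m)" using sections_Kpow sm_const by blast
    moreover have "dbar_K std_J m s = 0"
      unfolding s dbar_K_fpow[OF sm_const m] dpow_zero_iff[OF sm_const] by blast
    ultimately show "s \<in> ?V" by blast
  qed
  then have V: "?V = c2.span {?x}" by (simp only: c2.span_singleton)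
  have "?x \<noteq> 0"
  proof
    assume z: "?x = 0"
    have u: "ax 1 \<in> S6" by (simp add: mem_sphere_0 norm_axis_1)
    obtain vs where "vpow m (ax 1) vs \<noteq> 0" using vpow_nonzero[OF u] by blast
    then show False using fun_cong[OF fun_cong[OF z, of "ax 1"], of vs] u by (simp add: fpow_def)
  qed
  then have "c2.independent {?x}" by simp
  then have "c2.dim ?V = 1" unfolding V c2.dim_span using c2.dim_eq_card_independent by fastforce
  moreover have "\<exists>B. finite B \<and> ?V \<subseteq> c2.span B" using V by blast
  ultimately show ?thesis unfolding plurigenus_def cdim_def by (simp add: one_enat_def)
qed

theorem kodaira_dim_0: "kodaira_dim std_J = 0"
proof -
  \<comment> \<open>The numerator is ln 1 = 0. At m = 1 the denominator is 0 too, and the quotient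
    is 0 by convention.\<close>
  have "ln_enat (plurigenus std_J m) / ereal (ln (real m)) = 0" if "m \<ge> 1" for m
    unfolding plurigenus_1[OF that] by (simp add: ln_enat_def one_enat_def zero_ereal_def[symmetric])
  then have "\<forall>\<^sub>F m in sequentially. ln_enat (plurigenus std_J m) / ereal (ln (real m)) = 0"
    unfolding eventually_sequentially by blast
  then have "limsup (\<lambda>m. ln_enat (plurigenus std_J m) / ereal (ln (real m))) = limsup (\<lambda>m. 0)"
    by (rule Limsup_eq)
  also have "\<dots> = 0" by (rule Limsup_const) simp
  finally have "limsup (\<lambda>m. ln_enat (plurigenus std_J m) / ereal (ln (real m))) = 0" .
  moreover have "\<not> (\<forall>m\<ge>1. plurigenus std_J m = 0)" using plurigenus_1[of 1] by auto
  ultimately show ?thesis by (simp only: kodaira_dim_def if_False)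
qed

theorem theorem1p6:
  shows "(\<forall>g. compatible_metric std_J g \<longrightarrow>
            hodge_number std_J g 1 0 = 0 \<and> hodge_number std_J g 2 0 = 0 \<and>
            hodge_number std_J g 2 3 = 0 \<and> hodge_number std_J g 1 3 = 0)
       \<and> (\<forall>m\<ge>1. plurigenus std_J m = 1)
       \<and> kodaira_dim std_J = 0"
  using hodge_numbers_zero plurigenus_1 kodaira_dim_0 by blast

end
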